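(* Let $\rho$ be a rank $2$ Drinfeld $\mathbb{F}_q[t]$-module with complex multiplication given by $\rho_t=\theta+\kappa\tau+\tau^2$, $\kappa\in\bar{k}$, whose CM field is separable over $k=\mathbb{F}_q(\theta)$. Let $\omega_1,\omega_2$ be generators of the period lattice $\Lambda_\rho$ of $\rho$ over $\mathbb{F}_q[\theta]$. Suppose that $u_1,\dots,u_n\in\mathbb{C}_\infty$ satisfy $\exp_\rho(u_i)=:\alpha_i\in\bar{k}$ for $i=1,\dots,n$ and that $\omega_1,u_1,\dots,u_n$ are linearly independent over the CM field of $\rho$. For each $\alpha_i$, $1\le i\le n$, let $M_i\in\mathrm{Ext}^1_{\mathcal{T}}(\mathbf{1},M_\rho)$ be the $t$-motive associated to $\alpha_i$. Then $M_1,\ldots,M_n$ are $\mathcal{K}$-linearly independent in $\mathrm{Ext}^1_{\mathcal{T}}(\mathbf{1},M_\rho)$.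
   Context: $\bar{k}$ is the algebraic closure of $k=\mathbb{F}_q(\theta)$ in a fixed algebraic closure of $\mathbb{F}_q((1/\theta))$, and $\mathbb{C}_\infty$ is the completion of that algebraic closure; $\tau$ is the $q$-th power Frobenius, and for $f\in\bar{k}(t)$, $f^{(-1)}$ denotes the series with coefficients raised to the $q^{-1}$ power. $\mathcal{T}$ is Papanikolas' neutral Tannakian category of $t$-motives (rigid analytically trivial left $\bar{k}(t)[\sigma,\sigma^{-1}]$-modules, finite dimensional over $\bar{k}(t)$, built from Anderson $t$-motives), with trivial object $\mathbf{1}$ ($\bar{k}(t)$ with $\sigma f=f^{(-1)}$). $M_\rho$ is the $t$-motive of dimension $2$ over $\bar{k}(t)$ on which multiplication by $\sigma$ is represented, with respect to a basis $\mathbf{m}$, by $\Phi_\rho=\begin{pmatrix}0&1\\ t-\theta&-\kappa^{(-1)}\end{pmatrix}$. For each $i$, $M_i$ is the $3$-dimensional $t$-motive whose $\sigma$-action is represented by $\Phi_i=\begin{pmatrix}\Phi_\rho&\mathbf{0}\\ \mathbf{h}_i^{\mathrm{tr}}&1\end{pmatrix}$ with $\mathbf{h}_i=(\alpha_i,0)^{\mathrm{tr}}$; it is an extension of $\mathbf{1}$ by $M_\rho$. $\mathcal{K}:=\mathrm{End}_{\mathcal{T}}(M_\rho)$, which is identified with the CM field of $\rho$. $\mathrm{Ext}^1_{\mathcal{T}}(\mathbf{1},M_\rho)$ is a group under Baer sum (adding the bottom rows $\mathbf{v}$ of the defining matrices $\begin{pmatrix}\Phi_\rho&0\\ \mathbf{v}&1\end{pmatrix}$),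 and a $\mathcal{K}$-module via pushout: if $f\in\mathcal{K}$ satisfies $f(\mathbf{m})=F\mathbf{m}$, then $f_*X$ is represented by $\begin{pmatrix}\Phi_\rho&0\\ \mathbf{v}F&1\end{pmatrix}$. *)

theory Defs
  imports
    "HOL-Analysis.Elementary_Topology"
    "HOL-Computational_Algebra.Computational_Algebra"
    "HOL-Library.FuncSet"
    "HOL-Library.Cardinality"
    "HOL-Algebra.Module"
    "Jordan_Normal_Form.Determinant"
begin

section \<open>The field \<open>C_\<infinity>\<close> and its subfields\<close>

definition algebraic_over :: "'c::field set \<Rightarrow> 'c \<Rightarrow> bool" where
  "algebraic_over S x \<longleftrightarrow> (\<exists>p. p \<noteq> 0 \<and> (\<forall>i. coeff p i \<in> S) \<and> poly p x = 0)"

text \<open>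
  The finite field with \<open>q\<close> elements is an arbitrary finite field type \<open>'f\<close>, and \<open>'f fls\<close> is
  \<open>F_q((1/\<theta>))\<close>: the formal variable of \<open>'f fls\<close> is \<open>1/\<theta>\<close>.  The locale says that, through the
  embedding \<open>\<iota>\<close>, the type \<open>'c\<close> is the completion of an algebraic closure of \<open>'f fls\<close>. The
  absolute value of \<open>x\<close> is \<open>dist 0 x\<close>, normalised by \<open>\<bar>\<theta>\<bar> = q\<close>, and completeness is part of the
  class \<open>complete_space\<close>.
\<close>

locale C_infinity =
  fixes \<iota> :: "'f::{field,finite} fls \<Rightarrow> 'c::{field,complete_space}"
  assumes \<iota>_one: "\<iota> 1 = 1"
    and \<iota>_add: "\<iota> (f + g) = \<iota> f + \<iota> g"
    and \<iota>_mult: "\<iota> (f * g) = \<iota> f * \<iota> g"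
    and \<iota>_abs: "f \<noteq> 0 \<Longrightarrow> dist 0 (\<iota> f) = real CARD('f) powi (- fls_subdegree f)"
    and dist_translate: "dist (x + z) (y + z) = dist x (y::'c)"
    and abs_mult: "dist 0 (x * y) = dist 0 x * dist 0 (y::'c)"
    and abs_ultrametric: "dist 0 (x + y) \<le> max (dist 0 x) (dist 0 (y::'c))"
    and algebraically_closed:
      "\<lbrakk>degree p > 0; \<And>i. algebraic_over (range \<iota>) (coeff p i)\<rbrakk> \<Longrightarrow> \<exists>x. poly p x = 0"
    and dense: "closure {x. algebraic_over (range \<iota>) x} = UNIV"

definition theta :: "('f::{field,finite} fls \<Rightarrow> 'c::{field,complete_space}) \<Rightarrow> 'c" where
  "theta \<iota> = \<iota> fls_X_inv"

definition q_of :: "('f::{field,finite} fls \<Rightarrow> 'c::{field,complete_space}) \<Rightarrow> nat" where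
  "q_of \<iota> = CARD('f)"

definition A_ring :: "('f::{field,finite} fls \<Rightarrow> 'c::{field,complete_space}) \<Rightarrow> 'c set" where
  \<comment> \<open>\<open>F_q[\<theta>]\<close>\<close>
  "A_ring \<iota> = range (\<lambda>p::'f poly. poly (map_poly (\<lambda>a. \<iota> (fls_const a)) p) (theta \<iota>))"

definition k_field :: "('f::{field,finite} fls \<Rightarrow> 'c::{field,complete_space}) \<Rightarrow> 'c set" where
  \<comment> \<open>\<open>F_q(\<theta>)\<close>\<close>
  "k_field \<iota> = {a / b |a b. a \<in> A_ring \<iota> \<and> b \<in> A_ring \<iota> \<and> b \<noteq> 0}"

definition kbar :: "('f::{field,finite} fls \<Rightarrow> 'c::{field,complete_space}) \<Rightarrow> 'c set" where
  "kbar \<iota> = {x. algebraic_over (k_field \<iota>) x}"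


section \<open>Rank 2 Drinfeld modules\<close>

text \<open>
  A twisted polynomial \<open>\<Sum> c\<^sub>i \<tau>\<^sup>i\<close> is stored as the polynomial with coefficients \<open>c\<^sub>i\<close>; only the
  multiplication differs, by \<open>\<tau> c = c\<^sup>q \<tau>\<close>.
\<close>

definition twisted_mult ::
  "('f::{field,finite} fls \<Rightarrow> 'c::{field,complete_space}) \<Rightarrow> 'c poly \<Rightarrow> 'c poly \<Rightarrow> 'c poly" where
  "twisted_mult \<iota> f g =
     (\<Sum>i\<le>degree f. \<Sum>j\<le>degree g. monom (coeff f i * coeff g j ^ (q_of \<iota> ^ i)) (i + j))"

definition rho_t :: "('f::{field,finite} fls \<Rightarrow> 'c::{field,complete_space}) \<Rightarrow> 'c \<Rightarrow> 'c poly" where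
  "rho_t \<iota> \<kappa> = [:theta \<iota>, \<kappa>, 1:]"

text \<open>
  An endomorphism of the \<open>F_q[t]\<close>-module \<open>\<rho>\<close> commutes with \<open>\<rho>\<^sub>a\<close> for all \<open>a\<close>; this amounts to
  commuting with \<open>\<rho>\<^sub>t\<close>, because \<open>\<tau>\<close> commutes with the constants in \<open>F_q\<close>.
\<close>

definition drinfeld_End ::
  "('f::{field,finite} fls \<Rightarrow> 'c::{field,complete_space}) \<Rightarrow> 'c \<Rightarrow> 'c poly set" where
  "drinfeld_End \<iota> \<kappa> = {f. twisted_mult \<iota> f (rho_t \<iota> \<kappa>) = twisted_mult \<iota> (rho_t \<iota> \<kappa>) f}"

text \<open>
  \<open>End(\<rho>)\<close> is viewed inside \<open>C_\<infinity>\<close> through the constant term of a twisted polynomial;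
  \<open>F_q[t]\<close>, acting by \<open>\<rho>\<close>, corresponds to \<open>F_q[\<theta>]\<close>.
\<close>

definition CM_order :: "('f::{field,finite} fls \<Rightarrow> 'c::{field,complete_space}) \<Rightarrow> 'c \<Rightarrow> 'c set" where
  "CM_order \<iota> \<kappa> = (\<lambda>f. coeff f 0) ` drinfeld_End \<iota> \<kappa>"

definition has_CM :: "('f::{field,finite} fls \<Rightarrow> 'c::{field,complete_space}) \<Rightarrow> 'c \<Rightarrow> bool" where
  "has_CM \<iota> \<kappa> \<longleftrightarrow> A_ring \<iota> \<subset> CM_order \<iota> \<kappa>"

definition CM_field :: "('f::{field,finite} fls \<Rightarrow> 'c::{field,complete_space}) \<Rightarrow> 'c \<Rightarrow> 'c set" where
  "CM_field \<iota> \<kappa> = {a / b |a b. a \<in> CM_order \<iota> \<kappa> \<and> b \<in> CM_order \<iota> \<kappa> \<and> b \<noteq> 0}"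

text \<open>Since \<open>'c\<close> is algebraically closed, \<open>rsquarefree\<close> says that all roots of \<open>p\<close> are simple.\<close>

definition separable_over :: "'c::field set \<Rightarrow> 'c set \<Rightarrow> bool" where
  "separable_over L K \<longleftrightarrow>
     (\<forall>x\<in>L. \<exists>p. rsquarefree p \<and> (\<forall>i. coeff p i \<in> K) \<and> poly p x = 0)"

text \<open>
  The exponential is the unique \<open>F_q\<close>-linear power series \<open>F = z + \<dots>\<close> with
  \<open>F(\<theta>z) = \<rho>\<^sub>t(F(z))\<close>.
\<close>

definition exp_series ::
  "('f::{field,finite} fls \<Rightarrow> 'c::{field,complete_space}) \<Rightarrow> 'c \<Rightarrow> 'c fps" where
  "exp_series \<iota> \<kappa> = (THE F.
     fps_nth F 1 = 1 \<and>
     (\<forall>n. fps_nth F n \<noteq> 0 \<longrightarrow> (\<exists>i. n = q_of \<iota> ^ i)) \<and>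
     fps_compose F (fps_const (theta \<iota>) * fps_X) =
       (\<Sum>i\<le>degree (rho_t \<iota> \<kappa>). fps_const (coeff (rho_t \<iota> \<kappa>) i) * F ^ (q_of \<iota> ^ i)))"

definition exp_rho :: "('f::{field,finite} fls \<Rightarrow> 'c::{field,complete_space}) \<Rightarrow> 'c \<Rightarrow> 'c \<Rightarrow> 'c" where
  "exp_rho \<iota> \<kappa> z = (\<Sum>n. fps_nth (exp_series \<iota> \<kappa>) n * z ^ n)"

definition period_lattice ::
  "('f::{field,finite} fls \<Rightarrow> 'c::{field,complete_space}) \<Rightarrow> 'c \<Rightarrow> 'c set" where
  "period_lattice \<iota> \<kappa> = {z. exp_rho \<iota> \<kappa> z = 0}"


section \<open>Functions of \<open>t\<close>\<close>

text \<open>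
  All functions of \<open>t\<close> live in the field \<open>'c fls\<close> of formal Laurent series in \<open>t\<close> over \<open>C_\<infinity>\<close>,
  where \<open>f \<mapsto> f\<^bsup>(-1)\<^esup>\<close> acts on coefficients; \<open>x \<mapsto> x\<^sup>q\<close> is a bijection of \<open>C_\<infinity>\<close>.
\<close>

definition twist ::
  "('f::{field,finite} fls \<Rightarrow> 'c::{field,complete_space}) \<Rightarrow> 'c fls \<Rightarrow> 'c fls" where
  "twist \<iota> f = Abs_fls (\<lambda>n. inv_into UNIV (\<lambda>x. x ^ q_of \<iota>) (fls_nth f n))"

definition kbar_polys ::
  "('f::{field,finite} fls \<Rightarrow> 'c::{field,complete_space}) \<Rightarrow> 'c fls set" where
  \<comment> \<open>the image of \<open>kbar[t]\<close>\<close>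
  "kbar_polys \<iota> = {fps_to_fls (fps_of_poly p) |p. \<forall>i. coeff p i \<in> kbar \<iota>}"

definition kbar_rats ::
  "('f::{field,finite} fls \<Rightarrow> 'c::{field,complete_space}) \<Rightarrow> 'c fls set" where
  \<comment> \<open>the image of \<open>kbar(t)\<close>\<close>
  "kbar_rats \<iota> = {f / g |f g. f \<in> kbar_polys \<iota> \<and> g \<in> kbar_polys \<iota> \<and> g \<noteq> 0}"

text \<open>The fraction field of the Tate algebra of power series converging for \<open>\<bar>t\<bar> \<le> 1\<close>.\<close>

definition tate_fractions :: "'c::{field,complete_space} fls set" where
  "tate_fractions = {fps_to_fls f / fps_to_fls g |f g.
     fps_nth f \<longlonglongrightarrow> 0 \<and> fps_nth g \<longlonglongrightarrow> 0 \<and> g \<noteq> 0}"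

definition kbar_rats_ring ::
  "('f::{field,finite} fls \<Rightarrow> 'c::{field,complete_space}) \<Rightarrow> 'c fls ring" where
  "kbar_rats_ring \<iota> =
     \<lparr>carrier = kbar_rats \<iota>, mult = (*), one = 1, zero = 0, add = (+)\<rparr>"

definition vecs_in :: "'a set \<Rightarrow> nat \<Rightarrow> 'a vec set" where
  "vecs_in S n = {v \<in> carrier_vec n. \<forall>i<n. vec_index v i \<in> S}"


section \<open>Pre-t-motives\<close>

text \<open>
  A left module over the skew ring \<open>kbar(t)[\<sigma>,\<sigma>\<^sup>-\<^sup>1]\<close> is a \<open>kbar(t)\<close>-vector space with a bijective
  additive operator \<open>\<sigma>\<close> such that \<open>\<sigma>(f x) = f\<^bsup>(-1)\<^esup> \<sigma>(x)\<close>.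
\<close>

record ('a, 'm) sigma_module = "('a, 'm) module" +
  sigma :: "'m \<Rightarrow> 'm"

definition lin_comb :: "('a, 'm, 'e) module_scheme \<Rightarrow> 'a vec \<Rightarrow> 'm list \<Rightarrow> 'm" where
  "lin_comb M a b = (\<Oplus>\<^bsub>M\<^esub>i\<in>{..<length b}. vec_index a i \<odot>\<^bsub>M\<^esub> b ! i)"

definition is_basis :: "'a set \<Rightarrow> ('a, 'm, 'e) module_scheme \<Rightarrow> 'm set \<Rightarrow> 'm list \<Rightarrow> bool" where
  \<comment> \<open>\<open>b\<close> is a basis of \<open>N\<close> with respect to the subset \<open>S\<close> of scalars\<close>
  "is_basis S M N b \<longleftrightarrow>
     (\<forall>a \<in> vecs_in S (length b). lin_comb M a b \<in> N) \<and> set b \<subseteq> N \<and>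
     (\<forall>x\<in>N. \<exists>!a. a \<in> vecs_in S (length b) \<and> x = lin_comb M a b)"

definition pre_t_motive ::
  "('f::{field,finite} fls \<Rightarrow> 'c::{field,complete_space}) \<Rightarrow> ('c fls, 'm) sigma_module \<Rightarrow> bool" where
  "pre_t_motive \<iota> M \<longleftrightarrow>
     Module.module (kbar_rats_ring \<iota>) M \<and>
     (\<exists>b. is_basis (kbar_rats \<iota>) M (carrier M) b) \<and>
     bij_betw (sigma M) (carrier M) (carrier M) \<and>
     (\<forall>x\<in>carrier M. \<forall>y\<in>carrier M. sigma M (x \<oplus>\<^bsub>M\<^esub> y) = sigma M x \<oplus>\<^bsub>M\<^esub> sigma M y) \<and>
     (\<forall>f\<in>kbar_rats \<iota>. \<forall>x\<in>carrier M. sigma M (f \<odot>\<^bsub>M\<^esub> x) = twist \<iota> f \<odot>\<^bsub>M\<^esub> sigma M x)"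

text \<open>
  Morphisms of left \<open>kbar(t)[\<sigma>,\<sigma>\<^sup>-\<^sup>1]\<close>-modules, extensional outside the carrier so that equality of
  morphisms is equality of functions.
\<close>

definition ptm_hom ::
  "('f::{field,finite} fls \<Rightarrow> 'c::{field,complete_space}) \<Rightarrow>
    ('c fls, 'm) sigma_module \<Rightarrow> ('c fls, 'n) sigma_module \<Rightarrow> ('m \<Rightarrow> 'n) set" where
  "ptm_hom \<iota> M N = {\<phi> \<in> carrier M \<rightarrow>\<^sub>E carrier N.
     (\<forall>x\<in>carrier M. \<forall>y\<in>carrier M. \<phi> (x \<oplus>\<^bsub>M\<^esub> y) = \<phi> x \<oplus>\<^bsub>N\<^esub> \<phi> y) \<and>
     (\<forall>f\<in>kbar_rats \<iota>. \<forall>x\<in>carrier M. \<phi> (f \<odot>\<^bsub>M\<^esub> x) = f \<odot>\<^bsub>N\<^esub> \<phi> x) \<and>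
     (\<forall>x\<in>carrier M. \<phi> (sigma M x) = sigma N (\<phi> x))}"

definition ptm_End ::
  "('f::{field,finite} fls \<Rightarrow> 'c::{field,complete_space}) \<Rightarrow>
    ('c fls, 'm) sigma_module \<Rightarrow> ('m \<Rightarrow> 'm) ring" where
  "ptm_End \<iota> M = \<lparr>carrier = ptm_hom \<iota> M M, mult = compose (carrier M),
     one = (\<lambda>x\<in>carrier M. x), zero = (\<lambda>x\<in>carrier M. \<zero>\<^bsub>M\<^esub>),
     add = (\<lambda>f g. \<lambda>x\<in>carrier M. f x \<oplus>\<^bsub>M\<^esub> g x)\<rparr>"

text \<open>\<open>\<sigma> b = \<Phi> b\<close> for the column vector \<open>b\<close> of basis elements.\<close>

definition represented_by ::
  "('f::{field,finite} fls \<Rightarrow> 'c::{field,complete_space}) \<Rightarrow>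
    ('c fls, 'm) sigma_module \<Rightarrow> 'm list \<Rightarrow> 'c fls mat \<Rightarrow> bool" where
  "represented_by \<iota> M b \<Phi> \<longleftrightarrow>
     is_basis (kbar_rats \<iota>) M (carrier M) b \<and>
     \<Phi> \<in> carrier_mat (length b) (length b) \<and> elements_mat \<Phi> \<subseteq> kbar_rats \<iota> \<and>
     (\<forall>i<length b. sigma M (b ! i) = lin_comb M (row \<Phi> i) b)"

text \<open>
  The standard module with \<open>\<sigma>\<close> represented by \<open>\<Phi>\<close>: the vector \<open>x\<close> holds the coordinates of
  \<open>\<Sum> x\<^sub>i m\<^sub>i\<close>, and \<open>\<sigma>(\<Sum> x\<^sub>i m\<^sub>i) = \<Sum>\<^sub>i \<Sum>\<^sub>j x\<^sub>i\<^bsup>(-1)\<^esup> \<Phi>\<^sub>i\<^sub>j m\<^sub>j\<close>.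
\<close>

definition motive_of ::
  "('f::{field,finite} fls \<Rightarrow> 'c::{field,complete_space}) \<Rightarrow> 'c fls mat \<Rightarrow>
    ('c fls, 'c fls vec) sigma_module" where
  "motive_of \<iota> \<Phi> =
     \<lparr>carrier = vecs_in (kbar_rats \<iota>) (dim_row \<Phi>), mult = undefined, one = undefined,
      zero = 0\<^sub>v (dim_row \<Phi>), add = (+), smult = (\<cdot>\<^sub>v),
      sigma = (\<lambda>x. transpose_mat \<Phi> *\<^sub>v map_vec (twist \<iota>) x)\<rparr>"

definition rigid_analytically_trivial ::
  "('f::{field,finite} fls \<Rightarrow> 'c::{field,complete_space}) \<Rightarrow> ('c fls, 'm) sigma_module \<Rightarrow> bool" where
  "rigid_analytically_trivial \<iota> M \<longleftrightarrow>
     (\<exists>b \<Phi> \<Psi>. represented_by \<iota> M b \<Phi> \<and>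
        \<Psi> \<in> carrier_mat (length b) (length b) \<and> elements_mat \<Psi> \<subseteq> tate_fractions \<and>
        invertible_mat \<Psi> \<and> map_mat (twist \<iota>) \<Psi> = \<Phi> * \<Psi>)"

definition rat_motive ::
  "('f::{field,finite} fls \<Rightarrow> 'c::{field,complete_space}) \<Rightarrow> ('c fls, 'm) sigma_module \<Rightarrow> bool" where
  "rat_motive \<iota> M \<longleftrightarrow> pre_t_motive \<iota> M \<and> rigid_analytically_trivial \<iota> M"


section \<open>The category of t-motives\<close>

text \<open>
  \<open>P\<close> is, up to isomorphism, \<open>kbar(t) \<otimes> N\<close> for an Anderson t-motive \<open>N\<close>.  As an Anderson t-motive is
  free over \<open>kbar[t]\<close>, it embeds into \<open>kbar(t) \<otimes> N\<close>, so \<open>N\<close> is taken to be a lattice in \<open>P\<close>: a left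
  \<open>kbar[t,\<sigma>]\<close>-submodule that has a finite \<open>kbar[t]\<close>-basis \<open>b\<close> (which is a \<open>kbar(t)\<close>-basis of \<open>P\<close>),
  has a finite \<open>kbar[\<sigma>]\<close>-basis \<open>c\<close>, and satisfies \<open>(t - \<theta>)\<^sup>n N \<subseteq> \<sigma>N\<close> for some (hence every
  larger) \<open>n\<close>.
\<close>

definition from_anderson_t_motive ::
  "('f::{field,finite} fls \<Rightarrow> 'c::{field,complete_space}) \<Rightarrow> ('c fls, 'm) sigma_module \<Rightarrow> bool" where
  "from_anderson_t_motive \<iota> P \<longleftrightarrow> (\<exists>N.
     (\<exists>b. is_basis (kbar_rats \<iota>) P (carrier P) b \<and> is_basis (kbar_polys \<iota>) P N b) \<and>
     sigma P ` N \<subseteq> N \<and>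
     (\<exists>c. set c \<subseteq> N \<and>
        (\<forall>x\<in>N. \<exists>!a :: 'c poly list.
           length a = length c \<and> (\<forall>p\<in>set a. \<forall>j. coeff p j \<in> kbar \<iota>) \<and>
           x = (\<Oplus>\<^bsub>P\<^esub>i\<in>{..<length c}. \<Oplus>\<^bsub>P\<^esub>j\<in>{..degree (a ! i)}.
                  fls_const (coeff (a ! i) j) \<odot>\<^bsub>P\<^esub> (sigma P ^^ j) (c ! i)))) \<and>
     (\<exists>n. \<forall>x\<in>N. (fls_X - fls_const (theta \<iota>)) ^ n \<odot>\<^bsub>P\<^esub> x \<in> sigma P ` N))"

definition kronecker_mat :: "'a::times mat \<Rightarrow> 'a mat \<Rightarrow> 'a mat" where
  "kronecker_mat A B = mat (dim_row A * dim_row B) (dim_col A * dim_col B)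
     (\<lambda>(i, j). A $$ (i div dim_row B, j div dim_col B) * B $$ (i mod dim_row B, j mod dim_col B))"

definition trivial_motive ::
  "('f::{field,finite} fls \<Rightarrow> 'c::{field,complete_space}) \<Rightarrow> ('c fls, 'c fls vec) sigma_module" where
  "trivial_motive \<iota> = motive_of \<iota> (1\<^sub>m 1)"

text \<open>
  The objects of the strictly full Tannakian subcategory, generated by the rigid analytically trivial
  Anderson t-motives, of the category of rigid analytically trivial pre-t-motives: the closure under
  direct sums, tensor products, duals, subobjects and quotients (hence isomorphisms).  Every
  pre-t-motive is isomorphic to one with carrier in \<open>'c fls vec\<close>.
\<close>

inductive t_motive ::
  "('f::{field,finite} fls \<Rightarrow> 'c::{field,complete_space}) \<Rightarrow>
    ('c fls, 'c fls vec) sigma_module \<Rightarrow> bool" for \<iota> where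
  anderson: "\<lbrakk>rat_motive \<iota> P; from_anderson_t_motive \<iota> P\<rbrakk> \<Longrightarrow> t_motive \<iota> P"
| trivial: "t_motive \<iota> (trivial_motive \<iota>)"
| direct_sum:
    "\<lbrakk>t_motive \<iota> M; t_motive \<iota> N; represented_by \<iota> M b \<Phi>; represented_by \<iota> N c \<Psi>;
      rat_motive \<iota> X;
      represented_by \<iota> X d
        (four_block_mat \<Phi> (0\<^sub>m (length b) (length c)) (0\<^sub>m (length c) (length b)) \<Psi>)\<rbrakk>
     \<Longrightarrow> t_motive \<iota> X"
| tensor:
    "\<lbrakk>t_motive \<iota> M; t_motive \<iota> N; represented_by \<iota> M b \<Phi>; represented_by \<iota> N c \<Psi>;
      rat_motive \<iota> X; represented_by \<iota> X d (kronecker_mat \<Phi> \<Psi>)\<rbrakk>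
     \<Longrightarrow> t_motive \<iota> X"
| dual:
    "\<lbrakk>t_motive \<iota> M; represented_by \<iota> M b \<Phi>; rat_motive \<iota> X; represented_by \<iota> X d \<Phi>';
      inverts_mat \<Phi> (transpose_mat \<Phi>'); length d = length b\<rbrakk>
     \<Longrightarrow> t_motive \<iota> X"
| subobject:
    "\<lbrakk>t_motive \<iota> M; rat_motive \<iota> X; \<phi> \<in> ptm_hom \<iota> X M; inj_on \<phi> (carrier X)\<rbrakk>
     \<Longrightarrow> t_motive \<iota> X"
| quotient:
    "\<lbrakk>t_motive \<iota> M; rat_motive \<iota> X; \<phi> \<in> ptm_hom \<iota> M X; \<phi> ` carrier M = carrier X\<rbrakk>
     \<Longrightarrow> t_motive \<iota> X"


section \<open>Extensions of t-motives\<close>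

text \<open>\<open>(X, i, p)\<close> stands for \<open>0 \<rightarrow> M \<rightarrow> X \<rightarrow> N \<rightarrow> 0\<close> with \<open>i : M \<rightarrow> X\<close> and \<open>p : X \<rightarrow> N\<close>.\<close>

type_synonym ('a, 'v) extension = "('a, 'v) sigma_module \<times> ('v \<Rightarrow> 'v) \<times> ('v \<Rightarrow> 'v)"

definition extensions ::
  "('f::{field,finite} fls \<Rightarrow> 'c::{field,complete_space}) \<Rightarrow>
    ('c fls, 'c fls vec) sigma_module \<Rightarrow> ('c fls, 'c fls vec) sigma_module \<Rightarrow>
    ('c fls, 'c fls vec) extension set" where
  "extensions \<iota> N M = {(X, i, p). t_motive \<iota> X \<and>
     i \<in> ptm_hom \<iota> M X \<and> inj_on i (carrier M) \<and>
     p \<in> ptm_hom \<iota> X N \<and> p ` carrier X = carrier N \<and>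
     i ` carrier M = {x \<in> carrier X. p x = \<zero>\<^bsub>N\<^esub>}}"

definition ext_equiv ::
  "('f::{field,finite} fls \<Rightarrow> 'c::{field,complete_space}) \<Rightarrow>
    ('c fls, 'c fls vec) sigma_module \<Rightarrow> ('c fls, 'c fls vec) sigma_module \<Rightarrow>
    ('c fls, 'c fls vec) extension rel" where
  "ext_equiv \<iota> N M = {((X, i, p), (X', i', p')).
     (X, i, p) \<in> extensions \<iota> N M \<and> (X', i', p') \<in> extensions \<iota> N M \<and>
     (\<exists>g \<in> ptm_hom \<iota> X X'. bij_betw g (carrier X) (carrier X') \<and>
        (\<forall>x\<in>carrier M. g (i x) = i' x) \<and> (\<forall>x\<in>carrier X. p' (g x) = p x))}"

definition fibre_product ::
  "('a, 'm) sigma_module \<Rightarrow> ('m \<Rightarrow> 'n) \<Rightarrow> ('a, 'm) sigma_module \<Rightarrow> ('m \<Rightarrow> 'n) \<Rightarrow>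
    ('a, 'm \<times> 'm) sigma_module" where
  "fibre_product X p Y r =
     \<lparr>carrier = {(x, y) \<in> carrier X \<times> carrier Y. p x = r y}, mult = undefined, one = undefined,
      zero = (\<zero>\<^bsub>X\<^esub>, \<zero>\<^bsub>Y\<^esub>),
      add = (\<lambda>(x, y) (x', y'). (x \<oplus>\<^bsub>X\<^esub> x', y \<oplus>\<^bsub>Y\<^esub> y')),
      smult = (\<lambda>a (x, y). (a \<odot>\<^bsub>X\<^esub> x, a \<odot>\<^bsub>Y\<^esub> y)),
      sigma = (\<lambda>(x, y). (sigma X x, sigma Y y))\<rparr>"

text \<open>
  The Baer sum is the pushout along the addition \<open>M \<times> M \<rightarrow> M\<close> of the extension
  \<open>0 \<rightarrow> M \<times> M \<rightarrow> X1 \<times>\<^sub>N X2 \<rightarrow> N \<rightarrow> 0\<close>.  An extension is a pushout as soon as it receives a map that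
  covers the given map of the subobjects and the identity of \<open>N\<close>.
\<close>

fun is_baer_sum ::
  "('f::{field,finite} fls \<Rightarrow> 'c::{field,complete_space}) \<Rightarrow>
    ('c fls, 'c fls vec) sigma_module \<Rightarrow>
    ('c fls, 'c fls vec) extension \<Rightarrow> ('c fls, 'c fls vec) extension \<Rightarrow>
    ('c fls, 'c fls vec) extension \<Rightarrow> bool" where
  "is_baer_sum \<iota> M (X1, i1, p1) (X2, i2, p2) (X, i, p) \<longleftrightarrow>
     (\<exists>g \<in> ptm_hom \<iota> (fibre_product X1 p1 X2 p2) X.
        (\<forall>x\<in>carrier M. \<forall>y\<in>carrier M. g (i1 x, i2 y) = i (x \<oplus>\<^bsub>M\<^esub> y)) \<and>
        (\<forall>(x, y)\<in>carrier (fibre_product X1 p1 X2 p2). p (g (x, y)) = p1 x))"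

fun is_pushout ::
  "('f::{field,finite} fls \<Rightarrow> 'c::{field,complete_space}) \<Rightarrow>
    ('c fls, 'c fls vec) sigma_module \<Rightarrow> ('c fls vec \<Rightarrow> 'c fls vec) \<Rightarrow>
    ('c fls, 'c fls vec) extension \<Rightarrow> ('c fls, 'c fls vec) extension \<Rightarrow> bool" where
  "is_pushout \<iota> M f (X, i, p) (X', i', p') \<longleftrightarrow>
     (\<exists>g \<in> ptm_hom \<iota> X X'.
        (\<forall>x\<in>carrier M. g (i x) = i' (f x)) \<and> (\<forall>x\<in>carrier X. p' (g x) = p x))"

text \<open>
  The operations on classes collect all representatives of the result; the zero element is the
  class of split extensions.
\<close>

definition Ext1 ::
  "('f::{field,finite} fls \<Rightarrow> 'c::{field,complete_space}) \<Rightarrow>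
    ('c fls, 'c fls vec) sigma_module \<Rightarrow> ('c fls, 'c fls vec) sigma_module \<Rightarrow>
    ('c fls vec \<Rightarrow> 'c fls vec, ('c fls, 'c fls vec) extension set) module" where
  "Ext1 \<iota> N M =
     \<lparr>carrier = extensions \<iota> N M // ext_equiv \<iota> N M,
      mult = undefined, one = undefined,
      zero = {(X, i, p) \<in> extensions \<iota> N M. \<exists>s \<in> ptm_hom \<iota> N X. \<forall>y\<in>carrier N. p (s y) = y},
      add = (\<lambda>C D. {E \<in> extensions \<iota> N M. \<exists>E1\<in>C. \<exists>E2\<in>D. is_baer_sum \<iota> M E1 E2 E}),
      smult = (\<lambda>f C. {E \<in> extensions \<iota> N M. \<exists>E0\<in>C. is_pushout \<iota> M f E0 E})\<rparr>"

definition lin_indep_family ::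
  "('r, 's) ring_scheme \<Rightarrow> ('r, 'm, 'e) module_scheme \<Rightarrow> 'i set \<Rightarrow> ('i \<Rightarrow> 'm) \<Rightarrow> bool" where
  "lin_indep_family R M I x \<longleftrightarrow>
     x \<in> I \<rightarrow> carrier M \<and>
     (\<forall>c \<in> I \<rightarrow> carrier R. (\<Oplus>\<^bsub>M\<^esub>i\<in>I. c i \<odot>\<^bsub>M\<^esub> x i) = \<zero>\<^bsub>M\<^esub> \<longrightarrow> (\<forall>i\<in>I. c i = \<zero>\<^bsub>R\<^esub>))"


section \<open>The t-motives of the theorem\<close>

definition Phi_rho ::
  "('f::{field,finite} fls \<Rightarrow> 'c::{field,complete_space}) \<Rightarrow> 'c \<Rightarrow> 'c fls mat" where
  "Phi_rho \<iota> \<kappa> = mat_of_rows_list 2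
     [[0, 1],
      [fls_X - fls_const (theta \<iota>), - twist \<iota> (fls_const \<kappa>)]]"

definition M_rho ::
  "('f::{field,finite} fls \<Rightarrow> 'c::{field,complete_space}) \<Rightarrow> 'c \<Rightarrow>
    ('c fls, 'c fls vec) sigma_module" where
  "M_rho \<iota> \<kappa> = motive_of \<iota> (Phi_rho \<iota> \<kappa>)"

definition Phi_alpha ::
  "('f::{field,finite} fls \<Rightarrow> 'c::{field,complete_space}) \<Rightarrow> 'c \<Rightarrow> 'c \<Rightarrow> 'c fls mat" where
  "Phi_alpha \<iota> \<kappa> \<alpha> = four_block_mat
     (Phi_rho \<iota> \<kappa>) (0\<^sub>m 2 1)
     (mat_of_rows_list 2 [[fls_const \<alpha>, 0]]) (1\<^sub>m 1)"

text \<open>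
  \<open>M\<^sub>\<rho>\<close> is the span of the first two basis vectors and the last coordinate gives the quotient
  \<open>kbar(t)\<close>.
\<close>

definition M_alpha ::
  "('f::{field,finite} fls \<Rightarrow> 'c::{field,complete_space}) \<Rightarrow> 'c \<Rightarrow> 'c \<Rightarrow>
    ('c fls, 'c fls vec) extension" where
  "M_alpha \<iota> \<kappa> \<alpha> =
     (motive_of \<iota> (Phi_alpha \<iota> \<kappa> \<alpha>),
      \<lambda>x\<in>carrier (M_rho \<iota> \<kappa>). x @\<^sub>v 0\<^sub>v 1,
      \<lambda>x\<in>carrier (motive_of \<iota> (Phi_alpha \<iota> \<kappa> \<alpha>)). vec 1 (\<lambda>_. vec_index x 2))"

definition M_alpha_class ::
  "('f::{field,finite} fls \<Rightarrow> 'c::{field,complete_space}) \<Rightarrow> 'c \<Rightarrow> 'c \<Rightarrow>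
    ('c fls, 'c fls vec) extension set" where
  "M_alpha_class \<iota> \<kappa> \<alpha> =
     ext_equiv \<iota> (trivial_motive \<iota>) (M_rho \<iota> \<kappa>) `` {M_alpha \<iota> \<kappa> \<alpha>}"

end

theory Submission
  imports Defs "HOL-Algebra.Sylow" "Jordan_Normal_Form.Char_Poly"
begin

text \<open>
  Put \<open>y\<^sub>i = f\<^sub>i(m\<^sub>1)\<close> for endomorphisms \<open>f\<^sub>i\<close> of \<open>M\<^sub>\<rho>\<close>.  The class \<open>\<Sum> f\<^sub>i M\<^sub>i\<close> is that of the extension
  with bottom row \<open>v = \<Sum> \<alpha>\<^sub>i y\<^sub>i\<close>, and it is zero if and only if \<open>v = (1 - \<sigma>) r\<close> for a row \<open>r\<close> over
  \<open>kbar(t)\<close>.  A minimal monic common denominator of the \<open>y\<^sub>i\<close> and \<open>\<sigma> y\<^sub>i\<close> is fixed by \<open>\<sigma>\<close>, because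
  \<open>\<sigma>\<close> preserves minimality; so it lies in \<open>F\<^sub>q[t]\<close>, and the same argument applies to \<open>r\<close>.  After
  clearing it, \<open>v\<close> vanishes in the cokernel of \<open>1 - \<sigma>\<close> on \<open>C\<^sub>\<infinity>[t] m\<^sub>1 \<oplus> C\<^sub>\<infinity>[t] m\<^sub>2\<close>, which is \<open>C\<^sub>\<infinity>\<close> with
  \<open>t\<close> acting as \<open>\<rho>\<^sub>t\<close>.  This gives \<open>\<Sum> g\<^sub>i(\<alpha>\<^sub>i) = 0\<close> with endomorphisms \<open>g\<^sub>i\<close> of \<open>\<rho>\<close> that vanish only if
  \<open>f\<^sub>i\<close> does.  Hence \<open>\<Sum> g\<^sub>i u\<^sub>i\<close> is a period; by complex multiplication it is a multiple of \<open>\<omega>\<^sub>1\<close> over the CM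
  field, and linear independence forces \<open>g\<^sub>i = 0\<close>.

  The partial sums must also be realised by t-motives.  The rigid analytic trivialisations come from
  solving \<open>\<Psi>\<^bsup>(-1)\<^esup> = \<Phi> \<Psi>\<close> coefficientwise; and \<open>M\<^sub>i\<close> is a t-motive because its tensor product with the
  Carlitz motive is an Anderson t-motive.
\<close>

section \<open>Subrings, subfields and algebraic elements\<close>

text \<open>Roots are available only for polynomials over \<open>L\<close>, the algebraic closure of
  F_q((1/\<theta>)); its completion is not assumed to be algebraically closed. Hence the Frobenius
  is inverted by a limit argument, and the coefficients of all trivialisations are chosen in
  \<open>L\<close>.

  Denominators fixed by the twist matter because exactly these commute with \<sigma>, so that an
  equation can be cleared without changing its shape. For the y_i, minimality is preserved only up
  to a factor T = t - \<theta>: the determinant of \<sigma> on \<open>M_rho\<close> is - T, so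
  undoing \<sigma> costs one T. As T is prime and a denominator has the same degree as its twist,
  the defect disappears.

  The t-motive M_i is not an Anderson t-motive since \<sigma> is bijective on kbar[t] in its trivial
  quotient, whereas \<sigma> is never onto a nonzero free kbar[\<sigma>]-module of finite rank. The
  Carlitz factor multiplies \<sigma> by T, and division with remainder by T then produces a finite
  basis.\<close>

locale closed_subring =
  fixes S :: "'a::comm_ring_1 set"
  assumes one_mem: "1 \<in> S"
    and diff_mem: "x \<in> S \<Longrightarrow> y \<in> S \<Longrightarrow> x - y \<in> S"
    and mult_mem: "x \<in> S \<Longrightarrow> y \<in> S \<Longrightarrow> x * y \<in> S"
begin

lemma zero_mem: "0 \<in> S"
  using diff_mem[OF one_mem one_mem] by simp

lemma uminus_mem: "x \<in> S \<Longrightarrow> - x \<in> S"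
  using diff_mem[OF zero_mem] by simp

lemma add_mem: "x \<in> S \<Longrightarrow> y \<in> S \<Longrightarrow> x + y \<in> S"
  using diff_mem[OF _ uminus_mem[of y], of x] by simp

lemma power_mem: "x \<in> S \<Longrightarrow> x ^ n \<in> S"
  by (induction n) (auto intro: one_mem mult_mem)

lemma sum_mem: "(\<And>i. i \<in> A \<Longrightarrow> f i \<in> S) \<Longrightarrow> sum f A \<in> S"
  by (induction A rule: infinite_finite_induct) (auto intro: zero_mem add_mem)

lemma prod_mem: "(\<And>i. i \<in> A \<Longrightarrow> f i \<in> S) \<Longrightarrow> prod f A \<in> S"
  by (induction A rule: infinite_finite_induct) (auto intro: one_mem mult_mem)

lemma signof_mem: "signof p \<in> S"
  by (cases "evenperm p") (auto simp: sign_def intro: one_mem uminus_mem)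

lemma det_mem:
  assumes "A \<in> carrier_mat n n" "\<And>i j. i < n \<Longrightarrow> j < n \<Longrightarrow> A $$ (i, j) \<in> S"
  shows "det A \<in> S"
  unfolding det_def'[OF assms(1)]
  by (intro sum_mem mult_mem signof_mem prod_mem assms(2)) (auto simp: permutes_in_image)

lemmas mems = zero_mem one_mem add_mem diff_mem uminus_mem mult_mem power_mem

lemma poly_mem: "(\<And>i. coeff p i \<in> S) \<Longrightarrow> x \<in> S \<Longrightarrow> poly p x \<in> S"
  unfolding poly_altdef by (intro sum_mem mems)

end

definition coeffs_in :: "'a::zero set \<Rightarrow> 'a poly set" where
  "coeffs_in S = {p. \<forall>i. coeff p i \<in> S}"

lemma closed_subring_coeffs_in:
  assumes "closed_subring S"
  shows "closed_subring (coeffs_in S)"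
proof -
  interpret closed_subring S by fact
  show ?thesis
    by unfold_locales (auto simp: coeffs_in_def coeff_mult intro: mems sum_mem)
qed

locale closed_subfield = closed_subring S for S :: "'a::field set" +
  assumes inverse_mem: "x \<in> S \<Longrightarrow> inverse x \<in> S"
begin

lemma divide_mem: "x \<in> S \<Longrightarrow> y \<in> S \<Longrightarrow> x / y \<in> S"
  by (simp add: divide_inverse inverse_mem mult_mem)

end

definition fractions :: "'a::field set \<Rightarrow> 'a set" where
  "fractions S = {a / b |a b. a \<in> S \<and> b \<in> S \<and> b \<noteq> 0}"

lemma fractionsI: "a \<in> S \<Longrightarrow> b \<in> S \<Longrightarrow> b \<noteq> 0 \<Longrightarrow> a / b \<in> fractions S"
  by (auto simp: fractions_def)

lemma closed_subfield_fractions: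
  assumes "closed_subring S"
  shows "closed_subfield (fractions S)"
proof -
  interpret closed_subring S by fact
  show ?thesis
  proof
    show "1 \<in> fractions S"
      using fractionsI[OF one_mem one_mem] by simp
  next
    fix x y assume "x \<in> fractions S" "y \<in> fractions S"
    then obtain a b c d where ab: "x = a / b" "y = c / d" "a \<in> S" "b \<in> S" "c \<in> S" "d \<in> S"
      "b \<noteq> 0" "d \<noteq> 0"
      unfolding fractions_def by blast
    have "x - y = (a * d - c * b) / (b * d)" "x * y = (a * c) / (b * d)"
      using ab by (auto simp: field_simps)
    moreover have "(a * d - c * b) / (b * d) \<in> fractions S" "(a * c) / (b * d) \<in> fractions S"
      by (intro fractionsI mems; use ab in simp)+
    ultimately show "x - y \<in> fractions S" "x * y \<in> fractions S"
      by auto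
  next
    fix x assume "x \<in> fractions S"
    then obtain a b where ab: "x = a / b" "a \<in> S" "b \<in> S" "b \<noteq> 0"
      unfolding fractions_def by blast
    show "inverse x \<in> fractions S"
    proof (cases "a = 0")
      case True
      then show ?thesis
        using ab fractionsI[OF zero_mem one_mem] by simp
    next
      case False
      then show ?thesis
        using ab fractionsI[of b S a] by (simp add: divide_inverse mult.commute)
    qed
  qed
qed

lemma subset_fractions:
  assumes "closed_subring S"
  shows "S \<subseteq> fractions S"
  using fractionsI[OF _ closed_subring.one_mem[OF assms]] by force

section \<open>Algebraic elements through finite ring extensions\<close>

lemma algebraic_over_eigenvalue:
  fixes x :: "'a::field"
  assumes S: "closed_subring S" and A: "A \<in> carrier_mat n n"
    and ent: "\<And>i j. i < n \<Longrightarrow> j < n \<Longrightarrow> A $$ (i, j) \<in> S"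
    and v: "v \<in> carrier_vec n" "v \<noteq> 0\<^sub>v n" "A *\<^sub>v v = x \<cdot>\<^sub>v v"
  shows "algebraic_over S x"
proof -
  interpret closed_subring S by fact
  interpret P: closed_subring "coeffs_in S"
    by (rule closed_subring_coeffs_in) fact
  have "eigenvalue A x"
    using A v unfolding eigenvalue_def eigenvector_def by auto
  then have "poly (char_poly A) x = 0"
    using eigenvalue_root_char_poly[OF A] by simp
  moreover have "char_poly A \<noteq> 0"
    using degree_monic_char_poly[OF A] by auto
  moreover have "char_poly A \<in> coeffs_in S"
    unfolding char_poly_def
  proof (rule P.det_mem)
    show "char_poly_matrix A \<in> carrier_mat n n"
      using A by simp
    fix i j assume ij: "i < n" "j < n"
    have "char_poly_matrix A $$ (i, j) = (if i = j then [:0, 1:] else 0) + [:- (A $$ (i, j)):]"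
      using A ij by (auto simp: char_poly_matrix_def)
    also have "\<dots> \<in> coeffs_in S"
      using ent[OF ij] by (auto simp: coeffs_in_def coeff_pCons split: nat.split intro: mems)
    finally show "char_poly_matrix A $$ (i, j) \<in> coeffs_in S" .
  qed
  ultimately show ?thesis
    unfolding algebraic_over_def coeffs_in_def by blast
qed

definition fspan :: "'a::comm_ring_1 set \<Rightarrow> 'a set \<Rightarrow> 'a set" where
  "fspan S B = {\<Sum>b\<in>B. a b * b |a. \<forall>b\<in>B. a b \<in> S}"

context closed_subring
begin

lemma fspan_zero: "0 \<in> fspan S B"
  unfolding fspan_def by (rule CollectI, rule exI[of _ "\<lambda>_. 0"]) (auto intro: zero_mem)

lemma fspan_add: "x \<in> fspan S B \<Longrightarrow> y \<in> fspan S B \<Longrightarrow> x + y \<in> fspan S B"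
proof -
  assume "x \<in> fspan S B" "y \<in> fspan S B"
  then obtain a c where "x = (\<Sum>b\<in>B. a b * b)" "y = (\<Sum>b\<in>B. c b * b)"
    "\<forall>b\<in>B. a b \<in> S" "\<forall>b\<in>B. c b \<in> S"
    unfolding fspan_def by blast
  then show ?thesis
    unfolding fspan_def
    by (intro CollectI exI[of _ "\<lambda>b. a b + c b"]) (auto simp: sum.distrib algebra_simps intro: add_mem)
qed

lemma fspan_smult: "c \<in> S \<Longrightarrow> x \<in> fspan S B \<Longrightarrow> c * x \<in> fspan S B"
proof -
  assume "x \<in> fspan S B" and c: "c \<in> S"
  then obtain a where "x = (\<Sum>b\<in>B. a b * b)" "\<forall>b\<in>B. a b \<in> S"
    unfolding fspan_def by blast
  then show ?thesis
    unfolding fspan_def using c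
    by (intro CollectI exI[of _ "\<lambda>b. c * a b"])
      (auto simp: sum_distrib_left algebra_simps intro: mult_mem)
qed

lemma fspan_sum: "(\<And>i. i \<in> A \<Longrightarrow> f i \<in> fspan S B) \<Longrightarrow> sum f A \<in> fspan S B"
  by (induction A rule: infinite_finite_induct) (auto intro: fspan_zero fspan_add)

lemma fspan_base: "finite B \<Longrightarrow> b \<in> B \<Longrightarrow> b \<in> fspan S B"
  unfolding fspan_def
  by (rule CollectI, rule exI[of _ "\<lambda>c. if c = b then 1 else 0"])
    (auto intro: mems simp: if_distrib[of "\<lambda>x. x * _"] cong: if_cong)

lemma fspan_minimal:
  assumes "x \<in> fspan S B" "\<And>b. b \<in> B \<Longrightarrow> f b \<in> fspan S C"
    and "\<And>x y. f (x + y) = f x + f y" "\<And>c x. c \<in> S \<Longrightarrow> f (c * x) = c * f x"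
  shows "f x \<in> fspan S C"
proof -
  obtain a where a: "x = (\<Sum>b\<in>B. a b * b)" "\<forall>b\<in>B. a b \<in> S"
    using assms(1) unfolding fspan_def by blast
  have "f 0 = 0"
    using assms(3)[of 0 0] by simp
  then have "f (sum g A) = (\<Sum>i\<in>A. f (g i))" for g and A :: "'a set"
    by (induction A rule: infinite_finite_induct) (auto simp: assms(3))
  then have "f x = (\<Sum>b\<in>B. a b * f b)"
    using a assms(4) by auto
  also have "\<dots> \<in> fspan S C"
    using a assms(2) by (intro fspan_sum fspan_smult) auto
  finally show ?thesis .
qed

end

definition finite_subring :: "'a::comm_ring_1 set \<Rightarrow> 'a set \<Rightarrow> bool" where
  "finite_subring S W \<longleftrightarrow> closed_subring W \<and> (\<exists>B. finite B \<and> W = fspan S B)"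

text \<open>The determinant trick: multiplication by x sends the generators of W to S-combinations
  of themselves, so x is an eigenvalue of a matrix over S. The vector of generators is nonzero
  because W contains 1.\<close>

lemma finite_subring_imp_algebraic:
  fixes x :: "'a::field"
  assumes S: "closed_subring S" and W: "finite_subring S W" and x: "x \<in> W"
  shows "algebraic_over S x"
proof -
  interpret closed_subring S by fact
  interpret W: closed_subring W
    using W by (simp add: finite_subring_def)
  obtain B where B: "finite B" "W = fspan S B"
    using W by (auto simp: finite_subring_def)
  obtain bs where bs: "set bs = B" "distinct bs"
    using finite_distinct_list[OF B(1)] by blast
  define n where "n = length bs"
  have sum_bs: "(\<Sum>b\<in>B. g b) = (\<Sum>j<n. g (bs ! j))" for g :: "'a \<Rightarrow> 'a"
    unfolding n_def bs(1)[symmetric]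
    by (simp add: bs(2) sum.distinct_set_conv_list sum_list_sum_nth lessThan_atLeast0)
  have "\<exists>a. \<forall>i<n. x * bs ! i = (\<Sum>b\<in>B. a i b * b) \<and> (\<forall>b\<in>B. a i b \<in> S)"
  proof -
    have "\<exists>a. x * bs ! i = (\<Sum>b\<in>B. a b * b) \<and> (\<forall>b\<in>B. a b \<in> S)" if "i < n" for i
    proof -
      have "bs ! i \<in> W"
        using that bs(1) B fspan_base by (auto simp: n_def)
      then have "x * bs ! i \<in> fspan S B"
        using W.mult_mem[OF x] B by simp
      then show ?thesis
        unfolding fspan_def by blast
    qed
    then show ?thesis
      by metis
  qed
  then obtain a where a: "\<And>i. i < n \<Longrightarrow> x * bs ! i = (\<Sum>b\<in>B. a i b * b)"
    "\<And>i b. i < n \<Longrightarrow> b \<in> B \<Longrightarrow> a i b \<in> S"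
    by blast
  define A where "A = mat n n (\<lambda>(i, j). a i (bs ! j))"
  define v where "v = vec n (\<lambda>i. bs ! i)"
  show ?thesis
  proof (rule algebraic_over_eigenvalue[OF S])
    show "A \<in> carrier_mat n n" "v \<in> carrier_vec n"
      by (auto simp: A_def v_def)
    show "A $$ (i, j) \<in> S" if "i < n" "j < n" for i j
      using that a(2)[OF that(1), of "bs ! j"] bs by (auto simp: A_def n_def)
    show "v \<noteq> 0\<^sub>v n"
    proof
      assume "v = 0\<^sub>v n"
      then have "bs ! i = 0" if "i < n" for i
        using that by (metis index_vec index_zero_vec(1) v_def)
      then have "W = {0}"
        using B(2) sum_bs unfolding fspan_def by (auto intro: exI[of _ "\<lambda>_. 0"] zero_mem)
      then show False
        using W.one_mem by simp
    qed
    show "A *\<^sub>v v = x \<cdot>\<^sub>v v"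
    proof (rule eq_vecI)
      fix i assume "i < dim_vec (x \<cdot>\<^sub>v v)"
      then have i: "i < n"
        by (simp add: v_def)
      show "(A *\<^sub>v v) $ i = (x \<cdot>\<^sub>v v) $ i"
        using i a(1)[OF i] unfolding sum_bs
        by (simp add: A_def v_def scalar_prod_def lessThan_atLeast0)
    qed (simp add: A_def v_def)
  qed
qed

text \<open>The powers of y below d span W[y] over W, because the relation rewrites y^d. Their
  products with the generators of W then span it over S.\<close>

lemma finite_subring_adjoin:
  fixes y :: "'a::comm_ring_1"
  assumes S: "closed_subring S" and W: "finite_subring S W" and d: "d > 0"
    and c: "\<And>k. k < d \<Longrightarrow> c k \<in> W" and y: "y ^ d = (\<Sum>k<d. c k * y ^ k)"
  shows "\<exists>W'. finite_subring S W' \<and> W \<subseteq> W' \<and> y \<in> W'"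
proof -
  interpret closed_subring S by fact
  interpret W: closed_subring W
    using W by (simp add: finite_subring_def)
  obtain B where B: "finite B" "W = fspan S B"
    using W by (auto simp: finite_subring_def)
  define W' where "W' = {\<Sum>k<d. w k * y ^ k |w. \<forall>k<d. w k \<in> W}"
  define B' where "B' = (\<lambda>(b, k). b * y ^ k) ` (B \<times> {..<d})"
  have W'_add: "u + v \<in> W'" if uv: "u \<in> W'" "v \<in> W'" for u v
  proof -
    obtain w1 where "u = (\<Sum>k<d. w1 k * y ^ k)" "\<forall>k<d. w1 k \<in> W"
      using uv(1) unfolding W'_def by blast
    moreover obtain w2 where "v = (\<Sum>k<d. w2 k * y ^ k)" "\<forall>k<d. w2 k \<in> W"
      using uv(2) unfolding W'_def by blast
    ultimately show ?thesis
      unfolding W'_def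
      by (intro CollectI exI[of _ "\<lambda>k. w1 k + w2 k"])
        (auto simp: sum.distrib algebra_simps intro: W.add_mem)
  qed
  have W'_smult: "a * u \<in> W'" if au: "a \<in> W" "u \<in> W'" for a u
  proof -
    obtain w where "u = (\<Sum>k<d. w k * y ^ k)" "\<forall>k<d. w k \<in> W"
      using au unfolding W'_def by blast
    then show ?thesis
      using au unfolding W'_def
      by (intro CollectI exI[of _ "\<lambda>k. a * w k"])
        (auto simp: sum_distrib_left algebra_simps intro: W.mult_mem)
  qed
  have W'_pow: "y ^ k \<in> W'" if "k < d" for k
    unfolding W'_def using that
    by (intro CollectI exI[of _ "\<lambda>j. if j = k then 1 else 0"])
      (auto intro: W.mems simp: if_distrib[of "\<lambda>x. x * _"] cong: if_cong)
  have W'_sum: "sum f A \<in> W'" if "\<And>i. i \<in> A \<Longrightarrow> f i \<in> W'" for f and A :: "nat set"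
    using that
  proof (induction A rule: infinite_finite_induct)
    case empty
    then show ?case
      using W'_smult[OF W.zero_mem W'_pow[OF d]] by simp
  next
    case infinite
    then show ?case
      using W'_smult[OF W.zero_mem W'_pow[OF d]] by simp
  qed (auto intro: W'_add)
  have W'_y: "y * u \<in> W'" if u: "u \<in> W'" for u
  proof -
    obtain w where w: "u = (\<Sum>k<d. w k * y ^ k)" "\<forall>k<d. w k \<in> W"
      using u unfolding W'_def by blast
    \<comment> \<open>Only the top power leaves the chosen range of exponents, and there the
      relation for y^d applies.\<close>
    have yd: "y ^ Suc k \<in> W'" if "k < d" for k
    proof (cases "Suc k < d")
      case False
      then have "Suc k = d"
        using that by simp
      then show ?thesis
        unfolding \<open>Suc k = d\<close> y by (auto intro!: W'_sum W'_smult W'_pow c)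
    qed (rule W'_pow)
    have "y * u = (\<Sum>k<d. w k * y ^ Suc k)"
      unfolding w(1) by (simp add: sum_distrib_left algebra_simps)
    also have "\<dots> \<in> W'"
      using w(2) by (auto intro!: W'_sum W'_smult yd simp del: power_Suc)
    finally show ?thesis .
  qed
  have W'_ypow: "y ^ k * u \<in> W'" if "u \<in> W'" for u k
    by (induction k) (use that in \<open>auto simp: mult.assoc intro: W'_y\<close>)
  have "closed_subring W'"
  proof
    show "1 \<in> W'"
      using W'_pow[OF d] by simp
    show "u - v \<in> W'" if "u \<in> W'" "v \<in> W'" for u v
      using W'_add[OF that(1) W'_smult[OF W.uminus_mem[OF W.one_mem] that(2)]] by simp
    show "u * v \<in> W'" if u: "u \<in> W'" and v: "v \<in> W'" for u v
    proof -
      obtain w where w: "u = (\<Sum>k<d. w k * y ^ k)" "\<forall>k<d. w k \<in> W"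
        using u unfolding W'_def by blast
      have "u * v = (\<Sum>k<d. w k * (y ^ k * v))"
        unfolding w(1) by (simp add: sum_distrib_right mult.assoc)
      also have "\<dots> \<in> W'"
        using w(2) by (auto intro!: W'_sum W'_smult W'_ypow v)
      finally show ?thesis .
    qed
  qed
  moreover have W_sub: "W \<subseteq> W'"
  proof
    fix a assume "a \<in> W"
    then show "a \<in> W'"
      using W'_smult[OF _ W'_pow[OF d], of a] by simp
  qed
  moreover have fin: "finite B'"
    using B(1) by (auto simp: B'_def)
  moreover have "W' = fspan S B'"
  proof
    show "W' \<subseteq> fspan S B'"
    proof
      fix u assume "u \<in> W'"
      then obtain w where w: "u = (\<Sum>k<d. w k * y ^ k)" "\<forall>k<d. w k \<in> W"
        unfolding W'_def by blast
      have "w k * y ^ k \<in> fspan S B'" if "k < d" for k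
      proof (rule fspan_minimal[where f = "\<lambda>z. z * y ^ k"])
        show "w k \<in> fspan S B"
          using w(2) that B by auto
        show "b * y ^ k \<in> fspan S B'" if "b \<in> B" for b
          using that \<open>k < d\<close> by (intro fspan_base fin) (auto simp: B'_def)
      qed (auto simp: algebra_simps)
      then show "u \<in> fspan S B'"
        unfolding w(1) by (intro fspan_sum) auto
    qed
    have S_W: "a * u \<in> W'" if "a \<in> S" "u \<in> W'" for a u
    proof -
      have "a * 1 \<in> W"
        using fspan_smult[OF that(1)] W.one_mem B by blast
      then show ?thesis
        using W'_smult[OF _ that(2), of a] by simp
    qed
    show "fspan S B' \<subseteq> W'"
    proof
      fix u assume "u \<in> fspan S B'"
      then obtain a where a: "u = (\<Sum>b\<in>B'. a b * b)" "\<forall>b\<in>B'. a b \<in> S"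
        unfolding fspan_def by blast
      have "b \<in> W'" if b: "b \<in> B'" for b
      proof -
        obtain e k where "b = e * y ^ k" "e \<in> B" "k < d"
          using b by (auto simp: B'_def)
        then show ?thesis
          using W'_smult[OF _ W'_pow] fspan_base[OF B(1)] B(2) by blast
      qed
      moreover have sum': "sum f A \<in> W'" if "\<And>i. i \<in> A \<Longrightarrow> f i \<in> W'" for f and A :: "'a set"
        using that
      proof (induction A rule: infinite_finite_induct)
        case (insert x F)
        then show ?case
          by (auto intro: W'_add)
      qed (use W'_sum[of "{}"] in simp_all)
      ultimately show "u \<in> W'"
        using a unfolding a(1) by (intro sum' S_W) auto
    qed
  qed
  moreover have "y \<in> W'"
    using W'_y[OF W'_pow[OF d]] by simp
  ultimately show ?thesis
    unfolding finite_subring_def by blast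
qed

lemma algebraic_over_imp_monic:
  fixes S :: "'a::field set"
  assumes S: "closed_subfield S" and x: "algebraic_over S x"
  obtains d c where "d > 0" "\<And>k. c k \<in> S" "x ^ d = (\<Sum>k<d. c k * x ^ k)"
proof -
  interpret closed_subfield S by fact
  obtain p where p: "p \<noteq> 0" "\<And>i. coeff p i \<in> S" "poly p x = 0"
    using x unfolding algebraic_over_def by blast
  let ?d = "degree p"
  have d: "?d > 0"
    using p by (metis degree_eq_zeroE gr0I pCons_0_0 poly_const_conv)
  have "(\<Sum>k<?d. coeff p k * x ^ k) + lead_coeff p * x ^ ?d = 0"
    using p(3) unfolding poly_altdef lessThan_Suc_atMost[symmetric] by simp
  then have "lead_coeff p * x ^ ?d = - (\<Sum>k<?d. coeff p k * x ^ k)"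
    by (simp add: eq_neg_iff_add_eq_0 add.commute)
  then have "x ^ ?d = - (\<Sum>k<?d. coeff p k * x ^ k) / lead_coeff p"
    using p(1) by (simp add: field_simps)
  also have "\<dots> = (\<Sum>k<?d. (- (coeff p k / lead_coeff p)) * x ^ k)"
    by (simp add: sum_divide_distrib sum_negf)
  finally show ?thesis
    using d p(2) by (intro that[of ?d "\<lambda>k. - (coeff p k / lead_coeff p)"])
      (auto intro: uminus_mem divide_mem)
qed

lemma finite_subring_self:
  assumes "closed_subring S"
  shows "finite_subring S S"
proof -
  interpret closed_subring S by fact
  have "S = fspan S {1}"
    by (auto simp: fspan_def)
  then show ?thesis
    using assms unfolding finite_subring_def by blast
qed

lemma finite_subring_algebraic_finite:
  fixes S :: "'a::field set"
  assumes S: "closed_subfield S" and "finite X" and X: "\<And>x. x \<in> X \<Longrightarrow> algebraic_over S x"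
  shows "\<exists>W. finite_subring S W \<and> S \<subseteq> W \<and> X \<subseteq> W"
  using assms(2) X
proof (induction rule: finite_induct)
  case empty
  then show ?case
    using finite_subring_self S closed_subfield.axioms(1) by blast
next
  case (insert x X)
  then obtain W where W: "finite_subring S W" "S \<subseteq> W" "X \<subseteq> W"
    by auto
  obtain d c where dc: "d > 0" "\<And>k. c k \<in> S" "x ^ d = (\<Sum>k<d. c k * x ^ k)"
    using algebraic_over_imp_monic[OF S] insert.prems by (metis insertI1)
  obtain W' where "finite_subring S W'" "W \<subseteq> W'" "x \<in> W'"
    using finite_subring_adjoin[OF closed_subfield.axioms(1)[OF S] W(1) dc(1) _ dc(3)] dc(2) W(2)
    by blast
  then show ?case
    using W by (intro exI[of _ W']) auto
qed

text \<open>Two algebraic elements lie in one finite ring over S, all of whose elements are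
  algebraic; this gives differences and products. For inverses the coefficients of the polynomial
  are reversed.\<close>

lemma closed_subfield_algebraic:
  fixes S :: "'a::field set"
  assumes S: "closed_subfield S"
  shows "closed_subfield {x. algebraic_over S x}"
proof -
  interpret closed_subfield S by fact
  have one: "algebraic_over S 1"
    unfolding algebraic_over_def
    by (intro exI[of _ "[:-1, 1:]"]) (auto simp: coeff_pCons split: nat.split intro: mems)
  show ?thesis
  proof
    fix x y :: 'a assume "x \<in> {x. algebraic_over S x}" "y \<in> {x. algebraic_over S x}"
    then obtain W where W: "finite_subring S W" "x \<in> W" "y \<in> W"
      using finite_subring_algebraic_finite[OF S, of "{x, y}"] by auto
    then interpret W: closed_subring W
      by (simp add: finite_subring_def)
    show "x - y \<in> {x. algebraic_over S x}" "x * y \<in> {x. algebraic_over S x}"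
      using W finite_subring_imp_algebraic[OF closed_subring_axioms W(1)]
      by (auto intro: W.mems)
  next
    fix x :: 'a assume "x \<in> {x. algebraic_over S x}"
    then obtain p where p: "p \<noteq> 0" "\<And>i. coeff p i \<in> S" "poly p x = 0"
      unfolding algebraic_over_def by blast
    show "inverse x \<in> {x. algebraic_over S x}"
    proof (cases "x = 0")
      case True
      then show ?thesis
        using p by (auto simp: algebraic_over_def)
    next
      case False
      then have "poly (reflect_poly p) (inverse x) = 0"
        using p(3) poly_reflect_poly_nz[of "inverse x" p] by simp
      moreover have "coeff (reflect_poly p) i \<in> S" for i
        using p(2) by (auto simp: coeff_reflect_poly intro: mems)
      ultimately show ?thesis
        using p(1) unfolding algebraic_over_def by (auto intro!: exI[of _ "reflect_poly p"])
    qed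
  qed (use one in simp)
qed

text \<open>Only finitely many coefficients occur in a monic relation for x. They lie in one finite
  ring over S, which remains finite over S when x is adjoined.\<close>

lemma algebraic_over_trans:
  fixes S :: "'a::field set"
  assumes S: "closed_subfield S" and p: "p \<noteq> 0" "\<And>i. algebraic_over S (coeff p i)" "poly p x = 0"
  shows "algebraic_over S x"
proof -
  interpret closed_subfield S by fact
  have "algebraic_over {x. algebraic_over S x} x"
    using p unfolding algebraic_over_def[of "Collect _"] by blast
  then obtain d c where dc: "d > 0" "\<And>k. algebraic_over S (c k)" "x ^ d = (\<Sum>k<d. c k * x ^ k)"
    using algebraic_over_imp_monic[OF closed_subfield_algebraic[OF S]] by (metis mem_Collect_eq)
  obtain W where W: "finite_subring S W" "c ` {..<d} \<subseteq> W"
    using finite_subring_algebraic_finite[OF S, of "c ` {..<d}"] dc(2) by auto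
  then obtain W' where "finite_subring S W'" "x \<in> W'"
    using finite_subring_adjoin[OF closed_subring_axioms W(1) dc(1) _ dc(3)] by blast
  then show ?thesis
    using finite_subring_imp_algebraic[OF closed_subring_axioms] by blast
qed

lemma algebraic_over_self:
  assumes "closed_subring S" "x \<in> S"
  shows "algebraic_over S x"
proof -
  interpret closed_subring S by fact
  show ?thesis
    unfolding algebraic_over_def using assms(2)
    by (intro exI[of _ "[:-x, 1:]"]) (auto simp: coeff_pCons split: nat.split intro: mems)
qed

section \<open>Finite fields and Frobenius\<close>

text \<open>Needed because the freshman's dream concerns powers of the characteristic. A prime r
  dividing the order of the additive group yields a subgroup of order r; its elements are killed by
  r, so r is the characteristic.\<close>

lemma CARD_finite_field_eq_CHAR_power: "\<exists>n. CARD('a::{field,finite}) = CHAR('a) ^ n"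
proof -
  let ?G = "\<lparr>carrier = UNIV, mult = (+), one = 0\<rparr> :: 'a monoid"
  have G: "group ?G"
  proof (rule groupI)
    fix x :: 'a
    show "\<exists>y\<in>carrier ?G. y \<otimes>\<^bsub>?G\<^esub> x = \<one>\<^bsub>?G\<^esub>"
      by (intro bexI[of _ "- x"]) simp_all
  qed (simp_all add: add.assoc)
  have "r = CHAR('a)" if r: "prime r" "r dvd CARD('a)" for r
  proof -
    obtain m where "CARD('a) = r ^ 1 * m"
      using r by auto
    then obtain H where H: "subgroup H ?G" "card H = r ^ 1"
      using sylow_thm[OF r(1) G, of 1 m] by (auto simp: order_def)
    have fin: "finite H"
      by simp
    have "\<not> H \<subseteq> {0}"
      using H(2) prime_gt_1_nat[OF r(1)] card_mono[of "{0::'a}" H] by auto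
    then obtain x where x: "x \<in> H" "x \<noteq> 0"
      by blast
    \<comment> \<open>Translation by x permutes H. Comparing the two sums leaves r x = 0.\<close>
    have "(\<Sum>h\<in>H. h + x) = \<Sum>H"
    proof (rule sum.reindex_bij_witness[of _ "\<lambda>h. h - x" "\<lambda>h. h + x"])
      have sub: "h - g \<in> H" if "h \<in> H" "g \<in> H" for h g
      proof -
        have inv: "inv\<^bsub>?G\<^esub> g = - g"
          by (rule group.inv_equality[OF G]) auto
        show ?thesis
          using subgroup.m_closed[OF H(1) that(1) subgroup.m_inv_closed[OF H(1) that(2)]]
          unfolding inv by simp
      qed
      show "h - x \<in> H" if "h \<in> H" for h
        using sub[OF that x(1)] .
      show "h + x \<in> H" if "h \<in> H" for h
        using subgroup.m_closed[OF H(1) that x(1)] by simp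
    qed auto
    then have "of_nat r * x = 0"
      using H(2) by (simp add: sum.distrib)
    then have "CHAR('a) dvd r"
      using x(2) of_nat_eq_0_iff_char_dvd[of r, where 'a = 'a] by simp
    then show ?thesis
      using r(1) CHAR_not_1'[where 'a = 'a] by (metis One_nat_def prime_nat_iff)
  qed
  note prime_dvd = this
  have "CHAR('a) > 0" "prime CHAR('a)"
    using finite_imp_CHAR_pos[where 'a = 'a] prime_CHAR_semidom[where 'a = 'a] by simp_all
  then obtain m where m: "CARD('a) = CHAR('a) ^ multiplicity CHAR('a) CARD('a) * m" "\<not> CHAR('a) dvd m"
    using multiplicity_decompose'[of "CARD('a)" "CHAR('a)"] by (auto simp: prime_nat_iff)
  have "m = 1"
    using prime_dvd m by (metis dvd_trans dvd_triv_right prime_factor_nat)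
  then show ?thesis
    using m(1) by auto
qed

context closed_subfield
begin

text \<open>Division as for power series: starting from the lowest nonzero coefficient of g, each
  coefficient of p is a rational expression in known ones. This brings quotients computed in
  C_\<infinity>[t] back to polynomials over \<open>L\<close> or kbar.\<close>

lemma coeffs_in_quotient:
  assumes g: "g \<in> coeffs_in S" "g \<noteq> 0" and pg: "p * g \<in> coeffs_in S"
  shows "p \<in> coeffs_in S"
proof -
  obtain m where m: "coeff g m \<noteq> 0" "\<And>i. i < m \<Longrightarrow> coeff g i = 0"
  proof -
    have "\<exists>m. coeff g m \<noteq> 0"
      using g(2) by (auto simp: poly_eq_iff)
    then show ?thesis
      using that[of "LEAST m. coeff g m \<noteq> 0"] by (metis (mono_tags, lifting) LeastI not_less_Least)
  qed
  have "coeff p n \<in> S" for n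
  proof (induction n rule: less_induct)
    case (less n)
    have "coeff (p * g) (n + m) = (\<Sum>i\<le>n + m. coeff p i * coeff g (n + m - i))"
      by (simp add: coeff_mult)
    also have "\<dots> = (\<Sum>i\<le>n. coeff p i * coeff g (n + m - i))"
      by (rule sum.mono_neutral_right) (auto intro!: m(2))
    also have "\<dots> = (\<Sum>i<n. coeff p i * coeff g (n + m - i)) + coeff p n * coeff g m"
      by (simp add: lessThan_Suc_atMost[symmetric])
    finally have "coeff p n = (coeff (p * g) (n + m) - (\<Sum>i<n. coeff p i * coeff g (n + m - i))) / coeff g m"
      using m(1) by simp
    also have "\<dots> \<in> S"
      using g pg less unfolding coeffs_in_def by (auto intro!: mems divide_mem sum_mem)
    finally show ?case .
  qed
  then show ?thesis
    by (simp add: coeffs_in_def)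
qed

end

context C_infinity
begin

abbreviation "q \<equiv> q_of \<iota>"
abbreviation "\<theta> \<equiv> theta \<iota>"
abbreviation nm :: "'c \<Rightarrow> real" where "nm x \<equiv> dist 0 x"
abbreviation L :: "'c set" where "L \<equiv> {x. algebraic_over (range \<iota>) x}"

lemma \<iota>_zero [simp]: "\<iota> 0 = 0"
  using \<iota>_add[of 0 0] by (metis add.right_neutral add_left_cancel)

lemma \<iota>_uminus: "\<iota> (- x) = - \<iota> x"
  using \<iota>_add[of x "- x"] by (simp add: eq_neg_iff_add_eq_0 add.commute)

lemma \<iota>_diff: "\<iota> (x - y) = \<iota> x - \<iota> y"
  using \<iota>_add[of x "- y"] by (simp add: \<iota>_uminus)

lemma \<iota>_eq_0_iff [simp]: "\<iota> x = 0 \<longleftrightarrow> x = 0"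
  using \<iota>_abs[of x] by force

lemma \<iota>_of_nat: "\<iota> (of_nat n) = of_nat n"
  by (induction n) (simp_all add: \<iota>_add \<iota>_one)

lemma \<iota>_inverse: "\<iota> (inverse x) = inverse (\<iota> x)"
proof (cases "x = 0")
  case False
  then have "\<iota> x * \<iota> (inverse x) = 1"
    by (simp flip: \<iota>_mult add: \<iota>_one)
  then show ?thesis
    by (metis inverse_unique)
qed simp

lemma closed_subfield_range_\<iota>: "closed_subfield (range \<iota>)"
  by unfold_locales (auto simp flip: \<iota>_one \<iota>_diff \<iota>_mult \<iota>_inverse)

sublocale L: closed_subfield L
  by (rule closed_subfield_algebraic) (rule closed_subfield_range_\<iota>)

lemma CHAR_c: "CHAR('c) = CHAR('f)"
proof (rule CHAR_eqI)
  show "of_nat CHAR('f) = (0 :: 'c)"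
    by (simp flip: \<iota>_of_nat add: fls_of_nat)
  fix n assume "of_nat n = (0 :: 'c)"
  then show "CHAR('f) dvd n"
    by (simp flip: \<iota>_of_nat add: fls_of_nat of_nat_eq_0_iff_char_dvd)
qed

lemma prime_CHAR_c: "prime CHAR('c)"
  unfolding CHAR_c
  using finite_imp_CHAR_pos[where 'a = 'f] prime_CHAR_semidom[where 'a = 'f] by simp

lemma q_eq_power_CHAR: "\<exists>n. q = CHAR('c) ^ n"
  using CARD_finite_field_eq_CHAR_power[where 'a = 'f] by (simp add: q_of_def CHAR_c)

lemma q_gt_1: "q > 1"
proof -
  have "card {0, 1 :: 'f} \<le> CARD('f)"
    by (rule card_mono) auto
  then show ?thesis
    by (simp add: q_of_def)
qed

lemma q_pos [simp]: "q > 0"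
  using q_gt_1 by simp

lemma q_nonzero [simp]: "q \<noteq> 0"
  using q_gt_1 by simp

text \<open>Stated for every ring of this characteristic since it is applied to C_\<infinity> as
  well as to power series over it.\<close>

lemma frob_add:
  assumes "CHAR('r::comm_ring_1) = CHAR('c)"
  shows "(x + y :: 'r) ^ (q ^ i) = x ^ (q ^ i) + y ^ (q ^ i)"
  using q_eq_power_CHAR prime_CHAR_c assms
  by (metis freshmans_dream' power_mult)

lemma frob_uminus:
  assumes "CHAR('r::comm_ring_1) = CHAR('c)"
  shows "(- x :: 'r) ^ (q ^ i) = - (x ^ (q ^ i))"
  using frob_add[OF assms, of x "- x" i] by (simp add: eq_neg_iff_add_eq_0 add.commute power_0_left)

lemma frob_diff:
  assumes "CHAR('r::comm_ring_1) = CHAR('c)"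
  shows "(x - y :: 'r) ^ (q ^ i) = x ^ (q ^ i) - y ^ (q ^ i)"
  using frob_add[OF assms, of x "- y" i] by (simp add: frob_uminus[OF assms])

lemma frob_sum:
  assumes "CHAR('r::comm_ring_1) = CHAR('c)"
  shows "(sum f A :: 'r) ^ (q ^ i) = (\<Sum>x\<in>A. f x ^ (q ^ i))"
  by (induction A rule: infinite_finite_induct) (auto simp: frob_add[OF assms] power_0_left)

lemmas frob_add1 = frob_add[where i = 1, simplified]
  and frob_diff1 = frob_diff[where i = 1, simplified]
  and frob_uminus1 = frob_uminus[where i = 1, simplified]
  and frob_sum1 = frob_sum[where i = 1, simplified]

section \<open>The absolute value and the size of roots\<close>

lemma dist_eq_nm: "dist x y = nm (x - y)"
  using dist_translate[of y "- y" x] by (simp add: dist_commute)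

lemma nm_one [simp]: "nm 1 = 1"
proof -
  have "nm 1 * nm 1 = nm 1"
    using abs_mult[of 1 1] by simp
  then show ?thesis
    by (metis dist_eq_0_iff mult_cancel_right1 zero_neq_one)
qed

lemma nm_uminus [simp]: "nm (- x) = nm x"
  using dist_translate[of 0 x "- x"] by (simp add: dist_commute)

lemma nm_power [simp]: "nm (x ^ n) = nm x ^ n"
  by (induction n) (simp_all add: abs_mult)

lemma nm_inverse: "nm (inverse x) = inverse (nm x)"
proof (cases "x = 0")
  case False
  then have "nm x * nm (inverse x) = 1"
    by (simp flip: abs_mult)
  then show ?thesis
    by (metis inverse_unique)
qed simp

lemma nm_divide: "nm (x / y) = nm x / nm y"
  by (simp add: divide_inverse abs_mult nm_inverse)

lemma nm_sum_le:
  assumes "\<And>i. i \<in> A \<Longrightarrow> nm (f i) \<le> B" "B \<ge> 0"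
  shows "nm (sum f A) \<le> B"
  using assms(1)
proof (induction A rule: infinite_finite_induct)
  case (insert x F)
  then show ?case
    using abs_ultrametric[of "f x" "sum f F"] by (auto intro: order_trans)
qed (use assms(2) in auto)

lemma nm_theta: "nm \<theta> = real q"
proof -
  have "nm \<theta> = real CARD('f) powi (- fls_subdegree (fls_X_inv :: 'f fls))"
    unfolding theta_def by (rule \<iota>_abs) simp
  then show ?thesis
    by (simp add: q_of_def)
qed

lemma theta_nonzero [simp]: "\<theta> \<noteq> 0"
  using nm_theta q_pos by force

lemma nm_theta_gt_1: "nm \<theta> > 1"
  using nm_theta q_gt_1 by simp

lemma theta_power_neq:
  assumes "n > 1"
  shows "\<theta> ^ n \<noteq> \<theta>"
proof
  assume "\<theta> ^ n = \<theta>"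
  then have "nm \<theta> ^ n = nm \<theta> ^ 1"
    by (metis nm_power power_one_right)
  then show False
    using assms nm_theta_gt_1 power_inject_exp[of "nm \<theta>" n 1] by simp
qed

text \<open>The axiom places the root somewhere in C_\<infinity>; transitivity of algebraicity
  places it in \<open>L\<close>.\<close>

lemma L_root:
  assumes "p \<in> coeffs_in L" "degree p > 0"
  obtains x where "x \<in> L" "poly p x = 0"
proof -
  obtain x where "poly p x = 0"
    using algebraically_closed[of p] assms by (auto simp: coeffs_in_def)
  moreover have "x \<in> L"
    using algebraic_over_trans[OF closed_subfield_range_\<iota>, of p x] assms calculation
    by (cases "p = 0") (auto simp: coeffs_in_def)
  ultimately show ?thesis
    using that by blast
qed

text \<open>The product of the roots is the constant term up to sign and the leading coefficient.\<close>

lemma L_small_root: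
  assumes "p \<in> coeffs_in L" "degree p > 0"
  obtains x where "x \<in> L" "poly p x = 0" "nm x ^ degree p * nm (lead_coeff p) \<le> nm (coeff p 0)"
proof -
  have "\<exists>x\<in>L. poly p x = 0 \<and> nm x ^ degree p * nm (lead_coeff p) \<le> nm (coeff p 0)"
    using assms
  proof (induction "degree p" arbitrary: p)
    case (Suc m)
    obtain x1 where x1: "x1 \<in> L" "poly p x1 = 0"
      using L_root Suc.prems by blast
    then obtain r where r: "p = [:-x1, 1:] * r"
      by (metis dvdE poly_eq_0_iff_dvd)
    have "r \<noteq> 0"
      using r Suc.prems by auto
    then have deg: "degree p = Suc (degree r)" and lead: "lead_coeff p = lead_coeff r"
      unfolding r by (subst degree_mult_eq; simp) (simp add: lead_coeff_mult del: mult_pCons_left)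
    have "[:-x1, 1:] \<in> coeffs_in L"
      using x1(1) L.uminus_mem[of x1] L.mems by (auto simp: coeffs_in_def coeff_pCons split: nat.split)
    then have rL: "r \<in> coeffs_in L"
      using L.coeffs_in_quotient[of "[:-x1, 1:]" r] Suc.prems(1) by (simp add: r mult.commute)
    have p0: "nm (coeff p 0) = nm x1 * nm (coeff r 0)"
      unfolding r by (simp add: abs_mult)
    show ?case
    proof (cases "degree r = 0")
      case True
      then show ?thesis
        using x1 deg lead p0 by (intro bexI[of _ x1]) auto
    next
      case False
      then obtain x2 where x2: "x2 \<in> L" "poly r x2 = 0"
        "nm x2 ^ degree r * nm (lead_coeff r) \<le> nm (coeff r 0)"
        using Suc.hyps(1)[of r] Suc.hyps(2) deg rL by auto
      have le: "nm x1 * (nm x2 ^ degree r * nm (lead_coeff r)) \<le> nm (coeff p 0)"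
        unfolding p0 using x2(3) by (intro mult_left_mono) auto
      show ?thesis
      \<comment> \<open>The smaller of the two roots works: using it in place of the larger one only
        decreases the left-hand side of \<open>le\<close>.\<close>
      proof (cases "nm x2 \<le> nm x1")
        case True
        have "nm x2 ^ degree p * nm (lead_coeff p) \<le> nm x1 * (nm x2 ^ degree r * nm (lead_coeff r))"
          unfolding lead unfolding deg using True by (simp add: mult.assoc mult_right_mono)
        then show ?thesis
          using x2 le r by (intro bexI[of _ x2]) auto
      next
        case False
        have "nm x1 ^ degree p * nm (lead_coeff p) \<le> nm x1 * (nm x2 ^ degree r * nm (lead_coeff r))"
          unfolding lead unfolding deg using False
          by (simp add: mult.assoc mult_left_mono mult_right_mono power_mono)
        then show ?thesis
          using x1 le by (intro bexI[of _ x1]) auto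
      qed
    qed
  qed simp
  then show ?thesis
    using that by blast
qed

section \<open>Bijectivity of the Frobenius\<close>

lemma inj_frob: "inj (\<lambda>x::'c. x ^ q)"
proof (rule injI)
  fix x y :: 'c assume "x ^ q = y ^ q"
  then have "(x - y) ^ q = 0"
    by (simp add: frob_diff1)
  then show "x = y"
    by simp
qed

lemma L_frob_root:
  assumes "y \<in> L"
  obtains x where "x \<in> L" "x ^ q = y"
proof -
  have "degree (monom 1 q - [:y:]) = q"
    by (subst diff_conv_add_uminus, subst degree_add_eq_left) (simp_all add: degree_monom_eq)
  moreover have "monom 1 q - [:y:] \<in> coeffs_in L"
    using assms L.mems by (auto simp: coeffs_in_def coeff_pCons split: nat.split)
  ultimately obtain x where "x \<in> L" "poly (monom 1 q - [:y:]) x = 0"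
    using L_root[of "monom 1 q - [:y:]"] by auto
  then show ?thesis
    using that by (simp add: poly_monom)
qed

text \<open>Elements of \<open>L\<close> have q-th roots in \<open>L\<close>, and \<open>L\<close>
  is dense. As the distance of q-th powers is the q-th power of the distance, the roots of a
  convergent sequence form a Cauchy sequence, whose limit is the required root.\<close>

lemma surj_frob: "surj (\<lambda>x::'c. x ^ q)"
proof -
  have "\<exists>x. y = x ^ q" for y :: 'c
  proof -
    have "y \<in> closure L"
      using dense by simp
    then obtain f where f: "\<And>n::nat. f n \<in> L" "f \<longlonglongrightarrow> y"
      unfolding closure_sequential by blast
    have "\<exists>x. x ^ q = f n" for n
      using L_frob_root[OF f(1)[of n]] by blast
    then have "\<exists>x. \<forall>n. x n ^ q = f n"
      by (intro choice) blast
    then obtain x where x: "\<And>n. x n ^ q = f n"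
      by blast
    have nm_q: "dist (u ^ q) (v ^ q) = dist u v ^ q" for u v :: 'c
      unfolding dist_eq_nm[of u] dist_eq_nm[of "u ^ q"] by (simp flip: frob_diff1)
    have "Cauchy x"
    proof (rule metric_CauchyI)
      fix e :: real assume "e > 0"
      then obtain M where "\<And>m n. m \<ge> M \<Longrightarrow> n \<ge> M \<Longrightarrow> dist (f m) (f n) < e ^ q"
        using f(2) LIMSEQ_imp_Cauchy metric_CauchyD[of f "e ^ q"] by (meson zero_less_power)
      then have "dist (x m) (x n) ^ q < e ^ q" if "m \<ge> M" "n \<ge> M" for m n
        using that x[of m] x[of n] nm_q[of "x m" "x n"] by metis
      then show "\<exists>M. \<forall>m\<ge>M. \<forall>n\<ge>M. dist (x m) (x n) < e"
        using \<open>e > 0\<close> by (meson less_imp_le power_less_imp_less_base)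
    qed
    then obtain z where z: "x \<longlonglongrightarrow> z"
      using Cauchy_convergent convergent_def by blast
    have "f \<longlonglongrightarrow> z ^ q"
    proof (rule metric_LIMSEQ_I)
      fix e :: real assume "e > 0"
      then obtain M where M: "\<And>n. n \<ge> M \<Longrightarrow> dist (x n) z < root q e"
        using metric_LIMSEQ_D[OF z, of "root q e"] by auto
      have "dist (f n) (z ^ q) < e" if "n \<ge> M" for n
      proof -
        have "dist (x n) z ^ q < root q e ^ q"
          using M[OF that] by (intro power_strict_mono) auto
        moreover have "dist (f n) (z ^ q) = dist (x n) z ^ q"
          using nm_q[of "x n" z] x[of n] by simp
        ultimately show ?thesis
          using \<open>e > 0\<close> by simp
      qed
      then show "\<exists>no. \<forall>n\<ge>no. dist (f n) (z ^ q) < e"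
        by blast
    qed
    then show ?thesis
      using f(2) LIMSEQ_unique by blast
  qed
  then show ?thesis
    by (auto simp: surj_def)
qed

end

section \<open>Twisting\<close>

lemma algebraic_over_mono: "S \<subseteq> T \<Longrightarrow> algebraic_over S x \<Longrightarrow> algebraic_over T x"
  unfolding algebraic_over_def by blast

context C_infinity
begin

lemma closed_subring_A_ring: "closed_subring (A_ring \<iota>)"
proof -
  let ?c = "\<lambda>a. \<iota> (fls_const a)"
  interpret c: comm_ring_hom ?c
    by unfold_locales (auto simp: \<iota>_one \<iota>_add \<iota>_mult simp flip: fls_plus_const fls_const_mult_const)
  interpret mc: map_poly_comm_ring_hom ?c ..
  define g where "g = (\<lambda>p::'f poly. poly (map_poly ?c p) \<theta>)"
  have g: "g (x - y) = g x - g y" "g (x * y) = g x * g y" "g 1 = 1" for x y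
    by (simp_all add: g_def mc.hom_minus mc.hom_mult)
  have A: "A_ring \<iota> = range g"
    by (simp add: A_ring_def g_def)
  show ?thesis
    unfolding A by unfold_locales (auto simp flip: g)
qed

lemma theta_mem_A_ring: "\<theta> \<in> A_ring \<iota>"
  unfolding A_ring_def
  by (rule range_eqI[of _ _ "[:0, 1:]"]) (simp add: map_poly_pCons \<iota>_one)

lemma k_field_eq_fractions: "k_field \<iota> = fractions (A_ring \<iota>)"
  by (simp add: k_field_def fractions_def)

lemma closed_subfield_k_field: "closed_subfield (k_field \<iota>)"
  unfolding k_field_eq_fractions by (rule closed_subfield_fractions) (rule closed_subring_A_ring)

sublocale kbar: closed_subfield "kbar \<iota>"
  unfolding kbar_def by (rule closed_subfield_algebraic) (rule closed_subfield_k_field)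

lemma A_ring_subset_range: "A_ring \<iota> \<subseteq> range \<iota>"
proof -
  interpret R: closed_subfield "range \<iota>"
    by (rule closed_subfield_range_\<iota>)
  show ?thesis
    unfolding A_ring_def by (auto intro!: R.poly_mem simp: theta_def coeff_map_poly)
qed

lemma k_field_subset_range: "k_field \<iota> \<subseteq> range \<iota>"
proof -
  interpret R: closed_subfield "range \<iota>"
    by (rule closed_subfield_range_\<iota>)
  show ?thesis
    using A_ring_subset_range by (auto simp: k_field_def intro!: R.divide_mem)
qed

lemma kbar_subset_L: "kbar \<iota> \<subseteq> L"
  using algebraic_over_mono[OF k_field_subset_range] by (auto simp: kbar_def)

lemma k_field_subset_kbar: "k_field \<iota> \<subseteq> kbar \<iota>"
  using algebraic_over_self closed_subfield.axioms(1)[OF closed_subfield_k_field] by (auto simp: kbar_def)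

lemma theta_mem_kbar: "\<theta> \<in> kbar \<iota>"
  using theta_mem_A_ring subset_fractions[OF closed_subring_A_ring] k_field_subset_kbar
  by (auto simp: k_field_eq_fractions)

lemma theta_mem_L: "\<theta> \<in> L"
  using theta_mem_kbar kbar_subset_L by blast

section \<open>The inverse Frobenius, and polynomials in t inside Laurent series\<close>

definition phi :: "'c \<Rightarrow> 'c" where
  "phi = inv_into UNIV (\<lambda>x. x ^ q)"

lemma phi_power [simp]: "phi x ^ q = x"
  unfolding phi_def using f_inv_into_f[of x "\<lambda>x. x ^ q" UNIV] surj_frob by simp

lemma power_phi [simp]: "phi (x ^ q) = x"
  unfolding phi_def using inj_frob by (rule inv_f_f)

lemma phi_eqI: "x = y ^ q \<Longrightarrow> phi x = y"
  by simp

lemma phi_in_kbar [simp]: "phi x \<in> kbar \<iota> \<longleftrightarrow> x \<in> kbar \<iota>"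
proof
  assume "phi x \<in> kbar \<iota>"
  then show "x \<in> kbar \<iota>"
    using kbar.power_mem[of "phi x" q] by simp
next
  assume "x \<in> kbar \<iota>"
  have "poly (monom 1 q - [:x:]) (phi x) = 0"
    by (simp add: poly_monom)
  moreover have "monom 1 q - [:x:] \<noteq> (0 :: 'c poly)"
    by (metis degree_monom_eq degree_pCons_0 eq_iff_diff_eq_0 q_nonzero zero_neq_one)
  moreover have "coeff (monom 1 q - [:x:]) i \<in> kbar \<iota>" for i
    using \<open>x \<in> kbar \<iota>\<close> by (auto simp: coeff_pCons split: nat.split intro: kbar.mems)
  ultimately show "phi x \<in> kbar \<iota>"
    using algebraic_over_trans[OF closed_subfield_k_field] unfolding kbar_def by blast
qed

lemma phi_in_L: "x \<in> L \<Longrightarrow> phi x \<in> L"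
  using L_frob_root[of x] by (metis power_phi)

sublocale phi: inj_idom_hom phi
  by unfold_locales
    (auto intro!: phi_eqI simp: frob_add1 power_mult_distrib dest: arg_cong[of _ _ "\<lambda>x. x ^ q"])

sublocale ptw: map_poly_inj_idom_hom phi ..

abbreviation ptw :: "'c poly \<Rightarrow> 'c poly" where "ptw \<equiv> map_poly phi"

lemma fls_nth_twist [simp]: "fls_nth (twist \<iota> f) n = phi (fls_nth f n)"
  unfolding twist_def phi_def[symmetric]
proof (rule nth_Abs_fls_ex_lower_bound)
  show "\<exists>N. \<forall>n<N. phi (fls_nth f n) = 0"
    by (rule exI[of _ "fls_subdegree f"]) simp
qed

lemma fls_subdegree_twist [simp]: "fls_subdegree (twist \<iota> f) = fls_subdegree f"
proof (cases "f = 0")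
  case True
  then have "twist \<iota> f = 0"
    by (intro fls_eqI) simp
  then show ?thesis
    using True by simp
next
  case False
  then show ?thesis
    by (intro fls_subdegree_eqI) simp_all
qed

sublocale tw: field_hom "twist \<iota>"
proof
  fix f g
  show "twist \<iota> (f * g) = twist \<iota> f * twist \<iota> g"
    by (rule fls_eqI) (simp add: fls_times_nth(2) phi.hom_sum phi.hom_mult)
qed (auto intro!: fls_eqI simp: phi.hom_add)

lemma inj_twist: "twist \<iota> f = twist \<iota> g \<Longrightarrow> f = g"
  by (metis fls_eqI fls_nth_twist phi.injectivity)

lemma twist_const [simp]: "twist \<iota> (fls_const c) = fls_const (phi c)"
  by (rule fls_eqI) simp

lemma twist_divide: "twist \<iota> (f / g) = twist \<iota> f / twist \<iota> g"
  by (simp add: divide_inverse tw.hom_mult tw.hom_inverse)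

definition emb :: "'c poly \<Rightarrow> 'c fls" where
  "emb p = fps_to_fls (fps_of_poly p)"

sublocale emb: inj_idom_hom emb
  by unfold_locales
    (auto simp: emb_def fps_of_poly_add fps_of_poly_mult fls_times_fps_to_fls fps_of_poly_eq_iff)

lemma fls_nth_emb: "fls_nth (emb p) n = (if n < 0 then 0 else coeff p (nat n))"
  by (simp add: emb_def)

lemma emb_const: "emb [:c:] = fls_const c"
  by (rule fls_eqI) (auto simp: fls_nth_emb coeff_pCons split: nat.split)

lemma emb_X: "emb [:0, 1:] = fls_X"
  by (rule fls_eqI) (auto simp: fls_nth_emb coeff_pCons split: nat.split)

lemma emb_linear: "emb [:- c, 1:] = fls_X - fls_const c"
  by (rule fls_eqI) (auto simp: fls_nth_emb coeff_pCons split: nat.split)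

lemma X_minus_const_nonzero [simp]: "fls_X - fls_const c \<noteq> (0 :: 'c fls)"
  using emb.hom_0_iff[of "[:- c, 1:]"] by (simp add: emb_linear)

lemma twist_emb [simp]: "twist \<iota> (emb p) = emb (ptw p)"
  by (rule fls_eqI) (simp add: fls_nth_emb)

lemma kbar_polys_eq: "kbar_polys \<iota> = emb ` coeffs_in (kbar \<iota>)"
  by (auto simp: kbar_polys_def emb_def coeffs_in_def)

sublocale kbarp: closed_subring "kbar_polys \<iota>"
proof -
  interpret C: closed_subring "coeffs_in (kbar \<iota>)"
    by (rule closed_subring_coeffs_in) unfold_locales
  show "closed_subring (kbar_polys \<iota>)"
    unfolding kbar_polys_eq
    by unfold_locales
      (auto intro: C.mems simp flip: emb.hom_minus emb.hom_mult emb.hom_one intro!: imageI)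
qed

lemma kbar_rats_eq: "kbar_rats \<iota> = fractions (kbar_polys \<iota>)"
  by (simp add: kbar_rats_def fractions_def)

sublocale kbarr: closed_subfield "kbar_rats \<iota>"
  unfolding kbar_rats_eq by (rule closed_subfield_fractions) unfold_locales

lemma kbar_polys_subset_rats: "f \<in> kbar_polys \<iota> \<Longrightarrow> f \<in> kbar_rats \<iota>"
  using subset_fractions[OF kbarp.closed_subring_axioms] by (auto simp: kbar_rats_eq)

lemma const_mem_kbar_polys: "c \<in> kbar \<iota> \<Longrightarrow> fls_const c \<in> kbar_polys \<iota>"
  unfolding kbar_polys_eq emb_const[symmetric]
  by (auto simp: coeffs_in_def coeff_pCons kbar.zero_mem split: nat.split)

lemma X_mem_kbar_polys: "fls_X \<in> kbar_polys \<iota>"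
  unfolding kbar_polys_eq emb_X[symmetric]
  by (auto simp: coeffs_in_def coeff_pCons kbar.zero_mem kbar.one_mem split: nat.split)

lemma X_theta_mem_kbar_polys: "fls_X - fls_const \<theta> \<in> kbar_polys \<iota>"
  by (intro kbarp.mems X_mem_kbar_polys const_mem_kbar_polys theta_mem_kbar)

lemma twist_mem_kbar_polys [simp]: "twist \<iota> f \<in> kbar_polys \<iota> \<longleftrightarrow> f \<in> kbar_polys \<iota>"
proof
  assume "f \<in> kbar_polys \<iota>"
  then show "twist \<iota> f \<in> kbar_polys \<iota>"
    by (auto simp: kbar_polys_eq coeffs_in_def)
next
  assume "twist \<iota> f \<in> kbar_polys \<iota>"
  then obtain p where p: "twist \<iota> f = emb p" "p \<in> coeffs_in (kbar \<iota>)"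
    by (auto simp: kbar_polys_eq)
  define r where "r = map_poly (\<lambda>x. x ^ q) p"
  have "twist \<iota> f = twist \<iota> (emb r)"
    unfolding p by (rule fls_eqI) (auto simp: fls_nth_emb r_def coeff_map_poly)
  moreover have "r \<in> coeffs_in (kbar \<iota>)"
    using p(2) by (auto simp: r_def coeffs_in_def coeff_map_poly intro: kbar.power_mem)
  ultimately show "f \<in> kbar_polys \<iota>"
    using inj_twist by (auto simp: kbar_polys_eq simp del: twist_emb)
qed

lemma twist_surj_kbar_polys:
  assumes "f \<in> kbar_polys \<iota>"
  shows "\<exists>g\<in>kbar_polys \<iota>. twist \<iota> g = f"
proof -
  obtain p where p: "f = emb p" "p \<in> coeffs_in (kbar \<iota>)"
    using assms by (auto simp: kbar_polys_eq)
  have "twist \<iota> (emb (map_poly (\<lambda>x. x ^ q) p)) = f"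
    unfolding p by (rule fls_eqI) (auto simp: fls_nth_emb coeff_map_poly)
  then show ?thesis
    using assms by (metis twist_mem_kbar_polys)
qed

lemma twist_mem_kbar_rats: "f \<in> kbar_rats \<iota> \<Longrightarrow> twist \<iota> f \<in> kbar_rats \<iota>"
  unfolding kbar_rats_eq by (auto simp: fractions_def twist_divide) (metis tw.hom_0_iff twist_mem_kbar_polys)

lemma twist_surj_kbar_rats:
  assumes "f \<in> kbar_rats \<iota>"
  shows "\<exists>g\<in>kbar_rats \<iota>. twist \<iota> g = f"
proof -
  obtain a b where ab: "f = a / b" "a \<in> kbar_polys \<iota>" "b \<in> kbar_polys \<iota>" "b \<noteq> 0"
    using assms by (auto simp: kbar_rats_eq fractions_def)
  obtain a' b' where ab': "twist \<iota> a' = a" "a' \<in> kbar_polys \<iota>" "twist \<iota> b' = b" "b' \<in> kbar_polys \<iota>"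
    using twist_surj_kbar_polys ab by metis
  then have "a' / b' \<in> kbar_rats \<iota>" "twist \<iota> (a' / b') = f"
    using ab by (auto simp: kbar_rats_eq twist_divide intro!: fractionsI)
  then show ?thesis
    by blast
qed

subsection \<open>Denominators\<close>

lemma closed_subring_range_emb: "closed_subring (range emb)"
  by unfold_locales (auto simp flip: emb.hom_minus emb.hom_mult emb.hom_one)

lemma kbar_rats_subset_fractions: "kbar_rats \<iota> \<subseteq> fractions (range emb)"
  unfolding kbar_rats_eq kbar_polys_eq fractions_def by blast

text \<open>The polynomials that clear all denominators form a nonzero ideal. An element of least
  degree generates it by division with remainder, and is made monic.\<close>

lemma minimal_denominator:
  assumes "finite Y" "Y \<subseteq> fractions (range emb)"
  obtains D where "lead_coeff D = 1" "\<And>y. y \<in> Y \<Longrightarrow> emb D * y \<in> range emb"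
    "\<And>E. (\<And>y. y \<in> Y \<Longrightarrow> emb E * y \<in> range emb) \<Longrightarrow> D dvd E"
proof -
  interpret R: closed_subring "range emb"
    by (rule closed_subring_range_emb)
  define I where "I = {E. \<forall>y\<in>Y. emb E * y \<in> range emb}"
  have "\<exists>E\<in>I. E \<noteq> 0"
    using assms unfolding I_def
  proof (induction rule: finite_induct)
    case empty
    then show ?case
      by (intro bexI[of _ 1]) auto
  next
    case (insert y Y)
    then obtain E where E: "\<forall>y\<in>Y. emb E * y \<in> range emb" "E \<noteq> 0"
      by auto
    obtain a b where ab: "y = emb a / emb b" "emb b \<noteq> 0"
      using insert.prems by (auto simp: fractions_def)
    have "emb (b * E) * z \<in> range emb" if "z \<in> insert y Y" for z
    proof (cases "z = y")
      case True
      have "emb (b * E) * z = emb E * emb a"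
        using ab True by (simp add: emb.hom_mult)
      then show ?thesis
        using R.mult_mem by simp
    next
      case False
      then have "emb E * z \<in> range emb"
        using that E by auto
      then show ?thesis
        using R.mult_mem[of "emb b" "emb E * z"] by (simp add: emb.hom_mult mult.assoc)
    qed
    then show ?case
      using ab E by (intro bexI[of _ "b * E"] CollectI ballI) auto
  qed
  then obtain D where D: "D \<in> I" "D \<noteq> 0" "\<And>E. E \<in> I \<Longrightarrow> E \<noteq> 0 \<Longrightarrow> degree D \<le> degree E"
    using ex_has_least_nat[of "\<lambda>E. E \<in> I \<and> E \<noteq> 0" _ degree] by metis
  have dvd: "D dvd E" if E: "E \<in> I" for E
  proof -
    have "E mod D = E - (E div D) * D"
      by (simp add: minus_div_mult_eq_mod)
    have "emb (E mod D) * y \<in> range emb" if y: "y \<in> Y" for y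
    proof -
      have "emb (E mod D) * y = emb E * y - emb (E div D) * (emb D * y)"
        unfolding \<open>E mod D = _\<close> by (simp add: emb.hom_minus emb.hom_mult algebra_simps)
      also have "\<dots> \<in> range emb"
        using D(1) E y unfolding I_def by (intro R.diff_mem[OF _ R.mult_mem[OF rangeI]]) auto
      finally show ?thesis .
    qed
    then have "E mod D \<in> I"
      by (simp add: I_def)
    then have "E mod D = 0"
      using D(3)[of "E mod D"] degree_mod_less[OF D(2), of E] by linarith
    then show ?thesis
      by auto
  qed
  let ?D = "Polynomial.smult (inverse (lead_coeff D)) D"
  show ?thesis
  proof (rule that[of ?D])
    show "lead_coeff ?D = 1"
      using D(2) by simp
    show "emb ?D * y \<in> range emb" if "y \<in> Y" for y
    proof -
      have "emb ?D * y = emb [:inverse (lead_coeff D):] * (emb D * y)"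
        by (simp add: mult.assoc flip: emb.hom_mult)
      also have "\<dots> \<in> range emb"
        using R.mult_mem[OF rangeI, of "emb D * y"] D(1) that unfolding I_def by blast
      finally show ?thesis .
    qed
    show "?D dvd E" if "\<And>y. y \<in> Y \<Longrightarrow> emb E * y \<in> range emb" for E
      using dvd[of E] that D(2) by (simp add: I_def smult_dvd_iff)
  qed
qed

lemma monic_degree_eq_dvd:
  fixes D E :: "'a::field poly"
  assumes "lead_coeff D = 1" "lead_coeff E = 1" "degree D = degree E" "D dvd E"
  shows "D = E"
proof -
  obtain r where r: "E = D * r"
    using assms(4) by blast
  have "D \<noteq> 0" "r \<noteq> 0"
    using assms(1,2) r by auto
  then have "degree E = degree D + degree r"
    unfolding r by (rule degree_mult_eq)
  then have "degree r = 0"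
    using assms(3) by simp
  then obtain c where "r = [:c:]"
    by (metis degree_eq_zeroE)
  then show ?thesis
    using r assms by simp
qed

text \<open>With T = X - c, T E = D s and T D = E t one gets t s = T^2, so T divides s or t.
  Cancelling T leaves D dvd E or E dvd D, and the degrees agree. It absorbs the factor T that is
  lost when \<sigma> is undone.\<close>

lemma monic_eq_of_dvd_linear_mult:
  fixes D E :: "'a::field poly"
  assumes monic: "lead_coeff D = 1" "lead_coeff E = 1" and deg: "degree D = degree E"
    and DE: "D dvd [:-c, 1:] * E" and ED: "E dvd [:-c, 1:] * D"
  shows "D = E"
proof -
  let ?T = "[:-c, 1:]"
  have nz: "D \<noteq> 0" "E \<noteq> 0" "?T \<noteq> 0"
    using monic by auto
  obtain s where s: "?T * E = D * s"
    using DE by blast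
  obtain t where t: "?T * D = E * t"
    using ED by blast
  have "E * (?T * ?T) = (?T * E) * ?T"
    by (simp only: mult_ac)
  also have "\<dots> = s * (?T * D)"
    unfolding s by (simp only: mult_ac)
  also have "\<dots> = E * (t * s)"
    unfolding t by (simp only: mult_ac)
  finally have "E * (?T * ?T) = E * (t * s)" .
  then have "?T * ?T = t * s"
    by (rule mult_left_cancel[OF nz(2), THEN iffD1])
  then have "poly (?T * ?T) c = poly (t * s) c"
    by simp
  then have "poly t c = 0 \<or> poly s c = 0"
    by auto
  then show ?thesis
  proof
    assume "poly s c = 0"
    then have "?T dvd s"
      by (simp only: poly_eq_0_iff_dvd)
    then obtain r where r: "s = ?T * r"
      by (rule dvdE)
    have "?T * E = ?T * (D * r)"
      unfolding s r by (rule mult.left_commute)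
    then have "E = D * r"
      by (rule mult_left_cancel[OF nz(3), THEN iffD1])
    then have "D dvd E"
      by simp
    then show ?thesis
      using monic_degree_eq_dvd[OF monic deg] by simp
  next
    assume "poly t c = 0"
    then have "?T dvd t"
      by (simp only: poly_eq_0_iff_dvd)
    then obtain r where r: "t = ?T * r"
      by (rule dvdE)
    have "?T * D = ?T * (E * r)"
      unfolding t r by (rule mult.left_commute)
    then have "D = E * r"
      by (rule mult_left_cancel[OF nz(3), THEN iffD1])
    then have "E dvd D"
      by simp
    then show ?thesis
      using monic_degree_eq_dvd[OF monic(2,1) deg[symmetric]] by simp
  qed
qed

end

section \<open>Additive polynomials and the exponential\<close>

context C_infinity
begin

text \<open>The class \<open>complete_space\<close> supplies only a metric; continuity of the
  operations comes from the ultrametric inequality and from multiplicativity of the absolute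
  value.\<close>

lemma tendsto_add_nm:
  assumes "(f \<longlongrightarrow> (a::'c)) F" "(g \<longlongrightarrow> b) F"
  shows "((\<lambda>x. f x + g x) \<longlongrightarrow> a + b) F"
proof -
  have "((\<lambda>x. dist (f x) a + dist (g x) b) \<longlongrightarrow> 0) F"
    using tendsto_add assms unfolding tendsto_dist_iff[of f] tendsto_dist_iff[of g] by fastforce
  moreover have "dist (f x + g x) (a + b) \<le> dist (f x) a + dist (g x) b" for x
  proof -
    have "dist (f x + g x) (a + b) = nm ((f x - a) + (g x - b))"
      unfolding dist_eq_nm[of "f x + g x"] by (simp add: algebra_simps)
    also have "\<dots> \<le> max (nm (f x - a)) (nm (g x - b))"
      by (rule abs_ultrametric)
    also have "\<dots> \<le> dist (f x) a + dist (g x) b"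
      unfolding dist_eq_nm[of "f x"] dist_eq_nm[of "g x"] by simp
    finally show ?thesis .
  qed
  ultimately show ?thesis
    unfolding tendsto_dist_iff[of "\<lambda>x. f x + g x"]
    by (rule_tac tendsto_sandwich[of "\<lambda>_. 0", OF _ _ tendsto_const]) auto
qed

lemma tendsto_mult_nm:
  assumes "(f \<longlongrightarrow> (a::'c)) F"
  shows "((\<lambda>x. c * f x) \<longlongrightarrow> c * a) F"
proof -
  have "((\<lambda>x. nm c * dist (f x) a) \<longlongrightarrow> nm c * 0) F"
    using assms unfolding tendsto_dist_iff[of f] by (rule tendsto_mult_left)
  moreover have "dist (c * f x) (c * a) = nm c * dist (f x) a" for x
    unfolding dist_eq_nm[of "c * f x"] dist_eq_nm[of "f x"]
    by (simp flip: abs_mult add: algebra_simps)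
  ultimately show ?thesis
    unfolding tendsto_dist_iff[of "\<lambda>x. c * f x"] by simp
qed

lemma tendsto_frob_nm:
  assumes "(f \<longlongrightarrow> (a::'c)) F"
  shows "((\<lambda>x. f x ^ (q ^ i)) \<longlongrightarrow> a ^ (q ^ i)) F"
proof -
  have "((\<lambda>x. dist (f x) a ^ (q ^ i)) \<longlongrightarrow> 0 ^ (q ^ i)) F"
    using assms unfolding tendsto_dist_iff[of f] by (rule tendsto_power)
  moreover have "dist (f x ^ (q ^ i)) (a ^ (q ^ i)) = dist (f x) a ^ (q ^ i)" for x
    unfolding dist_eq_nm[of "f x ^ _"] dist_eq_nm[of "f x"] by (simp flip: frob_diff)
  ultimately show ?thesis
    unfolding tendsto_dist_iff[of "\<lambda>x. f x ^ _"] by (simp add: power_0_left)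
qed

lemma sums_add_nm: "f sums (a::'c) \<Longrightarrow> g sums b \<Longrightarrow> (\<lambda>n. f n + g n) sums (a + b)"
  unfolding sums_def sum.distrib by (rule tendsto_add_nm)

lemma sums_mult_nm: "f sums (a::'c) \<Longrightarrow> (\<lambda>n. c * f n) sums (c * a)"
  unfolding sums_def sum_distrib_left[symmetric] by (rule tendsto_mult_nm)

lemma sums_sum_nm:
  assumes "\<And>i. i \<in> I \<Longrightarrow> f i sums (a i :: 'c)"
  shows "(\<lambda>n. \<Sum>i\<in>I. f i n) sums (\<Sum>i\<in>I. a i)"
  using assms by (induction I rule: infinite_finite_induct) (auto intro: sums_add_nm)

text \<open>In an ultrametric a block of terms is no larger than its largest member, so null terms
  already make the partial sums Cauchy.\<close>

lemma summable_nm: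
  fixes f :: "nat \<Rightarrow> 'c"
  assumes "(\<lambda>n. nm (f n)) \<longlonglongrightarrow> 0"
  shows "summable f"
proof -
  have "Cauchy (\<lambda>n. sum f {..<n})"
  proof (rule metric_CauchyI)
    fix e :: real assume e: "e > 0"
    then obtain N where N: "\<And>n. n \<ge> N \<Longrightarrow> nm (f n) < e / 2"
      using assms order_tendstoD(2)[of _ 0 sequentially "e / 2"]
      unfolding eventually_sequentially by auto
    have *: "dist (sum f {..<m}) (sum f {..<n}) < e" if "m \<ge> n" "n \<ge> N" for m n
    proof -
      have "sum f {..<m} - sum f {..<n} = sum f ({..<m} - {..<n})"
        using that by (subst sum_diff) auto
      then have "dist (sum f {..<m}) (sum f {..<n}) = nm (sum f ({..<m} - {..<n}))"
        unfolding dist_eq_nm[of "sum f {..<m}"] by simp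
      also have "\<dots> \<le> e / 2"
        using that e N by (intro nm_sum_le) (auto intro!: less_imp_le)
      finally show ?thesis
        using e by simp
    qed
    have "dist (sum f {..<m}) (sum f {..<n}) < e" if "m \<ge> N" "n \<ge> N" for m n
      using *[of m n] *[of n m] that by (cases "m \<le> n") (auto simp: dist_commute)
    then show "\<exists>M. \<forall>m\<ge>M. \<forall>n\<ge>M. dist (sum f {..<m}) (sum f {..<n}) < e"
      by blast
  qed
  then show ?thesis
    using Cauchy_convergent[of "\<lambda>n. sum f {..<n}"] by (auto simp: summable_def sums_def convergent_def)
qed

text \<open>The Frobenius acts termwise. To stay with finite sums, F is cut off after exponent n:
  the power of the tail is divisible by X^((n+1) q^i) and cannot reach the coefficient n.\<close>

lemma fps_nth_frob:
  fixes F :: "'c fps"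
  shows "fps_nth (F ^ (q ^ i)) n = (if q ^ i dvd n then fps_nth F (n div q ^ i) ^ (q ^ i) else 0)"
proof -
  let ?Q = "q ^ i"
  have Q: "?Q > 0"
    by simp
  have c: "CHAR('c fps) = CHAR('c)"
    by simp
  let ?N = "Suc n"
  have cut: "fps_cutoff ?N F = (\<Sum>k<?N. fps_const (fps_nth F k) * fps_X ^ k)"
  proof (rule fps_ext)
    fix m
    have "fps_nth (\<Sum>k<?N. fps_const (fps_nth F k) * fps_X ^ k) m
        = (\<Sum>k<?N. if m = k then fps_nth F k else 0)"
      unfolding fps_sum_nth by (intro sum.cong refl) simp
    also have "\<dots> = fps_nth (fps_cutoff ?N F) m"
      by simp
    finally show "fps_nth (fps_cutoff ?N F) m = fps_nth (\<Sum>k<?N. fps_const (fps_nth F k) * fps_X ^ k) m"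
      by (rule sym)
  qed
  have "F ^ ?Q = (fps_X ^ ?N * fps_shift ?N F + fps_cutoff ?N F) ^ ?Q"
    by (simp only: fps_shift_cutoff')
  also have "\<dots> = (fps_X ^ ?N * fps_shift ?N F) ^ ?Q + (fps_cutoff ?N F) ^ ?Q"
    by (rule frob_add[OF c])
  also have "(fps_cutoff ?N F) ^ ?Q = (\<Sum>k<?N. (fps_const (fps_nth F k) * fps_X ^ k) ^ ?Q)"
    unfolding cut by (rule frob_sum[OF c])
  also have "\<dots> = (\<Sum>k<?N. fps_const (fps_nth F k ^ ?Q) * fps_X ^ (k * ?Q))"
    by (simp add: power_mult_distrib power_mult)
  finally have "fps_nth (F ^ ?Q) n = fps_nth ((fps_X ^ ?N * fps_shift ?N F) ^ ?Q) n
      + (\<Sum>k<?N. fps_nth (fps_const (fps_nth F k ^ ?Q) * fps_X ^ (k * ?Q)) n)"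
    by (simp add: fps_sum_nth)
  also have "(fps_X ^ ?N * fps_shift ?N F) ^ ?Q = fps_X ^ (?N * ?Q) * fps_shift ?N F ^ ?Q"
    by (simp only: power_mult_distrib power_mult)
  also have "fps_nth (fps_X ^ (?N * ?Q) * fps_shift ?N F ^ ?Q) n = 0"
  proof -
    have "n < ?N * 1"
      by simp
    also have "\<dots> \<le> ?N * ?Q"
      using Q by (intro mult_le_mono2) (simp add: Suc_le_eq)
    finally show ?thesis
      by (simp add: fps_X_power_mult_nth)
  qed
  also have "(\<Sum>k<?N. fps_nth (fps_const (fps_nth F k ^ ?Q) * fps_X ^ (k * ?Q)) n)
      = (\<Sum>k<?N. if n = k * ?Q then fps_nth F k ^ ?Q else 0)"
    by (auto intro!: sum.cong)
  also have "\<dots> = (if ?Q dvd n then fps_nth F (n div ?Q) ^ ?Q else 0)"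
  proof (cases "?Q dvd n")
    case True
    then have "(\<Sum>k<?N. if n = k * ?Q then fps_nth F k ^ ?Q else 0)
        = (\<Sum>k<?N. if k = n div ?Q then fps_nth F k ^ ?Q else 0)"
      using Q by (intro sum.cong) auto
    moreover have "n div ?Q < ?N"
      by (simp add: div_le_dividend le_imp_less_Suc)
    ultimately show ?thesis
      using True by simp
  next
    case False
    then have "n \<noteq> k * ?Q" for k
      by auto
    then show ?thesis
      using False by (simp only: if_False sum.neutral_const)
  qed
  finally show ?thesis
    by simp
qed

text \<open>\<open>h\<close> is the structure map of a commutative \<open>C\<^sub>\<infinity>\<close>-algebra, on which twisted polynomials act.\<close>

definition tev :: "('c \<Rightarrow> 'r::comm_ring_1) \<Rightarrow> 'c poly \<Rightarrow> 'r \<Rightarrow> 'r" where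
  "tev h g x = (\<Sum>i\<le>degree g. h (coeff g i) * x ^ (q ^ i))"

context
  fixes h :: "'c \<Rightarrow> 'r::comm_ring_1"
  assumes h: "comm_ring_hom h" and char: "CHAR('r) = CHAR('c)"
begin

interpretation h: comm_ring_hom h
  by (rule h)

lemma tev_extend:
  assumes "degree g \<le> N"
  shows "tev h g x = (\<Sum>i\<le>N. h (coeff g i) * x ^ (q ^ i))"
  unfolding tev_def by (rule sum.mono_neutral_left) (use assms in \<open>auto simp: coeff_eq_0 not_le\<close>)

lemma tev_add: "tev h (f + g) x = tev h f x + tev h g x"
proof -
  let ?N = "max (degree f) (degree g)"
  have "degree (f + g) \<le> ?N"
    by (rule degree_add_le) auto
  then show ?thesis
    by (simp add: tev_extend[of _ ?N] h.hom_add sum.distrib algebra_simps)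
qed

lemma tev_0 [simp]: "tev h 0 x = 0"
  by (simp add: tev_def)

lemma tev_sum: "tev h (sum f A) x = (\<Sum>a\<in>A. tev h (f a) x)"
  by (induction A rule: infinite_finite_induct) (auto simp: tev_add)

lemma tev_monom: "tev h (monom a i) x = h a * x ^ (q ^ i)"
proof -
  have "tev h (monom a i) x = (\<Sum>j\<le>i. h (coeff (monom a i) j) * x ^ (q ^ j))"
    by (rule tev_extend) (rule degree_monom_le)
  also have "\<dots> = (\<Sum>j\<le>i. if j = i then h a * x ^ (q ^ i) else 0)"
    by (intro sum.cong) auto
  finally show ?thesis
    by simp
qed

lemma tev_additive: "tev h g (x + y) = tev h g x + tev h g y"
  by (simp add: tev_def frob_add[OF char] sum.distrib algebra_simps)

lemma tev_twisted_mult: "tev h (twisted_mult \<iota> f g) x = tev h f (tev h g x)"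
proof -
  have "tev h (twisted_mult \<iota> f g) x
      = (\<Sum>i\<le>degree f. \<Sum>j\<le>degree g. h (coeff f i) * (h (coeff g j) * x ^ (q ^ j)) ^ (q ^ i))"
    unfolding twisted_mult_def tev_sum tev_monom
    by (simp add: h.hom_mult h.hom_power power_mult_distrib power_add mult_ac flip: power_mult)
  also have "\<dots> = tev h f (tev h g x)"
    unfolding tev_def[of h f] unfolding tev_def by (simp add: frob_sum[OF char] sum_distrib_left)
  finally show ?thesis .
qed

end

lemma comm_ring_hom_id: "comm_ring_hom (\<lambda>x::'c. x)"
  by unfold_locales auto

lemma comm_ring_hom_fps_const: "comm_ring_hom (fps_const :: 'c \<Rightarrow> _)"
  by unfold_locales auto

abbreviation teval :: "'c poly \<Rightarrow> 'c \<Rightarrow> 'c" where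
  "teval \<equiv> tev (\<lambda>x. x)"

abbreviation tevalf :: "'c poly \<Rightarrow> 'c fps \<Rightarrow> 'c fps" where
  "tevalf \<equiv> tev fps_const"

lemmas teval_add = tev_add[OF comm_ring_hom_id]
  and teval_0 = tev_0[OF comm_ring_hom_id]
  and teval_monom = tev_monom[OF comm_ring_hom_id]
  and teval_additive = tev_additive[OF comm_ring_hom_id refl]
  and teval_mult = tev_twisted_mult[OF comm_ring_hom_id refl]
  and tevalf_mult = tev_twisted_mult[OF comm_ring_hom_fps_const semiring_char_fps]

lemma infinite_UNIV_c: "infinite (UNIV :: 'c set)"
proof
  assume "finite (UNIV :: 'c set)"
  then have "finite (range (\<lambda>n::nat. \<theta> ^ n))"
    by (rule finite_subset[OF subset_UNIV])
  moreover have "inj (\<lambda>n::nat. \<theta> ^ n)"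
  proof (rule injI)
    fix m n :: nat assume "\<theta> ^ m = \<theta> ^ n"
    then have "nm \<theta> ^ m = nm \<theta> ^ n"
      by (metis nm_power)
    then show "m = n"
      using nm_theta_gt_1 power_inject_exp by blast
  qed
  ultimately show False
    using finite_imageD infinite_UNIV_nat by blast
qed

lemma inj_qpow: "q ^ i = q ^ j \<longleftrightarrow> i = j"
  using q_gt_1 power_inject_exp by blast

text \<open>C_\<infinity> is infinite, so a twisted polynomial is determined by the function that it
  defines. Identities in the twisted ring, such as commutation with \<open>rho_t\<close>, thereby
  become identities of functions.\<close>

lemma teval_eq_0_imp:
  assumes "\<And>x. teval g x = 0"
  shows "g = 0"
proof -
  define P where "P = (\<Sum>i\<le>degree g. monom (coeff g i) (q ^ i))"
  have "poly P x = teval g x" for x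
    by (simp add: P_def tev_def poly_sum poly_monom)
  then have "{x. poly P x = 0} = UNIV"
    using assms by simp
  then have "P = 0"
    using infinite_UNIV_c poly_roots_finite by metis
  have "coeff g i = 0" if "i \<le> degree g" for i
  proof -
    have "coeff P (q ^ i) = (\<Sum>j\<le>degree g. if j = i then coeff g j else 0)"
      unfolding P_def coeff_sum by (intro sum.cong) (auto simp: inj_qpow)
    then show ?thesis
      using \<open>P = 0\<close> that by simp
  qed
  then show ?thesis
    using leading_coeff_0_iff by blast
qed

lemma teval_uminus: "teval (- f) x = - teval f x"
  using teval_add[of f "- f" x] by (simp add: teval_0 eq_neg_iff_add_eq_0 add.commute)

lemma teval_diff: "teval (f - g) x = teval f x - teval g x"
  using teval_add[of f "- g" x] by (simp add: teval_uminus)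

lemma teval_inject:
  assumes "\<And>x. teval f x = teval g x"
  shows "f = g"
  using teval_eq_0_imp[of "f - g"] assms by (simp add: teval_diff)

lemma teval_minus_arg: "teval g (x - y) = teval g x - teval g y"
  by (metis add_diff_cancel_right' diff_add_cancel teval_additive)

lemma teval_zero_arg [simp]: "teval g 0 = 0"
  using teval_minus_arg[of g 0 0] by simp

lemma degree_rho_t: "degree (rho_t \<iota> \<kappa>) = 2"
  by (simp add: rho_t_def)

lemma tev_rho_t: "tev h (rho_t \<iota> \<kappa>) x = h \<theta> * x + h \<kappa> * x ^ q + h 1 * x ^ (q ^ 2)"
  unfolding tev_def degree_rho_t
  by (simp add: rho_t_def numeral_2_eq_2 atMost_Suc algebra_simps)

lemma drinfeld_End_iff:
  "g \<in> drinfeld_End \<iota> \<kappa> \<longleftrightarrow> (\<forall>x. teval g (teval (rho_t \<iota> \<kappa>) x) = teval (rho_t \<iota> \<kappa>) (teval g x))"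
  unfolding drinfeld_End_def mem_Collect_eq
  by (metis teval_mult teval_inject)

lemma coeff_twisted_mult_0: "coeff (twisted_mult \<iota> f g) 0 = coeff f 0 * coeff g 0"
proof -
  have "coeff (twisted_mult \<iota> f g) 0 = (\<Sum>i\<le>degree f. if i = 0 then coeff f 0 * coeff g 0 else 0)"
    unfolding twisted_mult_def coeff_sum
  proof (intro sum.cong refl)
    fix i
    have "(\<Sum>j\<le>degree g. coeff (monom (coeff f i * coeff g j ^ q ^ i) (i + j)) 0)
        = (\<Sum>j\<le>degree g. if j = 0 then (if i = 0 then coeff f 0 * coeff g 0 else 0) else 0)"
      by (intro sum.cong) auto
    then show "(\<Sum>j\<le>degree g. coeff (monom (coeff f i * coeff g j ^ q ^ i) (i + j)) 0)
        = (if i = 0 then coeff f 0 * coeff g 0 else 0)"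
      by simp
  qed
  then show ?thesis
    by simp
qed

lemma closed_subring_CM_order: "closed_subring (CM_order \<iota> \<kappa>)"
proof
  let ?E = "drinfeld_End \<iota> \<kappa>"
  have "[:1:] \<in> ?E"
    using teval_monom[of 1 0] by (simp add: drinfeld_End_iff monom_0)
  then show "1 \<in> CM_order \<iota> \<kappa>"
    unfolding CM_order_def by (rule rev_image_eqI) simp
  fix x y assume "x \<in> CM_order \<iota> \<kappa>" "y \<in> CM_order \<iota> \<kappa>"
  then obtain f g where fg: "f \<in> ?E" "g \<in> ?E" "x = coeff f 0" "y = coeff g 0"
    unfolding CM_order_def by blast
  have "f - g \<in> ?E" "twisted_mult \<iota> f g \<in> ?E"
    using fg by (auto simp: drinfeld_End_iff teval_diff teval_minus_arg teval_mult)
  then show "x - y \<in> CM_order \<iota> \<kappa>" "x * y \<in> CM_order \<iota> \<kappa>"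
    unfolding CM_order_def fg
    by (auto intro: rev_image_eqI[of "f - g"] rev_image_eqI[of "twisted_mult \<iota> f g"]
        simp: coeff_twisted_mult_0)
qed

lemma fps_nth_tevalf: "fps_nth (tevalf g F) n = (\<Sum>i\<le>degree g. coeff g i * fps_nth (F ^ (q ^ i)) n)"
  by (simp add: tev_def fps_sum_nth)

lemma fps_nth_frob_compose_linear:
  fixes F :: "'c fps"
  shows "fps_nth ((F oo (fps_const d * fps_X)) ^ (q ^ i)) n = d ^ n * fps_nth (F ^ (q ^ i)) n"
  by (auto simp: fps_nth_frob power_mult_distrib simp flip: power_mult)

lemma tevalf_compose_linear:
  "tevalf g (F oo (fps_const d * fps_X)) = tevalf g F oo (fps_const d * fps_X)"
  by (rule fps_ext) (simp add: fps_nth_tevalf fps_nth_frob_compose_linear sum_distrib_left mult.left_commute)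

text \<open>The equation expresses (\<theta>^n - \<theta>) F_n through coefficients of smaller
  index, and \<theta>^n differs from \<theta> for n > 1. Initial values other than 0 and 1 are
  allowed, so that compositions of the exponential with endomorphisms are covered.\<close>

lemma exp_functional_equation_unique:
  fixes F H :: "'c fps"
  assumes F: "F oo (fps_const \<theta> * fps_X) = tevalf (rho_t \<iota> \<kappa>) F"
    and H: "H oo (fps_const \<theta> * fps_X) = tevalf (rho_t \<iota> \<kappa>) H"
    and init: "fps_nth F 0 = fps_nth H 0" "fps_nth F 1 = fps_nth H 1"
  shows "F = H"
proof (rule fps_ext)
  fix n
  show "fps_nth F n = fps_nth H n"
  proof (induction n rule: less_induct)
    case (less n)
    show ?case
    proof (cases "n > 1")
      case False
      then show ?thesis
        using init by (cases n) auto
    next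
      case True
      have rec: "(\<theta> ^ n - \<theta>) * fps_nth G n = \<kappa> * fps_nth (G ^ q) n + fps_nth (G ^ (q ^ 2)) n"
        if "G oo (fps_const \<theta> * fps_X) = tevalf (rho_t \<iota> \<kappa>) G" for G
      proof -
        have "\<theta> ^ n * fps_nth G n = \<theta> * fps_nth G n + \<kappa> * fps_nth (G ^ q) n + fps_nth (G ^ (q ^ 2)) n"
          using arg_cong[OF that, of "\<lambda>G. fps_nth G n"] by (simp add: tev_rho_t)
        then show ?thesis
          by (simp add: left_diff_distrib)
      qed
      have lt: "n div q < n" "n div q ^ 2 < n"
      proof -
        show "n div q < n"
          using True q_gt_1 by (intro div_less_dividend) auto
        have "1 < q ^ 2"
          using q_gt_1 by (intro one_less_power) auto
        then show "n div q ^ 2 < n"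
          using True by (intro div_less_dividend) auto
      qed
      have "fps_nth (F ^ (q ^ i)) n = fps_nth (H ^ (q ^ i)) n" if "i = 1 \<or> i = 2" for i
        using that less.IH[OF lt(1)] less.IH[OF lt(2)] unfolding fps_nth_frob by auto
      from this[of 1] this[of 2] have "(\<theta> ^ n - \<theta>) * fps_nth F n = (\<theta> ^ n - \<theta>) * fps_nth H n"
        by (simp add: rec[OF F] rec[OF H])
      then show ?thesis
        using theta_power_neq[OF True] by simp
    qed
  qed
qed

end

section \<open>The exponential of \<rho>\<close>

locale drinfeld = C_infinity \<iota>
  for \<iota> :: "'f::{field,finite} fls \<Rightarrow> 'c::{field,complete_space}" +
  fixes \<kappa> :: 'c
  assumes kappa_mem: "\<kappa> \<in> kbar \<iota>"
begin

abbreviation R :: "'c \<Rightarrow> 'c" where "R \<equiv> teval (rho_t \<iota> \<kappa>)"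

lemma R_eq: "R x = \<theta> * x + \<kappa> * x ^ q + x ^ (q ^ 2)"
  by (simp add: tev_rho_t)

text \<open>The coefficient of z^(q^i) in the exponential, obtained by comparing these coefficients
  in F(\<theta> z) = \<rho>_t(F(z)). At i = 1 the \<tau>^2 term does not contribute yet.\<close>

fun ec :: "nat \<Rightarrow> 'c" where
  "ec 0 = 1"
| "ec (Suc 0) = \<kappa> / (\<theta> ^ q - \<theta>)"
| "ec (Suc (Suc i)) = (\<kappa> * ec (Suc i) ^ q + ec i ^ (q ^ 2)) / (\<theta> ^ (q ^ (i + 2)) - \<theta>)"

definition E :: "'c fps" where
  "E = Abs_fps (\<lambda>n. if \<exists>i. n = q ^ i then ec (THE i. n = q ^ i) else 0)"

lemma E_nth_qpow [simp]: "fps_nth E (q ^ i) = ec i"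
proof -
  have "(THE j. q ^ i = q ^ j) = i"
    by (rule the_equality) (auto simp: inj_qpow)
  then show ?thesis
    by (auto simp: E_def)
qed

lemma E_nth_nonzero: "fps_nth E n \<noteq> 0 \<Longrightarrow> \<exists>i. n = q ^ i"
  by (auto simp: E_def split: if_splits)

lemma E_nth_0 [simp]: "fps_nth E 0 = 0"
  using E_nth_nonzero[of 0] by auto

lemma E_nth_1 [simp]: "fps_nth E (Suc 0) = 1"
  using E_nth_qpow[of 0] by simp

lemma E_functional_equation: "E oo (fps_const \<theta> * fps_X) = tevalf (rho_t \<iota> \<kappa>) E"
proof (rule fps_ext)
  fix n
  have "\<theta> ^ n * fps_nth E n = \<theta> * fps_nth E n + \<kappa> * fps_nth (E ^ (q ^ 1)) n + fps_nth (E ^ (q ^ 2)) n"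
  proof (cases "\<exists>i. n = q ^ i")
    case False
    have "fps_nth E n = 0"
      using E_nth_nonzero False by blast
    moreover have zero: "fps_nth (E ^ (q ^ j)) n = 0" for j
    proof (rule ccontr)
      assume "fps_nth (E ^ (q ^ j)) n \<noteq> 0"
      then have dvd: "q ^ j dvd n" "fps_nth E (n div q ^ j) \<noteq> 0"
        by (auto simp: fps_nth_frob split: if_splits)
      then obtain i where "n div q ^ j = q ^ i"
        using E_nth_nonzero by blast
      then have "n = q ^ (i + j)"
        using dvd(1) by (metis dvd_div_mult_self power_add)
      then show False
        using False by blast
    qed
    ultimately show ?thesis
      using zero[of 1] by simp
  next
    case True
    then obtain i where i: "n = q ^ i"
      by blast
    have frob: "fps_nth (E ^ (q ^ j)) (q ^ i) = (if j \<le> i then ec (i - j) ^ (q ^ j) else 0)" for j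
    proof (cases "j \<le> i")
      case True
      then have "q ^ i div q ^ j = q ^ (i - j)" "q ^ j dvd q ^ i"
        by (auto simp: power_diff le_imp_power_dvd)
      then show ?thesis
        using True by (simp add: fps_nth_frob)
    next
      case False
      then have "\<not> q ^ j dvd q ^ i"
        using q_gt_1 power_dvd_imp_le by blast
      then show ?thesis
        using False by (simp add: fps_nth_frob)
    qed
    have ne: "\<theta> ^ (q ^ i) - \<theta> \<noteq> 0" if "i > 0"
      using theta_power_neq[OF one_less_power[OF q_gt_1 that]] by simp
    consider "i = 0" | "i = Suc 0" | j where "i = Suc (Suc j)"
      by (metis not0_implies_Suc)
    then show ?thesis
    proof cases
      case 3
      have "(\<theta> ^ (q ^ i) - \<theta>) * ec i = \<kappa> * ec (Suc j) ^ q + ec j ^ (q ^ 2)"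
        using ne unfolding 3 by simp
      then have "\<theta> ^ (q ^ i) * ec i = \<theta> * ec i + \<kappa> * ec (Suc j) ^ q + ec j ^ (q ^ 2)"
        unfolding left_diff_distrib diff_eq_eq by (simp only: add_ac)
      moreover have "1 \<le> i" "2 \<le> i" "i - 1 = Suc j" "i - 2 = j"
        using 3 by auto
      ultimately show ?thesis
        unfolding i frob E_nth_qpow by (simp only: if_True power_one_right)
    next
      case 2
      have "(\<theta> ^ (q ^ i) - \<theta>) * ec i = \<kappa>"
        using ne unfolding 2 by simp
      then have "\<theta> ^ (q ^ i) * ec i = \<theta> * ec i + \<kappa>"
        unfolding left_diff_distrib diff_eq_eq by (simp only: add_ac)
      moreover have "1 \<le> i" "\<not> 2 \<le> i" "i - 1 = 0"
        using 2 by auto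
      ultimately show ?thesis
        unfolding i frob E_nth_qpow by simp
    next
      case 1
      then show ?thesis
        unfolding i frob by simp
    qed
  qed
  then show "fps_nth (E oo (fps_const \<theta> * fps_X)) n = fps_nth (tevalf (rho_t \<iota> \<kappa>) E) n"
    by (simp add: tev_rho_t)
qed

lemma exp_series_eq: "exp_series \<iota> \<kappa> = E"
  unfolding exp_series_def tev_def[symmetric]
proof (rule the_equality)
  show "fps_nth E 1 = 1 \<and> (\<forall>n. fps_nth E n \<noteq> 0 \<longrightarrow> (\<exists>i. n = q ^ i)) \<and>
      E oo (fps_const \<theta> * fps_X) = tevalf (rho_t \<iota> \<kappa>) E"
    using E_nth_nonzero E_functional_equation by simp
  fix F assume F: "fps_nth F 1 = 1 \<and> (\<forall>n. fps_nth F n \<noteq> 0 \<longrightarrow> (\<exists>i. n = q ^ i)) \<and>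
      F oo (fps_const \<theta> * fps_X) = tevalf (rho_t \<iota> \<kappa>) F"
  note F1 = F[THEN conjunct1] and F2 = F[THEN conjunct2, THEN conjunct1, THEN spec]
    and F3 = F[THEN conjunct2, THEN conjunct2]
  have "fps_nth F 0 = 0"
  proof (rule ccontr)
    assume "fps_nth F 0 \<noteq> 0"
    then have "\<exists>i. 0 = q ^ i"
      using F2[of 0] by (rule rev_mp)
    then show False
      by simp
  qed
  then have "fps_nth F 0 = fps_nth E 0" "fps_nth F 1 = fps_nth E 1"
    using F1 by simp_all
  then show "F = E"
    by (rule exp_functional_equation_unique[OF F3 E_functional_equation])
qed

lemma nm_theta_qpow_diff:
  assumes "j > 0"
  shows "real q ^ (q ^ j) \<le> nm (\<theta> ^ (q ^ j) - \<theta>)"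
proof -
  have "1 < q ^ j"
    using one_less_power[OF q_gt_1 assms] .
  then have "nm \<theta> ^ 1 < nm \<theta> ^ (q ^ j)"
    using nm_theta_gt_1 by (intro power_strict_increasing) auto
  moreover have "nm (\<theta> ^ (q ^ j)) \<le> max (nm (\<theta> ^ (q ^ j) - \<theta>)) (nm \<theta>)"
    using abs_ultrametric[of "\<theta> ^ (q ^ j) - \<theta>" \<theta>] by simp
  ultimately have "nm \<theta> ^ (q ^ j) \<le> nm (\<theta> ^ (q ^ j) - \<theta>)"
    unfolding nm_power power_one_right by linarith
  then show ?thesis
    by (simp only: nm_theta)
qed

text \<open>The factor l^j inside the power q^j is what makes the exponential entire: c l^j |z| is
  eventually small for every z.\<close>

lemma ec_bound:
  obtains c l :: real where "c > 0" "0 < l" "l < 1" "\<And>j. nm (ec j) \<le> (c * l ^ j) ^ (q ^ j)"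
proof -
  \<comment> \<open>Chosen with l^2 = 1/q. The denominator of the recursion has absolute value at
    least q^(q^j), and dividing (c l^(j-2))^(q^j) by that gives exactly (c l^j)^(q^j).\<close>
  define l where "l = sqrt (1 / real q)"
  have q1: "real q > 1"
    using q_gt_1 by simp
  have l: "0 < l" "l < 1" "l * l = 1 / real q"
    using q1 by (auto simp: l_def real_sqrt_lt_1_iff)
  let ?w = "\<lambda>j. nm (ec j)"
  \<comment> \<open>The \<kappa> term of the recursion comes with a surplus factor l^(q^j), which
    absorbs |\<kappa>| for large j.\<close>
  obtain J where J: "\<And>j. j \<ge> J \<Longrightarrow> nm \<kappa> * l ^ j \<le> 1"
  proof -
    have "(\<lambda>j. nm \<kappa> * l ^ j) \<longlonglongrightarrow> nm \<kappa> * 0"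
      by (intro tendsto_intros LIMSEQ_power_zero) (use l in auto)
    then have "eventually (\<lambda>j. nm \<kappa> * l ^ j < 1) sequentially"
      by (rule order_tendstoD) simp
    then show ?thesis
      using that unfolding eventually_sequentially by (meson less_imp_le)
  qed
  \<comment> \<open>Large enough that c l^j dominates both 1 and \<open>nm (ec j)\<close> for the
    starting indices; the 1 ensures that raising c l^j to the power q^j does not spoil the
    bound.\<close>
  define c where "c = (\<Sum>j\<le>J + 1. (1 + ?w j) / l ^ j)"
  have c_ge: "1 + ?w j \<le> c * l ^ j" if "j \<le> J + 1" for j
  proof -
    have "(1 + ?w j) / l ^ j \<le> c"
      unfolding c_def using l that by (intro member_le_sum) auto
    then show ?thesis
      using l by (simp add: field_simps)
  qed
  have c0: "c > 0"
    using c_ge[of 0] zero_le_dist[of 0 "ec 0"] by simp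
  have "?w j \<le> (c * l ^ j) ^ (q ^ j)" for j
  proof (induction j rule: less_induct)
    case (less j)
    show ?case
    proof (cases "j \<le> J + 1")
      case True
      have "?w j \<le> c * l ^ j" "1 \<le> c * l ^ j"
        using c_ge[OF True] zero_le_dist[of 0 "ec j"] by linarith+
      moreover have "(c * l ^ j) ^ 1 \<le> (c * l ^ j) ^ (q ^ j)"
        using calculation(2) by (intro power_increasing) (auto simp: Suc_le_eq)
      ultimately show ?thesis
        by simp
    next
      case False
      then obtain i where i: "j = Suc (Suc i)" "i \<ge> J"
        by (metis One_nat_def Suc_eq_plus1 Suc_le_D Suc_le_mono not_less_eq_eq)
      let ?n = "q ^ j"
      let ?b = "(c * l ^ j) ^ ?n"
      have n: "?n = q ^ Suc i * q" "?n = q ^ i * q ^ 2"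
        by (simp_all add: i power2_eq_square)
      have shrink: "a ^ ?n / real q ^ ?n = (a * (l * l)) ^ ?n" for a
        by (simp add: l(3) power_divide power_mult_distrib)
      have "nm (ec (Suc i) ^ q) \<le> (c * l ^ Suc i) ^ ?n"
        unfolding nm_power n(1) power_mult using less.IH[of "Suc i"] i by (intro power_mono) auto
      then have "nm (\<kappa> * ec (Suc i) ^ q) / real q ^ ?n \<le> nm \<kappa> * ((c * l ^ Suc i) ^ ?n / real q ^ ?n)"
        unfolding abs_mult by (auto simp: divide_right_mono mult_left_mono)
      also have "\<dots> = (nm \<kappa> * l ^ ?n) * ?b"
        unfolding shrink by (simp add: i power_mult_distrib)
      also have "\<dots> \<le> 1 * ?b"
      proof (rule mult_right_mono)
        have "i < q ^ i"
          by (rule power_gt_expt[OF q_gt_1[unfolded One_nat_def]])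
        also have "q ^ i \<le> ?n"
          using q_gt_1 by (intro power_increasing) (auto simp: i)
        finally show "nm \<kappa> * l ^ ?n \<le> 1"
          using i by (intro J) simp
      qed (use c0 l in auto)
      finally have 1: "nm (\<kappa> * ec (Suc i) ^ q) / real q ^ ?n \<le> ?b"
        by simp
      have "nm (ec i ^ (q ^ 2)) \<le> (c * l ^ i) ^ ?n"
        unfolding nm_power n(2) power_mult using less.IH[of i] i by (intro power_mono) auto
      then have "nm (ec i ^ (q ^ 2)) / real q ^ ?n \<le> (c * l ^ i) ^ ?n / real q ^ ?n"
        by (rule divide_right_mono) simp
      also have "\<dots> = ?b"
        unfolding shrink by (simp add: i mult_ac)
      finally have 2: "nm (ec i ^ (q ^ 2)) / real q ^ ?n \<le> ?b" .
      let ?num = "\<kappa> * ec (Suc i) ^ q + ec i ^ (q ^ 2)"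
      have "?w j = nm ?num / nm (\<theta> ^ ?n - \<theta>)"
        by (simp add: i nm_divide)
      also have "\<dots> \<le> nm ?num / real q ^ ?n"
      proof (intro divide_left_mono mult_pos_pos)
        have pos: "0 < real q ^ ?n"
          by (intro zero_less_power) (use q1 in simp)
        show lb: "real q ^ ?n \<le> nm (\<theta> ^ ?n - \<theta>)"
          by (rule nm_theta_qpow_diff) (use i in simp)
        show "0 < nm (\<theta> ^ ?n - \<theta>)" "0 < real q ^ ?n"
          using pos lb by linarith+
      qed (rule zero_le_dist)
      also have "\<dots> \<le> max (nm (\<kappa> * ec (Suc i) ^ q)) (nm (ec i ^ (q ^ 2))) / real q ^ ?n"
        by (intro divide_right_mono abs_ultrametric) simp
      also have "\<dots> \<le> ?b"
        using 1 2 unfolding max_def by (auto simp only: split: if_splits)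
      finally show ?thesis .
    qed
  qed
  then show ?thesis
    using that[OF c0 l(1,2)] by blast
qed

lemma exp_rho_sums: "(\<lambda>n. fps_nth E n * z ^ n) sums exp_rho \<iota> \<kappa> z"
proof -
  obtain c l where cl: "c > 0" "0 < l" "l < 1" "\<And>j. nm (ec j) \<le> (c * l ^ j) ^ (q ^ j)"
    using ec_bound by blast
  have "(\<lambda>n. nm (fps_nth E n * z ^ n)) \<longlonglongrightarrow> 0"
  proof (rule LIMSEQ_I)
    fix r :: real assume r: "r > 0"
    have "(\<lambda>j. c * l ^ j * nm z) \<longlonglongrightarrow> c * 0 * nm z"
      by (intro tendsto_intros LIMSEQ_power_zero) (use cl in auto)
    then have "eventually (\<lambda>j. c * l ^ j * nm z < 1 / 2) sequentially"
      by (rule order_tendstoD) simp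
    moreover have "(\<lambda>j. (1 / 2 :: real) ^ j) \<longlonglongrightarrow> 0"
      by (intro LIMSEQ_power_zero) auto
    then have "eventually (\<lambda>j. (1 / 2 :: real) ^ j < r) sequentially"
      by (rule order_tendstoD) (rule r)
    ultimately have "eventually (\<lambda>j. c * l ^ j * nm z < 1 / 2 \<and> (1 / 2 :: real) ^ j < r) sequentially"
      by (rule eventually_conj)
    then obtain J where J: "\<And>j. j \<ge> J \<Longrightarrow> c * l ^ j * nm z < 1 / 2" "\<And>j. j \<ge> J \<Longrightarrow> (1 / 2 :: real) ^ j < r"
      unfolding eventually_sequentially by blast
    have "nm (fps_nth E n * z ^ n) < r" if n: "n \<ge> q ^ J" for n
    proof (cases "fps_nth E n = 0")
      case False
      then obtain j where j: "n = q ^ j"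
        using E_nth_nonzero by blast
      then have "J \<le> j"
        using n q_gt_1 by simp
      have "nm (fps_nth E n * z ^ n) = nm (ec j) * nm z ^ (q ^ j)"
        by (simp add: j abs_mult)
      also have "\<dots> \<le> (c * l ^ j) ^ (q ^ j) * nm z ^ (q ^ j)"
        by (intro mult_right_mono cl) auto
      also have "\<dots> = (c * l ^ j * nm z) ^ (q ^ j)"
        by (simp add: power_mult_distrib)
      also have "\<dots> \<le> (1 / 2) ^ (q ^ j)"
        using J(1)[OF \<open>J \<le> j\<close>] cl by (intro power_mono) auto
      also have "\<dots> \<le> (1 / 2) ^ j"
        using power_gt_expt[OF q_gt_1[unfolded One_nat_def], of j] by (intro power_decreasing) auto
      also have "\<dots> < r"
        by (rule J(2)) fact
      finally show ?thesis .
    qed (use r in simp)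
    then show "\<exists>no. \<forall>n\<ge>no. norm (nm (fps_nth E n * z ^ n) - 0) < r"
      by auto
  qed
  then have "summable (\<lambda>n. fps_nth E n * z ^ n)"
    by (rule summable_nm)
  then obtain s where "(\<lambda>n. fps_nth E n * z ^ n) sums s"
    by (auto simp: summable_def)
  then show ?thesis
    unfolding exp_rho_def exp_series_eq using sums_unique by blast
qed

lemma exp_rho_add: "exp_rho \<iota> \<kappa> (x + y) = exp_rho \<iota> \<kappa> x + exp_rho \<iota> \<kappa> y"
proof -
  have "fps_nth E n * (x + y) ^ n = fps_nth E n * x ^ n + fps_nth E n * y ^ n" for n
  proof (cases "fps_nth E n = 0")
    case False
    then obtain i where "n = q ^ i"
      using E_nth_nonzero by blast
    then show ?thesis
      by (simp add: frob_add algebra_simps)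
  qed simp
  then have "(\<lambda>n. fps_nth E n * (x + y) ^ n) sums (exp_rho \<iota> \<kappa> x + exp_rho \<iota> \<kappa> y)"
    using sums_add_nm[OF exp_rho_sums exp_rho_sums] by simp
  then show ?thesis
    using exp_rho_sums sums_unique2 by blast
qed

lemma exp_rho_0 [simp]: "exp_rho \<iota> \<kappa> 0 = 0"
  using exp_rho_add[of 0 0] by (metis add.right_neutral add_left_cancel)

lemma exp_rho_sum: "exp_rho \<iota> \<kappa> (sum f A) = (\<Sum>a\<in>A. exp_rho \<iota> \<kappa> (f a))"
  by (induction A rule: infinite_finite_induct) (auto simp: exp_rho_add)

text \<open>Each partial sum of the powered series is the Frobenius power of a partial sum of F, and
  the Frobenius is continuous.\<close>

lemma frob_series_sums:
  fixes F :: "'c fps"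
  assumes "(\<lambda>n. fps_nth F n * z ^ n) sums s"
  shows "(\<lambda>n. fps_nth (F ^ (q ^ i)) n * z ^ n) sums (s ^ (q ^ i))"
proof -
  let ?Q = "q ^ i"
  have Q: "?Q > 0"
    by simp
  \<comment> \<open>The quotient rounded up: the multiples m q^i below M are those with m < k
    M.\<close>
  define k where "k = (\<lambda>M. (M + ?Q - 1) div ?Q)"
  have k: "m * ?Q < M \<longleftrightarrow> m < k M" for m M
  proof -
    have "m < k M \<longleftrightarrow> Suc m * ?Q \<le> M + ?Q - 1"
      unfolding k_def Suc_le_eq[symmetric] by (rule less_eq_div_iff_mult_less_eq[OF Q])
    also have "\<dots> \<longleftrightarrow> m * ?Q < M"
      using Q unfolding mult_Suc by arith
    finally show ?thesis
      by (rule sym)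
  qed
  have part: "(\<Sum>n<M. fps_nth (F ^ ?Q) n * z ^ n) = (\<Sum>m<k M. fps_nth F m * z ^ m) ^ ?Q" for M
  proof -
    have "(\<Sum>n<M. fps_nth (F ^ ?Q) n * z ^ n)
        = (\<Sum>n\<in>(\<lambda>m. m * ?Q) ` {..<k M}. fps_nth (F ^ ?Q) n * z ^ n)"
    proof (rule sum.mono_neutral_right)
      show "\<forall>n\<in>{..<M} - (\<lambda>m. m * ?Q) ` {..<k M}. fps_nth (F ^ ?Q) n * z ^ n = 0"
      proof
        fix n assume n: "n \<in> {..<M} - (\<lambda>m. m * ?Q) ` {..<k M}"
        have "\<not> ?Q dvd n"
        proof
          assume "?Q dvd n"
          then obtain m where "n = m * ?Q"
            by (metis dvdE mult.commute)
          then show False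
            using n k[of m M] by auto
        qed
        then show "fps_nth (F ^ ?Q) n * z ^ n = 0"
          by (simp add: fps_nth_frob)
      qed
    qed (use k in auto)
    also have "\<dots> = (\<Sum>m<k M. fps_nth (F ^ ?Q) (m * ?Q) * z ^ (m * ?Q))"
      by (subst sum.reindex) (auto intro: inj_onI)
    also have "\<dots> = (\<Sum>m<k M. (fps_nth F m * z ^ m) ^ ?Q)"
      by (simp add: fps_nth_frob power_mult_distrib power_mult)
    finally show ?thesis
      by (simp add: frob_sum)
  qed
  have "filterlim k at_top sequentially"
    unfolding filterlim_at_top eventually_sequentially
  proof (intro allI exI impI)
    fix Z M assume "Z * ?Q \<le> M"
    then have "Z * ?Q \<le> M + ?Q - 1"
      using Q by linarith
    then show "Z \<le> k M"
      unfolding k_def by (rule less_eq_div_iff_mult_less_eq[OF Q, THEN iffD2])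
  qed
  then have "(\<lambda>M. \<Sum>m<k M. fps_nth F m * z ^ m) \<longlonglongrightarrow> s"
    using assms unfolding sums_def by (rule filterlim_compose[rotated])
  then show ?thesis
    unfolding sums_def part by (rule tendsto_frob_nm)
qed

text \<open>Because g commutes with \<rho>_t, both sides satisfy the functional equation of the
  exponential; both have constant coefficient 0 and linear coefficient
  \<open>coeff g 0\<close>.\<close>

lemma tevalf_E_End:
  assumes g: "g \<in> drinfeld_End \<iota> \<kappa>"
  shows "tevalf g E = E oo (fps_const (coeff g 0) * fps_X)"
proof -
  let ?d = "coeff g 0"
  have comm: "twisted_mult \<iota> g (rho_t \<iota> \<kappa>) = twisted_mult \<iota> (rho_t \<iota> \<kappa>) g"
    using g by (simp add: drinfeld_End_def)
  show ?thesis
  proof (rule exp_functional_equation_unique)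
    have "tevalf g E oo (fps_const \<theta> * fps_X) = tevalf g (tevalf (rho_t \<iota> \<kappa>) E)"
      by (simp only: E_functional_equation flip: tevalf_compose_linear)
    also have "\<dots> = tevalf (rho_t \<iota> \<kappa>) (tevalf g E)"
      by (simp only: comm flip: tevalf_mult)
    finally show "tevalf g E oo (fps_const \<theta> * fps_X) = tevalf (rho_t \<iota> \<kappa>) (tevalf g E)" .
    have "(E oo (fps_const ?d * fps_X)) oo (fps_const \<theta> * fps_X)
        = (E oo (fps_const \<theta> * fps_X)) oo (fps_const ?d * fps_X)"
      by (rule fps_ext) (simp only: fps_nth_compose_linear mult.left_commute)
    also have "\<dots> = tevalf (rho_t \<iota> \<kappa>) (E oo (fps_const ?d * fps_X))"
      by (simp only: E_functional_equation tevalf_compose_linear)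
    finally show "(E oo (fps_const ?d * fps_X)) oo (fps_const \<theta> * fps_X)
        = tevalf (rho_t \<iota> \<kappa>) (E oo (fps_const ?d * fps_X))" .
    show "fps_nth (tevalf g E) 0 = fps_nth (E oo (fps_const ?d * fps_X)) 0"
      by (simp add: fps_nth_tevalf fps_nth_frob power_0_left)
    have "fps_nth (tevalf g E) 1 = (\<Sum>i\<le>degree g. if i = 0 then ?d else 0)"
      unfolding fps_nth_tevalf
    proof (intro sum.cong refl)
      fix i
      have "\<not> q ^ i dvd 1" if "i > 0"
        using one_less_power[OF q_gt_1 that] by (metis less_irrefl nat_dvd_1_iff_1)
      then show "coeff g i * fps_nth (E ^ (q ^ i)) 1 = (if i = 0 then ?d else 0)"
        by (simp add: fps_nth_frob)
    qed
    then show "fps_nth (tevalf g E) 1 = fps_nth (E oo (fps_const ?d * fps_X)) 1"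
      by simp
  qed
qed

lemma exp_rho_End:
  assumes g: "g \<in> drinfeld_End \<iota> \<kappa>"
  shows "exp_rho \<iota> \<kappa> (coeff g 0 * z) = teval g (exp_rho \<iota> \<kappa> z)"
proof -
  let ?d = "coeff g 0"
  note H = tevalf_E_End[OF g]
  have "(\<lambda>n. \<Sum>i\<le>degree g. coeff g i * (fps_nth (E ^ (q ^ i)) n * z ^ n)) sums teval g (exp_rho \<iota> \<kappa> z)"
    unfolding tev_def by (intro sums_sum_nm sums_mult_nm frob_series_sums exp_rho_sums)
  moreover have "(\<Sum>i\<le>degree g. coeff g i * (fps_nth (E ^ (q ^ i)) n * z ^ n))
      = fps_nth E n * (?d * z) ^ n" for n
  proof -
    have "(\<Sum>i\<le>degree g. coeff g i * (fps_nth (E ^ (q ^ i)) n * z ^ n)) = fps_nth (tevalf g E) n * z ^ n"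
      by (simp add: fps_nth_tevalf sum_distrib_right mult.assoc)
    also have "\<dots> = fps_nth E n * (?d * z) ^ n"
      unfolding H fps_nth_compose_linear by (simp only: power_mult_distrib mult_ac)
    finally show ?thesis .
  qed
  ultimately have "(\<lambda>n. fps_nth E n * (?d * z) ^ n) sums teval g (exp_rho \<iota> \<kappa> z)"
    by simp
  then show ?thesis
    using exp_rho_sums sums_unique2 by blast
qed

end

section \<open>The cokernel of \<open>1 - \<sigma>\<close> and complex multiplication\<close>

context drinfeld
begin

abbreviation T :: "'c fls" where "T \<equiv> fls_X - fls_const \<theta>"
abbreviation K :: "'c fls" where "K \<equiv> fls_const (phi \<kappa>)"

text \<open>The composition of g with the exponential is 0. As the exponential starts with z, its
  coefficient at q^m isolates \<open>coeff g m\<close> once the lower coefficients of g are known to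
  vanish.\<close>

lemma End_coeff_0_eq_0_imp:
  assumes g: "g \<in> drinfeld_End \<iota> \<kappa>" "coeff g 0 = 0"
  shows "g = 0"
proof -
  have "tevalf g E = 0"
    unfolding tevalf_E_End[OF g(1)] g(2)
    by (rule fps_ext) (auto simp: power_0_left simp del: fps_const_0_eq_0)
  have "coeff g m = 0" for m
  proof (induction m rule: less_induct)
    case (less m)
    have "0 = fps_nth (tevalf g E) (q ^ m)"
      using \<open>tevalf g E = 0\<close> by simp
    also have "\<dots> = (\<Sum>i\<le>degree g. if i = m then coeff g m else 0)"
      unfolding fps_nth_tevalf
    proof (intro sum.cong refl)
      fix i
      consider "i < m" | "i = m" | "i > m"
        by linarith
      then show "coeff g i * fps_nth (E ^ (q ^ i)) (q ^ m) = (if i = m then coeff g m else 0)"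
      proof cases
        case 1
        then show ?thesis
          using less by simp
      next
        case 2
        then show ?thesis
          by (simp add: fps_nth_frob)
      next
        case 3
        then have "\<not> q ^ i dvd q ^ m"
          using q_gt_1 power_dvd_imp_le by (meson leD)
        then show ?thesis
          using 3 by (simp add: fps_nth_frob)
      qed
    qed
    also have "\<dots> = coeff g m"
      using coeff_eq_0[of g m] by (cases "m \<le> degree g") auto
    finally show ?case
      by simp
  qed
  then show ?thesis
    by (simp add: poly_eq_iff)
qed

lemma R_pow_add: "(R ^^ j) (x + y) = (R ^^ j) x + (R ^^ j) y"
  by (induction j) (simp_all add: teval_additive)

lemma R_pow_0 [simp]: "(R ^^ j) 0 = 0"
  by (induction j) simp_all

lemma R_pow_sum: "(R ^^ j) (sum f A) = (\<Sum>a\<in>A. (R ^^ j) (f a))"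
  by (induction A rule: infinite_finite_induct) (simp_all add: R_pow_add)

lemma R_sum: "R (sum f A) = (\<Sum>a\<in>A. R (f a))"
  using R_pow_sum[of 1] by simp

primrec rho_pow :: "nat \<Rightarrow> 'c poly" where
  "rho_pow 0 = [:1:]"
| "rho_pow (Suc j) = twisted_mult \<iota> (rho_t \<iota> \<kappa>) (rho_pow j)"

lemma teval_1: "teval [:1:] x = x"
  using teval_monom[of 1 0] by (simp add: monom_0)

lemma teval_rho_pow: "teval (rho_pow j) x = (R ^^ j) x"
  by (induction j) (simp_all add: teval_1 teval_mult)

definition R_poly :: "'c poly" where
  "R_poly = monom \<theta> 1 + monom \<kappa> q + monom 1 (q ^ 2)"

lemma poly_R_poly: "poly R_poly x = R x"
  by (simp add: R_poly_def poly_monom R_eq)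

lemma q_less_q2: "q < q ^ 2"
  using q_gt_1 by (simp add: power2_eq_square)

lemma degree_R_poly: "degree R_poly = q ^ 2"
proof -
  have "degree (monom \<theta> 1 + monom \<kappa> q) \<le> q"
    using q_gt_1 by (intro degree_add_le) (auto intro: order_trans[OF degree_monom_le])
  then show ?thesis
    unfolding R_poly_def using q_less_q2 by (subst degree_add_eq_right) (auto simp: degree_monom_eq)
qed

lemma poly_fun_eq_imp_eq:
  assumes "\<And>x::'c. poly p x = poly r x"
  shows "p = r"
proof -
  have "{x. poly (p - r) x = 0} = UNIV"
    using assms by simp
  then have "p - r = 0"
    using infinite_UNIV_c poly_roots_finite by metis
  then show ?thesis
    by simp
qed

text \<open>Expansion in powers of \<rho>_t with digits of \<tau>-degree at most 1. If S collects
  the higher digits, then R(S) = - (b_0 x + c_0 x^q) has degree q^2 deg S, but also at most q. So S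
  is constant, and it vanishes at 0.\<close>

lemma R_expansion_unique:
  assumes "\<And>x. (\<Sum>j<N. (R ^^ j) (b j * x + c j * x ^ q)) = 0" "j < N"
  shows "b j = 0 \<and> c j = 0"
  using assms
proof (induction N arbitrary: b c j)
  case (Suc N)
  define s where "s = (\<lambda>x. \<Sum>j<N. (R ^^ j) (b (Suc j) * x + c (Suc j) * x ^ q))"
  define S where "S = (\<Sum>j<N. ((\<lambda>p. pcompose R_poly p) ^^ j) (monom (b (Suc j)) 1 + monom (c (Suc j)) q))"
  have "poly (((\<lambda>p. pcompose R_poly p) ^^ j) p) x = (R ^^ j) (poly p x)" for j p x
    by (induction j) (simp_all add: poly_pcompose poly_R_poly)
  then have S: "poly S x = s x" for x
    by (simp add: S_def s_def poly_sum poly_monom)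
  have eq: "b 0 * x + c 0 * x ^ q + R (s x) = 0" for x
    using Suc.prems(1)[of x] unfolding sum.lessThan_Suc_shift by (simp add: s_def R_sum)
  have "pcompose R_poly S = - (monom (b 0) 1 + monom (c 0) q)"
  proof (rule poly_fun_eq_imp_eq)
    fix x
    have "R (s x) = - (b 0 * x + c 0 * x ^ q)"
      using eq[of x] by (simp only: eq_neg_iff_add_eq_0 add_ac)
    then show "poly (pcompose R_poly S) x = poly (- (monom (b 0) 1 + monom (c 0) q)) x"
      by (simp add: poly_pcompose poly_R_poly S poly_monom)
  qed
  moreover have "degree (monom (b 0) 1 + monom (c 0) q) \<le> q"
    using q_gt_1 by (intro degree_add_le) (auto intro: order_trans[OF degree_monom_le])
  ultimately have "q ^ 2 * degree S \<le> q"
    by (metis degree_minus degree_pcompose degree_R_poly)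
  then have "degree S = 0"
    using q_less_q2 by (cases "degree S") auto
  then have const: "s x = s 0" for x
    using S by (metis degree_eq_zeroE poly_const_conv)
  have "s 0 = 0"
    by (simp add: s_def power_0_left)
  then have s0: "s x = 0" for x
    using const[of x] by simp
  have "b 0 = 0 \<and> c 0 = 0"
  proof -
    have "monom (b 0) 1 + monom (c 0) q = (0 :: 'c poly)"
      by (rule poly_fun_eq_imp_eq) (use eq s0 in \<open>simp add: poly_monom\<close>)
    then have "coeff (monom (b 0) 1 + monom (c 0) q) 1 = 0" "coeff (monom (b 0) 1 + monom (c 0) q) q = 0"
      by simp_all
    then show ?thesis
      using q_gt_1 by (auto split: if_splits)
  qed
  moreover have "b (Suc i) = 0 \<and> c (Suc i) = 0" if "i < N" for i
    by (rule Suc.IH[of "\<lambda>j. b (Suc j)" "\<lambda>j. c (Suc j)"]) (use s0 that in \<open>auto simp: s_def\<close>)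
  ultimately show ?case
    using Suc.prems(2) by (cases j) auto
qed simp

text \<open>
  \<open>\<delta>\<close> identifies the cokernel of \<open>1 - \<sigma>\<close> on \<open>C\<^sub>\<infinity>[t] m\<^sub>1 \<oplus> C\<^sub>\<infinity>[t] m\<^sub>2 = C\<^sub>\<infinity>[\<sigma>] m\<^sub>1\<close> with \<open>C\<^sub>\<infinity>\<close>: the
  element \<open>\<Sum> c\<^sub>j \<sigma>\<^sup>j m\<^sub>1\<close> goes to \<open>\<Sum> c\<^sub>j\<close> raised to the power \<open>q\<^sup>j\<close>, and \<open>t\<close> acts as \<open>\<rho>\<^sub>t\<close>.
\<close>

definition delta :: "'c poly \<Rightarrow> 'c poly \<Rightarrow> 'c" where
  "delta p1 p2 = (\<Sum>j\<le>max (degree p1) (degree p2). (R ^^ j) (coeff p1 j + coeff p2 j ^ q))"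

lemma delta_extend:
  assumes "degree p1 \<le> N" "degree p2 \<le> N"
  shows "delta p1 p2 = (\<Sum>j\<le>N. (R ^^ j) (coeff p1 j + coeff p2 j ^ q))"
  unfolding delta_def
  by (rule sum.mono_neutral_left) (use assms in \<open>auto simp: coeff_eq_0 not_le power_0_left\<close>)

lemma delta_add: "delta (p1 + r1) (p2 + r2) = delta p1 p2 + delta r1 r2"
proof -
  let ?N = "max (max (degree p1) (degree r1)) (max (degree p2) (degree r2))"
  have "degree (p1 + r1) \<le> ?N" "degree (p2 + r2) \<le> ?N"
    by (intro degree_add_le; simp)+
  then show ?thesis
    by (simp add: delta_extend[of _ ?N] frob_add1 R_pow_add flip: sum.distrib)
      (simp add: add_ac flip: R_pow_add)
qed

lemma delta_0 [simp]: "delta 0 0 = 0"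
  by (simp add: delta_def)

lemma delta_sum: "delta (sum f A) (sum g A) = (\<Sum>a\<in>A. delta (f a) (g a))"
  by (induction A rule: infinite_finite_induct) (simp_all add: delta_add)

lemma delta_pCons_0: "delta (pCons 0 p1) (pCons 0 p2) = R (delta p1 p2)"
proof -
  let ?N = "max (degree p1) (degree p2)"
  have "degree (pCons 0 p1) \<le> Suc ?N" "degree (pCons 0 p2) \<le> Suc ?N"
    by (auto intro: order_trans[OF degree_pCons_le])
  then have "delta (pCons 0 p1) (pCons 0 p2)
      = (\<Sum>j\<le>Suc ?N. (R ^^ j) (coeff (pCons 0 p1) j + coeff (pCons 0 p2) j ^ q))"
    by (rule delta_extend)
  also have "\<dots> = R (delta p1 p2)"
    unfolding sum.atMost_Suc_shift by (simp add: delta_def R_sum)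
  finally show ?thesis .
qed

abbreviation T_poly :: "'c poly" where "T_poly \<equiv> [:- \<theta>, 1:]"
abbreviation K_poly :: "'c poly" where "K_poly \<equiv> [:phi \<kappa>:]"

text \<open>Let s be a coefficient of \<open>ptw p2\<close>. The t in T contributes R s, and
  subtracting \<theta> s leaves \<kappa> s^q + s^(q^2). The first term cancels against the q-th
  power of the K term; the second is the q-th power of the coefficient of p2.\<close>

lemma delta_sigma: "delta (T_poly * ptw p2) (ptw p1 - K_poly * ptw p2) = delta p1 p2"
proof -
  let ?N = "max (degree p1) (degree p2)"
  let ?s = "ptw p2"
  have "T_poly * ?s = pCons 0 ?s + Polynomial.smult (- \<theta>) ?s"
    by simp
  then have "delta (T_poly * ?s) (ptw p1 - K_poly * ?s)
      = delta (pCons 0 ?s) (pCons 0 0) + delta (Polynomial.smult (- \<theta>) ?s) (ptw p1 - Polynomial.smult (phi \<kappa>) ?s)"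
    by (simp flip: delta_add)
  also have "delta (pCons 0 ?s) (pCons 0 0) = (\<Sum>j\<le>?N. (R ^^ j) (R (coeff ?s j)))"
  proof -
    have "delta (pCons 0 ?s) (pCons 0 0) = R (\<Sum>j\<le>?N. (R ^^ j) (coeff ?s j))"
      unfolding delta_pCons_0 by (subst delta_extend[of _ ?N]) (simp_all add: power_0_left)
    then show ?thesis
      by (simp add: R_sum funpow_swap1)
  qed
  also have "delta (Polynomial.smult (- \<theta>) ?s) (ptw p1 - Polynomial.smult (phi \<kappa>) ?s)
      = (\<Sum>j\<le>?N. (R ^^ j) (- \<theta> * coeff ?s j + (phi (coeff p1 j) - phi \<kappa> * coeff ?s j) ^ q))"
    by (subst delta_extend[of _ ?N])
      (auto intro!: degree_diff_le order_trans[OF degree_smult_le])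
  also have "(\<Sum>j\<le>?N. (R ^^ j) (R (coeff ?s j))) + \<dots> = delta p1 p2"
    unfolding delta_def sum.distrib[symmetric] R_pow_add[symmetric]
  proof (intro sum.cong refl arg_cong[where f = "R ^^ _"])
    fix j
    have "coeff ?s j ^ (q ^ 2) = coeff p2 j ^ q"
      by (simp add: power2_eq_square power_mult)
    then show "R (coeff ?s j) + (- \<theta> * coeff ?s j + (phi (coeff p1 j) - phi \<kappa> * coeff ?s j) ^ q)
        = coeff p1 j + coeff p2 j ^ q"
      by (simp add: R_eq frob_diff1 power_mult_distrib)
  qed
  finally show ?thesis .
qed

lemma ptw_smult_power: "ptw (Polynomial.smult (x ^ q) p) = Polynomial.smult x (ptw p)"
  by (simp add: phi.map_poly_hom_smult)

text \<open>The equations say that \<open>m\<^sub>1 \<mapsto> b m\<^sub>1 + c m\<^sub>2\<close> extends to an endomorphism, where \<open>(d, e)\<close> is the image of \<open>m\<^sub>2\<close>.\<close>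

lemma End_of_poly_endomorphism:
  assumes d: "d = T_poly * ptw c" and e: "e = ptw b - K_poly * ptw c"
    and rel1: "T_poly * ptw e = T_poly * b - K_poly * d"
    and rel2: "ptw d - K_poly * ptw e = T_poly * c - K_poly * e"
  obtains g where "g \<in> drinfeld_End \<iota> \<kappa>" "\<And>x. teval g x = delta (Polynomial.smult x b) (Polynomial.smult x c)"
    "coeff g 0 = 0 \<Longrightarrow> b = 0 \<and> c = 0"
proof -
  let ?sm = "Polynomial.smult"
  let ?N = "max (degree b) (degree c)"
  \<comment> \<open>Read off from \<open>delta\<close> at (x b, x c): the j-th coefficients enter as
    b_j x and (c_j x)^q.\<close>
  define g where "g = (\<Sum>j\<le>?N. twisted_mult \<iota> (rho_pow j) [:coeff b j, coeff c j ^ q:])"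
  have lin: "teval [:u, v:] x = u * x + v * x ^ q" for u v x
    by (cases "v = 0") (simp_all add: tev_def)
  have tevals: "teval (sum f A) x = (\<Sum>a\<in>A. teval (f a) x)" for f x and A :: "nat set"
    by (rule tev_sum[OF comm_ring_hom_id refl])
  have g1: "teval g x = (\<Sum>j\<le>?N. (R ^^ j) (coeff b j * x + coeff c j ^ q * x ^ q))" for x
    by (simp add: g_def tevals teval_mult teval_rho_pow lin)
  have "delta (?sm x b) (?sm x c) = (\<Sum>j\<le>?N. (R ^^ j) (coeff b j * x + coeff c j ^ q * x ^ q))" for x
    by (subst delta_extend[of _ ?N])
      (auto intro!: order_trans[OF degree_smult_le] simp: power_mult_distrib mult_ac)
  then have g: "teval g x = delta (?sm x b) (?sm x c)" for x
    using g1 by simp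
  \<comment> \<open>One has x \<sigma>(p) = \<sigma>(x^q p), and \<open>delta\<close> is invariant
    under \<sigma>.\<close>
  have scale: "delta (?sm x (T_poly * ptw p2)) (?sm x (ptw p1 - K_poly * ptw p2))
      = delta (?sm (x ^ q) p1) (?sm (x ^ q) p2)" for x p1 p2
    using delta_sigma[of "?sm (x ^ q) p2" "?sm (x ^ q) p1"]
    by (simp add: ptw_smult_power smult_diff_right mult.commute)
  have "g \<in> drinfeld_End \<iota> \<kappa>"
    unfolding drinfeld_End_iff
  proof
    fix x
    \<comment> \<open>x times the identity t = \<theta> + \<open>phi \<kappa>\<close> \<sigma> +
      \<sigma>^2 on the image of m_1. Under \<open>delta\<close> and \<open>scale\<close> the
      scalars become \<theta> x, \<kappa> x^q and x^(q^2), whose sum is R x.\<close>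
    have b: "pCons 0 (?sm x b) = ?sm (\<theta> * x) b + (?sm (phi \<kappa> * x) d + ?sm x (T_poly * ptw e))"
      unfolding rel1 by (simp add: smult_diff_right smult_add_right mult.commute)
    have c: "pCons 0 (?sm x c) = ?sm (\<theta> * x) c + (?sm (phi \<kappa> * x) e + ?sm x (ptw d - K_poly * ptw e))"
      unfolding rel2 by (simp add: smult_diff_right smult_add_right mult.commute)
    have "R (teval g x) = delta (pCons 0 (?sm x b)) (pCons 0 (?sm x c))"
      by (simp add: g delta_pCons_0)
    also have "\<dots> = delta (?sm (\<theta> * x) b) (?sm (\<theta> * x) c)
        + (delta (?sm (phi \<kappa> * x) d) (?sm (phi \<kappa> * x) e)
        + delta (?sm x (T_poly * ptw e)) (?sm x (ptw d - K_poly * ptw e)))"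
      unfolding b c delta_add ..
    also have "delta (?sm (phi \<kappa> * x) d) (?sm (phi \<kappa> * x) e) = delta (?sm (\<kappa> * x ^ q) b) (?sm (\<kappa> * x ^ q) c)"
      unfolding d e scale by (simp add: power_mult_distrib)
    also have "delta (?sm x (T_poly * ptw e)) (?sm x (ptw d - K_poly * ptw e))
        = delta (?sm (x ^ (q ^ 2)) b) (?sm (x ^ (q ^ 2)) c)"
      unfolding scale unfolding d e scale by (simp add: power2_eq_square flip: power_mult)
    finally show "teval g (R x) = R (teval g x)"
      unfolding g by (simp add: R_eq smult_add_left delta_add add.assoc)
  qed
  moreover have "b = 0 \<and> c = 0" if "coeff g 0 = 0"
  proof -
    have "g = 0"
      using End_coeff_0_eq_0_imp calculation that by blast
    then have "(\<Sum>j<Suc ?N. (R ^^ j) (coeff b j * x + coeff c j ^ q * x ^ q)) = 0" for x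
      using g1[of x] by (simp add: teval_0 lessThan_Suc_atMost)
    then have "coeff b j = 0 \<and> coeff c j ^ q = 0" if "j < Suc ?N" for j
      using that by (rule R_expansion_unique)
    then have "lead_coeff b = 0 \<and> lead_coeff c = 0"
      by simp
    then show ?thesis
      by simp
  qed
  ultimately show ?thesis
    using that g by blast
qed

section \<open>Denominators fixed by the twist, and the torsion relation\<close>

lemma range_emb_untwist: "twist \<iota> x \<in> range emb \<Longrightarrow> x \<in> range emb"
proof -
  assume "twist \<iota> x \<in> range emb"
  then obtain p where "twist \<iota> x = emb p"
    by blast
  also have "emb p = twist \<iota> (emb (map_poly (\<lambda>x. x ^ q) p))"
    by (rule fls_eqI) (auto simp: fls_nth_emb coeff_map_poly)
  finally show ?thesis
    using inj_twist by blast
qed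

lemma range_emb_twist: "x \<in> range emb \<Longrightarrow> twist \<iota> x \<in> range emb"
  by auto

lemma T_mem: "T \<in> range emb"
  unfolding emb_linear[symmetric] by simp

lemma K_mem: "K \<in> range emb"
  unfolding emb_const[symmetric] by simp

text \<open>
  \<open>\<sigma>\<close> in coordinates; a pair \<open>y\<close> with \<open>sig_eq y\<close> is the image of \<open>m\<^sub>1\<close> under an endomorphism, by
  \<open>t m\<^sub>1 = (\<theta> + \<kappa>\<^bsup>(-1)\<^esup> \<sigma> + \<sigma>\<^sup>2) m\<^sub>1\<close>.
\<close>

definition sig :: "'c fls \<times> 'c fls \<Rightarrow> 'c fls \<times> 'c fls" where
  "sig y = (T * twist \<iota> (snd y), twist \<iota> (fst y) - K * twist \<iota> (snd y))"

definition sig_eq :: "'c fls \<times> 'c fls \<Rightarrow> bool" where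
  "sig_eq y \<longleftrightarrow> fst (sig (sig y)) = T * fst y - K * fst (sig y) \<and>
     snd (sig (sig y)) = T * snd y - K * snd (sig y)"

text \<open>The recursion \<open>sig_eq\<close> has order two, so \<sigma> y is put into the set Z
  together with y. Then Z is expressed through its twists, and the twists through Z, each time at
  the cost of one factor T. Thus D and \<open>ptw D\<close> divide each other up to T; being monic
  of equal degree, they coincide.\<close>

lemma sig_eq_denominator:
  assumes Y: "finite Y" "\<And>y. y \<in> Y \<Longrightarrow> fst y \<in> fractions (range emb) \<and> snd y \<in> fractions (range emb)"
    and rel: "\<And>y. y \<in> Y \<Longrightarrow> sig_eq y"
  obtains D where "D \<noteq> 0" "ptw D = D"
    "\<And>y. y \<in> Y \<Longrightarrow> emb D * fst y \<in> range emb \<and> emb D * snd y \<in> range emb"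
proof -
  interpret F: closed_subfield "fractions (range emb)"
    by (rule closed_subfield_fractions) (rule closed_subring_range_emb)
  interpret R: closed_subring "range emb"
    by (rule closed_subring_range_emb)
  have tw_frac: "twist \<iota> x \<in> fractions (range emb)" if x: "x \<in> fractions (range emb)" for x
  proof -
    obtain a b where "x = emb a / emb b" "emb b \<noteq> 0"
      using x by (auto simp: fractions_def)
    then show ?thesis
      by (auto simp: twist_divide intro!: fractionsI)
  qed
  have TK: "T \<in> fractions (range emb)" "K \<in> fractions (range emb)"
    using subset_fractions[OF closed_subring_range_emb] T_mem K_mem by blast+
  let ?Z = "(\<Union>y\<in>Y. {fst y, snd y, fst (sig y), snd (sig y)})"
  have "finite ?Z" "?Z \<subseteq> fractions (range emb)"
    using Y TK by (auto simp: sig_def intro!: F.mems tw_frac)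
  then obtain D where D: "lead_coeff D = 1" "\<And>z. z \<in> ?Z \<Longrightarrow> emb D * z \<in> range emb"
    "\<And>E. (\<And>z. z \<in> ?Z \<Longrightarrow> emb E * z \<in> range emb) \<Longrightarrow> D dvd E"
    using minimal_denominator[of ?Z] by blast
  have tD: "emb (ptw D) * twist \<iota> z \<in> range emb" if "z \<in> ?Z" for z
    using range_emb_twist[OF D(2)[OF that]] by (simp add: tw.hom_mult)
  have "emb (T_poly * ptw D) * z \<in> range emb" if z: "z \<in> ?Z" for z
  proof -
    obtain y where y: "y \<in> Y" "z \<in> {fst y, snd y, fst (sig y), snd (sig y)}"
      using z by auto
    obtain b c d e where bc: "y = (b, c)" "sig y = (d, e)"
      by (metis surj_pair)
    have mem: "b \<in> ?Z" "c \<in> ?Z" "d \<in> ?Z" "e \<in> ?Z"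
      using y(1) bc by (auto intro: bexI[of _ y])
    have de: "d = T * twist \<iota> c" "e = twist \<iota> b - K * twist \<iota> c"
      using bc by (auto simp: sig_def)
    have "sig (d, e) = (T * twist \<iota> e, twist \<iota> d - K * twist \<iota> e)"
      by (simp add: sig_def)
    then have R1: "T * twist \<iota> e = T * b - K * d" and R2: "twist \<iota> d - K * twist \<iota> e = T * c - K * e"
      using rel[OF y(1)] unfolding sig_eq_def bc(2) by (simp_all add: bc(1))
    have rel': "T * b = T * twist \<iota> e + K * d" "T * c = twist \<iota> d - K * twist \<iota> e + K * e"
      by (simp_all add: R1 R2)
    let ?D = "emb (ptw D)"
    have m: "?D * twist \<iota> b \<in> range emb" "?D * twist \<iota> c \<in> range emb" "?D * twist \<iota> d \<in> range emb"
      "?D * twist \<iota> e \<in> range emb"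
      using tD[of b] tD[of c] tD[of d] tD[of e] mem by blast+
    have De: "?D * e = ?D * twist \<iota> b - K * (?D * twist \<iota> c)"
      and Dd: "?D * d = T * (?D * twist \<iota> c)"
      unfolding de by (simp_all add: algebra_simps)
    have De': "?D * e \<in> range emb" and Dd': "?D * d \<in> range emb"
      unfolding De Dd by (intro R.mems m T_mem K_mem)+
    have "?D * (T * b) = T * (?D * twist \<iota> e) + K * (?D * d)"
      "?D * (T * c) = ?D * twist \<iota> d - K * (?D * twist \<iota> e) + K * (?D * e)"
      unfolding rel' by (simp_all add: algebra_simps)
    then have Tm: "T * (?D * b) \<in> range emb" "T * (?D * c) \<in> range emb" "T * (?D * d) \<in> range emb"
        "T * (?D * e) \<in> range emb"
      using R.mems m De' Dd' T_mem K_mem by (simp_all add: mult.left_commute)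
    have "z = b \<or> z = c \<or> z = d \<or> z = e"
      using y(2) bc by simp
    then have "T * (?D * z) \<in> range emb"
      by (elim disjE) (simp_all only: Tm)
    moreover have "emb (T_poly * ptw D) * z = T * (?D * z)"
      by (simp only: emb.hom_mult emb_linear mult.assoc)
    ultimately show ?thesis
      by (simp only:)
  qed
  then have 1: "D dvd T_poly * ptw D"
    by (rule D(3))
  \<comment> \<open>The untwisted form of T D. It clears Z because T D clears the twists of Z and
    \<open>twist\<close> reflects membership in the polynomials; twisting \<open>D dvd U\<close>
    then gives the second divisibility.\<close>
  define U where "U = map_poly (\<lambda>x. x ^ q) (T_poly * D)"
  have U: "ptw U = T_poly * D"
    unfolding U_def by (rule poly_eqI) (simp add: coeff_map_poly del: mult_pCons_left)
  have "emb U * z \<in> range emb" if z: "z \<in> ?Z" for z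
  proof -
    obtain y where y: "y \<in> Y" "z \<in> {fst y, snd y, fst (sig y), snd (sig y)}"
      using z by auto
    obtain b c d e where bc: "y = (b, c)" "sig y = (d, e)"
      by (metis surj_pair)
    have mem: "b \<in> ?Z" "c \<in> ?Z" "d \<in> ?Z" "e \<in> ?Z"
      using y(1) bc by (auto intro: bexI[of _ y])
    have de: "d = T * twist \<iota> c" "e = twist \<iota> b - K * twist \<iota> c"
      using bc by (auto simp: sig_def)
    have "sig (d, e) = (T * twist \<iota> e, twist \<iota> d - K * twist \<iota> e)"
      by (simp add: sig_def)
    then have R1: "T * twist \<iota> e = T * b - K * d" and R2: "twist \<iota> d - K * twist \<iota> e = T * c - K * e"
      using rel[OF y(1)] unfolding sig_eq_def bc(2) by (simp_all add: bc(1))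
    have "twist \<iota> d = T * c - K * e + K * twist \<iota> e"
      using R2 by (simp only: diff_eq_eq)
    note rel' = R1 this
    let ?D = "emb D"
    have m: "?D * b \<in> range emb" "?D * c \<in> range emb" "?D * d \<in> range emb" "?D * e \<in> range emb"
      using D(2)[of b] D(2)[of c] D(2)[of d] D(2)[of e] mem by blast+
    have c: "T * ?D * twist \<iota> c = ?D * d"
      unfolding de by simp
    have b: "T * ?D * twist \<iota> b = T * (?D * e) + K * (?D * d)"
      unfolding de by (simp add: algebra_simps)
    have "?D * (T * twist \<iota> e) = T * (?D * b) - K * (?D * d)"
      unfolding rel' by (simp add: algebra_simps)
    then have e: "T * ?D * twist \<iota> e = T * (?D * b) - K * (?D * d)"
      by (simp add: mult_ac)
    have d: "T * ?D * twist \<iota> d = T * (T * (?D * c)) - T * (K * (?D * e)) + K * (T * ?D * twist \<iota> e)"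
      unfolding rel' by (simp add: algebra_simps)
    have e': "T * ?D * twist \<iota> e \<in> range emb"
      unfolding e by (intro R.diff_mem R.mult_mem m T_mem K_mem)
    have "T * ?D * twist \<iota> b \<in> range emb" "T * ?D * twist \<iota> c \<in> range emb" "T * ?D * twist \<iota> d \<in> range emb"
      unfolding b c d by (intro R.diff_mem R.add_mem R.mult_mem m T_mem K_mem e')+
    note Tm = this e'
    have "z = b \<or> z = c \<or> z = d \<or> z = e"
      using y(2) bc by simp
    then have "T * ?D * twist \<iota> z \<in> range emb"
      by (elim disjE) (simp_all only: Tm)
    then have "twist \<iota> (emb U * z) \<in> range emb"
      by (simp only: tw.hom_mult twist_emb U emb.hom_mult emb_linear)
    then show ?thesis
      by (rule range_emb_untwist)
  qed
  then have "D dvd U"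
    by (rule D(3))
  then have 2: "ptw D dvd T_poly * D"
    unfolding U[symmetric] by (rule ptw.hom_dvd)
  have "D = ptw D"
    by (rule monic_eq_of_dvd_linear_mult[OF _ _ _ 1 2]) (use D(1) in auto)
  have "D \<noteq> 0"
    using D(1) by auto
  moreover have "emb D * fst y \<in> range emb \<and> emb D * snd y \<in> range emb" if "y \<in> Y" for y
    using D(2) that by blast
  ultimately show ?thesis
    using that[of D] \<open>D = ptw D\<close>[symmetric] by blast
qed

text \<open>\<open>ptw D\<close> clears \<sigma> r, and r differs from \<sigma> r by polynomials, so
  \<open>ptw D\<close> clears r as well. Minimality makes D divide its twist, which has the same
  degree.\<close>

lemma splitting_denominator:
  assumes r: "r1 \<in> fractions (range emb)" "r2 \<in> fractions (range emb)"
    and w: "w1 \<in> range emb" "w2 \<in> range emb"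
    and eq: "r1 = T * twist \<iota> r2 + w1" "r2 = twist \<iota> r1 - K * twist \<iota> r2 + w2"
  obtains D where "D \<noteq> 0" "ptw D = D" "emb D * r1 \<in> range emb" "emb D * r2 \<in> range emb"
proof -
  interpret R: closed_subring "range emb"
    by (rule closed_subring_range_emb)
  obtain D where D: "lead_coeff D = 1" "\<And>z. z \<in> {r1, r2} \<Longrightarrow> emb D * z \<in> range emb"
    "\<And>E. (\<And>z. z \<in> {r1, r2} \<Longrightarrow> emb E * z \<in> range emb) \<Longrightarrow> D dvd E"
    using minimal_denominator[of "{r1, r2}"] r by blast
  let ?D = "emb (ptw D)"
  have m: "?D * twist \<iota> r1 \<in> range emb" "?D * twist \<iota> r2 \<in> range emb"
    using D(2)[of r1, THEN range_emb_twist] D(2)[of r2, THEN range_emb_twist] by (simp_all add: tw.hom_mult)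
  have "?D * (T * twist \<iota> r2 + w1) = T * (?D * twist \<iota> r2) + ?D * w1"
    "?D * (twist \<iota> r1 - K * twist \<iota> r2 + w2) = ?D * twist \<iota> r1 - K * (?D * twist \<iota> r2) + ?D * w2"
    by (simp_all add: algebra_simps)
  moreover have "T * (?D * twist \<iota> r2) + ?D * w1 \<in> range emb"
    "?D * twist \<iota> r1 - K * (?D * twist \<iota> r2) + ?D * w2 \<in> range emb"
    by (intro R.add_mem R.diff_mem R.mult_mem m T_mem K_mem w rangeI)+
  ultimately have "?D * r1 \<in> range emb" "?D * r2 \<in> range emb"
    using eq by metis+
  then have "D dvd ptw D"
    by (intro D(3)) auto
  then have "D = ptw D"
    by (intro monic_degree_eq_dvd) (use D(1) in auto)
  moreover have "D \<noteq> 0"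
    using D(1) by auto
  ultimately show ?thesis
    using that[of D] D(2) by auto
qed

text \<open>Once D1 clears the y_i, the row D1 r solves an equation of the same form with polynomial
  inhomogeneity, and this yields D2. Since D = D2 D1 is fixed by the twist, multiplication by D
  preserves all relations, and \<open>delta\<close> can be applied.\<close>

proposition torsion_relation_of_splitting:
  fixes y :: "nat \<Rightarrow> 'c fls \<times> 'c fls"
  assumes I: "finite I"
    and y: "\<And>i. i \<in> I \<Longrightarrow> fst (y i) \<in> fractions (range emb) \<and> snd (y i) \<in> fractions (range emb) \<and> sig_eq (y i)"
    and r: "r1 \<in> fractions (range emb)" "r2 \<in> fractions (range emb)"
    and eq1: "r1 = T * twist \<iota> r2 + (\<Sum>i\<in>I. fls_const (\<alpha> i) * fst (y i))"
    and eq2: "r2 = twist \<iota> r1 - K * twist \<iota> r2 + (\<Sum>i\<in>I. fls_const (\<alpha> i) * snd (y i))"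
  obtains g where "\<And>i. i \<in> I \<Longrightarrow> g i \<in> drinfeld_End \<iota> \<kappa>"
    "\<And>i. i \<in> I \<Longrightarrow> coeff (g i) 0 = 0 \<Longrightarrow> y i = (0, 0)"
    "(\<Sum>i\<in>I. teval (g i) (\<alpha> i)) = 0"
proof -
  interpret R: closed_subring "range emb"
    by (rule closed_subring_range_emb)
  interpret F: closed_subfield "fractions (range emb)"
    by (rule closed_subfield_fractions) (rule closed_subring_range_emb)
  obtain D1 where D1: "D1 \<noteq> 0" "ptw D1 = D1"
    "\<And>i. i \<in> I \<Longrightarrow> emb D1 * fst (y i) \<in> range emb \<and> emb D1 * snd (y i) \<in> range emb"
  proof (rule sig_eq_denominator[of "y ` I"])
    show "finite (y ` I)"
      using I by simp
  qed (use y in auto)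
  have emb_frac: "emb p \<in> fractions (range emb)" for p
    using subset_fractions[OF closed_subring_range_emb] by blast
  have const: "fls_const c \<in> range emb" for c
    unfolding emb_const[symmetric] by simp
  obtain D2 where D2: "D2 \<noteq> 0" "ptw D2 = D2" "emb D2 * (emb D1 * r1) \<in> range emb" "emb D2 * (emb D1 * r2) \<in> range emb"
  proof (rule splitting_denominator)
    show "emb D1 * r1 \<in> fractions (range emb)" "emb D1 * r2 \<in> fractions (range emb)"
      using r by (auto intro!: F.mult_mem emb_frac)
    show "(\<Sum>i\<in>I. fls_const (\<alpha> i) * (emb D1 * fst (y i))) \<in> range emb"
      "(\<Sum>i\<in>I. fls_const (\<alpha> i) * (emb D1 * snd (y i))) \<in> range emb"
      by (rule R.sum_mem, rule R.mult_mem[OF const], use D1(3) in blast)+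
    have "emb D1 * r1 = emb D1 * (T * twist \<iota> r2 + (\<Sum>i\<in>I. fls_const (\<alpha> i) * fst (y i)))"
      using eq1 by simp
    then show "emb D1 * r1 = T * twist \<iota> (emb D1 * r2) + (\<Sum>i\<in>I. fls_const (\<alpha> i) * (emb D1 * fst (y i)))"
      by (simp add: tw.hom_mult D1(2) algebra_simps sum_distrib_left)
    have "emb D1 * r2 = emb D1 * (twist \<iota> r1 - K * twist \<iota> r2 + (\<Sum>i\<in>I. fls_const (\<alpha> i) * snd (y i)))"
      using eq2 by simp
    then show "emb D1 * r2 = twist \<iota> (emb D1 * r1) - K * twist \<iota> (emb D1 * r2)
        + (\<Sum>i\<in>I. fls_const (\<alpha> i) * (emb D1 * snd (y i)))"
      by (simp add: tw.hom_mult D1(2) algebra_simps sum_distrib_left)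
  qed
  define D where "D = D2 * D1"
  have D: "D \<noteq> 0" "ptw D = D" and embD: "emb D = emb D2 * emb D1"
    using D1 D2 by (auto simp: D_def ptw.hom_mult emb.hom_mult)
  have tD: "twist \<iota> (emb D) = emb D"
    by (simp add: D(2))
  obtain s1 s2 where s: "emb s1 = emb D * r1" "emb s2 = emb D * r2"
    using D2(3,4) unfolding embD mult.assoc by (metis imageE)
  have "\<exists>b c. emb b = emb D * fst (y i) \<and> emb c = emb D * snd (y i)" if i: "i \<in> I" for i
  proof -
    have "emb D2 * (emb D1 * fst (y i)) \<in> range emb" "emb D2 * (emb D1 * snd (y i)) \<in> range emb"
      using D1(3)[OF i] R.mult_mem[OF rangeI] by blast+
    then show ?thesis
      unfolding embD mult.assoc by (metis imageE)
  qed
  then have "\<exists>b c. \<forall>i\<in>I. emb (b i) = emb D * fst (y i) \<and> emb (c i) = emb D * snd (y i)"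
    by metis
  then obtain b c where bc: "\<And>i. i \<in> I \<Longrightarrow> emb (b i) = emb D * fst (y i)"
    "\<And>i. i \<in> I \<Longrightarrow> emb (c i) = emb D * snd (y i)"
    by blast
  have "\<exists>g. g \<in> drinfeld_End \<iota> \<kappa> \<and>
      (\<forall>x. teval g x = delta (Polynomial.smult x (b i)) (Polynomial.smult x (c i))) \<and>
      (coeff g 0 = 0 \<longrightarrow> b i = 0 \<and> c i = 0)" if i: "i \<in> I" for i
  proof -
    define d where "d = T_poly * ptw (c i)"
    define e where "e = ptw (b i) - K_poly * ptw (c i)"
    have embd: "emb d = emb D * fst (sig (y i))"
      unfolding d_def emb.hom_mult emb_linear twist_emb[symmetric] bc[OF i] tw.hom_mult tD
      by (simp add: sig_def)
    have embe: "emb e = emb D * snd (sig (y i))"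
      unfolding e_def emb.hom_mult emb.hom_minus emb_const twist_emb[symmetric] bc[OF i] tw.hom_mult tD
      by (simp add: sig_def algebra_simps)
    have "emb (T_poly * ptw e) = emb D * fst (sig (sig (y i)))"
      unfolding emb.hom_mult emb_linear twist_emb[symmetric] embe tw.hom_mult tD
      by (simp add: sig_def[of "sig _"])
    also have "\<dots> = emb D * (T * fst (y i) - K * fst (sig (y i)))"
      using y[OF i] unfolding sig_eq_def by simp
    also have "\<dots> = emb (T_poly * b i - K_poly * d)"
      unfolding emb.hom_mult emb.hom_minus emb_const emb_linear bc[OF i] embd by (simp add: algebra_simps)
    finally have rel1: "T_poly * ptw e = T_poly * b i - K_poly * d"
      by (rule emb.injectivity)
    have "emb (ptw d - K_poly * ptw e) = emb D * snd (sig (sig (y i)))"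
      unfolding emb.hom_mult emb.hom_minus emb_const twist_emb[symmetric] embe embd tw.hom_mult tD
      by (simp add: sig_def[of "sig _"] algebra_simps)
    also have "\<dots> = emb D * (T * snd (y i) - K * snd (sig (y i)))"
      using y[OF i] unfolding sig_eq_def by simp
    also have "\<dots> = emb (T_poly * c i - K_poly * e)"
      unfolding emb.hom_mult emb.hom_minus emb_const emb_linear bc[OF i] embe by (simp add: algebra_simps)
    finally have rel2: "ptw d - K_poly * ptw e = T_poly * c i - K_poly * e"
      by (rule emb.injectivity)
    show ?thesis
    proof (rule End_of_poly_endomorphism[OF d_def e_def rel1 rel2])
      fix g assume g: "g \<in> drinfeld_End \<iota> \<kappa>"
        "\<And>x. teval g x = delta (Polynomial.smult x (b i)) (Polynomial.smult x (c i))"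
        "coeff g 0 = 0 \<Longrightarrow> b i = 0 \<and> c i = 0"
      show ?thesis
      proof (intro exI[of _ g] conjI allI)
        show "coeff g 0 = 0 \<longrightarrow> b i = 0 \<and> c i = 0"
          using g(3) by (rule impI)
      qed (fact g)+
    qed
  qed
  then have "\<exists>g. \<forall>i\<in>I. g i \<in> drinfeld_End \<iota> \<kappa> \<and>
      (\<forall>x. teval (g i) x = delta (Polynomial.smult x (b i)) (Polynomial.smult x (c i))) \<and>
      (coeff (g i) 0 = 0 \<longrightarrow> b i = 0 \<and> c i = 0)"
    by (intro bchoice ballI)
  then obtain g where g': "\<forall>i\<in>I. g i \<in> drinfeld_End \<iota> \<kappa> \<and>
      (\<forall>x. teval (g i) x = delta (Polynomial.smult x (b i)) (Polynomial.smult x (c i))) \<and>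
      (coeff (g i) 0 = 0 \<longrightarrow> b i = 0 \<and> c i = 0)"
    by (rule exE)
  have g: "g i \<in> drinfeld_End \<iota> \<kappa>"
    "teval (g i) x = delta (Polynomial.smult x (b i)) (Polynomial.smult x (c i))"
    "coeff (g i) 0 = 0 \<Longrightarrow> b i = 0 \<and> c i = 0" if "i \<in> I" for i x
    using bspec[OF g' that] by simp_all
  have emb_smult: "emb (Polynomial.smult x p) = fls_const x * emb p" for x p
    using emb.hom_mult[of "[:x:]" p] by (simp add: emb_const)
  have "emb s1 = emb (T_poly * ptw s2 + (\<Sum>i\<in>I. Polynomial.smult (\<alpha> i) (b i)))"
  proof -
    have "emb s1 = emb D * (T * twist \<iota> r2 + (\<Sum>i\<in>I. fls_const (\<alpha> i) * fst (y i)))"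
      unfolding s using eq1 by simp
    also have "\<dots> = T * (emb D * twist \<iota> r2) + (\<Sum>i\<in>I. fls_const (\<alpha> i) * emb (b i))"
      by (simp add: algebra_simps sum_distrib_left bc cong: sum.cong)
    also have "\<dots> = emb (T_poly * ptw s2 + (\<Sum>i\<in>I. Polynomial.smult (\<alpha> i) (b i)))"
      unfolding emb.hom_add emb.hom_sum emb_smult emb.hom_mult emb_linear twist_emb[symmetric] s tw.hom_mult tD ..
    finally show ?thesis .
  qed
  then have s1: "s1 = T_poly * ptw s2 + (\<Sum>i\<in>I. Polynomial.smult (\<alpha> i) (b i))"
    by (rule emb.injectivity)
  have "emb s2 = emb ((ptw s1 - K_poly * ptw s2) + (\<Sum>i\<in>I. Polynomial.smult (\<alpha> i) (c i)))"
  proof -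
    have "emb s2 = emb D * (twist \<iota> r1 - K * twist \<iota> r2 + (\<Sum>i\<in>I. fls_const (\<alpha> i) * snd (y i)))"
      unfolding s using eq2 by simp
    also have "\<dots> = emb D * twist \<iota> r1 - K * (emb D * twist \<iota> r2) + (\<Sum>i\<in>I. fls_const (\<alpha> i) * emb (c i))"
      by (simp add: algebra_simps sum_distrib_left bc cong: sum.cong)
    also have "\<dots> = emb ((ptw s1 - K_poly * ptw s2) + (\<Sum>i\<in>I. Polynomial.smult (\<alpha> i) (c i)))"
      unfolding emb.hom_add emb.hom_minus emb.hom_sum emb_smult emb.hom_mult emb_const twist_emb[symmetric] s tw.hom_mult tD ..
    finally show ?thesis .
  qed
  then have s2: "s2 = (ptw s1 - K_poly * ptw s2) + (\<Sum>i\<in>I. Polynomial.smult (\<alpha> i) (c i))"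
    by (rule emb.injectivity)
  \<comment> \<open>By \<open>delta_sigma\<close> the first summand equals the left-hand side, so
    the inhomogeneous part has value 0; that value is the sum of the g_i(\<alpha>_i).\<close>
  have "delta s1 s2 = delta (T_poly * ptw s2) (ptw s1 - K_poly * ptw s2)
      + delta (\<Sum>i\<in>I. Polynomial.smult (\<alpha> i) (b i)) (\<Sum>i\<in>I. Polynomial.smult (\<alpha> i) (c i))"
    unfolding delta_add[symmetric] s1[symmetric] s2[symmetric] ..
  then have "(\<Sum>i\<in>I. teval (g i) (\<alpha> i)) = 0"
    unfolding delta_sigma delta_sum using g(2) by simp
  moreover have "y i = (0, 0)" if "i \<in> I" "coeff (g i) 0 = 0" for i
    using g(3)[OF that] bc[OF that(1)] D(1) by (simp add: prod_eq_iff)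
  ultimately show ?thesis
    using that g(1) by blast
qed

text \<open>Take an endomorphism with constant term outside F_q[\<theta>]. It multiplies \<omega>_1
  to a period a \<omega>_1 + b \<omega>_2 with b nonzero, which exhibits \<omega>_2 as a multiple of
  \<omega>_1 over the CM field.\<close>

lemma period_lattice_subset_line:
  assumes CM: "has_CM \<iota> \<kappa>"
    and lattice: "period_lattice \<iota> \<kappa> = {a * \<omega>\<^sub>1 + b * \<omega>\<^sub>2 |a b. a \<in> A_ring \<iota> \<and> b \<in> A_ring \<iota>}"
    and nonzero: "\<omega>\<^sub>1 \<noteq> 0"
    and w: "w \<in> period_lattice \<iota> \<kappa>"
  shows "\<exists>c\<in>CM_field \<iota> \<kappa>. w = c * \<omega>\<^sub>1"
proof -
  interpret A: closed_subring "A_ring \<iota>"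
    by (rule closed_subring_A_ring)
  interpret O: closed_subring "CM_order \<iota> \<kappa>"
    by (rule closed_subring_CM_order)
  have CMf: "CM_field \<iota> \<kappa> = fractions (CM_order \<iota> \<kappa>)"
    by (simp add: CM_field_def fractions_def)
  interpret C: closed_subfield "CM_field \<iota> \<kappa>"
    unfolding CMf by (rule closed_subfield_fractions) (rule closed_subring_CM_order)
  have sub: "A_ring \<iota> \<subseteq> CM_field \<iota> \<kappa>" "CM_order \<iota> \<kappa> \<subseteq> CM_field \<iota> \<kappa>"
    using CM subset_fractions[OF closed_subring_CM_order] by (auto simp: has_CM_def CMf)
  obtain f where f: "f \<in> drinfeld_End \<iota> \<kappa>" "coeff f 0 \<notin> A_ring \<iota>"
    using CM unfolding has_CM_def CM_order_def by blast
  have f0: "coeff f 0 \<in> CM_field \<iota> \<kappa>"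
    using f(1) sub(2) unfolding CM_order_def by blast
  have "\<omega>\<^sub>1 = 1 * \<omega>\<^sub>1 + 0 * \<omega>\<^sub>2"
    by simp
  then have "\<omega>\<^sub>1 \<in> period_lattice \<iota> \<kappa>"
    unfolding lattice using A.one_mem A.zero_mem by blast
  then have "exp_rho \<iota> \<kappa> (coeff f 0 * \<omega>\<^sub>1) = 0"
    using exp_rho_End[OF f(1), of \<omega>\<^sub>1] by (simp add: period_lattice_def)
  then have "coeff f 0 * \<omega>\<^sub>1 \<in> period_lattice \<iota> \<kappa>"
    by (simp add: period_lattice_def)
  then obtain a b where ab: "coeff f 0 * \<omega>\<^sub>1 = a * \<omega>\<^sub>1 + b * \<omega>\<^sub>2" "a \<in> A_ring \<iota>" "b \<in> A_ring \<iota>"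
    unfolding lattice by blast
  \<comment> \<open>Otherwise the constant term of f would be a, an element of
    F_q[\<theta>].\<close>
  have "b \<noteq> 0"
    using ab f(2) nonzero by auto
  then have w2: "\<omega>\<^sub>2 = (coeff f 0 - a) / b * \<omega>\<^sub>1"
    using ab(1) by (simp add: field_simps)
  obtain a' b' where "w = a' * \<omega>\<^sub>1 + b' * \<omega>\<^sub>2" "a' \<in> A_ring \<iota>" "b' \<in> A_ring \<iota>"
    using w unfolding lattice by blast
  then have "w = (a' + b' * ((coeff f 0 - a) / b)) * \<omega>\<^sub>1"
    "a' + b' * ((coeff f 0 - a) / b) \<in> CM_field \<iota> \<kappa>"
    using sub(1) ab(2,3) f0 by (auto simp: w2 algebra_simps intro!: C.add_mem C.mult_mem C.divide_mem C.diff_mem)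
  then show ?thesis
    by blast
qed

proposition splitting_imp_zero:
  fixes y :: "nat \<Rightarrow> 'c fls \<times> 'c fls"
  assumes CM: "has_CM \<iota> \<kappa>"
    and lattice: "period_lattice \<iota> \<kappa> = {a * \<omega>\<^sub>1 + b * \<omega>\<^sub>2 |a b. a \<in> A_ring \<iota> \<and> b \<in> A_ring \<iota>}"
    and indep: "\<And>c d. \<lbrakk>c \<in> CM_field \<iota> \<kappa>; d \<in> {1..n} \<rightarrow> CM_field \<iota> \<kappa>;
              c * \<omega>\<^sub>1 + (\<Sum>i=1..n. d i * u i) = 0\<rbrakk> \<Longrightarrow> c = 0 \<and> (\<forall>i\<in>{1..n}. d i = 0)"
    and y: "\<And>i. i \<in> {1..n} \<Longrightarrow> fst (y i) \<in> kbar_rats \<iota> \<and> snd (y i) \<in> kbar_rats \<iota> \<and> sig_eq (y i)"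
    and r: "r1 \<in> kbar_rats \<iota>" "r2 \<in> kbar_rats \<iota>"
    and eq1: "r1 = T * twist \<iota> r2 + (\<Sum>i=1..n. fls_const (exp_rho \<iota> \<kappa> (u i)) * fst (y i))"
    and eq2: "r2 = twist \<iota> r1 - K * twist \<iota> r2 + (\<Sum>i=1..n. fls_const (exp_rho \<iota> \<kappa> (u i)) * snd (y i))"
    and i: "i \<in> {1..n}"
  shows "y i = (0, 0)"
proof -
  have CMf: "CM_field \<iota> \<kappa> = fractions (CM_order \<iota> \<kappa>)"
    by (simp add: CM_field_def fractions_def)
  interpret C: closed_subfield "CM_field \<iota> \<kappa>"
    unfolding CMf by (rule closed_subfield_fractions) (rule closed_subring_CM_order)
  obtain g where g: "\<And>i. i \<in> {1..n} \<Longrightarrow> g i \<in> drinfeld_End \<iota> \<kappa>"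
    "\<And>i. i \<in> {1..n} \<Longrightarrow> coeff (g i) 0 = 0 \<Longrightarrow> y i = (0, 0)"
    "(\<Sum>i=1..n. teval (g i) (exp_rho \<iota> \<kappa> (u i))) = 0"
  proof (rule torsion_relation_of_splitting[OF _ _ _ _ eq1 eq2])
    show "fst (y i) \<in> fractions (range emb) \<and> snd (y i) \<in> fractions (range emb) \<and> sig_eq (y i)"
      if "i \<in> {1..n}" for i
      using y[OF that] kbar_rats_subset_fractions by blast
    show "r1 \<in> fractions (range emb)" "r2 \<in> fractions (range emb)"
      using r kbar_rats_subset_fractions by blast+
  qed auto
  have "\<omega>\<^sub>1 \<noteq> 0"
  proof
    assume "\<omega>\<^sub>1 = 0"
    then have "1 * \<omega>\<^sub>1 + (\<Sum>i=1..n. (\<lambda>_. 0) i * u i) = 0"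
      by simp
    then have "(1::'c) = 0"
      using indep[of 1 "\<lambda>_. 0"] C.one_mem C.zero_mem by blast
    then show False
      by simp
  qed
  let ?w = "\<Sum>i=1..n. coeff (g i) 0 * u i"
  have "exp_rho \<iota> \<kappa> ?w = (\<Sum>i=1..n. teval (g i) (exp_rho \<iota> \<kappa> (u i)))"
    unfolding exp_rho_sum using g(1) by (intro sum.cong refl exp_rho_End) auto
  then have "?w \<in> period_lattice \<iota> \<kappa>"
    using g(3) by (simp add: period_lattice_def)
  then obtain c where c: "c \<in> CM_field \<iota> \<kappa>" "?w = c * \<omega>\<^sub>1"
    using period_lattice_subset_line[OF CM lattice \<open>\<omega>\<^sub>1 \<noteq> 0\<close>] by blast
  have mem: "(\<lambda>i. coeff (g i) 0) \<in> {1..n} \<rightarrow> CM_field \<iota> \<kappa>"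
    using g(1) subset_fractions[OF closed_subring_CM_order] unfolding CMf CM_order_def by blast
  have "- c * \<omega>\<^sub>1 + ?w = 0"
    using c(2) by simp
  then have "coeff (g i) 0 = 0"
    using indep[OF C.uminus_mem[OF c(1)] mem] i by blast
  then show ?thesis
    by (rule g(2)[OF i])
qed

end

section \<open>Rigid analytic trivialisations\<close>

context drinfeld
begin

lemma kappa_mem_L: "\<kappa> \<in> L"
  using kappa_mem kbar_subset_L by blast

sublocale CL: closed_subring "coeffs_in L"
  by (rule closed_subring_coeffs_in) unfold_locales

lemma monom_mem_coeffs_in_L: "c \<in> L \<Longrightarrow> monom c n \<in> coeffs_in L"
  using L.zero_mem by (simp add: coeffs_in_def)

lemma const_mem_coeffs_in_L: "c \<in> L \<Longrightarrow> [:c:] \<in> coeffs_in L"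
  using L.zero_mem by (simp add: coeffs_in_def coeff_pCons split: nat.split)

lemmas coeffs_in_L_mems = CL.add_mem CL.diff_mem monom_mem_coeffs_in_L const_mem_coeffs_in_L
  L.mems theta_mem_L kappa_mem_L

section \<open>Small solutions of the coefficient equations\<close>

lemma nm_power_le_imp_le:
  assumes "nm x ^ n * a ^ n \<le> nm y ^ n" "n > 0" "a \<ge> 0"
  shows "nm x * a \<le> nm y"
  using assms by (simp flip: power_mult_distrib add: power_mono_iff)

lemma phi_phi_power: "phi (phi (x ^ (q ^ 2))) = x"
  by (simp add: power2_eq_square power_mult)

lemma phi_phi_power': "phi (phi (x ^ q)) = phi x"
  by simp

text \<open>The q^2-th power of the equation is \<theta>^(q^2) x^(q^2) + \<kappa>^q x^q + x =
  y^(q^2). The large leading coefficient makes a smallest root smaller than y by the factor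
  |\<theta>|, and this gain forces the coefficients of the solution series to tend to 0.\<close>

lemma rho_adjoint_small_solution:
  assumes y: "y \<in> L"
  obtains x where "x \<in> L" "phi (phi x) + phi \<kappa> * phi x + \<theta> * x = y" "nm x * nm \<theta> \<le> nm y"
proof -
  let ?p = "monom (\<theta> ^ (q ^ 2)) (q ^ 2) + (monom (\<kappa> ^ q) q + monom 1 1 - [:y ^ (q ^ 2):])"
  have deg: "degree (monom (\<kappa> ^ q) q + monom 1 1 - [:y ^ (q ^ 2):]) \<le> q"
    using q_gt_1 by (intro degree_diff_le degree_add_le) (auto intro: order_trans[OF degree_monom_le])
  have degp: "degree ?p = q ^ 2"
    using deg q_less_q2 by (subst degree_add_eq_left) (auto simp: degree_monom_eq)
  have lead: "lead_coeff ?p = \<theta> ^ (q ^ 2)"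
    unfolding degp using deg q_less_q2 coeff_eq_0[of "monom (\<kappa> ^ q) q + monom 1 1 - [:y ^ (q ^ 2):]" "q ^ 2"]
    by simp
  have "?p \<in> coeffs_in L"
    by (intro coeffs_in_L_mems y)
  then obtain x where x: "x \<in> L" "poly ?p x = 0" "nm x ^ degree ?p * nm (lead_coeff ?p) \<le> nm (coeff ?p 0)"
    using L_small_root[of ?p] degp by auto
  have c0: "coeff ?p 0 = - (y ^ (q ^ 2))"
    by simp
  have "nm x ^ (q ^ 2) * nm \<theta> ^ (q ^ 2) \<le> nm y ^ (q ^ 2)"
    using x(3) unfolding lead unfolding degp c0 by simp
  then have "nm x * nm \<theta> \<le> nm y"
    by (rule nm_power_le_imp_le) auto
  moreover have "\<theta> ^ (q ^ 2) * x ^ (q ^ 2) + \<kappa> ^ q * x ^ q + x = y ^ (q ^ 2)"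
    using x(2) by (simp add: poly_monom algebra_simps)
  then have "(\<theta> * x) ^ (q ^ 2) + (\<kappa> * x) ^ q + x = y ^ (q ^ 2)"
    by (simp only: power_mult_distrib)
  then have "phi (phi ((\<theta> * x) ^ (q ^ 2) + (\<kappa> * x) ^ q + x)) = phi (phi (y ^ (q ^ 2)))"
    by (rule arg_cong)
  then have "phi (phi x) + phi \<kappa> * phi x + \<theta> * x = y"
    by (simp only: phi.hom_add phi_phi_power phi_phi_power') (simp add: phi.hom_mult add_ac)
  ultimately show ?thesis
    using that x(1) by blast
qed

text \<open>The q-th power of the equation is x^q - x + y^q = 0. A bound by |y| without any gain
  suffices, as the equation is solved for each coefficient of a given null sequence
  separately.\<close>

lemma artin_schreier_small_solution:
  assumes y: "y \<in> L"
  obtains x where "x \<in> L" "phi x = y + x" "nm x \<le> nm y"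
proof -
  let ?p = "monom 1 q + ([:y ^ q:] - monom 1 1)"
  have deg: "degree ([:y ^ q:] - monom 1 1) \<le> 1"
    by (intro degree_diff_le) (auto intro: order_trans[OF degree_monom_le])
  have degp: "degree ?p = q"
    using deg q_gt_1 by (subst degree_add_eq_left) (auto simp: degree_monom_eq)
  have lead: "lead_coeff ?p = 1"
    unfolding degp using deg q_gt_1 coeff_eq_0[of "[:y ^ q:] - monom 1 1" q] by simp
  have "?p \<in> coeffs_in L"
    by (intro coeffs_in_L_mems y)
  then obtain x where x: "x \<in> L" "poly ?p x = 0" "nm x ^ degree ?p * nm (lead_coeff ?p) \<le> nm (coeff ?p 0)"
    using L_small_root[of ?p] degp by auto
  have c0: "coeff ?p 0 = y ^ q"
    by simp
  have "nm x ^ q * 1 ^ q \<le> nm y ^ q"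
    using x(3) unfolding lead unfolding degp c0 by simp
  then have "nm x \<le> nm y"
    using nm_power_le_imp_le[of x q 1 y] by simp
  moreover have "x ^ q + (y ^ q - x) = 0"
    using x(2) by (simp only: poly_add poly_diff poly_monom poly_pCons) simp
  then have "x = (y + x) ^ q"
    by (simp add: frob_add1 algebra_simps)
  then have "phi x = y + x"
    by (rule phi_eqI)
  ultimately show ?thesis
    using that x(1) by blast
qed

lemma carlitz_small_solution:
  assumes y: "y \<in> L"
  obtains x where "x \<in> L" "phi x + \<theta> * x = y" "nm x * nm \<theta> \<le> nm y"
proof -
  let ?p = "monom (\<theta> ^ q) q + (monom 1 1 - [:y ^ q:])"
  have deg: "degree (monom 1 1 - [:y ^ q:]) \<le> 1"
    by (intro degree_diff_le) (auto intro: order_trans[OF degree_monom_le])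
  have degp: "degree ?p = q"
    using deg q_gt_1 by (subst degree_add_eq_left) (auto simp: degree_monom_eq)
  have lead: "lead_coeff ?p = \<theta> ^ q"
    unfolding degp using deg q_gt_1 coeff_eq_0[of "monom 1 1 - [:y ^ q:]" q] by simp
  have "?p \<in> coeffs_in L"
    by (intro coeffs_in_L_mems y)
  then obtain x where x: "x \<in> L" "poly ?p x = 0" "nm x ^ degree ?p * nm (lead_coeff ?p) \<le> nm (coeff ?p 0)"
    using L_small_root[of ?p] degp by auto
  have c0: "coeff ?p 0 = - (y ^ q)"
    by simp
  have "nm x ^ q * nm \<theta> ^ q \<le> nm y ^ q"
    using x(3) unfolding lead unfolding degp c0 by simp
  then have "nm x * nm \<theta> \<le> nm y"
    by (rule nm_power_le_imp_le) auto
  moreover have "\<theta> ^ q * x ^ q + (x - y ^ q) = 0"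
    using x(2) by (simp add: poly_monom)
  then have "(\<theta> * x) ^ q + x = y ^ q"
    by (simp only: add_diff_eq right_minus_eq power_mult_distrib)
  then have "phi ((\<theta> * x) ^ q + x) = phi (y ^ q)"
    by (rule arg_cong)
  then have "phi x + \<theta> * x = y"
    by (simp only: phi.hom_add power_phi add.commute)
  ultimately show ?thesis
    using that x(1) by blast
qed

text \<open>The Tate condition for series over \<open>L\<close>, the field in which roots can be
  extracted.\<close>

definition tate_L :: "'c fls set" where
  "tate_L = {fps_to_fls F |F. (\<forall>n. fps_nth F n \<in> L) \<and> fps_nth F \<longlonglongrightarrow> 0}"

lemma tate_LI:
  assumes "\<And>n. a n \<in> L" "a \<longlonglongrightarrow> 0"
  shows "fps_to_fls (Abs_fps a) \<in> tate_L"
proof -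
  have "fps_nth (Abs_fps a) = a"
    by auto
  then show ?thesis
    unfolding tate_L_def using assms by (intro CollectI exI[of _ "Abs_fps a"]) simp
qed

lemma null_iff: "(a :: nat \<Rightarrow> 'c) \<longlonglongrightarrow> 0 \<longleftrightarrow> (\<lambda>n. nm (a n)) \<longlonglongrightarrow> 0"
  unfolding tendsto_dist_iff[of a] by (simp add: dist_commute)

lemma null_comparison:
  assumes "b \<longlonglongrightarrow> (0::real)" "\<And>n. nm (a n) \<le> b n"
  shows "(a :: nat \<Rightarrow> 'c) \<longlonglongrightarrow> 0"
  unfolding null_iff
proof (rule tendsto_sandwich[of "\<lambda>_. 0" _ sequentially b])
  show "\<forall>\<^sub>F n in sequentially. nm (a n) \<le> b n"
    using assms(2) by (rule always_eventually[OF allI])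
qed (use assms(1) in simp_all)

lemma geometric_null:
  assumes "\<And>n. nm (a (Suc n)) * nm \<theta> \<le> nm (a n)"
  shows "(a :: nat \<Rightarrow> 'c) \<longlonglongrightarrow> 0"
proof (rule null_comparison)
  have "\<bar>1 / nm \<theta>\<bar> < 1"
    using nm_theta_gt_1 by simp
  then have "(\<lambda>n. nm (a 0) * (1 / nm \<theta>) ^ n) \<longlonglongrightarrow> nm (a 0) * 0"
    by (intro tendsto_intros LIMSEQ_power_zero) simp
  then show "(\<lambda>n. nm (a 0) * (1 / nm \<theta>) ^ n) \<longlonglongrightarrow> 0"
    by simp
  show "nm (a n) \<le> nm (a 0) * (1 / nm \<theta>) ^ n" for n
  proof (induction n)
    case (Suc n)
    have "nm (a (Suc n)) \<le> nm (a n) * (1 / nm \<theta>)"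
      using assms[of n] nm_theta_gt_1 by (simp add: field_simps)
    also have "\<dots> \<le> nm (a 0) * (1 / nm \<theta>) ^ n * (1 / nm \<theta>)"
      using Suc by (intro mult_right_mono) auto
    finally show ?case
      by (simp add: mult_ac)
  qed simp
qed

text \<open>P y x relates a coefficient y of a power series to the next coefficient x; the factor
  |\<theta>| gives geometric decay.\<close>

lemma recursive_solution:
  assumes init: "a0 \<in> L" "P 0 a0"
    and step: "\<And>y. y \<in> L \<Longrightarrow> \<exists>x\<in>L. P y x \<and> nm x * nm \<theta> \<le> nm y"
  obtains a where "a 0 = a0" "\<And>n. a n \<in> L" "\<And>n. P (a n) (a (Suc n))" "a \<longlonglongrightarrow> 0"
proof -
  have "\<exists>a. \<forall>n. a n \<in> L \<and> (n = 0 \<longrightarrow> a n = a0) \<and> (P (a n) (a (Suc n)) \<and> nm (a (Suc n)) * nm \<theta> \<le> nm (a n))"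
  proof -
    have "\<exists>a. \<forall>n. (a n \<in> L \<and> (n = 0 \<longrightarrow> a n = a0)) \<and> (P (a n) (a (Suc n)) \<and> nm (a (Suc n)) * nm \<theta> \<le> nm (a n))"
    proof (rule dependent_nat_choice)
      show "\<exists>x. x \<in> L \<and> (0 = (0::nat) \<longrightarrow> x = a0)"
        by (rule exI[of _ a0]) (use init in simp)
    next
      fix x n assume x: "x \<in> L \<and> (n = (0::nat) \<longrightarrow> x = a0)"
      obtain z where "z \<in> L" "P x z \<and> nm z * nm \<theta> \<le> nm x"
        using step[OF conjunct1[OF x]] by (rule bexE)
      then show "\<exists>z. (z \<in> L \<and> (Suc n = 0 \<longrightarrow> z = a0)) \<and> (P x z \<and> nm z * nm \<theta> \<le> nm x)"
        by auto
    qed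
    then show ?thesis
      by simp
  qed
  then obtain a where a: "\<forall>n. a n \<in> L \<and> (n = 0 \<longrightarrow> a n = a0) \<and> (P (a n) (a (Suc n)) \<and> nm (a (Suc n)) * nm \<theta> \<le> nm (a n))"
    by (rule exE)
  show ?thesis
  proof (rule that[of a])
    show "a \<longlonglongrightarrow> 0"
      by (rule geometric_null) (use a in simp)
  qed (use a in auto)
qed

lemma nth_T_mult:
  fixes F :: "'c fps"
  shows "fls_nth (T * fps_to_fls F) (int n) = (if n = 0 then 0 else fps_nth F (n - 1)) - \<theta> * fps_nth F n"
proof -
  have "T * fps_to_fls F = fps_to_fls (fps_X * F - fps_const \<theta> * F)"
    by (simp add: fls_times_fps_to_fls left_diff_distrib fls_X_def fps_const_to_fls[symmetric] del: fps_const_to_fls)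
  then show ?thesis
    by simp
qed

lemma fls_eq_of_nonneg:
  assumes "\<And>n. n < 0 \<Longrightarrow> fls_nth f n = 0" "\<And>n. n < 0 \<Longrightarrow> fls_nth g n = 0"
    "\<And>n::nat. fls_nth f (int n) = fls_nth g (int n)"
  shows "f = (g :: 'c fls)"
proof (rule fls_eqI)
  fix n
  show "fls_nth f n = fls_nth g n"
    using assms(1,2)[of n] assms(3)[of "nat n"] by (cases "n < 0") auto
qed

lemma negative_nth_fps_times: "n < 0 \<Longrightarrow> fls_nth (T * fps_to_fls (F :: 'c fps)) n = 0"
  "n < 0 \<Longrightarrow> fls_nth (fls_const c * fps_to_fls (F :: 'c fps)) n = 0"
proof -
  have "T * fps_to_fls F = fps_to_fls (fps_X * F - fps_const \<theta> * F)"
    by (simp add: fls_times_fps_to_fls left_diff_distrib fls_X_def fps_const_to_fls[symmetric] del: fps_const_to_fls)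
  then show "n < 0 \<Longrightarrow> fls_nth (T * fps_to_fls (F :: 'c fps)) n = 0"
    by simp
qed simp

lemma rho_solution:
  assumes a0: "a0 \<in> L" "phi (phi a0) + phi \<kappa> * phi a0 + \<theta> * a0 = 0"
  obtains A where "A \<in> tate_L" "fls_nth A 0 = a0" "twist \<iota> (twist \<iota> A) = T * A - K * twist \<iota> A"
proof -
  let ?P = "\<lambda>y x. phi (phi x) + phi \<kappa> * phi x + \<theta> * x = y"
  obtain a where a: "a 0 = a0" "\<And>n. a n \<in> L" "\<And>n. ?P (a n) (a (Suc n))" "a \<longlonglongrightarrow> 0"
  proof (rule recursive_solution[of a0 ?P])
    show "\<exists>x\<in>L. ?P y x \<and> nm x * nm \<theta> \<le> nm y" if "y \<in> L" for y
      using rho_adjoint_small_solution[OF that] by blast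
  qed (use a0 in auto)
  let ?A = "fps_to_fls (Abs_fps a)"
  show ?thesis
  proof (rule that[of ?A])
    show "?A \<in> tate_L"
      using a by (intro tate_LI)
    show "twist \<iota> (twist \<iota> ?A) = T * ?A - K * twist \<iota> ?A"
    proof (rule fls_eq_of_nonneg)
      show "fls_nth (twist \<iota> (twist \<iota> ?A)) (int n) = fls_nth (T * ?A - K * twist \<iota> ?A) (int n)" for n
      proof -
        \<comment> \<open>The equation at t^n; multiplication by t brings in the preceding
          coefficient, which is 0 for n = 0.\<close>
        have "phi (phi (a n)) + phi \<kappa> * phi (a n) + \<theta> * a n = (if n = 0 then 0 else a (n - 1))"
          using a(3)[of "n - 1"] a0(2) a(1) by (cases n) simp_all
        then have "phi (phi (a n)) = (if n = 0 then 0 else a (n - 1)) - \<theta> * a n - phi \<kappa> * phi (a n)"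
          by (simp only: eq_diff_eq)
        moreover have "fls_nth (twist \<iota> (twist \<iota> ?A)) (int n) = phi (phi (a n))"
          "fls_nth (K * twist \<iota> ?A) (int n) = phi \<kappa> * phi (a n)"
          by simp_all
        ultimately show ?thesis
          by (simp only: fls_minus_nth nth_T_mult fps_nth_Abs_fps)
      qed
    qed (simp_all add: negative_nth_fps_times)
  qed (use a in auto)
qed

text \<open>The equation of the function usually called Omega, which trivialises the Carlitz motive.
  A nonzero initial value makes the solution nonzero.\<close>

lemma carlitz_solution:
  obtains A where "A \<in> tate_L" "A \<noteq> 0" "twist \<iota> A = T * A"
proof -
  let ?P = "\<lambda>y x. phi x + \<theta> * x = y"
  have "\<exists>a0\<in>L. a0 \<noteq> 0 \<and> ?P 0 a0"
  proof -
    \<comment> \<open>The equation \<theta>^q x^q + x = 0 divided by x, so as to exclude the zero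
      solution.\<close>
    let ?p = "monom (\<theta> ^ q) (q - 1) + [:1:]"
    have "degree ?p = q - 1"
      using q_gt_1 by (subst degree_add_eq_left) (auto simp: degree_monom_eq)
    moreover have "?p \<in> coeffs_in L"
      by (intro coeffs_in_L_mems)
    ultimately obtain x where x: "x \<in> L" "poly ?p x = 0"
      using L_root[of ?p] q_gt_1 by auto
    have eq: "\<theta> ^ q * x ^ (q - 1) + 1 = 0"
      using x(2) by (simp add: poly_monom)
    have "x \<noteq> 0"
      using eq q_gt_1 by (auto simp: power_0_left)
    moreover have "\<theta> ^ q * x ^ q + x = x * (\<theta> ^ q * x ^ (q - 1) + 1)"
      using q_gt_1 by (simp add: algebra_simps flip: power_Suc)
    then have "(\<theta> * x) ^ q + x = 0"
      unfolding eq by (simp add: power_mult_distrib)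
    then have "phi ((\<theta> * x) ^ q + x) = phi 0"
      by (rule arg_cong)
    then have "?P 0 x"
      by (simp only: phi.hom_add power_phi add.commute phi.hom_zero)
    ultimately show ?thesis
      using x(1) by blast
  qed
  then obtain a0 where a0: "a0 \<in> L" "a0 \<noteq> 0" "?P 0 a0"
    by blast
  obtain a where a: "a 0 = a0" "\<And>n. a n \<in> L" "\<And>n. ?P (a n) (a (Suc n))" "a \<longlonglongrightarrow> 0"
  proof (rule recursive_solution[of a0 ?P])
    show "\<exists>x\<in>L. ?P y x \<and> nm x * nm \<theta> \<le> nm y" if "y \<in> L" for y
      using carlitz_small_solution[OF that] by blast
  qed (use a0 in auto)
  let ?A = "fps_to_fls (Abs_fps a)"
  show ?thesis
  proof (rule that[of ?A])
    show "?A \<in> tate_L"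
      using a by (intro tate_LI)
    show "?A \<noteq> 0"
    proof
      assume "?A = 0"
      then have "fls_nth ?A 0 = 0"
        by (simp only: fls_zero_nth)
      then show False
        using a(1) a0(2) by simp
    qed
    show "twist \<iota> ?A = T * ?A"
    proof (rule fls_eq_of_nonneg)
      show "fls_nth (twist \<iota> ?A) (int n) = fls_nth (T * ?A) (int n)" for n
      proof -
        have "phi (a n) + \<theta> * a n = (if n = 0 then 0 else a (n - 1))"
          using a(3)[of "n - 1"] a0(3) a(1) by (cases n) simp_all
        then have "phi (a n) = (if n = 0 then 0 else a (n - 1)) - \<theta> * a n"
          by (simp only: eq_diff_eq)
        moreover have "fls_nth (twist \<iota> ?A) (int n) = phi (a n)"
          by simp
        ultimately show ?thesis
          by (simp only: nth_T_mult fps_nth_Abs_fps)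
      qed
    qed (simp_all add: negative_nth_fps_times)
  qed
qed

text \<open>
  Given one nonzero solution \<open>a\<close> of the constant-term equation, the left factor of order one is
  \<open>W(x) = x\<^sup>q - a\<^bsup>q-1\<^esup> x\<close>; a solution with \<open>W(x) \<noteq> 0\<close> is independent of \<open>a\<close> over \<open>F\<^sub>q\<close>.
\<close>

lemma rho_initial_values:
  obtains a b where "a \<in> L" "b \<in> L" "phi (phi a) + phi \<kappa> * phi a + \<theta> * a = 0"
    "phi (phi b) + phi \<kappa> * phi b + \<theta> * b = 0" "a * phi b \<noteq> b * phi a"
proof -
  let ?c2 = "\<theta> ^ (q ^ 2)"
  let ?c1 = "\<kappa> ^ q"
  let ?P = "\<lambda>x. phi (phi x) + phi \<kappa> * phi x + \<theta> * x = 0"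
  have P: "?P x" if "?c2 * x ^ (q ^ 2) + ?c1 * x ^ q + x = 0" for x
  proof -
    have "(\<theta> * x) ^ (q ^ 2) + (\<kappa> * x) ^ q + x = 0"
      using that by (simp only: power_mult_distrib)
    then have "phi (phi ((\<theta> * x) ^ (q ^ 2) + (\<kappa> * x) ^ q + x)) = phi (phi 0)"
      by simp
    then show ?thesis
      by (simp only: phi.hom_add phi_phi_power phi_phi_power') (simp add: phi.hom_mult add_ac)
  qed
  have q2: "q ^ 2 = Suc (q ^ 2 - 1)" "q = Suc (q - 1)"
    using q_gt_1 by simp_all
  obtain a where a: "a \<in> L" "a \<noteq> 0" "?c2 * a ^ (q ^ 2) + ?c1 * a ^ q + a = 0"
  proof -
    let ?p = "monom ?c2 (q ^ 2 - 1) + (monom ?c1 (q - 1) + [:1:])"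
    have "degree (monom ?c1 (q - 1) + [:1:]) \<le> q - 1"
      by (intro degree_add_le) (auto intro: order_trans[OF degree_monom_le])
    moreover have "q - 1 < q ^ 2 - 1"
      using q_less_q2 q_gt_1 by linarith
    ultimately have deg: "degree ?p = q ^ 2 - 1"
      by (subst degree_add_eq_left) (auto simp: degree_monom_eq)
    moreover have "?p \<in> coeffs_in L"
      by (intro coeffs_in_L_mems)
    moreover have "degree ?p > 0"
      using \<open>q - 1 < q ^ 2 - 1\<close> unfolding deg by linarith
    ultimately obtain x where x: "x \<in> L" "poly ?p x = 0"
      using L_root[of ?p] by blast
    have eq: "?c2 * x ^ (q ^ 2 - 1) + ?c1 * x ^ (q - 1) + 1 = 0"
      using x(2) by (simp add: poly_monom add.assoc)
    have "q ^ 2 - 1 \<noteq> 0" "q - 1 \<noteq> 0"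
      using q_gt_1 \<open>q - 1 < q ^ 2 - 1\<close> by linarith+
    then have "x \<noteq> 0"
      using eq by (metis add_0_left mult_zero_right zero_neq_one zero_power2 power_0_left)
    moreover have "?c2 * x ^ (q ^ 2) + ?c1 * x ^ q + x = x * (?c2 * x ^ (q ^ 2 - 1) + ?c1 * x ^ (q - 1) + 1)"
    proof -
      have "x ^ (q ^ 2) = x * x ^ (q ^ 2 - 1)" "x ^ q = x * x ^ (q - 1)"
        using q2 power_Suc by metis+
      then show ?thesis
        by (simp add: algebra_simps)
    qed
    ultimately show ?thesis
      using that[of x] x(1) eq by simp
  qed
  \<comment> \<open>Chosen for the factorisation \<theta>^(q^2) \<tau>^2 + \<kappa>^q \<tau> + 1 =
    (\<theta>^(q^2) \<tau> + B)(\<tau> - a^(q-1)): the constant terms require - B a^(q-1) =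
    1.\<close>
  define B where "B = - inverse (a ^ (q - 1))"
  have B: "B \<in> L" "B \<noteq> 0" "B * a ^ (q - 1) = - 1"
    using a unfolding B_def by (auto intro!: L.uminus_mem L.inverse_mem L.power_mem simp del: mem_Collect_eq)
  \<comment> \<open>A nonzero element of the kernel of the left factor. Any preimage of it under the
    right factor W is a second solution.\<close>
  obtain y where y: "y \<in> L" "y \<noteq> 0" "?c2 * y ^ q + B * y = 0"
  proof -
    let ?p = "monom ?c2 (q - 1) + [:B:]"
    have "degree ?p = q - 1"
      using q_gt_1 by (subst degree_add_eq_left) (auto simp: degree_monom_eq)
    moreover have "?p \<in> coeffs_in L"
      by (intro coeffs_in_L_mems B(1))
    ultimately obtain x where x: "x \<in> L" "poly ?p x = 0"
      using L_root[of ?p] q_gt_1 by auto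
    have eq: "?c2 * x ^ (q - 1) + B = 0"
      using x(2) by (simp add: poly_monom)
    have "x \<noteq> 0"
      using eq q_gt_1 B(2) by (auto simp: power_0_left)
    moreover have "?c2 * x ^ q + B * x = x * (?c2 * x ^ (q - 1) + B)"
    proof -
      have "x ^ q = x * x ^ (q - 1)"
        using q2 power_Suc by metis
      then show ?thesis
        by (simp add: algebra_simps)
    qed
    ultimately show ?thesis
      using that[of x] x(1) eq by simp
  qed
  obtain b where b: "b \<in> L" "b ^ q - a ^ (q - 1) * b = y"
  proof -
    let ?p = "monom 1 q + (monom (- (a ^ (q - 1))) 1 + [:- y:])"
    have "degree (monom (- (a ^ (q - 1))) 1 + [:- y:]) \<le> 1"
      by (intro degree_add_le) (auto intro: order_trans[OF degree_monom_le])
    then have "degree ?p = q"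
      using q_gt_1 by (subst degree_add_eq_left) (auto simp: degree_monom_eq)
    moreover have "?p \<in> coeffs_in L"
      by (intro coeffs_in_L_mems a(1) y(1))
    ultimately obtain x where x: "x \<in> L" "poly ?p x = 0"
      using L_root[of ?p] q_gt_1 by auto
    have "x ^ q - a ^ (q - 1) * x - y = 0"
      using x(2) by (simp add: poly_monom algebra_simps)
    then show ?thesis
      using that[of x] x(1) by (simp only: right_minus_eq)
  qed
  have aq: "a ^ q = a ^ (q - 1) * a"
    using q2 power_Suc2 by metis
  have "?c1 = B - ?c2 * (a ^ (q - 1)) ^ q"
  proof -
    have "a ^ (q ^ 2) = (a ^ q) ^ q"
      by (simp add: power2_eq_square power_mult)
    also have "\<dots> = (a ^ (q - 1) * a) ^ q"
      by (rule arg_cong[OF aq])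
    also have "\<dots> = (a ^ (q - 1)) ^ q * a ^ q"
      by (rule power_mult_distrib)
    finally have "(a ^ (q - 1)) ^ q * a ^ q = a ^ (q ^ 2)"
      by (rule sym)
    moreover have "B * a ^ q = - a"
      using B(3) unfolding aq by (simp flip: mult.assoc)
    ultimately have "(B - ?c2 * (a ^ (q - 1)) ^ q) * a ^ q = - a - ?c2 * a ^ (q ^ 2)"
      by (simp add: left_diff_distrib mult.assoc)
    also have "\<dots> = ?c1 * a ^ q"
    proof -
      have "?c1 * a ^ q = - (a + ?c2 * a ^ (q ^ 2))"
        unfolding eq_neg_iff_add_eq_0 using a(3) by (simp only: add_ac)
      then show ?thesis
        by simp
    qed
    finally show ?thesis
      using a(2) by simp
  qed
  then have "?c2 * b ^ (q ^ 2) + ?c1 * b ^ q + b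
      = ?c2 * (b ^ q) ^ q + (B - ?c2 * (a ^ (q - 1)) ^ q) * b ^ q - (B * a ^ (q - 1)) * b"
    unfolding B(3) by (simp add: power2_eq_square power_mult)
  also have "\<dots> = ?c2 * (b ^ q - a ^ (q - 1) * b) ^ q + B * (b ^ q - a ^ (q - 1) * b)"
    by (simp add: frob_diff1 power_mult_distrib algebra_simps)
  finally have "?c2 * b ^ (q ^ 2) + ?c1 * b ^ q + b = 0"
    unfolding b(2) y(3) .
  moreover have "a * phi b \<noteq> b * phi a"
  proof
    \<comment> \<open>The q-th power of this relation says that a W(b) = 0.\<close>
    assume "a * phi b = b * phi a"
    then have "(a * phi b) ^ q = (b * phi a) ^ q"
      by simp
    then have "a * (b ^ q - a ^ (q - 1) * b) = 0"
      using aq by (auto simp: power_mult_distrib algebra_simps)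
    then show False
      using a(2) b(2) y(2) by simp
  qed
  ultimately show ?thesis
    using that a b P by blast
qed

text \<open>The determinant of the two solutions and their twists is nonzero because its constant
  coefficient a phi(b) - b phi(a) is.\<close>

lemma rho_fundamental_solutions:
  obtains A B where "A \<in> tate_L" "B \<in> tate_L"
    "twist \<iota> (twist \<iota> A) = T * A - K * twist \<iota> A" "twist \<iota> (twist \<iota> B) = T * B - K * twist \<iota> B"
    "A * twist \<iota> B \<noteq> B * twist \<iota> A"
proof -
  obtain a b where ab: "a \<in> L" "b \<in> L" "phi (phi a) + phi \<kappa> * phi a + \<theta> * a = 0"
    "phi (phi b) + phi \<kappa> * phi b + \<theta> * b = 0" "a * phi b \<noteq> b * phi a"
    by (rule rho_initial_values)
  obtain A where A: "A \<in> tate_L" "fls_nth A 0 = a" "twist \<iota> (twist \<iota> A) = T * A - K * twist \<iota> A"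
    by (rule rho_solution[OF ab(1,3)])
  obtain B where B: "B \<in> tate_L" "fls_nth B 0 = b" "twist \<iota> (twist \<iota> B) = T * B - K * twist \<iota> B"
    by (rule rho_solution[OF ab(2,4)])
  obtain F G where FG: "A = fps_to_fls F" "B = fps_to_fls G"
    using A(1) B(1) unfolding tate_L_def by blast
  have tw: "twist \<iota> (fps_to_fls H) = fps_to_fls (Abs_fps (\<lambda>n. phi (fps_nth H n)))" for H
    by (rule fls_eqI) simp
  have FG0: "fps_nth F 0 = a" "fps_nth G 0 = b"
    using A(2) B(2) by (simp_all add: FG)
  have "fls_nth (A * twist \<iota> B) 0 = a * phi b" "fls_nth (B * twist \<iota> A) 0 = b * phi a"
    by (simp_all add: FG tw FG0 flip: fls_times_fps_to_fls)
  then have "A * twist \<iota> B \<noteq> B * twist \<iota> A"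
    using ab(5) by metis
  then show ?thesis
    using that A B by blast
qed

section \<open>Operations on Tate series and Artin-Schreier equations\<close>

lemma tate_L_subset: "tate_L \<subseteq> tate_fractions"
proof
  fix f assume "f \<in> tate_L"
  then obtain F where F: "f = fps_to_fls F" "fps_nth F \<longlonglongrightarrow> 0"
    unfolding tate_L_def by blast
  have "fps_nth (1 :: 'c fps) \<longlonglongrightarrow> 0"
    by (rule tendsto_eventually) (auto simp: eventually_sequentially intro!: exI[of _ 1])
  then show "f \<in> tate_fractions"
    unfolding tate_fractions_def using F by (intro CollectI exI[of _ F] exI[of _ 1]) simp
qed

lemma tate_L_add: "f \<in> tate_L \<Longrightarrow> g \<in> tate_L \<Longrightarrow> f + g \<in> tate_L"
proof -
  assume "f \<in> tate_L" "g \<in> tate_L"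
  then obtain F G where FG: "f = fps_to_fls F" "g = fps_to_fls G" "\<forall>n. fps_nth F n \<in> L" "\<forall>n. fps_nth G n \<in> L"
    "fps_nth F \<longlonglongrightarrow> 0" "fps_nth G \<longlonglongrightarrow> 0"
    unfolding tate_L_def by blast
  have "fps_nth (F + G) = (\<lambda>n. fps_nth F n + fps_nth G n)"
    by auto
  then have "fps_nth (F + G) \<longlonglongrightarrow> 0 + 0"
    using tendsto_add_nm[OF FG(5,6)] by (simp only:)
  moreover have "\<forall>n. fps_nth (F + G) n \<in> L"
    using FG(3,4) L.add_mem by simp
  ultimately show ?thesis
    unfolding tate_L_def FG by (intro CollectI exI[of _ "F + G"]) simp
qed

lemma tate_L_const_mult: "c \<in> L \<Longrightarrow> f \<in> tate_L \<Longrightarrow> fls_const c * f \<in> tate_L"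
proof -
  assume c: "c \<in> L" and "f \<in> tate_L"
  then obtain F where F: "f = fps_to_fls F" "\<forall>n. fps_nth F n \<in> L" "fps_nth F \<longlonglongrightarrow> 0"
    unfolding tate_L_def by blast
  have "fls_const c * f = fps_to_fls (Abs_fps (\<lambda>n. c * fps_nth F n))"
    by (rule fls_eqI) (simp add: F)
  moreover have "(\<lambda>n. c * fps_nth F n) \<longlonglongrightarrow> 0"
    using tendsto_mult_nm[OF F(3), of c] by simp
  ultimately show ?thesis
    using F(2) c L.mult_mem by (simp only:) (intro tate_LI; simp)
qed

lemma tate_L_X_mult: "f \<in> tate_L \<Longrightarrow> fls_X * f \<in> tate_L"
proof -
  assume "f \<in> tate_L"
  then obtain F where F: "f = fps_to_fls F" "\<forall>n. fps_nth F n \<in> L" "fps_nth F \<longlonglongrightarrow> 0"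
    unfolding tate_L_def by blast
  let ?a = "\<lambda>n. if n = 0 then 0 else fps_nth F (n - 1)"
  have "fls_X * f = fps_to_fls (fps_X * F)"
    by (simp add: F(1) fls_times_fps_to_fls fls_X_def)
  also have "fps_X * F = Abs_fps ?a"
    by (rule fps_ext) simp
  finally have "fls_X * f = fps_to_fls (Abs_fps ?a)" .
  moreover have "?a \<longlonglongrightarrow> 0"
    by (rule LIMSEQ_imp_Suc) (use F(3) in simp)
  ultimately show ?thesis
    using F(2) L.zero_mem by (simp only:) (intro tate_LI; simp)
qed

lemma tate_L_0: "0 \<in> tate_L"
  using tate_LI[of "\<lambda>_. 0"] L.zero_mem by (simp flip: fps_zero_def)

lemma tate_L_poly_mult: "p \<in> coeffs_in L \<Longrightarrow> f \<in> tate_L \<Longrightarrow> emb p * f \<in> tate_L"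
proof (induction p)
  case 0
  then show ?case
    by (simp add: tate_L_0)
next
  case (pCons c p)
  have "coeff (pCons c p) 0 \<in> L" "\<forall>i. coeff (pCons c p) (Suc i) \<in> L"
    using pCons.prems(1) unfolding coeffs_in_def by blast+
  then have cp: "c \<in> L" "p \<in> coeffs_in L"
    by (auto simp: coeffs_in_def)
  have "pCons c p = [:c:] + [:0, 1:] * p"
    by simp
  then have "emb (pCons c p) * f = fls_const c * f + fls_X * (emb p * f)"
    by (simp only: emb.hom_add emb.hom_mult emb_const emb_X algebra_simps)
  then show ?case
    using cp pCons by (simp add: tate_L_add tate_L_const_mult tate_L_X_mult)
qed

lemma tate_L_twist: "f \<in> tate_L \<Longrightarrow> twist \<iota> f \<in> tate_L"
proof -
  assume "f \<in> tate_L"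
  then obtain F where F: "f = fps_to_fls F" "\<forall>n. fps_nth F n \<in> L" "fps_nth F \<longlonglongrightarrow> 0"
    unfolding tate_L_def by blast
  have "twist \<iota> f = fps_to_fls (Abs_fps (\<lambda>n. phi (fps_nth F n)))"
    by (rule fls_eqI) (simp add: F)
  moreover have "(\<lambda>n. phi (fps_nth F n)) \<longlonglongrightarrow> 0"
    unfolding null_iff
  proof (rule LIMSEQ_I)
    fix r :: real assume r: "r > 0"
    then have "eventually (\<lambda>n. nm (fps_nth F n) < r ^ q) sequentially"
      using F(3) unfolding null_iff by (intro order_tendstoD) auto
    then obtain N where N: "\<And>n. n \<ge> N \<Longrightarrow> nm (fps_nth F n) < r ^ q"
      unfolding eventually_sequentially by blast
    have "nm (phi (fps_nth F n)) < r" if "n \<ge> N" for n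
    proof (rule power_less_imp_less_base)
      show "nm (phi (fps_nth F n)) ^ q < r ^ q"
        using N[OF that] by (simp flip: nm_power)
    qed (use r in simp)
    then show "\<exists>no. \<forall>n\<ge>no. norm (nm (phi (fps_nth F n)) - 0) < r"
      by auto
  qed
  ultimately show ?thesis
    using F(2) phi_in_L by (simp only:) (intro tate_LI; simp)
qed

lemma tate_L_artin_schreier:
  assumes "h \<in> tate_L"
  obtains z where "z \<in> tate_L" "twist \<iota> z = h + z"
proof -
  obtain F where F: "h = fps_to_fls F" "\<forall>n. fps_nth F n \<in> L" "fps_nth F \<longlonglongrightarrow> 0"
    using assms unfolding tate_L_def by blast
  have "\<exists>x. x \<in> L \<and> phi x = fps_nth F n + x \<and> nm x \<le> nm (fps_nth F n)" for n
    using artin_schreier_small_solution[of "fps_nth F n"] F(2) by metis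
  then have "\<exists>x. \<forall>n. x n \<in> L \<and> phi (x n) = fps_nth F n + x n \<and> nm (x n) \<le> nm (fps_nth F n)"
    by (intro choice allI)
  then obtain x where x: "\<forall>n. x n \<in> L \<and> phi (x n) = fps_nth F n + x n \<and> nm (x n) \<le> nm (fps_nth F n)"
    by (rule exE)
  show ?thesis
  proof (rule that[of "fps_to_fls (Abs_fps x)"])
    have "x \<longlonglongrightarrow> 0"
      using F(3) x unfolding null_iff[of "fps_nth F"] by (intro null_comparison) auto
    then show "fps_to_fls (Abs_fps x) \<in> tate_L"
      using x by (intro tate_LI) auto
    show "twist \<iota> (fps_to_fls (Abs_fps x)) = h + fps_to_fls (Abs_fps x)"
      by (rule fls_eqI) (use x in \<open>simp add: F\<close>)
  qed
qed

lemma divide_emb_mem_tate_fractions: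
  assumes "f \<in> tate_L" "D \<noteq> 0"
  shows "f / emb D \<in> tate_fractions"
proof -
  obtain F where F: "f = fps_to_fls F" "fps_nth F \<longlonglongrightarrow> 0"
    using assms(1) unfolding tate_L_def by blast
  have "fps_nth (fps_of_poly D) \<longlonglongrightarrow> 0"
    by (rule tendsto_eventually)
      (auto simp: eventually_sequentially coeff_eq_0 intro!: exI[of _ "Suc (degree D)"])
  then show ?thesis
    unfolding tate_fractions_def emb_def using F assms(2)
    by (intro CollectI exI[of _ F] exI[of _ "fps_of_poly D"]) (simp add: fps_of_poly_eq_iff[of D 0, simplified])
qed

text \<open>These are the bottom rows for which a trivialisation can be found. D is fixed by the
  twist, so the Artin-Schreier equation may be solved after multiplication by D and the solution
  divided by D. The numerators must lie over \<open>L\<close> to act on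
  \<open>tate_L\<close>.\<close>

definition fq_denominators :: "'c fls \<times> 'c fls \<Rightarrow> bool" where
  "fq_denominators v \<longleftrightarrow> fst v \<in> kbar_rats \<iota> \<and> snd v \<in> kbar_rats \<iota> \<and> (\<exists>D. D \<noteq> 0 \<and> ptw D = D \<and>
     emb D * fst v \<in> emb ` coeffs_in L \<and> emb D * snd v \<in> emb ` coeffs_in L)"

text \<open>The coefficients are roots of X^q - X.\<close>

lemma coeffs_in_L_of_fixed:
  assumes "ptw D = D"
  shows "D \<in> coeffs_in L"
proof -
  have "coeff D i \<in> L" for i
  proof -
    have "phi (coeff D i) = coeff D i"
      using arg_cong[OF assms, of "\<lambda>p. coeff p i"] by simp
    then have fixed: "coeff D i ^ q = coeff D i"
      by (metis phi_power)
    let ?p = "monom 1 q - monom 1 1 :: 'c poly"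
    have "algebraic_over (range \<iota>) (coeff D i)"
    proof (rule algebraic_over_trans[OF closed_subfield_range_\<iota>])
      show "poly ?p (coeff D i) = 0"
        by (simp add: poly_monom fixed)
      show "?p \<noteq> 0"
      proof
        assume "?p = 0"
        then have "coeff (monom 1 q :: 'c poly) q = coeff (monom 1 1) q"
          by simp
        then show False
          using q_gt_1 by simp
      qed
      have "?p \<in> coeffs_in L"
        by (intro coeffs_in_L_mems)
      then show "algebraic_over (range \<iota>) (coeff ?p j)" for j
        unfolding coeffs_in_def by simp
    qed
    then show ?thesis
      by simp
  qed
  then show ?thesis
    by (simp add: coeffs_in_def)
qed

lemma fq_denominators_add:
  assumes "fq_denominators v" "fq_denominators w"
  shows "fq_denominators (fst v + fst w, snd v + snd w)"
proof -
  interpret EL: closed_subring "emb ` coeffs_in L"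
    by unfold_locales
      (auto intro: CL.mems simp flip: emb.hom_minus emb.hom_mult emb.hom_one intro!: imageI)
  obtain D where D: "D \<noteq> 0" "ptw D = D" "emb D * fst v \<in> emb ` coeffs_in L" "emb D * snd v \<in> emb ` coeffs_in L"
    using assms(1) unfolding fq_denominators_def by blast
  obtain E where E: "E \<noteq> 0" "ptw E = E" "emb E * fst w \<in> emb ` coeffs_in L" "emb E * snd w \<in> emb ` coeffs_in L"
    using assms(2) unfolding fq_denominators_def by blast
  have DE: "emb D \<in> emb ` coeffs_in L" "emb E \<in> emb ` coeffs_in L"
    using coeffs_in_L_of_fixed D(2) E(2) by blast+
  have mem: "emb (D * E) * (x + y) \<in> emb ` coeffs_in L"
    if "emb D * x \<in> emb ` coeffs_in L" "emb E * y \<in> emb ` coeffs_in L" for x y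
  proof -
    have "emb (D * E) * (x + y) = emb E * (emb D * x) + emb D * (emb E * y)"
      by (simp add: emb.hom_mult algebra_simps)
    then show ?thesis
      using EL.add_mem[OF EL.mult_mem[OF DE(2) that(1)] EL.mult_mem[OF DE(1) that(2)]] by simp
  qed
  show ?thesis
    unfolding fq_denominators_def
    using assms D E mem
    by (auto simp: fq_denominators_def kbarr.add_mem ptw.hom_mult intro!: exI[of _ "D * E"])
qed

text \<open>\<open>sig_eq_denominator\<close> only produces polynomials over C_\<infinity>. Since y
  is also a quotient of polynomials over kbar, \<open>coeffs_in_quotient\<close> shows that they
  have coefficients in \<open>L\<close>.\<close>

lemma fq_denominators_of_sig_eq:
  assumes y: "fst y \<in> kbar_rats \<iota>" "snd y \<in> kbar_rats \<iota>" "sig_eq y" and a: "a \<in> kbar \<iota>"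
  shows "fq_denominators (fls_const a * fst y, fls_const a * snd y)"
proof -
  have "\<exists>D. D \<noteq> 0 \<and> ptw D = D \<and> emb D * fst y \<in> range emb \<and> emb D * snd y \<in> range emb"
  proof (rule sig_eq_denominator[of "{y}"])
    fix D assume "D \<noteq> 0" "ptw D = D"
      "\<And>z. z \<in> {y} \<Longrightarrow> emb D * fst z \<in> range emb \<and> emb D * snd z \<in> range emb"
    then show ?thesis
      by blast
  qed (use y kbar_rats_subset_fractions in auto)
  then obtain D where D: "D \<noteq> 0" "ptw D = D" "emb D * fst y \<in> range emb" "emb D * snd y \<in> range emb"
    by blast
  have kL: "coeffs_in (kbar \<iota>) \<subseteq> coeffs_in L"
    using kbar_subset_L by (auto simp: coeffs_in_def)
  have "emb D * (fls_const a * x) \<in> emb ` coeffs_in L" if x: "x \<in> kbar_rats \<iota>" "emb D * x \<in> range emb" for x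
  proof -
    obtain p where p: "emb D * x = emb p"
      using x(2) by blast
    obtain f g where fg: "x = emb f / emb g" "f \<in> coeffs_in L" "g \<in> coeffs_in L" "emb g \<noteq> 0"
      using x(1) kL unfolding kbar_rats_eq fractions_def kbar_polys_eq by blast
    have "emb (p * g) = emb (D * f)"
      using fg(4) p[symmetric] by (simp add: emb.hom_mult fg(1))
    then have "p * g = D * f"
      by (rule emb.injectivity)
    then have "p \<in> coeffs_in L"
      using fg L.coeffs_in_quotient[of g p] CL.mult_mem[OF coeffs_in_L_of_fixed[OF D(2)] fg(2)] by auto
    moreover have "[:a:] \<in> coeffs_in L"
      using a kbar_subset_L L.zero_mem by (auto simp: coeffs_in_def coeff_pCons split: nat.split)
    ultimately have "[:a:] * p \<in> coeffs_in L"
      by (rule CL.mult_mem[rotated])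
    moreover have "emb D * (fls_const a * x) = emb ([:a:] * p)"
      by (simp only: emb.hom_mult emb_const p[symmetric] mult.left_commute)
    ultimately show ?thesis
      by blast
  qed
  then show ?thesis
    unfolding fq_denominators_def
    using y a D kbarr.mult_mem kbar_polys_subset_rats const_mem_kbar_polys by auto
qed

lemma fq_denominators_const: "a \<in> kbar \<iota> \<Longrightarrow> fq_denominators (fls_const a, 0)"
proof -
  assume a: "a \<in> kbar \<iota>"
  have "[:a:] \<in> coeffs_in L" "0 \<in> coeffs_in L"
    using a kbar_subset_L L.zero_mem by (auto simp: coeffs_in_def coeff_pCons split: nat.split)
  then have "fls_const a \<in> emb ` coeffs_in L" "0 \<in> emb ` coeffs_in L"
    using emb_const emb.hom_zero by (metis imageI)+
  then show ?thesis
    unfolding fq_denominators_def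
    using a kbar_polys_subset_rats const_mem_kbar_polys kbarr.zero_mem by (auto intro!: exI[of _ 1])
qed

lemma fq_denominators_artin_schreier:
  assumes "fq_denominators v" "A \<in> tate_L"
  obtains z where "z \<in> tate_fractions" "twist \<iota> z = fst v * A + snd v * twist \<iota> A + z"
proof -
  obtain D p1 p2 where D: "D \<noteq> 0" "ptw D = D" "emb D * fst v = emb p1" "emb D * snd v = emb p2"
    "p1 \<in> coeffs_in L" "p2 \<in> coeffs_in L"
    using assms(1) unfolding fq_denominators_def by blast
  have "emb p1 * A + emb p2 * twist \<iota> A \<in> tate_L"
    using D assms(2) by (intro tate_L_add tate_L_poly_mult tate_L_twist)
  then obtain z where z: "z \<in> tate_L" "twist \<iota> z = (emb p1 * A + emb p2 * twist \<iota> A) + z"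
    by (rule tate_L_artin_schreier)
  show ?thesis
  proof (rule that[of "z / emb D"])
    show "z / emb D \<in> tate_fractions"
      by (rule divide_emb_mem_tate_fractions) fact+
    have "twist \<iota> (z / emb D) = (emb D * fst v * A + emb D * snd v * twist \<iota> A + z) / emb D"
      by (simp add: twist_divide z(2) D(2-4))
    also have "\<dots> = fst v * A + snd v * twist \<iota> A + z / emb D"
      using D(1) by (simp add: add_divide_distrib)
    finally show "twist \<iota> (z / emb D) = fst v * A + snd v * twist \<iota> A + z / emb D" .
  qed
qed

end

section \<open>The standard modules attached to matrices\<close>

no_notation fps_nth (infixl "$" 75)

lemma vecs_inI: "dim_vec v = n \<Longrightarrow> (\<And>i. i < n \<Longrightarrow> v $ i \<in> S) \<Longrightarrow> v \<in> vecs_in S n"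
  unfolding vecs_in_def using carrier_vecI[of v n] by blast

lemma vecs_in_dim [simp]: "v \<in> vecs_in S n \<Longrightarrow> dim_vec v = n"
  by (auto simp: vecs_in_def)

lemma vecs_in_nth: "v \<in> vecs_in S n \<Longrightarrow> i < n \<Longrightarrow> v $ i \<in> S"
  by (auto simp: vecs_in_def)

lemma vecs_in_carrier: "v \<in> vecs_in S n \<Longrightarrow> v \<in> carrier_vec n"
  by (auto simp: vecs_in_def)

lemma elements_mat_subset_iff:
  "elements_mat A \<subseteq> S \<longleftrightarrow> (\<forall>i<dim_row A. \<forall>j<dim_col A. A $$ (i, j) \<in> S)"
  by (fastforce simp: elements_mat_def)

lemma (in closed_subring) vecs_in_mult_mat:
  assumes "A \<in> carrier_mat m n" "\<And>i j. i < m \<Longrightarrow> j < n \<Longrightarrow> A $$ (i, j) \<in> S" "v \<in> vecs_in S n"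
  shows "A *\<^sub>v v \<in> vecs_in S m"
proof (rule vecs_inI)
  show "(A *\<^sub>v v) $ i \<in> S" if "i < m" for i
    using assms that by (auto simp: scalar_prod_def intro!: sum_mem mult_mem vecs_in_nth[of v S n])
qed (use assms(1) in auto)

text \<open>The inverse is the adjugate divided by the determinant, and both are formed by ring
  operations on the entries.\<close>

lemma (in closed_subfield) inverse_mat_mem:
  assumes A: "A \<in> carrier_mat n n" "\<And>i j. i < n \<Longrightarrow> j < n \<Longrightarrow> A $$ (i, j) \<in> S" "det A \<noteq> 0"
  obtains B where "B \<in> carrier_mat n n" "\<And>i j. i < n \<Longrightarrow> j < n \<Longrightarrow> B $$ (i, j) \<in> S"
    "A * B = 1\<^sub>m n" "B * A = 1\<^sub>m n"
proof -
  let ?B = "inverse (det A) \<cdot>\<^sub>m adj_mat A"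
  note adj = adj_mat[OF A(1)]
  have cof: "cofactor A i j \<in> S" if "i < n" "j < n" for i j
  proof -
    have "mat_delete A i j \<in> carrier_mat (n - 1) (n - 1)"
      using A(1) by (rule mat_delete_carrier)
    moreover have "mat_delete A i j $$ (k, l) \<in> S" if "k < n - 1" "l < n - 1" for k l
      using that A \<open>i < n\<close> \<open>j < n\<close> by (auto simp: mat_delete_def)
    ultimately have "det (mat_delete A i j) \<in> S"
      by (rule det_mem)
    then show ?thesis
      unfolding cofactor_def by (intro mult_mem power_mem uminus_mem one_mem)
  qed
  show ?thesis
  proof (rule that[of ?B])
    show "?B \<in> carrier_mat n n"
      using adj by simp
    show "?B $$ (i, j) \<in> S" if "i < n" "j < n" for i j
      using that A cof[of j i] det_mem[OF A(1,2)] by (auto simp: adj_mat_def intro!: mult_mem inverse_mem)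
    show "A * ?B = 1\<^sub>m n" "?B * A = 1\<^sub>m n"
      using adj A by (auto simp: mult_smult_distrib[of A n n] mult_smult_assoc_mat[of _ n n])
  qed
qed

lemma invertible_mat_of_det:
  fixes A :: "'a::field mat"
  assumes "A \<in> carrier_mat n n" "det A \<noteq> 0"
  shows "invertible_mat A"
proof -
  have "closed_subfield (UNIV :: 'a set)"
    by unfold_locales auto
  then obtain B where "B \<in> carrier_mat n n" "A * B = 1\<^sub>m n" "B * A = 1\<^sub>m n"
    using closed_subfield.inverse_mat_mem[of UNIV A n] assms by auto
  then show ?thesis
    unfolding invertible_mat_def inverts_mat_def using assms(1) by auto
qed

context drinfeld
begin

abbreviation V :: "nat \<Rightarrow> 'c fls vec set" where "V \<equiv> vecs_in (kbar_rats \<iota>)"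

lemma motive_of_simps [simp]:
  "carrier (motive_of \<iota> \<Phi>) = V (dim_row \<Phi>)"
  "zero (motive_of \<iota> \<Phi>) = 0\<^sub>v (dim_row \<Phi>)"
  "add (motive_of \<iota> \<Phi>) = (+)"
  "module.smult (motive_of \<iota> \<Phi>) = (\<cdot>\<^sub>v)"
  "sigma (motive_of \<iota> \<Phi>) = (\<lambda>x. transpose_mat \<Phi> *\<^sub>v map_vec (twist \<iota>) x)"
  by (simp_all add: motive_of_def)

lemma V_add: "x \<in> V d \<Longrightarrow> y \<in> V d \<Longrightarrow> x + y \<in> V d"
  by (auto simp: vecs_in_def intro: kbarr.add_mem)

lemma V_zero: "0\<^sub>v d \<in> V d"
  by (auto simp: vecs_in_def intro: kbarr.zero_mem)

lemma V_smult: "a \<in> kbar_rats \<iota> \<Longrightarrow> x \<in> V d \<Longrightarrow> a \<cdot>\<^sub>v x \<in> V d"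
  by (auto simp: vecs_in_def intro: kbarr.mult_mem)

lemma V_twist: "x \<in> V d \<Longrightarrow> map_vec (twist \<iota>) x \<in> V d"
  by (auto simp: vecs_in_def intro: twist_mem_kbar_rats)

lemma abelian_group_motive_of: "abelian_group (motive_of \<iota> \<Phi>)"
proof (rule abelian_groupI)
  let ?d = "dim_row \<Phi>"
  fix x assume x: "x \<in> carrier (motive_of \<iota> \<Phi>)"
  then have c: "x \<in> carrier_vec ?d"
    by (auto simp: vecs_in_carrier)
  show "\<exists>y\<in>carrier (motive_of \<iota> \<Phi>). y \<oplus>\<^bsub>motive_of \<iota> \<Phi>\<^esub> x = \<zero>\<^bsub>motive_of \<iota> \<Phi>\<^esub>"
  proof (rule bexI[of _ "(- 1) \<cdot>\<^sub>v x"])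
    show "(- 1) \<cdot>\<^sub>v x \<in> carrier (motive_of \<iota> \<Phi>)"
      using x V_smult kbarr.uminus_mem kbarr.one_mem by simp
    show "(- 1) \<cdot>\<^sub>v x \<oplus>\<^bsub>motive_of \<iota> \<Phi>\<^esub> x = \<zero>\<^bsub>motive_of \<iota> \<Phi>\<^esub>"
      using c by (intro eq_vecI) auto
  qed
qed (auto intro!: V_add V_zero eq_vecI simp: add.assoc add.commute)

lemma cring_kbar_rats_ring: "cring (kbar_rats_ring \<iota>)"
proof (rule cringI)
  show "abelian_group (kbar_rats_ring \<iota>)"
  proof (rule abelian_groupI)
    fix x assume "x \<in> carrier (kbar_rats_ring \<iota>)"
    then show "\<exists>y\<in>carrier (kbar_rats_ring \<iota>). y \<oplus>\<^bsub>kbar_rats_ring \<iota>\<^esub> x = \<zero>\<^bsub>kbar_rats_ring \<iota>\<^esub>"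
      by (intro bexI[of _ "- x"]) (auto simp: kbar_rats_ring_def kbarr.uminus_mem)
  qed (auto simp: kbar_rats_ring_def kbarr.mems add.assoc add.commute)
  show "comm_monoid (kbar_rats_ring \<iota>)"
    by (rule comm_monoidI) (auto simp: kbar_rats_ring_def kbarr.mems mult_ac)
qed (auto simp: kbar_rats_ring_def algebra_simps)

lemma module_motive_of: "Module.module (kbar_rats_ring \<iota>) (motive_of \<iota> \<Phi>)"
proof (rule moduleI)
  show "cring (kbar_rats_ring \<iota>)" "abelian_group (motive_of \<iota> \<Phi>)"
    by (rule cring_kbar_rats_ring abelian_group_motive_of)+
qed (auto simp: kbar_rats_ring_def algebra_simps intro!: V_smult eq_vecI)

lemma finsum_motive_of:
  assumes "finite A" "f \<in> A \<rightarrow> V (dim_row \<Phi>)"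
  shows "(\<Oplus>\<^bsub>motive_of \<iota> \<Phi>\<^esub>i\<in>A. f i) = vec (dim_row \<Phi>) (\<lambda>k. \<Sum>i\<in>A. f i $ k)"
  using assms
proof (induction A rule: finite_induct)
  interpret abelian_group "motive_of \<iota> \<Phi>"
    by (rule abelian_group_motive_of)
  case empty
  show ?case
    unfolding finsum_empty by (auto intro!: eq_vecI)
next
  interpret abelian_group "motive_of \<iota> \<Phi>"
    by (rule abelian_group_motive_of)
  case (insert x A)
  have "f x \<in> V (dim_row \<Phi>)" "f \<in> A \<rightarrow> V (dim_row \<Phi>)"
    using insert.prems by auto
  then show ?case
    using insert by (subst finsum_insert) (auto intro!: eq_vecI)
qed

lemma lin_comb_unit_vecs:
  assumes "a \<in> V (dim_row \<Phi>)"
  shows "lin_comb (motive_of \<iota> \<Phi>) a (unit_vecs (dim_row \<Phi>)) = a"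
proof -
  let ?d = "dim_row \<Phi>"
  have nth: "unit_vecs ?d ! i = unit_vec ?d i" if "i < ?d" for i
    using that by (simp add: unit_vecs_def)
  have mem: "a $ i \<cdot>\<^sub>v unit_vecs ?d ! i \<in> V ?d" if "i < ?d" for i
    using that assms
    by (intro vecs_inI) (auto simp: nth intro!: kbarr.mult_mem kbarr.mems vecs_in_nth[of a _ ?d])
  have "lin_comb (motive_of \<iota> \<Phi>) a (unit_vecs ?d)
      = vec ?d (\<lambda>k. \<Sum>i<?d. (a $ i \<cdot>\<^sub>v unit_vecs ?d ! i) $ k)"
    unfolding lin_comb_def using mem by (subst finsum_motive_of) (auto simp: unit_vecs_def)
  also have "\<dots> = a"
  proof (rule eq_vecI)
    fix k assume "k < dim_vec a"
    then have k: "k < ?d"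
      using assms by simp
    have "(\<Sum>i<?d. (a $ i \<cdot>\<^sub>v unit_vecs ?d ! i) $ k) = (\<Sum>i<?d. if i = k then a $ k else 0)"
      using k by (intro sum.cong) (auto simp: nth)
    then show "vec ?d (\<lambda>k. \<Sum>i<?d. (a $ i \<cdot>\<^sub>v unit_vecs ?d ! i) $ k) $ k = a $ k"
      using k by simp
  qed (use assms in simp)
  finally show ?thesis .
qed

lemma length_unit_vecs [simp]: "length (unit_vecs n) = n"
  by (simp add: unit_vecs_def)

lemma is_basis_unit_vecs:
  assumes S: "closed_subring S" "S \<subseteq> kbar_rats \<iota>"
  shows "is_basis S (motive_of \<iota> \<Phi>) (vecs_in S (dim_row \<Phi>)) (unit_vecs (dim_row \<Phi>))"
proof -
  interpret S: closed_subring S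
    by (rule S)
  let ?d = "dim_row \<Phi>"
  have sub: "vecs_in S ?d \<subseteq> V ?d"
    using S(2) by (auto simp: vecs_in_def)
  then have lc: "lin_comb (motive_of \<iota> \<Phi>) a (unit_vecs ?d) = a" if "a \<in> vecs_in S ?d" for a
    using lin_comb_unit_vecs that by blast
  moreover have "set (unit_vecs ?d) \<subseteq> vecs_in S ?d"
    by (auto simp: unit_vecs_def vecs_in_def intro: S.mems)
  ultimately show ?thesis
    unfolding is_basis_def by auto
qed

lemma transpose_mult_unit_vec:
  fixes A :: "'a::comm_ring_1 mat"
  assumes "A \<in> carrier_mat d e" "i < d"
  shows "transpose_mat A *\<^sub>v unit_vec d i = row A i"
proof (rule eq_vecI)
  fix j assume "j < dim_vec (row A i)"
  then have j: "j < e"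
    using assms by simp
  have "(transpose_mat A *\<^sub>v unit_vec d i) $ j = (\<Sum>k\<in>{0..<d}. A $$ (k, j) * unit_vec d i $ k)"
    using assms j by (simp add: scalar_prod_def)
  also have "\<dots> = (\<Sum>k\<in>{0..<d}. if k = i then A $$ (i, j) else 0)"
    by (intro sum.cong) (auto simp: unit_vec_def)
  finally show "(transpose_mat A *\<^sub>v unit_vec d i) $ j = row A i $ j"
    using assms j by simp
qed (use assms in simp)

lemma map_vec_twist_unit_vec: "map_vec (twist \<iota>) (unit_vec d i) = unit_vec d i"
  by (intro eq_vecI) (auto simp: unit_vec_def)

text \<open>The nonzero determinant makes \<sigma> bijective on the standard module.\<close>

definition valid :: "'c fls mat \<Rightarrow> nat \<Rightarrow> bool" where
  "valid \<Phi> d \<longleftrightarrow> \<Phi> \<in> carrier_mat d d \<and> (\<forall>i<d. \<forall>j<d. \<Phi> $$ (i, j) \<in> kbar_rats \<iota>) \<and> det \<Phi> \<noteq> 0"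

lemma represented_by_unit_vecs:
  assumes "valid \<Phi> d"
  shows "represented_by \<iota> (motive_of \<iota> \<Phi>) (unit_vecs d) \<Phi>"
proof -
  have \<Phi>: "\<Phi> \<in> carrier_mat d d" "\<And>i j. i < d \<Longrightarrow> j < d \<Longrightarrow> \<Phi> $$ (i, j) \<in> kbar_rats \<iota>"
    using assms by (auto simp: valid_def)
  have dim: "dim_row \<Phi> = d"
    using \<Phi> by simp
  have "is_basis (kbar_rats \<iota>) (motive_of \<iota> \<Phi>) (carrier (motive_of \<iota> \<Phi>)) (unit_vecs d)"
    using is_basis_unit_vecs[OF kbarr.closed_subring_axioms order_refl, of \<Phi>] by (simp add: dim)
  moreover have "sigma (motive_of \<iota> \<Phi>) (unit_vecs d ! i) = lin_comb (motive_of \<iota> \<Phi>) (row \<Phi> i) (unit_vecs d)"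
    if i: "i < d" for i
  proof -
    have "row \<Phi> i \<in> V (dim_row \<Phi>)"
      using \<Phi> i by (intro vecs_inI) auto
    then have "lin_comb (motive_of \<iota> \<Phi>) (row \<Phi> i) (unit_vecs d) = row \<Phi> i"
      using lin_comb_unit_vecs[of "row \<Phi> i" \<Phi>] dim by simp
    then show ?thesis
      using i \<Phi>(1) by (simp add: unit_vecs_def map_vec_twist_unit_vec transpose_mult_unit_vec)
  qed
  ultimately show ?thesis
    unfolding represented_by_def elements_mat_subset_iff using \<Phi> by auto
qed

lemma map_vec_twist_add:
  "x \<in> carrier_vec d \<Longrightarrow> y \<in> carrier_vec d \<Longrightarrow> map_vec (twist \<iota>) (x + y) = map_vec (twist \<iota>) x + map_vec (twist \<iota>) y"
  by (intro eq_vecI) (auto simp: tw.hom_add)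

lemma map_vec_twist_smult: "map_vec (twist \<iota>) (a \<cdot>\<^sub>v x) = twist \<iota> a \<cdot>\<^sub>v map_vec (twist \<iota>) x"
  by (intro eq_vecI) (auto simp: tw.hom_mult)

lemma map_vec_twist_mult_mat:
  assumes "A \<in> carrier_mat m n" "x \<in> carrier_vec n"
  shows "map_vec (twist \<iota>) (A *\<^sub>v x) = map_mat (twist \<iota>) A *\<^sub>v map_vec (twist \<iota>) x"
  using assms by (intro eq_vecI) (auto simp: scalar_prod_def tw.hom_sum tw.hom_mult)

lemma sigma_closed:
  assumes "valid \<Phi> d" "x \<in> V d"
  shows "transpose_mat \<Phi> *\<^sub>v map_vec (twist \<iota>) x \<in> V d"
  using assms by (intro kbarr.vecs_in_mult_mat[of _ d d] V_twist) (auto simp: valid_def)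

lemma pre_t_motive_motive_of:
  assumes v: "valid \<Phi> d"
  shows "pre_t_motive \<iota> (motive_of \<iota> \<Phi>)"
proof -
  have \<Phi>: "\<Phi> \<in> carrier_mat d d" "\<And>i j. i < d \<Longrightarrow> j < d \<Longrightarrow> \<Phi> $$ (i, j) \<in> kbar_rats \<iota>" "det \<Phi> \<noteq> 0"
    using assms by (auto simp: valid_def)
  have dim: "dim_row \<Phi> = d"
    using \<Phi> by simp
  let ?T = "transpose_mat \<Phi>"
  have T: "?T \<in> carrier_mat d d"
    using \<Phi> by simp
  obtain B where B: "B \<in> carrier_mat d d" "\<And>i j. i < d \<Longrightarrow> j < d \<Longrightarrow> B $$ (i, j) \<in> kbar_rats \<iota>"
    "?T * B = 1\<^sub>m d" "B * ?T = 1\<^sub>m d"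
    using kbarr.inverse_mat_mem[of ?T d] \<Phi> det_transpose[OF \<Phi>(1)] by auto
  let ?s = "\<lambda>x. ?T *\<^sub>v map_vec (twist \<iota>) x"
  have inj: "x = y" if xy: "x \<in> V d" "y \<in> V d" "?s x = ?s y" for x y
  proof -
    have "B *\<^sub>v ?s x = B *\<^sub>v ?s y"
      using xy by simp
    then have "(B * ?T) *\<^sub>v map_vec (twist \<iota>) x = (B * ?T) *\<^sub>v map_vec (twist \<iota>) y"
      using xy(1,2) B(1) T by (simp add: assoc_mult_mat_vec[of _ d d _ d] vecs_in_carrier)
    then have "map_vec (twist \<iota>) x = map_vec (twist \<iota>) y"
      using xy(1,2) unfolding B(4) by (simp add: vecs_in_carrier)
    then show ?thesis
      using xy(1,2) by (intro eq_vecI) (auto simp: vec_eq_iff)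
  qed
  \<comment> \<open>The matrix is inverted first; then each coordinate is untwisted inside
    kbar(t).\<close>
  have surj: "\<exists>x\<in>V d. ?s x = y" if y: "y \<in> V d" for y
  proof -
    have z: "B *\<^sub>v y \<in> V d"
      using kbarr.vecs_in_mult_mat[OF B(1,2) y] by blast
    have "\<forall>i<d. \<exists>g\<in>kbar_rats \<iota>. twist \<iota> g = (B *\<^sub>v y) $ i"
      using twist_surj_kbar_rats vecs_in_nth[OF z] by blast
    then obtain g where g: "\<And>i. i < d \<Longrightarrow> g i \<in> kbar_rats \<iota> \<and> twist \<iota> (g i) = (B *\<^sub>v y) $ i"
      by metis
    have "map_vec (twist \<iota>) (vec d g) = B *\<^sub>v y"
    proof (rule eq_vecI)
      fix i assume "i < dim_vec (B *\<^sub>v y)"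
      then have "i < d"
        using B(1) by simp
      then show "map_vec (twist \<iota>) (vec d g) $ i = (B *\<^sub>v y) $ i"
        using g by (simp del: index_mult_mat_vec)
    qed (use B(1) in simp)
    then have "?s (vec d g) = (?T * B) *\<^sub>v y"
      using B(1) T y by (simp add: assoc_mult_mat_vec[of _ d d _ d] vecs_in_carrier)
    also have "\<dots> = y"
      unfolding B(3) using y by (simp add: vecs_in_carrier)
    finally show ?thesis
      using g by (intro bexI[of _ "vec d g"] vecs_inI) auto
  qed
  have "bij_betw ?s (V d) (V d)"
    unfolding bij_betw_def using inj surj sigma_closed[OF v] by (auto simp: inj_on_def image_iff) metis
  moreover have "?s (x + y) = ?s x + ?s y" if "x \<in> V d" "y \<in> V d" for x y
    using that T by (simp add: map_vec_twist_add[of _ d] mult_add_distrib_mat_vec[of _ d d] vecs_in_carrier)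
  moreover have "?s (f \<cdot>\<^sub>v x) = twist \<iota> f \<cdot>\<^sub>v ?s x" if "x \<in> V d" for f x
    using that T by (simp add: map_vec_twist_smult mult_mat_vec[of _ d d] vecs_in_carrier)
  moreover have "\<exists>b. is_basis (kbar_rats \<iota>) (motive_of \<iota> \<Phi>) (carrier (motive_of \<iota> \<Phi>)) b"
    using represented_by_unit_vecs[OF v] unfolding represented_by_def by blast
  ultimately show ?thesis
    unfolding pre_t_motive_def using module_motive_of by (auto simp: dim)
qed

definition trivialised_by :: "'c fls mat \<Rightarrow> 'c fls mat \<Rightarrow> nat \<Rightarrow> bool" where
  "trivialised_by \<Phi> \<Psi> d \<longleftrightarrow> valid \<Phi> d \<and> \<Psi> \<in> carrier_mat d d \<and>
     (\<forall>i<d. \<forall>j<d. \<Psi> $$ (i, j) \<in> tate_fractions) \<and> det \<Psi> \<noteq> 0 \<and> map_mat (twist \<iota>) \<Psi> = \<Phi> * \<Psi>"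

lemma rat_motive_motive_of:
  assumes "trivialised_by \<Phi> \<Psi> d"
  shows "rat_motive \<iota> (motive_of \<iota> \<Phi>)"
proof -
  have v: "valid \<Phi> d"
    using assms by (simp add: trivialised_by_def)
  have "rigid_analytically_trivial \<iota> (motive_of \<iota> \<Phi>)"
    unfolding rigid_analytically_trivial_def
    by (intro exI[of _ "unit_vecs d"] exI[of _ \<Phi>] exI[of _ \<Psi>])
      (use assms represented_by_unit_vecs[OF v] invertible_mat_of_det[of \<Psi> d] in
        \<open>auto simp: trivialised_by_def elements_mat_subset_iff\<close>)
  then show ?thesis
    unfolding rat_motive_def using pre_t_motive_motive_of[OF v] by simp
qed

text \<open>Coordinate vectors are row vectors, so a matrix \<open>B\<close> acts by \<open>x \<mapsto> x B\<close>.\<close>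

lemma ptm_hom_matrix:
  assumes v: "valid \<Phi> d" "valid \<Phi>' e"
    and B: "B \<in> carrier_mat d e" "\<And>i j. i < d \<Longrightarrow> j < e \<Longrightarrow> B $$ (i, j) \<in> kbar_rats \<iota>"
    and comm: "\<Phi> * B = map_mat (twist \<iota>) B * \<Phi>'"
  shows "(\<lambda>x\<in>V d. transpose_mat B *\<^sub>v x) \<in> ptm_hom \<iota> (motive_of \<iota> \<Phi>) (motive_of \<iota> \<Phi>')"
proof -
  let ?f = "\<lambda>x. transpose_mat B *\<^sub>v x"
  have \<Phi>: "\<Phi> \<in> carrier_mat d d" "\<Phi>' \<in> carrier_mat e e"
    using v by (auto simp: valid_def)
  have BT: "transpose_mat B \<in> carrier_mat e d"
    using B by simp
  have closed: "?f x \<in> V e" if "x \<in> V d" for x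
    using that B by (intro kbarr.vecs_in_mult_mat[OF BT]) auto
  have sig: "?f (transpose_mat \<Phi> *\<^sub>v map_vec (twist \<iota>) x) = transpose_mat \<Phi>' *\<^sub>v map_vec (twist \<iota>) (?f x)"
    if x: "x \<in> V d" for x
  proof -
    let ?x = "map_vec (twist \<iota>) x"
    have xc: "?x \<in> carrier_vec d"
      using x by (simp add: vecs_in_carrier)
    have "?f (transpose_mat \<Phi> *\<^sub>v ?x) = (transpose_mat B * transpose_mat \<Phi>) *\<^sub>v ?x"
      using BT \<Phi>(1) xc by (simp add: assoc_mult_mat_vec[of _ e d _ d])
    also have "transpose_mat B * transpose_mat \<Phi> = transpose_mat (\<Phi> * B)"
      using transpose_mult[OF \<Phi>(1) B(1)] by simp
    also have "\<dots> = transpose_mat \<Phi>' * transpose_mat (map_mat (twist \<iota>) B)"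
      unfolding comm using transpose_mult[of "map_mat (twist \<iota>) B" d e \<Phi>' e] B(1) \<Phi>(2) by simp
    also have "transpose_mat (map_mat (twist \<iota>) B) = map_mat (twist \<iota>) (transpose_mat B)"
      by (intro eq_matI) auto
    also have "(transpose_mat \<Phi>' * map_mat (twist \<iota>) (transpose_mat B)) *\<^sub>v ?x
        = transpose_mat \<Phi>' *\<^sub>v (map_mat (twist \<iota>) (transpose_mat B) *\<^sub>v ?x)"
      using B(1) \<Phi>(2) xc by (intro assoc_mult_mat_vec[of _ e e _ d]) auto
    also have "map_mat (twist \<iota>) (transpose_mat B) *\<^sub>v ?x = map_vec (twist \<iota>) (?f x)"
      using map_vec_twist_mult_mat[OF BT] x by (simp add: vecs_in_carrier)
    finally show ?thesis .
  qed
  have "?f (x + y) = ?f x + ?f y" if "x \<in> V d" "y \<in> V d" for x y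
    using that BT by (simp add: mult_add_distrib_mat_vec[of _ e d] vecs_in_carrier)
  moreover have "?f (a \<cdot>\<^sub>v x) = a \<cdot>\<^sub>v ?f x" if "x \<in> V d" for a x
    using that BT by (simp add: mult_mat_vec[of _ e d] vecs_in_carrier)
  ultimately show ?thesis
    unfolding ptm_hom_def using closed sig \<Phi> sigma_closed[OF v(1)]
    by (auto simp: V_add V_smult)
qed

end

lemma det_2:
  fixes A :: "'a::comm_ring_1 mat"
  assumes A: "A \<in> carrier_mat 2 2"
  shows "det A = A $$ (0, 0) * A $$ (Suc 0, Suc 0) - A $$ (0, Suc 0) * A $$ (Suc 0, 0)"
proof -
  have det_1: "det (mat (Suc 0) (Suc 0) f) = f (0, 0)" for f :: "nat \<times> nat \<Rightarrow> 'a"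
    by (subst det_single) auto
  have "det A = (\<Sum>i<2. A $$ (i, 0) * cofactor A i 0)"
    using laplace_expansion_column[OF A, of 0] by simp
  also have "\<dots> = A $$ (0, 0) * A $$ (Suc 0, Suc 0) - A $$ (0, Suc 0) * A $$ (Suc 0, 0)"
    using A by (simp add: numeral_2_eq_2 cofactor_def det_1 mat_delete_def mult.commute)
  finally show ?thesis .
qed

context drinfeld
begin

section \<open>Constructions of trivialised matrices\<close>

lemma X_neq_const [simp]: "fls_X \<noteq> fls_const (c :: 'c)"
  using X_minus_const_nonzero[of c] by (metis diff_self)

text \<open>For n at least N1 + N2, every product in the Cauchy sum has one small factor and one
  bounded by M. By the ultrametric inequality the number of products is irrelevant.\<close>

lemma null_mult:
  fixes F G :: "'c fps"
  assumes "fps_nth F \<longlonglongrightarrow> 0" "fps_nth G \<longlonglongrightarrow> 0"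
  shows "fps_nth (F * G) \<longlonglongrightarrow> 0"
  unfolding null_iff
proof (rule LIMSEQ_I)
  fix r :: real assume r: "r > 0"
  have bounded: "\<exists>M>0. \<forall>n. nm (fps_nth H n) \<le> M" if "fps_nth H \<longlonglongrightarrow> 0" for H
  proof -
    have "Bseq (\<lambda>n. nm (fps_nth H n))"
      using that unfolding null_iff by (intro convergent_imp_Bseq convergentI)
    then show ?thesis
      unfolding Bseq_def by auto
  qed
  obtain M1 M2 where M: "M1 > 0" "M2 > 0" "\<And>n. nm (fps_nth F n) \<le> M1" "\<And>n. nm (fps_nth G n) \<le> M2"
    using bounded[OF assms(1)] bounded[OF assms(2)] by blast
  define M where "M = max M1 M2"
  have M: "M > 0" "\<And>n. nm (fps_nth F n) \<le> M" "\<And>n. nm (fps_nth G n) \<le> M"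
    using M by (auto simp: M_def intro: max.coboundedI1 max.coboundedI2)
  have small: "\<exists>N. \<forall>n\<ge>N. nm (fps_nth H n) < r / (2 * M)" if "fps_nth H \<longlonglongrightarrow> 0" for H
    using that M(1) r order_tendstoD(2)[of "\<lambda>n. nm (fps_nth H n)" 0 sequentially "r / (2 * M)"]
    unfolding null_iff eventually_sequentially by auto
  obtain N1 N2 where N: "\<And>n. n \<ge> N1 \<Longrightarrow> nm (fps_nth F n) < r / (2 * M)" "\<And>n. n \<ge> N2 \<Longrightarrow> nm (fps_nth G n) < r / (2 * M)"
    using small[OF assms(1)] small[OF assms(2)] by blast
  have "nm (fps_nth (F * G) n) < r" if n: "n \<ge> N1 + N2" for n
  proof -
    have "nm (fps_nth (F * G) n) \<le> r / 2"
      unfolding fps_mult_nth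
    proof (rule nm_sum_le)
      fix i assume "i \<in> {0..n}"
      show "nm (fps_nth F i * fps_nth G (n - i)) \<le> r / 2"
      proof (cases "i \<ge> N1")
        case True
        then have "nm (fps_nth F i) * nm (fps_nth G (n - i)) \<le> r / (2 * M) * M"
          using N(1)[OF True] M r by (intro mult_mono) auto
        then show ?thesis
          using M(1) by (simp add: abs_mult)
      next
        case False
        then have "nm (fps_nth F i) * nm (fps_nth G (n - i)) \<le> M * (r / (2 * M))"
          using M r n by (intro mult_mono less_imp_le[OF N(2)]) auto
        then show ?thesis
          using M(1) by (simp add: abs_mult)
      qed
    qed (use r in simp)
    then show ?thesis
      using r by simp
  qed
  then show "\<exists>no. \<forall>n\<ge>no. norm (nm (fps_nth (F * G) n) - 0) < r"
    by auto
qed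

lemma tate_fractions_mult:
  assumes "(f :: 'c fls) \<in> tate_fractions" "g \<in> tate_fractions"
  shows "f * g \<in> tate_fractions"
proof -
  obtain a b where ab: "f = fps_to_fls a / fps_to_fls b" "fps_nth a \<longlonglongrightarrow> 0" "fps_nth b \<longlonglongrightarrow> 0" "b \<noteq> 0"
    using assms(1) unfolding tate_fractions_def by blast
  obtain c d where cd: "g = fps_to_fls c / fps_to_fls d" "fps_nth c \<longlonglongrightarrow> 0" "fps_nth d \<longlonglongrightarrow> 0" "d \<noteq> 0"
    using assms(2) unfolding tate_fractions_def by blast
  have "f * g = fps_to_fls (a * c) / fps_to_fls (b * d)"
    unfolding ab(1) cd(1) by (simp add: fls_times_fps_to_fls)
  then show ?thesis
    unfolding tate_fractions_def using ab cd null_mult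
    by (intro CollectI exI[of _ "a * c"] exI[of _ "b * d"]) auto
qed

lemma tate_fractions_0: "(0 :: 'c fls) \<in> tate_fractions"
  using tate_L_0 tate_L_subset by auto

lemma tate_L_1: "1 \<in> tate_L"
proof -
  have "fps_nth (1 :: 'c fps) \<longlonglongrightarrow> 0"
    by (rule tendsto_eventually) (auto simp: eventually_sequentially intro!: exI[of _ 1])
  moreover have "\<forall>n. fps_nth (1 :: 'c fps) n \<in> L"
    using L.zero_mem L.one_mem by auto
  ultimately show ?thesis
    unfolding tate_L_def by (intro CollectI exI[of _ 1]) simp
qed

lemma tate_fractions_1: "(1 :: 'c fls) \<in> tate_fractions"
  using tate_L_1 tate_L_subset by auto

lemma tate_L_inverse:
  assumes "f \<in> tate_L" "f \<noteq> 0"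
  shows "1 / f \<in> tate_fractions"
proof -
  obtain F where F: "f = fps_to_fls F" "fps_nth F \<longlonglongrightarrow> 0"
    using assms(1) unfolding tate_L_def by blast
  have "fps_nth (1 :: 'c fps) \<longlonglongrightarrow> 0"
    by (rule tendsto_eventually) (auto simp: eventually_sequentially intro!: exI[of _ 1])
  then show ?thesis
    unfolding tate_fractions_def using F assms(2)
    by (intro CollectI exI[of _ 1] exI[of _ F]) auto
qed

text \<open>\<open>eq\<close> is the lower left block of the trivialisation equation for block
  triangular matrices, so an additional row amounts to one Artin-Schreier equation per
  entry.\<close>

lemma trivialised_by_lower_block:
  assumes trivialised_by: "trivialised_by \<Phi> \<Psi> m"
    and U: "U \<in> carrier_mat k m" "\<And>i j. i < k \<Longrightarrow> j < m \<Longrightarrow> U $$ (i, j) \<in> kbar_rats \<iota>"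
    and X: "X \<in> carrier_mat k m" "\<And>i j. i < k \<Longrightarrow> j < m \<Longrightarrow> X $$ (i, j) \<in> tate_fractions"
    and eq: "map_mat (twist \<iota>) X = U * \<Psi> + X"
  shows "trivialised_by (four_block_mat \<Phi> (0\<^sub>m m k) U (1\<^sub>m k)) (four_block_mat \<Psi> (0\<^sub>m m k) X (1\<^sub>m k)) (m + k)"
proof -
  have P: "\<Phi> \<in> carrier_mat m m" "\<And>i j. i < m \<Longrightarrow> j < m \<Longrightarrow> \<Phi> $$ (i, j) \<in> kbar_rats \<iota>" "det \<Phi> \<noteq> 0"
    "\<Psi> \<in> carrier_mat m m" "\<And>i j. i < m \<Longrightarrow> j < m \<Longrightarrow> \<Psi> $$ (i, j) \<in> tate_fractions" "det \<Psi> \<noteq> 0"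
    "map_mat (twist \<iota>) \<Psi> = \<Phi> * \<Psi>"
    using trivialised_by by (auto simp: trivialised_by_def valid_def)
  have "det (four_block_mat \<Phi> (0\<^sub>m m k) U (1\<^sub>m k)) \<noteq> 0"
    using det_four_block_mat_upper_right_zero[OF P(1) refl U(1), of "1\<^sub>m k"] P(3) by simp
  moreover have "det (four_block_mat \<Psi> (0\<^sub>m m k) X (1\<^sub>m k)) \<noteq> 0"
    using det_four_block_mat_upper_right_zero[OF P(4) refl X(1), of "1\<^sub>m k"] P(6) by simp
  moreover have "map_mat (twist \<iota>) (four_block_mat \<Psi> (0\<^sub>m m k) X (1\<^sub>m k))
      = four_block_mat (map_mat (twist \<iota>) \<Psi>) (0\<^sub>m m k) (map_mat (twist \<iota>) X) (1\<^sub>m k)"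
    using P(4) X(1) by (intro eq_matI) auto
  moreover have "four_block_mat \<Phi> (0\<^sub>m m k) U (1\<^sub>m k) * four_block_mat \<Psi> (0\<^sub>m m k) X (1\<^sub>m k)
      = four_block_mat (\<Phi> * \<Psi>) (0\<^sub>m m k) (U * \<Psi> + X) (1\<^sub>m k)"
    using P(1,4) U(1) X(1)
    by (subst mult_four_block_mat[of _ m m _ k _ k]) (auto simp: left_add_zero_mat[of _ m m])
  ultimately show ?thesis
    unfolding trivialised_by_def valid_def
    using P U X eq
    by (auto simp: four_block_mat_def Let_def kbarr.mems tate_fractions_0 tate_fractions_1)
qed

lemma trivialised_by_direct_sum:
  assumes "trivialised_by \<Phi> \<Psi> m" "trivialised_by \<Phi>' \<Psi>' k"
  shows "trivialised_by (four_block_mat \<Phi> (0\<^sub>m m k) (0\<^sub>m k m) \<Phi>') (four_block_mat \<Psi> (0\<^sub>m m k) (0\<^sub>m k m) \<Psi>') (m + k)"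
proof -
  have P: "\<Phi> \<in> carrier_mat m m" "\<And>i j. i < m \<Longrightarrow> j < m \<Longrightarrow> \<Phi> $$ (i, j) \<in> kbar_rats \<iota>" "det \<Phi> \<noteq> 0"
    "\<Psi> \<in> carrier_mat m m" "\<And>i j. i < m \<Longrightarrow> j < m \<Longrightarrow> \<Psi> $$ (i, j) \<in> tate_fractions" "det \<Psi> \<noteq> 0"
    "map_mat (twist \<iota>) \<Psi> = \<Phi> * \<Psi>"
    using assms(1) by (auto simp: trivialised_by_def valid_def)
  have Q: "\<Phi>' \<in> carrier_mat k k" "\<And>i j. i < k \<Longrightarrow> j < k \<Longrightarrow> \<Phi>' $$ (i, j) \<in> kbar_rats \<iota>" "det \<Phi>' \<noteq> 0"
    "\<Psi>' \<in> carrier_mat k k" "\<And>i j. i < k \<Longrightarrow> j < k \<Longrightarrow> \<Psi>' $$ (i, j) \<in> tate_fractions" "det \<Psi>' \<noteq> 0"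
    "map_mat (twist \<iota>) \<Psi>' = \<Phi>' * \<Psi>'"
    using assms(2) by (auto simp: trivialised_by_def valid_def)
  have "det (four_block_mat \<Phi> (0\<^sub>m m k) (0\<^sub>m k m) \<Phi>') \<noteq> 0" "det (four_block_mat \<Psi> (0\<^sub>m m k) (0\<^sub>m k m) \<Psi>') \<noteq> 0"
    using det_four_block_mat_upper_right_zero[OF P(1) refl _ Q(1)] P(3) Q(3)
      det_four_block_mat_upper_right_zero[OF P(4) refl _ Q(4)] P(6) Q(6) by simp_all
  moreover have "map_mat (twist \<iota>) (four_block_mat \<Psi> (0\<^sub>m m k) (0\<^sub>m k m) \<Psi>')
      = four_block_mat (map_mat (twist \<iota>) \<Psi>) (0\<^sub>m m k) (0\<^sub>m k m) (map_mat (twist \<iota>) \<Psi>')"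
    using P(4) Q(4) by (intro eq_matI) auto
  moreover have "four_block_mat \<Phi> (0\<^sub>m m k) (0\<^sub>m k m) \<Phi>' * four_block_mat \<Psi> (0\<^sub>m m k) (0\<^sub>m k m) \<Psi>'
      = four_block_mat (\<Phi> * \<Psi>) (0\<^sub>m m k) (0\<^sub>m k m) (\<Phi>' * \<Psi>')"
    using P(1,4) Q(1,4) by (subst mult_four_block_mat[of _ m m _ k _ k]) auto
  ultimately show ?thesis
    unfolding trivialised_by_def valid_def
    using P Q
    by (auto simp: four_block_mat_def Let_def kbarr.mems tate_fractions_0 tate_fractions_1)
qed

lemma T_mem_kbar_rats: "T \<in> kbar_rats \<iota>"
  by (rule kbar_polys_subset_rats[OF X_theta_mem_kbar_polys])

lemma K_mem_kbar_polys: "K \<in> kbar_polys \<iota>"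
  using kappa_mem by (intro const_mem_kbar_polys) simp

lemma K_mem_kbar_rats: "K \<in> kbar_rats \<iota>"
  by (rule kbar_polys_subset_rats[OF K_mem_kbar_polys])

text \<open>The tensor product with the Carlitz motive in terms of matrices.\<close>

lemma trivialised_by_scale:
  assumes trivialised_by: "trivialised_by \<Phi> \<Psi> d" and c: "c \<in> tate_L" "c \<noteq> 0" "twist \<iota> c = T * c"
  shows "trivialised_by (T \<cdot>\<^sub>m \<Phi>) (c \<cdot>\<^sub>m \<Psi>) d"
proof -
  have P: "\<Phi> \<in> carrier_mat d d" "\<And>i j. i < d \<Longrightarrow> j < d \<Longrightarrow> \<Phi> $$ (i, j) \<in> kbar_rats \<iota>" "det \<Phi> \<noteq> 0"
    "\<Psi> \<in> carrier_mat d d" "\<And>i j. i < d \<Longrightarrow> j < d \<Longrightarrow> \<Psi> $$ (i, j) \<in> tate_fractions" "det \<Psi> \<noteq> 0"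
    "map_mat (twist \<iota>) \<Psi> = \<Phi> * \<Psi>"
    using trivialised_by by (auto simp: trivialised_by_def valid_def)
  have "det (T \<cdot>\<^sub>m \<Phi>) \<noteq> 0" "det (c \<cdot>\<^sub>m \<Psi>) \<noteq> 0"
    using P c(2) by simp_all
  moreover have "map_mat (twist \<iota>) (c \<cdot>\<^sub>m \<Psi>) = (T * c) \<cdot>\<^sub>m map_mat (twist \<iota>) \<Psi>"
    using P(4) c(3) by (intro eq_matI) (auto simp: tw.hom_mult)
  moreover have "(T \<cdot>\<^sub>m \<Phi>) * (c \<cdot>\<^sub>m \<Psi>) = (T * c) \<cdot>\<^sub>m (\<Phi> * \<Psi>)"
    using P(1,4) by (intro eq_matI) (auto simp: mult_ac)
  moreover have "c \<in> tate_fractions"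
    using c(1) tate_L_subset by blast
  ultimately show ?thesis
    unfolding trivialised_by_def valid_def
    using P T_mem_kbar_rats by (auto intro: kbarr.mult_mem tate_fractions_mult)
qed

lemma trivialised_by_one: "trivialised_by (1\<^sub>m 1) (1\<^sub>m 1) 1"
proof -
  have "map_mat (twist \<iota>) (1\<^sub>m 1) = 1\<^sub>m 1"
    by (intro eq_matI) auto
  then show ?thesis
    unfolding trivialised_by_def valid_def by (auto simp: kbarr.mems tate_fractions_1)
qed

text \<open>Chosen once and for all, so that every later trivialisation has the same upper block
  \<open>Psi_rho\<close>.\<close>

definition fundamental_solutions :: "'c fls \<times> 'c fls" where
  "fundamental_solutions = (SOME s. fst s \<in> tate_L \<and> snd s \<in> tate_L \<and>
     twist \<iota> (twist \<iota> (fst s)) = T * fst s - K * twist \<iota> (fst s) \<and>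
     twist \<iota> (twist \<iota> (snd s)) = T * snd s - K * twist \<iota> (snd s) \<and>
     fst s * twist \<iota> (snd s) \<noteq> snd s * twist \<iota> (fst s))"

lemma fundamental_solutions: "fst fundamental_solutions \<in> tate_L" "snd fundamental_solutions \<in> tate_L"
    "twist \<iota> (twist \<iota> (fst fundamental_solutions)) = T * fst fundamental_solutions - K * twist \<iota> (fst fundamental_solutions)"
    "twist \<iota> (twist \<iota> (snd fundamental_solutions)) = T * snd fundamental_solutions - K * twist \<iota> (snd fundamental_solutions)"
    "fst fundamental_solutions * twist \<iota> (snd fundamental_solutions) \<noteq> snd fundamental_solutions * twist \<iota> (fst fundamental_solutions)"
proof -
  obtain A B where "A \<in> tate_L" "B \<in> tate_L"
    "twist \<iota> (twist \<iota> A) = T * A - K * twist \<iota> A" "twist \<iota> (twist \<iota> B) = T * B - K * twist \<iota> B"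
    "A * twist \<iota> B \<noteq> B * twist \<iota> A"
    by (rule rho_fundamental_solutions)
  then have "\<exists>s. fst s \<in> tate_L \<and> snd s \<in> tate_L \<and>
     twist \<iota> (twist \<iota> (fst s)) = T * fst s - K * twist \<iota> (fst s) \<and>
     twist \<iota> (twist \<iota> (snd s)) = T * snd s - K * twist \<iota> (snd s) \<and>
     fst s * twist \<iota> (snd s) \<noteq> snd s * twist \<iota> (fst s)"
    by (intro exI[of _ "(A, B)"]) simp
  from someI_ex[OF this] show "fst fundamental_solutions \<in> tate_L" "snd fundamental_solutions \<in> tate_L"
    "twist \<iota> (twist \<iota> (fst fundamental_solutions)) = T * fst fundamental_solutions - K * twist \<iota> (fst fundamental_solutions)"
    "twist \<iota> (twist \<iota> (snd fundamental_solutions)) = T * snd fundamental_solutions - K * twist \<iota> (snd fundamental_solutions)"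
    "fst fundamental_solutions * twist \<iota> (snd fundamental_solutions) \<noteq> snd fundamental_solutions * twist \<iota> (fst fundamental_solutions)"
    unfolding fundamental_solutions_def by simp_all
qed

definition Psi_rho :: "'c fls mat" where
  "Psi_rho = mat_of_rows_list 2 [[fst fundamental_solutions, snd fundamental_solutions], [twist \<iota> (fst fundamental_solutions), twist \<iota> (snd fundamental_solutions)]]"

lemma Phi_rho_eq: "Phi_rho \<iota> \<kappa> = mat_of_rows_list 2 [[0, 1], [T, - K]]"
  by (simp add: Phi_rho_def)

lemma less_2_iff_or: "i < (2::nat) \<longleftrightarrow> i = 0 \<or> i = 1"
  by auto

lemma Phi_rho_carrier [simp]: "Phi_rho \<iota> \<kappa> \<in> carrier_mat 2 2"
  by (simp add: Phi_rho_eq mat_of_rows_list_def numeral_2_eq_2)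

lemma Phi_rho_dims [simp]: "dim_row (Phi_rho \<iota> \<kappa>) = 2" "dim_col (Phi_rho \<iota> \<kappa>) = 2"
  by (simp_all add: Phi_rho_eq mat_of_rows_list_def)

lemma Phi_rho_nth [simp]:
  "Phi_rho \<iota> \<kappa> $$ (0, 0) = 0" "Phi_rho \<iota> \<kappa> $$ (0, Suc 0) = 1"
  "Phi_rho \<iota> \<kappa> $$ (Suc 0, 0) = T" "Phi_rho \<iota> \<kappa> $$ (Suc 0, Suc 0) = - K"
  by (simp_all add: Phi_rho_eq mat_of_rows_list_def)

lemma trivialised_by_rho: "trivialised_by (Phi_rho \<iota> \<kappa>) Psi_rho 2"
proof -
  let ?A = "fst fundamental_solutions" and ?B = "snd fundamental_solutions"
  have P: "Psi_rho \<in> carrier_mat 2 2"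
    by (simp add: Psi_rho_def mat_of_rows_list_def numeral_2_eq_2)
  have nth: "Psi_rho $$ (0, 0) = ?A" "Psi_rho $$ (0, Suc 0) = ?B" "Psi_rho $$ (Suc 0, 0) = twist \<iota> ?A"
    "Psi_rho $$ (Suc 0, Suc 0) = twist \<iota> ?B"
    by (simp_all add: Psi_rho_def mat_of_rows_list_def)
  have "det (Phi_rho \<iota> \<kappa>) = - T"
    by (subst det_2) simp_all
  then have d1: "det (Phi_rho \<iota> \<kappa>) \<noteq> 0"
    using X_minus_const_nonzero[of \<theta>] by (metis neg_equal_0_iff_equal)
  have d2: "det Psi_rho \<noteq> 0"
    using fundamental_solutions(5) by (subst det_2[OF P]) (simp add: nth mult.commute)
  have tate: "?A \<in> tate_fractions" "?B \<in> tate_fractions" "twist \<iota> ?A \<in> tate_fractions" "twist \<iota> ?B \<in> tate_fractions"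
    using fundamental_solutions(1,2) tate_L_twist tate_L_subset by blast+
  have eq: "map_mat (twist \<iota>) Psi_rho = Phi_rho \<iota> \<kappa> * Psi_rho"
  proof (rule eq_matI)
    fix i j assume "i < dim_row (Phi_rho \<iota> \<kappa> * Psi_rho)" "j < dim_col (Phi_rho \<iota> \<kappa> * Psi_rho)"
    then have "i < 2" "j < 2"
      using P by auto
    then show "map_mat (twist \<iota>) Psi_rho $$ (i, j) = (Phi_rho \<iota> \<kappa> * Psi_rho) $$ (i, j)"
      using P fundamental_solutions(3,4) by (auto simp: less_Suc_eq nth scalar_prod_def numeral_2_eq_2)
  qed (use P in auto)
  show ?thesis
    unfolding trivialised_by_def valid_def
    using P d1 d2 eq tate T_mem_kbar_rats K_mem_kbar_rats
    by (auto simp: less_2_iff_or nth kbarr.mems)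
qed

definition row1 :: "'c fls \<times> 'c fls \<Rightarrow> 'c fls mat" where
  "row1 v = mat_of_rows_list 2 [[fst v, snd v]]"

definition row2 :: "'c fls \<times> 'c fls \<Rightarrow> 'c fls \<times> 'c fls \<Rightarrow> 'c fls mat" where
  "row2 v w = mat_of_rows_list 2 [[fst v, snd v], [fst w, snd w]]"

definition Phi_v :: "'c fls \<times> 'c fls \<Rightarrow> 'c fls mat" where
  "Phi_v v = four_block_mat (Phi_rho \<iota> \<kappa>) (0\<^sub>m 2 1) (row1 v) (1\<^sub>m 1)"

text \<open>An extension of the direct sum of two trivial motives by \<open>M_rho\<close>; it is the
  intermediate object when two bottom rows are added.\<close>

definition Phi_vw :: "'c fls \<times> 'c fls \<Rightarrow> 'c fls \<times> 'c fls \<Rightarrow> 'c fls mat" where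
  "Phi_vw v w = four_block_mat (Phi_rho \<iota> \<kappa>) (0\<^sub>m 2 2) (row2 v w) (1\<^sub>m 2)"

lemma Phi_alpha_eq: "Phi_alpha \<iota> \<kappa> \<alpha> = Phi_v (fls_const \<alpha>, 0)"
  by (simp add: Phi_alpha_def Phi_v_def row1_def)

lemma fq_denominators_row_solution:
  assumes "fq_denominators v"
  obtains x1 x2 where "x1 \<in> tate_fractions" "x2 \<in> tate_fractions"
    "twist \<iota> x1 = (fst v * Psi_rho $$ (0, 0) + snd v * Psi_rho $$ (Suc 0, 0)) + x1"
    "twist \<iota> x2 = (fst v * Psi_rho $$ (0, Suc 0) + snd v * Psi_rho $$ (Suc 0, Suc 0)) + x2"
proof -
  obtain x1 where "x1 \<in> tate_fractions" "twist \<iota> x1 = fst v * fst fundamental_solutions + snd v * twist \<iota> (fst fundamental_solutions) + x1"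
    by (rule fq_denominators_artin_schreier[OF assms fundamental_solutions(1)])
  moreover obtain x2 where "x2 \<in> tate_fractions" "twist \<iota> x2 = fst v * snd fundamental_solutions + snd v * twist \<iota> (snd fundamental_solutions) + x2"
    by (rule fq_denominators_artin_schreier[OF assms fundamental_solutions(2)])
  ultimately show ?thesis
    by (intro that[of x1 x2]) (simp_all add: Psi_rho_def mat_of_rows_list_def)
qed

lemma Psi_rho_carrier: "Psi_rho \<in> carrier_mat 2 2"
  by (simp add: Psi_rho_def mat_of_rows_list_def numeral_2_eq_2)

lemma trivialised_by_Phi_v:
  assumes "fq_denominators v"
  obtains \<Psi> where "trivialised_by (Phi_v v) \<Psi> 3"
proof -
  obtain x1 x2 where x: "x1 \<in> tate_fractions" "x2 \<in> tate_fractions"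
    "twist \<iota> x1 = (fst v * Psi_rho $$ (0, 0) + snd v * Psi_rho $$ (Suc 0, 0)) + x1"
    "twist \<iota> x2 = (fst v * Psi_rho $$ (0, Suc 0) + snd v * Psi_rho $$ (Suc 0, Suc 0)) + x2"
    by (rule fq_denominators_row_solution[OF assms])
  have P: "Psi_rho \<in> carrier_mat 2 2"
    by (rule Psi_rho_carrier)
  have "trivialised_by (four_block_mat (Phi_rho \<iota> \<kappa>) (0\<^sub>m 2 1) (row1 v) (1\<^sub>m 1))
      (four_block_mat Psi_rho (0\<^sub>m 2 1) (row1 (x1, x2)) (1\<^sub>m 1)) (2 + 1)"
  proof (rule trivialised_by_lower_block[OF trivialised_by_rho])
    show "map_mat (twist \<iota>) (row1 (x1, x2)) = row1 v * Psi_rho + row1 (x1, x2)"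
    proof (rule eq_matI)
      fix i j assume "i < dim_row (row1 v * Psi_rho + row1 (x1, x2))" "j < dim_col (row1 v * Psi_rho + row1 (x1, x2))"
      then have "i = 0" "j < 2"
        by (auto simp: row1_def mat_of_rows_list_def)
      then show "map_mat (twist \<iota>) (row1 (x1, x2)) $$ (i, j) = (row1 v * Psi_rho + row1 (x1, x2)) $$ (i, j)"
        using P x(3,4) by (auto simp: less_Suc_eq row1_def mat_of_rows_list_def scalar_prod_def numeral_2_eq_2)
    qed (use P in \<open>auto simp: row1_def mat_of_rows_list_def\<close>)
  qed (use x assms in \<open>auto simp: row1_def mat_of_rows_list_def less_2_iff_or fq_denominators_def\<close>)
  then show ?thesis
    using that unfolding Phi_v_def by simp
qed

lemma trivialised_by_Phi_vw:
  assumes "fq_denominators v" "fq_denominators w"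
  obtains \<Psi> where "trivialised_by (Phi_vw v w) \<Psi> 4"
proof -
  obtain x1 x2 where x: "x1 \<in> tate_fractions" "x2 \<in> tate_fractions"
    "twist \<iota> x1 = (fst v * Psi_rho $$ (0, 0) + snd v * Psi_rho $$ (Suc 0, 0)) + x1"
    "twist \<iota> x2 = (fst v * Psi_rho $$ (0, Suc 0) + snd v * Psi_rho $$ (Suc 0, Suc 0)) + x2"
    by (rule fq_denominators_row_solution[OF assms(1)])
  obtain y1 y2 where y: "y1 \<in> tate_fractions" "y2 \<in> tate_fractions"
    "twist \<iota> y1 = (fst w * Psi_rho $$ (0, 0) + snd w * Psi_rho $$ (Suc 0, 0)) + y1"
    "twist \<iota> y2 = (fst w * Psi_rho $$ (0, Suc 0) + snd w * Psi_rho $$ (Suc 0, Suc 0)) + y2"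
    by (rule fq_denominators_row_solution[OF assms(2)])
  have P: "Psi_rho \<in> carrier_mat 2 2"
    by (rule Psi_rho_carrier)
  have "trivialised_by (four_block_mat (Phi_rho \<iota> \<kappa>) (0\<^sub>m 2 2) (row2 v w) (1\<^sub>m 2))
      (four_block_mat Psi_rho (0\<^sub>m 2 2) (row2 (x1, x2) (y1, y2)) (1\<^sub>m 2)) (2 + 2)"
  proof (rule trivialised_by_lower_block[OF trivialised_by_rho])
    show "map_mat (twist \<iota>) (row2 (x1, x2) (y1, y2)) = row2 v w * Psi_rho + row2 (x1, x2) (y1, y2)"
    proof (rule eq_matI)
      fix i j assume "i < dim_row (row2 v w * Psi_rho + row2 (x1, x2) (y1, y2))"
        "j < dim_col (row2 v w * Psi_rho + row2 (x1, x2) (y1, y2))"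
      then have "i < 2" "j < 2"
        by (auto simp: row2_def mat_of_rows_list_def)
      then show "map_mat (twist \<iota>) (row2 (x1, x2) (y1, y2)) $$ (i, j)
          = (row2 v w * Psi_rho + row2 (x1, x2) (y1, y2)) $$ (i, j)"
        using P x(3,4) y(3,4)
        by (auto simp: less_Suc_eq row2_def mat_of_rows_list_def scalar_prod_def numeral_2_eq_2)
    qed (use P in \<open>auto simp: row2_def mat_of_rows_list_def\<close>)
  qed (use x y assms in \<open>auto simp: row2_def mat_of_rows_list_def less_2_iff_or fq_denominators_def\<close>)
  then show ?thesis
    using that unfolding Phi_vw_def by simp
qed

text \<open>If c trivialises the Carlitz motive, then 1 / c trivialises its dual.\<close>

lemma trivialised_by_dual_carlitz:
  obtains \<Psi> where "trivialised_by ((1 / T) \<cdot>\<^sub>m 1\<^sub>m 1) \<Psi> 1"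
proof -
  obtain c where c: "c \<in> tate_L" "c \<noteq> 0" "twist \<iota> c = T * c"
    by (rule carlitz_solution)
  have "(1 / T) \<in> kbar_rats \<iota>"
    by (intro kbarr.divide_mem kbarr.one_mem T_mem_kbar_rats)
  moreover have "map_mat (twist \<iota>) ((1 / c) \<cdot>\<^sub>m 1\<^sub>m 1) = ((1 / T) \<cdot>\<^sub>m 1\<^sub>m 1) * ((1 / c) \<cdot>\<^sub>m 1\<^sub>m 1)"
    using c(2) by (intro eq_matI) (auto simp: twist_divide c(3) scalar_prod_def)
  moreover have "1 / T \<noteq> 0"
    using X_minus_const_nonzero by simp
  ultimately show ?thesis
    using c tate_L_inverse
    by (intro that[of "(1 / c) \<cdot>\<^sub>m 1\<^sub>m 1"]) (auto simp: trivialised_by_def valid_def)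
qed

end

section \<open>Anderson t-motives\<close>

context drinfeld
begin

definition sig_mat :: "'c fls mat \<Rightarrow> 'c fls vec \<Rightarrow> 'c fls vec" where
  "sig_mat \<Phi> x = transpose_mat \<Phi> *\<^sub>v map_vec (twist \<iota>) x"

lemma sigma_motive_of: "sigma (motive_of \<iota> \<Phi>) = sig_mat \<Phi>"
  by (rule ext) (simp add: sig_mat_def)

lemma sig_mat_nth:
  assumes "\<Phi> \<in> carrier_mat d d" "x \<in> carrier_vec d" "r < d"
  shows "sig_mat \<Phi> x $ r = (\<Sum>s<d. \<Phi> $$ (s, r) * twist \<iota> (x $ s))"
  using assms by (simp add: sig_mat_def scalar_prod_def lessThan_atLeast0)

lemma sig_mat_polys:
  assumes "\<Phi> \<in> carrier_mat d d" "\<And>i j. i < d \<Longrightarrow> j < d \<Longrightarrow> \<Phi> $$ (i, j) \<in> kbar_polys \<iota>"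
    "x \<in> vecs_in (kbar_polys \<iota>) d"
  shows "sig_mat \<Phi> x \<in> vecs_in (kbar_polys \<iota>) d"
  unfolding sig_mat_def
proof (rule kbarp.vecs_in_mult_mat)
  show "map_vec (twist \<iota>) x \<in> vecs_in (kbar_polys \<iota>) d"
    using assms(3) by (intro vecs_inI) (auto simp: vecs_in_nth)
qed (use assms in auto)

lemma polys_subset_V: "vecs_in (kbar_polys \<iota>) d \<subseteq> V d"
  using kbar_polys_subset_rats by (auto simp: vecs_in_def)

text \<open>Division with remainder by \<sigma>: \<open>dec\<close> writes x as a constant
  combination of c plus \<sigma> y, with y lower in the filtration \<open>bound\<close>, and
  iteration expands x in the \<sigma>^j c_i. By \<open>unique\<close> a division of 0 is trivial, so
  expansions are unique.\<close>

lemma anderson_criterion: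
  fixes bound :: "nat \<Rightarrow> 'c fls vec \<Rightarrow> bool"
  assumes valid: "valid \<Phi> d" and poly: "\<And>i j. i < d \<Longrightarrow> j < d \<Longrightarrow> \<Phi> $$ (i, j) \<in> kbar_polys \<iota>"
    and c: "set c \<subseteq> vecs_in (kbar_polys \<iota>) d"
    and dec: "\<And>m x. \<lbrakk>x \<in> vecs_in (kbar_polys \<iota>) d; bound (Suc m) x\<rbrakk> \<Longrightarrow>
      \<exists>k y. (\<forall>i<length c. k i \<in> kbar \<iota>) \<and> y \<in> vecs_in (kbar_polys \<iota>) d \<and> bound m y \<and>
        (\<forall>r<d. x $ r = (\<Sum>i<length c. fls_const (k i) * c ! i $ r) + sig_mat \<Phi> y $ r)"
    and bound0: "\<And>x. x \<in> vecs_in (kbar_polys \<iota>) d \<Longrightarrow> bound 0 x \<Longrightarrow> x = 0\<^sub>v d"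
    and bounded: "\<And>x. x \<in> vecs_in (kbar_polys \<iota>) d \<Longrightarrow> \<exists>m. bound m x"
    and unique: "\<And>k y. \<lbrakk>\<And>i. i < length c \<Longrightarrow> k i \<in> kbar \<iota>; y \<in> vecs_in (kbar_polys \<iota>) d;
        \<And>r. r < d \<Longrightarrow> (\<Sum>i<length c. fls_const (k i) * c ! i $ r) + sig_mat \<Phi> y $ r = 0\<rbrakk>
      \<Longrightarrow> (\<forall>i<length c. k i = 0) \<and> y = 0\<^sub>v d"
    and pow: "\<And>x. x \<in> vecs_in (kbar_polys \<iota>) d \<Longrightarrow> \<exists>y\<in>vecs_in (kbar_polys \<iota>) d. T ^ n \<cdot>\<^sub>v x = sig_mat \<Phi> y"
  shows "from_anderson_t_motive \<iota> (motive_of \<iota> \<Phi>)"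
proof -
  let ?N = "vecs_in (kbar_polys \<iota>) d"
  let ?l = "length c"
  have \<Phi>: "\<Phi> \<in> carrier_mat d d"
    using valid by (simp add: valid_def)
  have dim: "dim_row \<Phi> = d"
    using \<Phi> by simp
  define w where "w j i = (sig_mat \<Phi> ^^ j) (c ! i)" for j i
  have w: "w j i \<in> ?N" if "i < ?l" for i j
  proof (induction j)
    case 0
    then show ?case
      using c that by (auto simp: w_def)
  next
    case (Suc j)
    then show ?case
      using sig_mat_polys[OF \<Phi> poly] by (simp add: w_def)
  qed
  \<comment> \<open>An expansion with a common bound N for all i, which keeps inductions free of the
    individual degrees.\<close>
  define val where "val N \<alpha> = vec d (\<lambda>r. \<Sum>i<?l. \<Sum>j<N. fls_const (\<alpha> i j) * w j i $ r)"
    for N and \<alpha> :: "nat \<Rightarrow> nat \<Rightarrow> 'c"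
  have val_polys: "val N \<alpha> \<in> ?N" if \<alpha>: "\<And>i j. \<alpha> i j \<in> kbar \<iota>" for N \<alpha>
  proof (rule vecs_inI)
    fix r assume r: "r < d"
    have "(\<Sum>i<?l. \<Sum>j<N. fls_const (\<alpha> i j) * w j i $ r) \<in> kbar_polys \<iota>"
      using r by (intro kbarp.sum_mem kbarp.mult_mem const_mem_kbar_polys \<alpha> vecs_in_nth[OF w]) auto
    then show "val N \<alpha> $ r \<in> kbar_polys \<iota>"
      using r by (simp add: val_def)
  qed (simp add: val_def)
  \<comment> \<open>The terms with j = 0 are split off. The rest is \<sigma> of an expansion whose
    coefficients are raised to the power q, because \<sigma> twists scalars by the inverse
    Frobenius.\<close>
  have step: "val (Suc N) \<alpha> $ r
      = (\<Sum>i<?l. fls_const (\<alpha> i 0) * c ! i $ r) + sig_mat \<Phi> (val N (\<lambda>i j. \<alpha> i (Suc j) ^ q)) $ r"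
    if r: "r < d" for N \<alpha> r
  proof -
    let ?\<beta> = "\<lambda>i j. \<alpha> i (Suc j) ^ q"
    have tw: "twist \<iota> (val N ?\<beta> $ s) = (\<Sum>i<?l. \<Sum>j<N. fls_const (\<alpha> i (Suc j)) * twist \<iota> (w j i $ s))"
      if "s < d" for s
      using that by (simp add: val_def tw.hom_sum tw.hom_mult)
    have wS: "w (Suc j) i $ r = (\<Sum>s<d. \<Phi> $$ (s, r) * twist \<iota> (w j i $ s))" if "i < ?l" for i j
      using sig_mat_nth[OF \<Phi> vecs_in_carrier[OF w[OF that, of j]] r] by (simp add: w_def)
    have "sig_mat \<Phi> (val N ?\<beta>) $ r = (\<Sum>s<d. \<Phi> $$ (s, r) * twist \<iota> (val N ?\<beta> $ s))"
      by (rule sig_mat_nth[OF \<Phi> _ r]) (simp add: val_def)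
    also have "\<dots> = (\<Sum>s<d. \<Sum>i<?l. \<Sum>j<N. fls_const (\<alpha> i (Suc j)) * (\<Phi> $$ (s, r) * twist \<iota> (w j i $ s)))"
      by (intro sum.cong refl) (simp add: tw sum_distrib_left mult.left_commute)
    also have "\<dots> = (\<Sum>i<?l. \<Sum>s<d. \<Sum>j<N. fls_const (\<alpha> i (Suc j)) * (\<Phi> $$ (s, r) * twist \<iota> (w j i $ s)))"
      by (rule sum.swap)
    also have "\<dots> = (\<Sum>i<?l. \<Sum>j<N. \<Sum>s<d. fls_const (\<alpha> i (Suc j)) * (\<Phi> $$ (s, r) * twist \<iota> (w j i $ s)))"
      by (rule sum.cong[OF refl]) (rule sum.swap)
    also have "\<dots> = (\<Sum>i<?l. \<Sum>j<N. fls_const (\<alpha> i (Suc j)) * w (Suc j) i $ r)"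
      by (intro sum.cong refl) (simp add: wS sum_distrib_left)
    finally have "sig_mat \<Phi> (val N ?\<beta>) $ r = (\<Sum>i<?l. \<Sum>j<N. fls_const (\<alpha> i (Suc j)) * w (Suc j) i $ r)" .
    moreover have "val (Suc N) \<alpha> $ r
        = (\<Sum>i<?l. fls_const (\<alpha> i 0) * w 0 i $ r + (\<Sum>j<N. fls_const (\<alpha> i (Suc j)) * w (Suc j) i $ r))"
      using r unfolding val_def by (simp add: sum.lessThan_Suc_shift del: sum.lessThan_Suc)
    ultimately show ?thesis
      by (simp add: sum.distrib w_def)
  qed
  have exist: "\<exists>\<alpha>. (\<forall>i j. \<alpha> i j \<in> kbar \<iota>) \<and> x = val m \<alpha>" if "x \<in> ?N" "bound m x" for x m
    using that
  proof (induction m arbitrary: x)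
    case 0
    then have "x = val 0 (\<lambda>_ _. 0)"
      using bound0[OF 0] by (intro eq_vecI) (auto simp: val_def)
    then show ?case
      using kbar.zero_mem by (intro exI[of _ "\<lambda>_ _. 0"] conjI allI) auto
  next
    case (Suc m)
    obtain k y where ky: "\<forall>i<?l. k i \<in> kbar \<iota>" "y \<in> ?N" "bound m y"
      "\<forall>r<d. x $ r = (\<Sum>i<?l. fls_const (k i) * c ! i $ r) + sig_mat \<Phi> y $ r"
      using dec[OF Suc.prems] by blast
    obtain \<beta> where \<beta>: "\<forall>i j. \<beta> i j \<in> kbar \<iota>" "y = val m \<beta>"
      using Suc.IH[OF ky(2,3)] by blast
    \<comment> \<open>\<open>phi\<close> undoes the q-th power in \<open>step\<close>; the value 0
      beyond the list keeps all coefficients in kbar.\<close>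
    define \<alpha> where "\<alpha> i j = (case j of 0 \<Rightarrow> if i < ?l then k i else 0 | Suc j' \<Rightarrow> phi (\<beta> i j'))" for i j
    have "\<alpha> i j \<in> kbar \<iota>" for i j
      using ky(1) \<beta>(1) kbar.zero_mem by (auto simp: \<alpha>_def split: nat.split)
    moreover have "x = val (Suc m) \<alpha>"
    proof (rule eq_vecI)
      fix r assume "r < dim_vec (val (Suc m) \<alpha>)"
      then have r: "r < d"
        by (simp add: val_def)
      have "val m (\<lambda>i j. \<alpha> i (Suc j) ^ q) = y"
        by (simp add: \<alpha>_def \<beta>(2))
      moreover have "(\<Sum>i<?l. fls_const (\<alpha> i 0) * c ! i $ r) = (\<Sum>i<?l. fls_const (k i) * c ! i $ r)"
        by (intro sum.cong) (auto simp: \<alpha>_def)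
      ultimately show "x $ r = val (Suc m) \<alpha> $ r"
        using step[OF r, of m \<alpha>] ky(4) r by simp
    qed (use Suc.prems(1) in \<open>simp add: val_def\<close>)
    ultimately show ?case
      by blast
  qed
  have kernel: "\<alpha> i j = 0" if "\<And>i j. \<alpha> i j \<in> kbar \<iota>" "val N \<alpha> = 0\<^sub>v d" "i < ?l" "j < N" for \<alpha> N i j
    using that
  proof (induction N arbitrary: \<alpha> j)
    case (Suc N)
    let ?\<beta> = "\<lambda>i j. \<alpha> i (Suc j) ^ q"
    have \<beta>: "?\<beta> i j \<in> kbar \<iota>" for i j
      using Suc.prems(1) by (intro kbar.power_mem)
    have *: "(\<forall>i<?l. \<alpha> i 0 = 0) \<and> val N ?\<beta> = 0\<^sub>v d"
    proof (rule unique)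
      show "(\<Sum>i<?l. fls_const (\<alpha> i 0) * c ! i $ r) + sig_mat \<Phi> (val N ?\<beta>) $ r = 0" if "r < d" for r
        using step[OF that, of N \<alpha>] Suc.prems(2) that by simp
    qed (use Suc.prems(1) \<beta> val_polys in auto)
    show ?case
    proof (cases j)
      case 0
      then show ?thesis
        using * Suc.prems(3) by simp
    next
      case (Suc j')
      have "?\<beta> i j' = 0"
        using Suc.IH[of ?\<beta> j'] \<beta> * Suc.prems(3,4) Suc by simp
      then show ?thesis
        using Suc by simp
    qed
  qed simp
  let ?P = "motive_of \<iota> \<Phi>"
  let ?ok = "\<lambda>a::'c poly list. length a = ?l \<and> (\<forall>p\<in>set a. \<forall>j. coeff p j \<in> kbar \<iota>)"
  let ?co = "\<lambda>a i j. if i < ?l then coeff (a ! i) j else 0"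
  have co: "?co a i j \<in> kbar \<iota>" if "?ok a" for a i j
    using that kbar.zero_mem by (auto simp: all_set_conv_all_nth)
  have sum_eq: "(\<Oplus>\<^bsub>?P\<^esub>i\<in>{..<?l}. \<Oplus>\<^bsub>?P\<^esub>j\<in>{..degree (a ! i)}. fls_const (coeff (a ! i) j) \<odot>\<^bsub>?P\<^esub> (sigma ?P ^^ j) (c ! i))
      = val N (?co a)"
    if a: "?ok a" and N: "\<And>i. i < ?l \<Longrightarrow> degree (a ! i) < N" for a N
  proof -
    have mem: "fls_const (coeff (a ! i) j) \<cdot>\<^sub>v w j i \<in> V d" if "i < ?l" for i j
      using that a w polys_subset_V
      by (intro V_smult kbar_polys_subset_rats const_mem_kbar_polys) (auto simp: all_set_conv_all_nth)
    have inner: "(\<Oplus>\<^bsub>?P\<^esub>j\<in>{..degree (a ! i)}. fls_const (coeff (a ! i) j) \<odot>\<^bsub>?P\<^esub> (sigma ?P ^^ j) (c ! i))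
        = vec d (\<lambda>r. \<Sum>j<N. fls_const (?co a i j) * w j i $ r)" if i: "i < ?l" for i
    proof -
      have "(\<Oplus>\<^bsub>?P\<^esub>j\<in>{..degree (a ! i)}. fls_const (coeff (a ! i) j) \<odot>\<^bsub>?P\<^esub> (sigma ?P ^^ j) (c ! i))
          = vec d (\<lambda>r. \<Sum>j\<le>degree (a ! i). (fls_const (coeff (a ! i) j) \<cdot>\<^sub>v w j i) $ r)"
        unfolding sigma_motive_of motive_of_simps(4) w_def[symmetric]
        using mem[OF i] by (subst finsum_motive_of) (auto simp: dim)
      also have "\<dots> = vec d (\<lambda>r. \<Sum>j<N. fls_const (?co a i j) * w j i $ r)"
      proof (rule eq_vecI)
        fix r assume "r < dim_vec (vec d (\<lambda>r. \<Sum>j<N. fls_const (?co a i j) * w j i $ r))"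
        then have r: "r < d"
          by simp
        have "(\<Sum>j\<le>degree (a ! i). (fls_const (coeff (a ! i) j) \<cdot>\<^sub>v w j i) $ r)
            = (\<Sum>j\<le>degree (a ! i). fls_const (?co a i j) * w j i $ r)"
          using i r by (intro sum.cong refl) (simp add: vecs_in_dim[OF w[OF i]])
        also have "\<dots> = (\<Sum>j<N. fls_const (?co a i j) * w j i $ r)"
          using N[OF i] by (intro sum.mono_neutral_left) (auto simp: coeff_eq_0)
        finally show "vec d (\<lambda>r. \<Sum>j\<le>degree (a ! i). (fls_const (coeff (a ! i) j) \<cdot>\<^sub>v w j i) $ r) $ r
            = vec d (\<lambda>r. \<Sum>j<N. fls_const (?co a i j) * w j i $ r) $ r"
          using r by simp
      qed simp
      finally show ?thesis .
    qed
    have inner_mem: "vec d (\<lambda>r. \<Sum>j<N. fls_const (?co a i j) * w j i $ r) \<in> V d" if i: "i < ?l" for i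
    proof (rule vecs_inI)
      fix r assume r: "r < d"
      have "(\<Sum>j<N. fls_const (?co a i j) * w j i $ r) \<in> kbar_polys \<iota>"
        by (intro kbarp.sum_mem kbarp.mult_mem const_mem_kbar_polys co[OF a] vecs_in_nth[OF w[OF i] r])
      then show "vec d (\<lambda>r. \<Sum>j<N. fls_const (?co a i j) * w j i $ r) $ r \<in> kbar_rats \<iota>"
        using r kbar_polys_subset_rats by simp
    qed simp
    have "(\<Oplus>\<^bsub>?P\<^esub>i\<in>{..<?l}. \<Oplus>\<^bsub>?P\<^esub>j\<in>{..degree (a ! i)}. fls_const (coeff (a ! i) j) \<odot>\<^bsub>?P\<^esub> (sigma ?P ^^ j) (c ! i))
        = (\<Oplus>\<^bsub>?P\<^esub>i\<in>{..<?l}. vec d (\<lambda>r. \<Sum>j<N. fls_const (?co a i j) * w j i $ r))"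
    proof -
      interpret abelian_group ?P
        by (rule abelian_group_motive_of)
      show ?thesis
        by (rule finsum_cong') (use inner inner_mem in \<open>auto simp: dim\<close>)
    qed
    also have "\<dots> = val N (?co a)"
      using inner_mem by (subst finsum_motive_of) (auto simp: dim val_def intro!: eq_vecI)
    finally show ?thesis .
  qed
  have ex1: "\<exists>!a :: 'c poly list. ?ok a \<and>
      x = (\<Oplus>\<^bsub>?P\<^esub>i\<in>{..<?l}. \<Oplus>\<^bsub>?P\<^esub>j\<in>{..degree (a ! i)}. fls_const (coeff (a ! i) j) \<odot>\<^bsub>?P\<^esub> (sigma ?P ^^ j) (c ! i))"
    if x: "x \<in> ?N" for x
  proof (rule ex_ex1I)
    obtain m where "bound m x"
      using bounded[OF x] by blast
    then obtain \<alpha> where \<alpha>: "\<forall>i j. \<alpha> i j \<in> kbar \<iota>" "x = val m \<alpha>"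
      using exist[OF x] by blast
    define a where "a = map (\<lambda>i. Poly (map (\<alpha> i) [0..<m])) [0..<?l]"
    have coeff_a: "coeff (a ! i) j = (if j < m then \<alpha> i j else 0)" if "i < ?l" for i j
      using that by (simp add: a_def nth_default_def)
    have ok: "?ok a"
      using coeff_a \<alpha>(1) kbar.zero_mem by (auto simp: all_set_conv_all_nth) (simp_all add: a_def)
    have "degree (a ! i) < Suc m" if "i < ?l" for i
      using coeff_a[OF that] by (intro le_imp_less_Suc degree_le) auto
    moreover have "val (Suc m) (?co a) = val m \<alpha>"
      unfolding val_def by (intro eq_vecI) (auto simp: coeff_a intro!: sum.cong)
    ultimately show "\<exists>a. ?ok a \<and>
      x = (\<Oplus>\<^bsub>?P\<^esub>i\<in>{..<?l}. \<Oplus>\<^bsub>?P\<^esub>j\<in>{..degree (a ! i)}. fls_const (coeff (a ! i) j) \<odot>\<^bsub>?P\<^esub> (sigma ?P ^^ j) (c ! i))"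
      using sum_eq[OF ok, of "Suc m"] ok \<alpha>(2) by (intro exI[of _ a]) simp
  next
    fix a b
    assume a: "?ok a \<and> x = (\<Oplus>\<^bsub>?P\<^esub>i\<in>{..<?l}. \<Oplus>\<^bsub>?P\<^esub>j\<in>{..degree (a ! i)}. fls_const (coeff (a ! i) j) \<odot>\<^bsub>?P\<^esub> (sigma ?P ^^ j) (c ! i))"
      and b: "?ok b \<and> x = (\<Oplus>\<^bsub>?P\<^esub>i\<in>{..<?l}. \<Oplus>\<^bsub>?P\<^esub>j\<in>{..degree (b ! i)}. fls_const (coeff (b ! i) j) \<odot>\<^bsub>?P\<^esub> (sigma ?P ^^ j) (c ! i))"
    \<comment> \<open>Exceeds all degrees in both lists, so that the two expansions become
      comparable.\<close>
    define N where "N = Suc (\<Sum>i<?l. degree (a ! i) + degree (b ! i))"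
    have le: "degree (a ! i) + degree (b ! i) < N" if "i < ?l" for i
      unfolding N_def using that by (intro le_imp_less_Suc member_le_sum) auto
    then have "degree (a ! i) < N" "degree (b ! i) < N" if "i < ?l" for i
      using that by fastforce+
    then have eq: "x = val N (?co a)" "x = val N (?co b)"
      using sum_eq[of a N] sum_eq[of b N] a b by simp_all
    have "val N (\<lambda>i j. ?co a i j - ?co b i j) = 0\<^sub>v d"
    proof (rule eq_vecI)
      fix r assume "r < dim_vec (0\<^sub>v d :: 'c fls vec)"
      then have r: "r < d"
        by simp
      have "val N (\<lambda>i j. ?co a i j - ?co b i j) $ r = val N (?co a) $ r - val N (?co b) $ r"
        using r by (simp add: val_def sum_subtractf[symmetric] fls_minus_const[symmetric] left_diff_distrib
            del: if_False)
      then show "val N (\<lambda>i j. ?co a i j - ?co b i j) $ r = 0\<^sub>v d $ r"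
        using eq r by simp
    qed (simp add: val_def)
    then have "?co a i j - ?co b i j = 0" if "i < ?l" "j < N" for i j
      using kernel[of "\<lambda>i j. ?co a i j - ?co b i j" N i j] that a b co[of a] co[of b] kbar.diff_mem by blast
    then have "coeff (a ! i) j = coeff (b ! i) j" if "i < ?l" for i j
      using that le[OF that] by (cases "j < N") (auto simp: coeff_eq_0)
    then show "a = b"
      using a b by (intro nth_equalityI) (auto intro: poly_eqI)
  qed
  have basis: "is_basis (kbar_rats \<iota>) ?P (carrier ?P) (unit_vecs d)" "is_basis (kbar_polys \<iota>) ?P ?N (unit_vecs d)"
    using is_basis_unit_vecs[OF kbarr.closed_subring_axioms order_refl, of \<Phi>]
      is_basis_unit_vecs[OF kbarp.closed_subring_axioms, of \<Phi>] kbar_polys_subset_rats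
    by (auto simp: dim)
  show ?thesis
    unfolding from_anderson_t_motive_def
  proof (intro exI[of _ ?N] conjI)
    show "\<exists>b. is_basis (kbar_rats \<iota>) ?P (carrier ?P) b \<and> is_basis (kbar_polys \<iota>) ?P ?N b"
      using basis by blast
    show "sigma ?P ` ?N \<subseteq> ?N"
      unfolding sigma_motive_of using sig_mat_polys[OF \<Phi> poly] by blast
    show "\<exists>c. set c \<subseteq> ?N \<and> (\<forall>x\<in>?N. \<exists>!a :: 'c poly list.
           length a = length c \<and> (\<forall>p\<in>set a. \<forall>j. coeff p j \<in> kbar \<iota>) \<and>
           x = (\<Oplus>\<^bsub>?P\<^esub>i\<in>{..<length c}. \<Oplus>\<^bsub>?P\<^esub>j\<in>{..degree (a ! i)}.
                  fls_const (coeff (a ! i) j) \<odot>\<^bsub>?P\<^esub> (sigma ?P ^^ j) (c ! i)))"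
      using c ex1 by (intro exI[of _ c]) (simp only: conj_assoc, blast)
    show "\<exists>n. \<forall>x\<in>?N. (fls_X - fls_const \<theta>) ^ n \<odot>\<^bsub>?P\<^esub> x \<in> sigma ?P ` ?N"
      using pow unfolding sigma_motive_of motive_of_simps(4) by blast
  qed
qed

definition degree_below :: "nat \<Rightarrow> 'c poly \<Rightarrow> bool" where
  "degree_below m p \<longleftrightarrow> p = 0 \<or> degree p < m"

lemma degree_below_0 [simp]: "degree_below 0 p \<longleftrightarrow> p = 0"
  by (simp add: degree_below_def)

lemma degree_below_mono: "degree_below m p \<Longrightarrow> m \<le> n \<Longrightarrow> degree_below n p"
  by (auto simp: degree_below_def)

lemma degree_below_iff: "degree_below m p \<longleftrightarrow> (\<forall>j\<ge>m. coeff p j = 0)"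
proof
  show "\<forall>j\<ge>m. coeff p j = 0" if "degree_below m p"
    using that by (auto simp: degree_below_def coeff_eq_0)
  show "degree_below m p" if "\<forall>j\<ge>m. coeff p j = 0"
    using that leading_coeff_0_iff[of p] unfolding degree_below_def by (meson not_le)
qed

lemma degree_below_add: "degree_below m p \<Longrightarrow> degree_below m r \<Longrightarrow> degree_below m (p + r)"
  by (simp add: degree_below_iff)

lemma degree_below_diff: "degree_below m p \<Longrightarrow> degree_below m r \<Longrightarrow> degree_below m (p - r)"
  by (simp add: degree_below_iff)

lemma degree_below_smult: "degree_below m p \<Longrightarrow> degree_below m (Polynomial.smult a p)"
  by (simp add: degree_below_iff)

lemma degree_below_T_mult: "degree_below m p \<Longrightarrow> degree_below (Suc m) (T_poly * p)"
  by (auto simp: degree_below_iff coeff_pCons split: nat.split)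

sublocale Ck: closed_subring "coeffs_in (kbar \<iota>)"
  by (rule closed_subring_coeffs_in) unfold_locales

lemma T_poly_mem: "T_poly \<in> coeffs_in (kbar \<iota>)"
  using theta_mem_kbar by (auto simp: coeffs_in_def coeff_pCons split: nat.split intro: kbar.mems)

lemma const_mem_Ck: "a \<in> kbar \<iota> \<Longrightarrow> [:a:] \<in> coeffs_in (kbar \<iota>)"
  by (auto simp: coeffs_in_def coeff_pCons split: nat.split intro: kbar.mems)

text \<open>The remainder is p(\<theta>), and \<open>coeffs_in_quotient\<close> keeps the quotient
  over kbar.\<close>

lemma division_by_T:
  assumes p: "p \<in> coeffs_in (kbar \<iota>)" "degree_below (Suc m) p"
  obtains k s where "k \<in> kbar \<iota>" "s \<in> coeffs_in (kbar \<iota>)" "degree_below m s" "p = [:k:] + T_poly * s"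
proof -
  let ?k = "poly p \<theta>"
  have k: "?k \<in> kbar \<iota>"
    using p(1) theta_mem_kbar by (intro kbar.poly_mem) (auto simp: coeffs_in_def)
  have "poly (p - [:?k:]) \<theta> = 0"
    by simp
  then have "T_poly dvd p - [:?k:]"
    by (simp only: poly_eq_0_iff_dvd)
  then obtain s where s: "p - [:?k:] = T_poly * s"
    by (rule dvdE)
  have "s * T_poly \<in> coeffs_in (kbar \<iota>)"
    using Ck.diff_mem[OF p(1) const_mem_Ck[OF k]] unfolding s by (simp only: mult.commute)
  then have sk: "s \<in> coeffs_in (kbar \<iota>)"
    by (rule kbar.coeffs_in_quotient[OF T_poly_mem, rotated]) simp
  have "degree_below (Suc m) (p - [:?k:])"
    using p(2) by (auto simp: degree_below_iff coeff_pCons split: nat.split)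
  then have "degree_below (Suc m) (T_poly * s)"
    unfolding s .
  then have "degree_below m s"
  proof (cases "s = 0")
    case False
    have "degree (T_poly * s) = Suc (degree s)"
      using False by (subst degree_mult_eq) simp_all
    then show ?thesis
      using \<open>degree_below (Suc m) (T_poly * s)\<close> False unfolding degree_below_def by auto
  qed (simp add: degree_below_def)
  moreover have "p = [:?k:] + T_poly * s"
    unfolding s[symmetric] by simp
  ultimately show ?thesis
    using that k sk by blast
qed

lemma untwist_poly:
  assumes "s \<in> coeffs_in (kbar \<iota>)" "degree_below m s"
  obtains s' where "s' \<in> coeffs_in (kbar \<iota>)" "degree_below m s'" "twist \<iota> (emb s') = emb s"
proof (rule that[of "map_poly (\<lambda>x. x ^ q) s"])
  show "map_poly (\<lambda>x. x ^ q) s \<in> coeffs_in (kbar \<iota>)"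
    using assms by (auto simp: coeffs_in_def coeff_map_poly intro: kbar.power_mem)
  show "degree_below m (map_poly (\<lambda>x. x ^ q) s)"
    using assms(2) by (auto simp: degree_below_iff coeff_map_poly)
  show "twist \<iota> (emb (map_poly (\<lambda>x. x ^ q) s)) = emb s"
    by (rule fls_eqI) (auto simp: fls_nth_emb coeff_map_poly)
qed

definition degrees_below :: "nat \<Rightarrow> nat \<Rightarrow> 'c fls vec \<Rightarrow> bool" where
  "degrees_below d m x \<longleftrightarrow> (\<forall>r<d. \<exists>p\<in>coeffs_in (kbar \<iota>). x $ r = emb p \<and> degree_below m p)"

lemma degrees_below_0:
  assumes "x \<in> vecs_in (kbar_polys \<iota>) d" "degrees_below d 0 x"
  shows "x = 0\<^sub>v d"
  using assms by (intro eq_vecI) (auto simp: degrees_below_def)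

lemma degrees_below_exists:
  assumes "x \<in> vecs_in (kbar_polys \<iota>) d"
  shows "\<exists>m. degrees_below d m x"
proof -
  have "\<forall>r<d. \<exists>p. p \<in> coeffs_in (kbar \<iota>) \<and> x $ r = emb p"
    using vecs_in_nth[OF assms] unfolding kbar_polys_eq by blast
  then obtain p where p: "\<And>r. r < d \<Longrightarrow> p r \<in> coeffs_in (kbar \<iota>) \<and> x $ r = emb (p r)"
    by metis
  define m where "m = Suc (\<Sum>r<d. degree (p r))"
  have "degree (p r) < m" if "r < d" for r
    unfolding m_def using that by (intro le_imp_less_Suc member_le_sum) auto
  then have "degrees_below d m x"
    unfolding degrees_below_def degree_below_def using p by blast
  then show ?thesis
    by blast
qed

lemma emb_eq_0: "emb p = 0 \<longleftrightarrow> p = 0"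
  by simp

lemma T_division_unique:
  assumes "[:k:] + T_poly * s = 0"
  shows "k = 0 \<and> s = 0"
proof -
  have "poly ([:k:] + T_poly * s) \<theta> = 0"
    unfolding assms by simp
  then have "k = 0"
    by simp
  then have "T_poly * s = 0"
    using assms by simp
  then have "s = 0"
    by (simp only: mult_eq_0_iff) simp
  then show ?thesis
    using \<open>k = 0\<close> by simp
qed

text \<open>On kbar[t] the operator \<sigma> is T times the twist, so its image consists of the
  multiples of T. Division by T makes 1 a basis over kbar[\<sigma>], and n = 1 suffices.\<close>

lemma t_motive_carlitz: "t_motive \<iota> (motive_of \<iota> (T \<cdot>\<^sub>m 1\<^sub>m 1))"
proof -
  let ?\<Phi> = "T \<cdot>\<^sub>m 1\<^sub>m 1 :: 'c fls mat"
  obtain A where A: "A \<in> tate_L" "A \<noteq> 0" "twist \<iota> A = T * A"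
    by (rule carlitz_solution)
  have trivialised_by: "trivialised_by ?\<Phi> (A \<cdot>\<^sub>m 1\<^sub>m 1) 1"
    by (rule trivialised_by_scale[OF trivialised_by_one A])
  then have valid: "valid ?\<Phi> 1"
    by (simp add: trivialised_by_def)
  have sig: "sig_mat ?\<Phi> x $ 0 = T * twist \<iota> (x $ 0)" if "x \<in> vecs_in (kbar_polys \<iota>) 1" for x
    by (subst sig_mat_nth[of _ 1]) (use that in \<open>auto simp: vecs_in_carrier\<close>)
  let ?c = "[vec 1 (\<lambda>_. 1)] :: 'c fls vec list"
  have "from_anderson_t_motive \<iota> (motive_of \<iota> ?\<Phi>)"
  proof (rule anderson_criterion[OF valid, of ?c "degrees_below 1" 1])
    show "?\<Phi> $$ (i, j) \<in> kbar_polys \<iota>" if "i < 1" "j < 1" for i j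
      using that X_theta_mem_kbar_polys by simp
    have "vec 1 (\<lambda>_. 1) \<in> vecs_in (kbar_polys \<iota>) 1"
      by (rule vecs_inI) (simp_all add: kbarp.one_mem)
    then show "set ?c \<subseteq> vecs_in (kbar_polys \<iota>) 1"
      by simp
  next
    fix m x assume x: "x \<in> vecs_in (kbar_polys \<iota>) 1" "degrees_below 1 (Suc m) x"
    obtain p where p: "p \<in> coeffs_in (kbar \<iota>)" "x $ 0 = emb p" "degree_below (Suc m) p"
      using x(2) unfolding degrees_below_def by auto
    obtain k s where ks: "k \<in> kbar \<iota>" "s \<in> coeffs_in (kbar \<iota>)" "degree_below m s" "p = [:k:] + T_poly * s"
      by (rule division_by_T[OF p(1,3)])
    obtain s' where s': "s' \<in> coeffs_in (kbar \<iota>)" "degree_below m s'" "twist \<iota> (emb s') = emb s"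
      by (rule untwist_poly[OF ks(2,3)])
    let ?y = "vec 1 (\<lambda>_. emb s')"
    have y: "?y \<in> vecs_in (kbar_polys \<iota>) 1"
      using s'(1) by (intro vecs_inI) (auto simp: kbar_polys_eq)
    have "x $ 0 = fls_const k + T * emb s"
      unfolding p(2) ks(4) emb.hom_add emb.hom_mult emb_const emb_linear ..
    then show "\<exists>k y. (\<forall>i<length ?c. k i \<in> kbar \<iota>) \<and> y \<in> vecs_in (kbar_polys \<iota>) 1 \<and> degrees_below 1 m y \<and>
        (\<forall>r<1. x $ r = (\<Sum>i<length ?c. fls_const (k i) * ?c ! i $ r) + sig_mat ?\<Phi> y $ r)"
      using ks(1,3) s' y sig[OF y] by (intro exI[of _ "\<lambda>_. k"] exI[of _ ?y]) (auto simp: degrees_below_def)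
  next
    fix k :: "nat \<Rightarrow> 'c" and y
    assume k: "\<And>i. i < length ?c \<Longrightarrow> k i \<in> kbar \<iota>" and y: "y \<in> vecs_in (kbar_polys \<iota>) 1"
      and eq: "\<And>r. r < 1 \<Longrightarrow> (\<Sum>i<length ?c. fls_const (k i) * ?c ! i $ r) + sig_mat ?\<Phi> y $ r = 0"
    have "y $ 0 \<in> kbar_polys \<iota>"
      using vecs_in_nth[OF y, of 0] by simp
    then obtain p where p: "y $ 0 = emb p"
      by (auto simp: kbar_polys_eq)
    have "fls_const (k 0) + T * twist \<iota> (emb p) = 0"
      using eq[of 0] sig[OF y] p by simp
    then have "emb ([:k 0:] + T_poly * ptw p) = 0"
      by (simp only: emb.hom_add emb.hom_mult emb_const emb_linear twist_emb)
    then have "[:k 0:] + T_poly * ptw p = 0"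
      by (simp only: emb_eq_0)
    then have "k 0 = 0" "ptw p = 0"
      using T_division_unique by blast+
    then have "y $ 0 = 0"
      unfolding p by simp
    then show "(\<forall>i<length ?c. k i = 0) \<and> y = 0\<^sub>v 1"
      using \<open>k 0 = 0\<close> y by (auto intro!: eq_vecI)
  next
    fix x assume x: "x \<in> vecs_in (kbar_polys \<iota>) 1"
    obtain g where g: "g \<in> kbar_polys \<iota>" "twist \<iota> g = x $ 0"
      using twist_surj_kbar_polys vecs_in_nth[OF x, of 0] by auto
    have y: "vec 1 (\<lambda>_. g) \<in> vecs_in (kbar_polys \<iota>) 1"
      using g by (intro vecs_inI) auto
    have "T ^ 1 \<cdot>\<^sub>v x = sig_mat ?\<Phi> (vec 1 (\<lambda>_. g))"
      using x sig[OF y] g by (intro eq_vecI) (auto simp: sig_mat_def)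
    then show "\<exists>y\<in>vecs_in (kbar_polys \<iota>) 1. T ^ 1 \<cdot>\<^sub>v x = sig_mat ?\<Phi> y"
      using y by blast
  qed (rule degrees_below_0 degrees_below_exists; assumption)+
  then show ?thesis
    using rat_motive_motive_of[OF trivialised_by] by (rule t_motive.anderson[rotated])
qed

lemma Phi_v_carrier: "Phi_v v \<in> carrier_mat 3 3"
  unfolding Phi_v_def by (rule carrier_matI) simp_all

lemma Phi_v_dims [simp]: "dim_row (Phi_v v) = 3" "dim_col (Phi_v v) = 3"
  using Phi_v_carrier[of v] by simp_all

lemma Phi_v_nth [simp]:
  "Phi_v v $$ (0, 0) = 0" "Phi_v v $$ (0, Suc 0) = 1" "Phi_v v $$ (0, Suc (Suc 0)) = 0"
  "Phi_v v $$ (Suc 0, 0) = T" "Phi_v v $$ (Suc 0, Suc 0) = - K" "Phi_v v $$ (Suc 0, Suc (Suc 0)) = 0"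
  "Phi_v v $$ (Suc (Suc 0), 0) = fst v" "Phi_v v $$ (Suc (Suc 0), Suc 0) = snd v"
  "Phi_v v $$ (Suc (Suc 0), Suc (Suc 0)) = 1"
  by (simp_all add: Phi_v_def row1_def mat_of_rows_list_def four_block_mat_def Let_def)

definition v3 :: "'a \<Rightarrow> 'a \<Rightarrow> 'a \<Rightarrow> 'a vec" where
  "v3 a b c = vec 3 (\<lambda>i. [a, b, c] ! i)"

lemma v3_nth [simp]: "v3 a b c $ 0 = a" "v3 a b c $ Suc 0 = b" "v3 a b c $ Suc (Suc 0) = c" "dim_vec (v3 a b c) = 3"
  by (simp_all add: v3_def)

lemma less_3_iff: "i < (3::nat) \<longleftrightarrow> i = 0 \<or> i = Suc 0 \<or> i = Suc (Suc 0)"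
  by arith

lemma v3_mem: "v3 a b c \<in> vecs_in S 3 \<longleftrightarrow> a \<in> S \<and> b \<in> S \<and> c \<in> S"
proof -
  have c: "v3 a b c \<in> carrier_vec 3"
    by (rule carrier_vecI) (rule v3_nth)
  have eq: "(\<forall>i<3. v3 a b c $ i \<in> S) \<longleftrightarrow> a \<in> S \<and> b \<in> S \<and> c \<in> S"
  proof (intro iffI conjI allI impI)
    assume *: "\<forall>i<3. v3 a b c $ i \<in> S"
    show "a \<in> S" "b \<in> S" "c \<in> S"
      using *[rule_format, of 0] *[rule_format, of "Suc 0"] *[rule_format, of "Suc (Suc 0)"]
      by (simp_all only: v3_nth)
  next
    fix i :: nat assume "a \<in> S \<and> b \<in> S \<and> c \<in> S" "i < 3"
    then show "v3 a b c $ i \<in> S"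
      unfolding less_3_iff by (elim disjE) (simp_all only: v3_nth)
  qed
  show ?thesis
    unfolding vecs_in_def mem_Collect_eq eq using c by (simp only: simp_thms)
qed

lemma vec_eq_v3:
  assumes "x \<in> carrier_vec 3"
  shows "x = v3 (x $ 0) (x $ Suc 0) (x $ Suc (Suc 0))"
proof (rule eq_vecI)
  fix i assume "i < dim_vec (v3 (x $ 0) (x $ Suc 0) (x $ Suc (Suc 0)))"
  then have "i = 0 \<or> i = Suc 0 \<or> i = Suc (Suc 0)"
    unfolding v3_nth less_3_iff .
  then show "x $ i = v3 (x $ 0) (x $ Suc 0) (x $ Suc (Suc 0)) $ i"
    by (elim disjE) (simp_all only: v3_nth)
qed (use assms in simp)

lemma sig_Phi_v:
  assumes "x \<in> carrier_vec 3"
  shows "sig_mat (a \<cdot>\<^sub>m Phi_v v) x = v3 (a * (T * twist \<iota> (x $ Suc 0) + fst v * twist \<iota> (x $ Suc (Suc 0))))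
    (a * (twist \<iota> (x $ 0) - K * twist \<iota> (x $ Suc 0) + snd v * twist \<iota> (x $ Suc (Suc 0))))
    (a * twist \<iota> (x $ Suc (Suc 0)))"
proof (rule eq_vecI)
  have P: "a \<cdot>\<^sub>m Phi_v v \<in> carrier_mat 3 3"
    using Phi_v_carrier by simp
  have three: "{..<3::nat} = {0, Suc 0, Suc (Suc 0)}"
    by auto
  fix r assume "r < dim_vec (v3 (a * (T * twist \<iota> (x $ Suc 0) + fst v * twist \<iota> (x $ Suc (Suc 0))))
    (a * (twist \<iota> (x $ 0) - K * twist \<iota> (x $ Suc 0) + snd v * twist \<iota> (x $ Suc (Suc 0))))
    (a * twist \<iota> (x $ Suc (Suc 0))))"
  then have r: "r < 3"
    by simp
  show "sig_mat (a \<cdot>\<^sub>m Phi_v v) x $ r = v3 (a * (T * twist \<iota> (x $ Suc 0) + fst v * twist \<iota> (x $ Suc (Suc 0))))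
    (a * (twist \<iota> (x $ 0) - K * twist \<iota> (x $ Suc 0) + snd v * twist \<iota> (x $ Suc (Suc 0))))
    (a * twist \<iota> (x $ Suc (Suc 0))) $ r"
    unfolding sig_mat_nth[OF P assms r] three
    using r by (auto simp: less_3_iff algebra_simps)
qed (simp add: sig_mat_def)

text \<open>On the lattice kbar[t]^3 the factor T forces the whole image of \<sigma> to be divisible
  by T, which leaves enough remainders to form a basis over kbar[\<sigma>].\<close>

lemma t_motive_scaled_Phi_alpha:
  assumes a: "\<alpha> \<in> kbar \<iota>"
  shows "t_motive \<iota> (motive_of \<iota> (T \<cdot>\<^sub>m Phi_v (fls_const \<alpha>, 0)))"
proof -
  let ?\<Phi> = "T \<cdot>\<^sub>m Phi_v (fls_const \<alpha>, 0)"
  let ?N = "vecs_in (kbar_polys \<iota>) 3"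
  obtain A where A: "A \<in> tate_L" "A \<noteq> 0" "twist \<iota> A = T * A"
    by (rule carlitz_solution)
  obtain \<Psi> where "trivialised_by (Phi_v (fls_const \<alpha>, 0)) \<Psi> 3"
    by (rule trivialised_by_Phi_v[OF fq_denominators_const[OF a]])
  then have trivialised_by: "trivialised_by ?\<Phi> (A \<cdot>\<^sub>m \<Psi>) 3"
    by (rule trivialised_by_scale[OF _ A])
  then have valid: "valid ?\<Phi> 3"
    by (simp add: trivialised_by_def)
  have sig: "sig_mat ?\<Phi> x = v3 (T * (T * twist \<iota> (x $ Suc 0) + fls_const \<alpha> * twist \<iota> (x $ Suc (Suc 0))))
      (T * (twist \<iota> (x $ 0) - K * twist \<iota> (x $ Suc 0))) (T * twist \<iota> (x $ Suc (Suc 0)))"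
    if "x \<in> ?N" for x
    using sig_Phi_v[of x T "(fls_const \<alpha>, 0)"] that by (simp add: vecs_in_carrier)
  \<comment> \<open>Representatives of the cokernel of \<sigma>: remainders modulo T^2 in the first
    coordinate and modulo T in the others. Their number is the degree of the determinant -
    T^4.\<close>
  let ?c = "[v3 1 0 0, v3 T 0 0, v3 0 1 0, v3 0 0 1] :: 'c fls vec list"
  have aP: "fls_const \<alpha> \<in> kbar_polys \<iota>"
    by (rule const_mem_kbar_polys[OF a])
  have "from_anderson_t_motive \<iota> (motive_of \<iota> ?\<Phi>)"
  proof (rule anderson_criterion[OF valid, of ?c "degrees_below 3" 2])
    show "?\<Phi> $$ (i, j) \<in> kbar_polys \<iota>" if "i < 3" "j < 3" for i j
    proof -
      have "Phi_v (fls_const \<alpha>, 0) $$ (i, j) \<in> kbar_polys \<iota>"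
        using that X_theta_mem_kbar_polys K_mem_kbar_polys aP
        by (auto simp: less_3_iff kbarp.mems)
      then show ?thesis
        using that X_theta_mem_kbar_polys by (simp add: kbarp.mult_mem)
    qed
    show "set ?c \<subseteq> ?N"
      using X_theta_mem_kbar_polys by (simp add: v3_mem kbarp.mems)
  next
    fix m x assume x: "x \<in> ?N" "degrees_below 3 (Suc m) x"
    have "\<exists>p\<in>coeffs_in (kbar \<iota>). x $ r = emb p \<and> degree_below (Suc m) p" if "r < 3" for r
      using x(2) that by (simp add: degrees_below_def)
    from this[of 0] this[of "Suc 0"] this[of "Suc (Suc 0)"]
    obtain p0 p1 p2 where p: "p0 \<in> coeffs_in (kbar \<iota>)" "p1 \<in> coeffs_in (kbar \<iota>)" "p2 \<in> coeffs_in (kbar \<iota>)"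
      "x $ 0 = emb p0" "x $ Suc 0 = emb p1" "x $ Suc (Suc 0) = emb p2"
      "degree_below (Suc m) p0" "degree_below (Suc m) p1" "degree_below (Suc m) p2"
      by auto
    obtain k3 s2 where 3: "k3 \<in> kbar \<iota>" "s2 \<in> coeffs_in (kbar \<iota>)" "degree_below m s2" "p2 = [:k3:] + T_poly * s2"
      by (rule division_by_T[OF p(3,9)])
    \<comment> \<open>The last coordinate of the quotient also contributes \<alpha> T s2 to the
      first coordinate of its image under \<sigma>; this is removed before the two divisions by
      T.\<close>
    let ?p = "p0 - [:\<alpha>:] * (T_poly * s2)"
    have "?p \<in> coeffs_in (kbar \<iota>)"
      by (intro Ck.diff_mem Ck.mult_mem const_mem_Ck T_poly_mem a p 3)
    moreover have "degree_below (Suc m) ([:\<alpha>:] * (T_poly * s2))"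
      using degree_below_smult[OF degree_below_T_mult[OF 3(3)], of \<alpha>] by simp
    then have "degree_below (Suc m) ?p"
      by (rule degree_below_diff[OF p(7)])
    ultimately obtain k0 s0 where 0: "k0 \<in> kbar \<iota>" "s0 \<in> coeffs_in (kbar \<iota>)" "degree_below m s0" "?p = [:k0:] + T_poly * s0"
      by (rule division_by_T)
    obtain k1 s1 where 1: "k1 \<in> kbar \<iota>" "s1 \<in> coeffs_in (kbar \<iota>)" "degree_below m s1" "s0 = [:k1:] + T_poly * s1"
      by (rule division_by_T[OF 0(2) degree_below_mono[OF 0(3) le_SucI[OF order_refl]]])
    obtain k2 s where 2: "k2 \<in> kbar \<iota>" "s \<in> coeffs_in (kbar \<iota>)" "degree_below m s" "p1 = [:k2:] + T_poly * s"
      by (rule division_by_T[OF p(2,8)])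
    \<comment> \<open>The second coordinate of \<sigma> y is T times the twist of y_0 minus K times
      the twist of y_1, and it has to be T s.\<close>
    let ?s = "s + K_poly * s1"
    have sK: "?s \<in> coeffs_in (kbar \<iota>)"
      using kappa_mem by (intro Ck.add_mem Ck.mult_mem const_mem_Ck 1 2) simp
    have sb: "degree_below m ?s"
      using degree_below_add[OF 2(3) degree_below_smult[OF 1(3), of "phi \<kappa>"]] by simp
    obtain y0 where y0: "y0 \<in> coeffs_in (kbar \<iota>)" "degree_below m y0" "twist \<iota> (emb y0) = emb ?s"
      by (rule untwist_poly[OF sK sb])
    obtain y1 where y1: "y1 \<in> coeffs_in (kbar \<iota>)" "degree_below m y1" "twist \<iota> (emb y1) = emb s1"
      by (rule untwist_poly[OF 1(2,3)])
    obtain y2 where y2: "y2 \<in> coeffs_in (kbar \<iota>)" "degree_below m y2" "twist \<iota> (emb y2) = emb s2"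
      by (rule untwist_poly[OF 3(2,3)])
    let ?y = "v3 (emb y0) (emb y1) (emb y2)"
    let ?k = "\<lambda>i. [k0, k1, k2, k3] ! i"
    have y: "?y \<in> ?N"
      using y0(1) y1(1) y2(1) by (simp add: v3_mem kbar_polys_eq)
    have bdy: "degrees_below 3 m ?y"
      using y0 y1 y2 sb 1(3) 3(3) unfolding degrees_below_def less_3_iff by auto
    have k: "\<forall>i<length ?c. ?k i \<in> kbar \<iota>"
      using 0(1) 1(1) 2(1) 3(1) by (auto simp: less_Suc_eq)
    have tws: "twist \<iota> (?y $ 0) = emb s + K * emb s1" "twist \<iota> (?y $ Suc 0) = emb s1"
      "twist \<iota> (?y $ Suc (Suc 0)) = emb s2"
      unfolding v3_nth y0(3) y1(3) y2(3) emb.hom_add emb.hom_mult emb_const by (rule refl)+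
    have "p0 = [:k0:] + T_poly * ([:k1:] + T_poly * s1) + [:\<alpha>:] * (T_poly * s2)"
      unfolding 1(4)[symmetric] 0(4)[symmetric] by simp
    then have x0: "x $ 0 = fls_const k0 + T * (fls_const k1 + T * emb s1) + fls_const \<alpha> * (T * emb s2)"
      unfolding p(4) by (simp only: emb.hom_add emb.hom_mult emb_const emb_linear)
    have x1: "x $ Suc 0 = fls_const k2 + T * emb s" "x $ Suc (Suc 0) = fls_const k3 + T * emb s2"
      unfolding p 2(4) 3(4) by (simp_all only: emb.hom_add emb.hom_mult emb_const emb_linear)
    have "\<forall>r<3. x $ r = (\<Sum>i<length ?c. fls_const (?k i) * ?c ! i $ r) + sig_mat ?\<Phi> ?y $ r"
      unfolding less_3_iff sig[OF y] tws
      by (auto simp: x0 x1) (simp_all add: algebra_simps)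
    then show "\<exists>k y. (\<forall>i<length ?c. k i \<in> kbar \<iota>) \<and> y \<in> ?N \<and> degrees_below 3 m y \<and>
        (\<forall>r<3. x $ r = (\<Sum>i<length ?c. fls_const (k i) * ?c ! i $ r) + sig_mat ?\<Phi> y $ r)"
      using k y bdy by blast
  next
    fix k :: "nat \<Rightarrow> 'c" and y
    assume k: "\<And>i. i < length ?c \<Longrightarrow> k i \<in> kbar \<iota>" and y: "y \<in> ?N"
      and eq: "\<And>r. r < 3 \<Longrightarrow> (\<Sum>i<length ?c. fls_const (k i) * ?c ! i $ r) + sig_mat ?\<Phi> y $ r = 0"
    have "y $ 0 \<in> kbar_polys \<iota>" "y $ Suc 0 \<in> kbar_polys \<iota>" "y $ Suc (Suc 0) \<in> kbar_polys \<iota>"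
      using vecs_in_nth[OF y] by simp_all
    then obtain p0 p1 p2 where p: "y $ 0 = emb p0" "y $ Suc 0 = emb p1" "y $ Suc (Suc 0) = emb p2"
      by (auto simp: kbar_polys_eq)
    have "fls_const (k 3) + T * twist \<iota> (emb p2) = 0"
      using eq[of 2] unfolding sig[OF y] p by (simp add: numeral_2_eq_2 numeral_3_eq_3)
    then have "emb ([:k 3:] + T_poly * ptw p2) = 0"
      by (simp only: emb.hom_add emb.hom_mult emb_const emb_linear twist_emb)
    then have 3: "k 3 = 0" "ptw p2 = 0"
      using T_division_unique unfolding emb_eq_0 by blast+
    have "fls_const (k 0) + T * (fls_const (k 1) + T * twist \<iota> (emb p1)) = 0"
      using eq[of 0] unfolding sig[OF y] p twist_emb 3(2) by (simp add: algebra_simps)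
    then have "emb ([:k 0:] + T_poly * ([:k 1:] + T_poly * ptw p1)) = 0"
      by (simp only: emb.hom_add emb.hom_mult emb_const emb_linear twist_emb)
    then have "k 0 = 0 \<and> [:k 1:] + T_poly * ptw p1 = 0"
      unfolding emb_eq_0 by (rule T_division_unique)
    then have 1: "k 0 = 0" "k 1 = 0" "ptw p1 = 0"
      using T_division_unique[of "k 1" "ptw p1"] by blast+
    have "fls_const (k 2) + T * twist \<iota> (emb p0) = 0"
      using eq[of 1] unfolding sig[OF y] p twist_emb 1(3) by (simp add: numeral_2_eq_2)
    then have "emb ([:k 2:] + T_poly * ptw p0) = 0"
      by (simp only: emb.hom_add emb.hom_mult emb_const emb_linear twist_emb)
    then have 2: "k 2 = 0" "ptw p0 = 0"
      using T_division_unique unfolding emb_eq_0 by blast+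
    have "p0 = 0" "p1 = 0" "p2 = 0"
      using 1(3) 2(2) 3(2) by simp_all
    then have "y = v3 0 0 0"
      using vec_eq_v3[OF vecs_in_carrier[OF y]] p by simp
    also have "\<dots> = 0\<^sub>v 3"
      by (intro eq_vecI) (auto simp: less_3_iff)
    finally show "(\<forall>i<length ?c. k i = 0) \<and> y = 0\<^sub>v 3"
      using 1 2 3 by (auto simp: less_Suc_eq numeral_2_eq_2 numeral_3_eq_3)
  next
    fix x assume x: "x \<in> ?N"
    have mem: "x $ 0 \<in> kbar_polys \<iota>" "x $ Suc 0 \<in> kbar_polys \<iota>" "x $ Suc (Suc 0) \<in> kbar_polys \<iota>"
      using vecs_in_nth[OF x] by simp_all
    \<comment> \<open>The equation T^2 x = \<sigma> y is solved starting from the last coordinate.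
      The exponent is 2 because the twist of y_1 occurs with factor T^2 in the first
      coordinate.\<close>
    let ?y1 = "x $ 0 - fls_const \<alpha> * x $ Suc (Suc 0)"
    obtain y1 where y1: "y1 \<in> kbar_polys \<iota>" "twist \<iota> y1 = ?y1"
      using twist_surj_kbar_polys[of ?y1] mem aP by (auto intro: kbarp.mems)
    obtain y2 where y2: "y2 \<in> kbar_polys \<iota>" "twist \<iota> y2 = T * x $ Suc (Suc 0)"
      using twist_surj_kbar_polys[of "T * x $ Suc (Suc 0)"] mem X_theta_mem_kbar_polys kbarp.mult_mem by blast
    obtain y0 where y0: "y0 \<in> kbar_polys \<iota>" "twist \<iota> y0 = T * x $ Suc 0 + K * ?y1"
    proof -
      have "T * x $ Suc 0 + K * ?y1 \<in> kbar_polys \<iota>"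
        by (intro kbarp.add_mem kbarp.mult_mem kbarp.diff_mem mem aP X_theta_mem_kbar_polys K_mem_kbar_polys)
      then show ?thesis
        using twist_surj_kbar_polys that by blast
    qed
    have y: "v3 y0 y1 y2 \<in> ?N"
      using y0 y1 y2 by (simp add: v3_mem)
    have "T ^ 2 \<cdot>\<^sub>v x = v3 (T ^ 2 * x $ 0) (T ^ 2 * x $ Suc 0) (T ^ 2 * x $ Suc (Suc 0))"
      using vec_eq_v3[of "T ^ 2 \<cdot>\<^sub>v x"] x by (simp add: vecs_in_carrier)
    also have "\<dots> = sig_mat ?\<Phi> (v3 y0 y1 y2)"
      unfolding sig[OF y] v3_nth y0(2) y1(2) y2(2)
      by (intro arg_cong3[where f = v3]) (simp_all add: power2_eq_square algebra_simps)
    finally show "\<exists>y\<in>?N. T ^ 2 \<cdot>\<^sub>v x = sig_mat ?\<Phi> y"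
      using y by blast
  qed (rule degrees_below_0 degrees_below_exists; assumption)+
  then show ?thesis
    using rat_motive_motive_of[OF trivialised_by] by (rule t_motive.anderson[rotated])
qed

lemma trivialised_by_imp_valid: "trivialised_by \<Phi> \<Psi> d \<Longrightarrow> valid \<Phi> d"
  by (simp add: trivialised_by_def)

text \<open>\<open>M\<^sub>\<alpha>\<close> itself is not an Anderson t-motive, but its tensor product with the Carlitz motive is.\<close>

lemma t_motive_Phi_alpha:
  assumes a: "\<alpha> \<in> kbar \<iota>"
  shows "t_motive \<iota> (motive_of \<iota> (Phi_v (fls_const \<alpha>, 0)))"
proof -
  let ?C = "T \<cdot>\<^sub>m 1\<^sub>m 1 :: 'c fls mat"
  let ?D = "(1 / T) \<cdot>\<^sub>m 1\<^sub>m 1 :: 'c fls mat"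
  let ?P = "T \<cdot>\<^sub>m Phi_v (fls_const \<alpha>, 0)"
  let ?X = "Phi_v (fls_const \<alpha>, 0)"
  obtain A where A: "A \<in> tate_L" "A \<noteq> 0" "twist \<iota> A = T * A"
    by (rule carlitz_solution)
  obtain \<Psi> where X: "trivialised_by ?X \<Psi> 3"
    by (rule trivialised_by_Phi_v[OF fq_denominators_const[OF a]])
  have P: "trivialised_by ?P (A \<cdot>\<^sub>m \<Psi>) 3"
    by (rule trivialised_by_scale[OF X A])
  have C: "trivialised_by ?C (A \<cdot>\<^sub>m 1\<^sub>m 1) 1"
    by (rule trivialised_by_scale[OF trivialised_by_one A])
  obtain \<Psi>D where D: "trivialised_by ?D \<Psi>D 1"
    by (rule trivialised_by_dual_carlitz)
  note rep = represented_by_unit_vecs[OF trivialised_by_imp_valid]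
  have "t_motive \<iota> (motive_of \<iota> ?D)"
  proof (rule t_motive.dual[OF t_motive_carlitz rep[OF C] rat_motive_motive_of[OF D] rep[OF D]])
    show "inverts_mat ?C (transpose_mat ?D)"
      unfolding inverts_mat_def by (intro eq_matI) (auto simp: scalar_prod_def)
  qed simp
  then show ?thesis
  proof (rule t_motive.tensor[OF t_motive_scaled_Phi_alpha[OF a] _ rep[OF P] rep[OF D] rat_motive_motive_of[OF X]])
    have "kronecker_mat ?P ?D = ?X"
      by (intro eq_matI) (auto simp: kronecker_mat_def)
    then show "represented_by \<iota> (motive_of \<iota> ?X) (unit_vecs 3) (kronecker_mat ?P ?D)"
      using rep[OF X] by simp
  qed
qed

section \<open>The sum of two bottom rows\<close>

lemma Phi_vw_eq: "Phi_vw v w = mat_of_rows_list 4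
  [[0, 1, 0, 0], [T, - K, 0, 0], [fst v, snd v, 1, 0], [fst w, snd w, 0, 1]]"
  by (intro eq_matI) (auto simp: Phi_vw_def row2_def mat_of_rows_list_def four_block_mat_def Let_def
      Phi_rho_eq less_Suc_eq eval_nat_numeral)

lemma Phi_v_eq: "Phi_v v = mat_of_rows_list 3 [[0, 1, 0], [T, - K, 0], [fst v, snd v, 1]]"
  by (intro eq_matI) (auto simp: mat_of_rows_list_def less_Suc_eq eval_nat_numeral)

definition Phi_sum :: "'c fls \<times> 'c fls \<Rightarrow> 'c fls \<times> 'c fls \<Rightarrow> 'c fls mat" where
  "Phi_sum v w = four_block_mat (Phi_v v) (0\<^sub>m 3 3) (0\<^sub>m 3 3) (Phi_v w)"

lemma Phi_sum_eq: "Phi_sum v w = mat_of_rows_list 6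
  [[0, 1, 0, 0, 0, 0], [T, - K, 0, 0, 0, 0], [fst v, snd v, 1, 0, 0, 0],
   [0, 0, 0, 0, 1, 0], [0, 0, 0, T, - K, 0], [0, 0, 0, fst w, snd w, 1]]"
  by (intro eq_matI) (auto simp: Phi_sum_def Phi_v_eq mat_of_rows_list_def four_block_mat_def Let_def
      less_Suc_eq eval_nat_numeral)

text \<open>
  The pushout of \<open>X\<^sub>v \<oplus> X\<^sub>w\<close> along \<open>(m, m') \<mapsto> m + f(m')\<close> is a quotient, with two extra basis vectors;
  the diagonal of these gives the extension with bottom row \<open>v + w F\<close>.
\<close>

lemma t_motive_Phi_v_add:
  assumes a: "\<alpha> \<in> kbar \<iota>" and v: "fq_denominators v" "t_motive \<iota> (motive_of \<iota> (Phi_v v))"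
    and y: "fst y \<in> kbar_rats \<iota>" "snd y \<in> kbar_rats \<iota>" "sig_eq y"
  shows "t_motive \<iota> (motive_of \<iota> (Phi_v (fst v + fls_const \<alpha> * fst y, snd v + fls_const \<alpha> * snd y)))"
proof -
  obtain b c where bc: "y = (b, c)"
    by (metis surj_pair)
  obtain d e where de: "sig y = (d, e)"
    by (metis surj_pair)
  have de': "d = T * twist \<iota> c" "e = twist \<iota> b - K * twist \<iota> c"
    using de by (simp_all add: sig_def bc)
  have "sig (d, e) = (T * twist \<iota> e, twist \<iota> d - K * twist \<iota> e)"
    by (simp add: sig_def)
  then have rel: "T * twist \<iota> e = T * b - K * d" "twist \<iota> d - K * twist \<iota> e = T * c - K * e"
    using y(3) unfolding sig_eq_def de by (simp_all add: bc)
  have mem: "b \<in> kbar_rats \<iota>" "c \<in> kbar_rats \<iota>" "d \<in> kbar_rats \<iota>" "e \<in> kbar_rats \<iota>"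
    using y T_mem_kbar_rats K_mem_kbar_rats unfolding de' bc by (auto intro!: kbarr.mems twist_mem_kbar_rats)
  let ?w = "(fls_const \<alpha>, 0)" and ?u = "(fls_const \<alpha> * b, fls_const \<alpha> * c)"
  let ?s = "(fst v + fls_const \<alpha> * b, snd v + fls_const \<alpha> * c)"
  have gw: "fq_denominators ?w"
    by (rule fq_denominators_const[OF a])
  have gu: "fq_denominators ?u"
    using fq_denominators_of_sig_eq[OF y a] by (simp add: bc)
  have gs: "fq_denominators ?s"
    using fq_denominators_add[OF v(1) gu] by simp
  obtain \<Psi>1 where P1: "trivialised_by (Phi_v v) \<Psi>1 3"
    by (rule trivialised_by_Phi_v[OF v(1)])
  obtain \<Psi>2 where P2: "trivialised_by (Phi_v ?w) \<Psi>2 3"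
    by (rule trivialised_by_Phi_v[OF gw])
  obtain \<Psi>3 where P3: "trivialised_by (Phi_v ?s) \<Psi>3 3"
    by (rule trivialised_by_Phi_v[OF gs])
  obtain \<Psi>4 where P4: "trivialised_by (Phi_vw v ?u) \<Psi>4 4"
    by (rule trivialised_by_Phi_vw[OF v(1) gu])
  have PY: "trivialised_by (Phi_sum v ?w) (four_block_mat \<Psi>1 (0\<^sub>m 3 3) (0\<^sub>m 3 3) \<Psi>2) 6"
    using trivialised_by_direct_sum[OF P1 P2] by (simp add: Phi_sum_def)
  note rep = represented_by_unit_vecs[OF trivialised_by_imp_valid]
  have Y: "t_motive \<iota> (motive_of \<iota> (Phi_sum v ?w))"
    by (rule t_motive.direct_sum[OF v(2) t_motive_Phi_alpha[OF a] rep[OF P1] rep[OF P2] rat_motive_motive_of[OF PY],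
          where d = "unit_vecs 6"]) (use rep[OF PY] in \<open>simp add: Phi_sum_def\<close>)
  \<comment> \<open>The rows are the images of the six basis vectors. In the second copy m_1 goes to
    y = (b, c) and m_2 = \<sigma> m_1 to \<sigma> y = (d, e), while the two lifts of 1 stay
    separate.\<close>
  let ?B = "mat_of_rows_list 4 [[1, 0, 0, 0], [0, 1, 0, 0], [0, 0, 1, 0], [b, c, 0, 0], [d, e, 0, 0], [0, 0, 0, 1]]"
  have B: "?B \<in> carrier_mat 6 4"
    by (simp add: mat_of_rows_list_def eval_nat_numeral)
  have Bmem: "?B $$ (i, j) \<in> kbar_rats \<iota>" if "i < 6" "j < 4" for i j
    using that mem by (auto simp: mat_of_rows_list_def less_Suc_eq eval_nat_numeral kbarr.mems)
  have Bcomm: "Phi_sum v ?w * ?B = map_mat (twist \<iota>) ?B * Phi_vw v ?u"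
    unfolding Phi_sum_eq Phi_vw_eq
  proof (rule eq_matI, goal_cases)
    case (1 i j)
    then have "i < 6" "j < 4"
      by (auto simp: mat_of_rows_list_def)
    then show ?case
      using rel de'
      by (auto simp: mat_of_rows_list_def less_Suc_eq eval_nat_numeral scalar_prod_def mult.commute)
  qed (auto simp: mat_of_rows_list_def)
  have "t_motive \<iota> (motive_of \<iota> (Phi_vw v ?u))"
  proof (rule t_motive.quotient[OF Y rat_motive_motive_of[OF P4]])
    let ?f = "\<lambda>x\<in>V 6. transpose_mat ?B *\<^sub>v x"
    show hom: "?f \<in> ptm_hom \<iota> (motive_of \<iota> (Phi_sum v ?w)) (motive_of \<iota> (Phi_vw v ?u))"
      by (rule ptm_hom_matrix[OF trivialised_by_imp_valid[OF PY] trivialised_by_imp_valid[OF P4] B Bmem Bcomm])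
    have dims: "dim_row (Phi_sum v ?w) = 6" "dim_row (Phi_vw v ?u) = 4"
      using PY P4 by (auto simp: trivialised_by_def valid_def)
    have "\<exists>x\<in>V 6. z = transpose_mat ?B *\<^sub>v x" if z: "z \<in> V 4" for z
    \<comment> \<open>A preimage without component in the second copy of
      \<open>M_rho\<close>.\<close>
    proof (rule bexI[of _ "vec 6 (\<lambda>i. [z $ 0, z $ 1, z $ 2, 0, 0, z $ 3] ! i)"])
      have "z $ 0 \<in> kbar_rats \<iota>" "z $ 1 \<in> kbar_rats \<iota>" "z $ 2 \<in> kbar_rats \<iota>" "z $ 3 \<in> kbar_rats \<iota>"
        using vecs_in_nth[OF z, of 0] vecs_in_nth[OF z, of 1] vecs_in_nth[OF z, of 2] vecs_in_nth[OF z, of 3]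
        by simp_all
      then show "vec 6 (\<lambda>i. [z $ 0, z $ 1, z $ 2, 0, 0, z $ 3] ! i) \<in> V 6"
        by (intro vecs_inI) (auto simp: less_Suc_eq eval_nat_numeral kbarr.zero_mem)
      show "z = transpose_mat ?B *\<^sub>v vec 6 (\<lambda>i. [z $ 0, z $ 1, z $ 2, 0, 0, z $ 3] ! i)"
        using z by (intro eq_vecI)
          (auto simp: mat_of_rows_list_def less_Suc_eq eval_nat_numeral scalar_prod_def)
    qed
    moreover have "?f x \<in> V 4" if "x \<in> V 6" for x
      using hom that unfolding ptm_hom_def by (auto simp: dims)
    ultimately show "?f ` carrier (motive_of \<iota> (Phi_sum v ?w)) = carrier (motive_of \<iota> (Phi_vw v ?u))"
      unfolding motive_of_simps dims by (auto simp: image_iff)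
  qed
  then have "t_motive \<iota> (motive_of \<iota> (Phi_v ?s))"
  proof (rule t_motive.subobject[OF _ rat_motive_motive_of[OF P3]])
    \<comment> \<open>The third basis vector goes to the sum of the two lifts of 1, so the two
      bottom rows are added.\<close>
    let ?E = "mat_of_rows_list 4 [[1, 0, 0, 0], [0, 1, 0, 0], [0, 0, 1, 1]] :: 'c fls mat"
    have E: "?E \<in> carrier_mat 3 4"
      by (simp add: mat_of_rows_list_def eval_nat_numeral)
    have Emem: "?E $$ (i, j) \<in> kbar_rats \<iota>" if "i < 3" "j < 4" for i j
      using that by (auto simp: mat_of_rows_list_def less_Suc_eq eval_nat_numeral kbarr.mems)
    have Ecomm: "Phi_v ?s * ?E = map_mat (twist \<iota>) ?E * Phi_vw v ?u"
      unfolding Phi_v_eq Phi_vw_eq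
    proof (rule eq_matI, goal_cases)
      case (1 i j)
      then have "i < 3" "j < 4"
        by (auto simp: mat_of_rows_list_def)
      then show ?case
        by (auto simp: mat_of_rows_list_def less_Suc_eq eval_nat_numeral scalar_prod_def)
    qed (auto simp: mat_of_rows_list_def)
    show "(\<lambda>x\<in>V 3. transpose_mat ?E *\<^sub>v x) \<in> ptm_hom \<iota> (motive_of \<iota> (Phi_v ?s)) (motive_of \<iota> (Phi_vw v ?u))"
      by (rule ptm_hom_matrix[OF trivialised_by_imp_valid[OF P3] trivialised_by_imp_valid[OF P4] E Emem Ecomm])
    have nth: "(transpose_mat ?E *\<^sub>v x) $ i = x $ i" if "x \<in> V 3" "i < 3" for x i
      using that by (auto simp: mat_of_rows_list_def less_Suc_eq eval_nat_numeral scalar_prod_def)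
    show "inj_on (\<lambda>x\<in>V 3. transpose_mat ?E *\<^sub>v x) (carrier (motive_of \<iota> (Phi_v ?s)))"
    proof (rule inj_onI)
      fix x z assume "x \<in> carrier (motive_of \<iota> (Phi_v ?s))" "z \<in> carrier (motive_of \<iota> (Phi_v ?s))"
        and eq: "(\<lambda>x\<in>V 3. transpose_mat ?E *\<^sub>v x) x = (\<lambda>x\<in>V 3. transpose_mat ?E *\<^sub>v x) z"
      then have xz: "x \<in> V 3" "z \<in> V 3"
        by simp_all
      then have "transpose_mat ?E *\<^sub>v x = transpose_mat ?E *\<^sub>v z"
        using eq by (simp only: restrict_apply if_True)
      then have "x $ i = z $ i" if "i < 3" for i
        using nth[OF xz(1) that] nth[OF xz(2) that] by (simp only:)
      then show "x = z"
        using xz by (intro eq_vecI) auto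
    qed
  qed
  then show ?thesis
    by (simp add: bc)
qed

text \<open>Every introduction rule except \<open>trivial\<close> has this as a premise.\<close>

lemma rat_motive_t_motive: "t_motive \<iota> X \<Longrightarrow> rat_motive \<iota> X"
proof (cases rule: t_motive.cases, assumption)
  assume "X = trivial_motive \<iota>"
  then show ?thesis
    using rat_motive_motive_of[OF trivialised_by_one] by (simp add: trivial_motive_def)
qed auto

end

section \<open>Extensions of the trivial motive by \<open>M\<^sub>\<rho>\<close>\<close>

lemma ptm_homD:
  assumes "f \<in> ptm_hom \<iota> A B" "x \<in> carrier A"
  shows "f x \<in> carrier B" "y \<in> carrier A \<Longrightarrow> f (x \<oplus>\<^bsub>A\<^esub> y) = f x \<oplus>\<^bsub>B\<^esub> f y"
    "a \<in> kbar_rats \<iota> \<Longrightarrow> f (a \<odot>\<^bsub>A\<^esub> x) = a \<odot>\<^bsub>B\<^esub> f x" "f (sigma A x) = sigma B (f x)"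
  using assms by (auto simp: ptm_hom_def)

lemma ptm_hom_restrict:
  assumes "\<And>x. x \<in> carrier A \<Longrightarrow> f x \<in> carrier B"
    and "\<And>x y. x \<in> carrier A \<Longrightarrow> y \<in> carrier A \<Longrightarrow> x \<oplus>\<^bsub>A\<^esub> y \<in> carrier A \<and> f (x \<oplus>\<^bsub>A\<^esub> y) = f x \<oplus>\<^bsub>B\<^esub> f y"
    and "\<And>a x. a \<in> kbar_rats \<iota> \<Longrightarrow> x \<in> carrier A \<Longrightarrow> a \<odot>\<^bsub>A\<^esub> x \<in> carrier A \<and> f (a \<odot>\<^bsub>A\<^esub> x) = a \<odot>\<^bsub>B\<^esub> f x"
    and "\<And>x. x \<in> carrier A \<Longrightarrow> sigma A x \<in> carrier A \<and> f (sigma A x) = sigma B (f x)"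
  shows "(\<lambda>x\<in>carrier A. f x) \<in> ptm_hom \<iota> A B"
  using assms unfolding ptm_hom_def by auto

context drinfeld
begin

abbreviation Nt :: "('c fls, 'c fls vec) sigma_module" where "Nt \<equiv> trivial_motive \<iota>"
abbreviation Mr :: "('c fls, 'c fls vec) sigma_module" where "Mr \<equiv> M_rho \<iota> \<kappa>"
abbreviation Mw :: "'c fls vec \<Rightarrow> ('c fls, 'c fls vec) sigma_module" where
  "Mw w \<equiv> motive_of \<iota> (Phi_v (w $ 0, w $ Suc 0))"

definition snoc_vec :: "'c fls vec \<Rightarrow> 'c fls \<Rightarrow> 'c fls vec" where
  "snoc_vec m c = m @\<^sub>v vec 1 (\<lambda>_. c)"

definition first_two :: "'c fls vec \<Rightarrow> 'c fls vec" where
  "first_two x = vec 2 (\<lambda>i. x $ i)"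

text \<open>The standard extension with bottom row w; for w = (\<alpha>, 0) it is
  \<open>M_alpha\<close>.\<close>

definition row_extension :: "'c fls vec \<Rightarrow> ('c fls, 'c fls vec) extension" where
  "row_extension w = (Mw w, \<lambda>x\<in>V 2. snoc_vec x 0, \<lambda>x\<in>V 3. vec 1 (\<lambda>_. x $ 2))"

lemma Nt_simps [simp]:
  "carrier Nt = V 1" "zero Nt = 0\<^sub>v 1" "add Nt = (+)" "module.smult Nt = (\<cdot>\<^sub>v)"
  by (simp_all add: trivial_motive_def)

lemma sigma_Nt: "y \<in> V 1 \<Longrightarrow> sigma Nt y = map_vec (twist \<iota>) y"
  by (simp add: trivial_motive_def vecs_in_carrier)

lemma Mr_simps [simp]:
  "carrier Mr = V 2" "zero Mr = 0\<^sub>v 2" "add Mr = (+)" "module.smult Mr = (\<cdot>\<^sub>v)"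
  by (simp_all add: M_rho_def)

lemma V2_eqI: "m \<in> V 2 \<Longrightarrow> m' \<in> V 2 \<Longrightarrow> m $ 0 = m' $ 0 \<Longrightarrow> m $ Suc 0 = m' $ Suc 0 \<Longrightarrow> m = m'"
  by (intro eq_vecI) (auto simp: less_2_iff_or)

lemma V2_iff: "m \<in> V 2 \<longleftrightarrow> dim_vec m = 2 \<and> m $ 0 \<in> kbar_rats \<iota> \<and> m $ Suc 0 \<in> kbar_rats \<iota>"
proof
  assume m: "m \<in> V 2"
  show "dim_vec m = 2 \<and> m $ 0 \<in> kbar_rats \<iota> \<and> m $ Suc 0 \<in> kbar_rats \<iota>"
    using vecs_in_dim[OF m] vecs_in_nth[OF m, of 0] vecs_in_nth[OF m, of "Suc 0"] by simp
next
  assume m: "dim_vec m = 2 \<and> m $ 0 \<in> kbar_rats \<iota> \<and> m $ Suc 0 \<in> kbar_rats \<iota>"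
  show "m \<in> V 2"
  proof (rule vecs_inI)
    fix i :: nat assume "i < 2"
    then have "i = 0 \<or> i = Suc 0"
      by arith
    then show "m $ i \<in> kbar_rats \<iota>"
      using m by (elim disjE) simp_all
  qed (use m in simp)
qed

lemma sigma_Mr:
  assumes "m \<in> V 2"
  shows "sigma Mr m \<in> V 2" "sigma Mr m $ 0 = T * twist \<iota> (m $ Suc 0)"
    "sigma Mr m $ Suc 0 = twist \<iota> (m $ 0) - K * twist \<iota> (m $ Suc 0)"
proof -
  have two: "{..<2::nat} = {0, Suc 0}"
    by auto
  have eq: "sigma Mr m = sig_mat (Phi_rho \<iota> \<kappa>) m"
    unfolding M_rho_def sigma_motive_of ..
  show "sigma Mr m \<in> V 2"
    unfolding eq sig_mat_def using assms trivialised_by_imp_valid[OF trivialised_by_rho] sigma_closed by blast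
  show "sigma Mr m $ 0 = T * twist \<iota> (m $ Suc 0)"
    "sigma Mr m $ Suc 0 = twist \<iota> (m $ 0) - K * twist \<iota> (m $ Suc 0)"
    unfolding eq using sig_mat_nth[OF Phi_rho_carrier vecs_in_carrier[OF assms]] two by simp_all
qed

lemma snoc_vec_eq_v3: "m \<in> V 2 \<Longrightarrow> snoc_vec m c = v3 (m $ 0) (m $ Suc 0) c"
  unfolding snoc_vec_def v3_def by (rule eq_vecI) (auto simp: less_Suc_eq eval_nat_numeral)

lemma snoc_vec_nth [simp]:
  assumes "m \<in> V 2"
  shows "snoc_vec m c $ 0 = m $ 0" "snoc_vec m c $ Suc 0 = m $ Suc 0" "snoc_vec m c $ 2 = c" "dim_vec (snoc_vec m c) = 3"
  using assms v3_nth(3)[of "m $ 0" "m $ Suc 0" c] by (simp_all add: snoc_vec_eq_v3 numeral_2_eq_2)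

lemma snoc_vec_mem: "m \<in> V 2 \<Longrightarrow> c \<in> kbar_rats \<iota> \<Longrightarrow> snoc_vec m c \<in> V 3"
  by (subst snoc_vec_eq_v3) (simp_all add: v3_mem V2_iff)

lemma first_two_snoc_vec [simp]: "m \<in> V 2 \<Longrightarrow> first_two (snoc_vec m c) = m"
  unfolding first_two_def by (rule V2_eqI) (auto simp: V2_iff)

lemma snoc_vec_cases:
  assumes "x \<in> V 3"
  obtains m c where "m \<in> V 2" "c \<in> kbar_rats \<iota>" "x = snoc_vec m c"
proof (rule that)
  show 2: "first_two x \<in> V 2"
    using vecs_in_nth[OF assms, of 0] vecs_in_nth[OF assms, of "Suc 0"] by (simp add: V2_iff first_two_def)
  show "x $ 2 \<in> kbar_rats \<iota>"
    using vecs_in_nth[OF assms, of 2] by simp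
  show "x = snoc_vec (first_two x) (x $ 2)"
    unfolding snoc_vec_eq_v3[OF 2] using vec_eq_v3[OF vecs_in_carrier[OF assms]]
    by (simp add: first_two_def numeral_2_eq_2)
qed

lemma snoc_vec_inject:
  assumes "m \<in> V 2" "m' \<in> V 2"
  shows "snoc_vec m c = snoc_vec m' c' \<longleftrightarrow> m = m' \<and> c = c'"
  using first_two_snoc_vec[OF assms(1), of c] first_two_snoc_vec[OF assms(2), of c'] snoc_vec_nth(3)[OF assms(1), of c]
    snoc_vec_nth(3)[OF assms(2), of c'] by metis

lemma snoc_vec_add: "m \<in> V 2 \<Longrightarrow> m' \<in> V 2 \<Longrightarrow> snoc_vec m c + snoc_vec m' c' = snoc_vec (m + m') (c + c')"
  unfolding snoc_vec_def by (intro eq_vecI) auto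

lemma snoc_vec_smult: "a \<cdot>\<^sub>v snoc_vec m c = snoc_vec (a \<cdot>\<^sub>v m) (a * c)"
  unfolding snoc_vec_def by (intro eq_vecI) auto

lemma sigma_snoc_vec:
  assumes m: "m \<in> V 2" and w: "w \<in> V 2"
  shows "sigma (Mw w) (snoc_vec m c) = snoc_vec (sigma Mr m + twist \<iota> c \<cdot>\<^sub>v w) (twist \<iota> c)"
proof -
  let ?v = "(w $ 0, w $ Suc 0)"
  have one: "1 \<cdot>\<^sub>m Phi_v ?v = Phi_v ?v"
    by (intro eq_matI) auto
  have jc: "snoc_vec m c \<in> carrier_vec 3"
    using snoc_vec_nth(4)[OF m] by (rule carrier_vecI)
  have d: "dim_vec (sigma Mr m) = 2" "dim_vec w = 2"
    using sigma_Mr(1)[OF m] w by (simp_all add: V2_iff)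
  have nth: "snoc_vec m c $ 0 = m $ 0" "snoc_vec m c $ Suc 0 = m $ Suc 0" "snoc_vec m c $ Suc (Suc 0) = c"
    using snoc_vec_nth[OF m, of c] by (simp_all add: numeral_2_eq_2)
  have "sigma (Mw w) (snoc_vec m c) = v3 (T * twist \<iota> (m $ Suc 0) + w $ 0 * twist \<iota> c)
      (twist \<iota> (m $ 0) - K * twist \<iota> (m $ Suc 0) + w $ Suc 0 * twist \<iota> c) (twist \<iota> c)"
    unfolding sigma_motive_of using sig_Phi_v[OF jc, of 1 ?v] unfolding one nth by simp
  also have "\<dots> = v3 ((sigma Mr m + twist \<iota> c \<cdot>\<^sub>v w) $ 0) ((sigma Mr m + twist \<iota> c \<cdot>\<^sub>v w) $ Suc 0) (twist \<iota> c)"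
    using d by (simp add: sigma_Mr[OF m] mult.commute)
  also have "\<dots> = v3 (first_two (sigma Mr m + twist \<iota> c \<cdot>\<^sub>v w) $ 0) (first_two (sigma Mr m + twist \<iota> c \<cdot>\<^sub>v w) $ Suc 0) (twist \<iota> c)"
    by (simp add: first_two_def)
  also have "\<dots> = snoc_vec (sigma Mr m + twist \<iota> c \<cdot>\<^sub>v w) (twist \<iota> c)"
    unfolding first_two_def snoc_vec_def v3_def using d by (intro eq_vecI) (auto simp: less_Suc_eq eval_nat_numeral)
  finally show ?thesis .
qed

lemma carrier_Mw: "carrier (Mw w) = V 3"
  by simp

lemma sigma_Mw_mem:
  assumes "x \<in> V 3" "w \<in> V 2"
  shows "sigma (Mw w) x \<in> V 3"
proof -
  obtain m c where "m \<in> V 2" "c \<in> kbar_rats \<iota>" "x = snoc_vec m c"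
    by (rule snoc_vec_cases[OF assms(1)])
  then show ?thesis
    using assms(2) sigma_Mr(1)
    by (simp only: sigma_snoc_vec) (intro snoc_vec_mem V_add V_smult twist_mem_kbar_rats)
qed

lemma row_extension_mem:
  assumes w: "w \<in> V 2" and t: "t_motive \<iota> (Mw w)"
  shows "row_extension w \<in> extensions \<iota> Nt Mr"
proof -
  let ?i = "\<lambda>x\<in>V 2. snoc_vec x 0" and ?p = "\<lambda>x\<in>V 3. vec 1 (\<lambda>_. x $ 2) :: 'c fls vec"
  have z: "0 \<in> kbar_rats \<iota>"
    by (rule kbarr.zero_mem)
  have "(\<lambda>x\<in>carrier Mr. snoc_vec x 0) \<in> ptm_hom \<iota> Mr (Mw w)"
  proof (rule ptm_hom_restrict, goal_cases)
    case (1 x)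
    then show ?case
      using z snoc_vec_mem by simp
  next
    case (2 x y)
    then show ?case
      by (simp add: V_add snoc_vec_add)
  next
    case (3 a x)
    then show ?case
      by (simp add: V_smult snoc_vec_smult)
  next
    case (4 x)
    then have x: "x \<in> V 2"
      by simp
    have "twist \<iota> 0 \<cdot>\<^sub>v w = 0\<^sub>v 2"
      using w by (intro eq_vecI) auto
    then have "sigma (Mw w) (snoc_vec x 0) = snoc_vec (sigma Mr x) 0"
      using sigma_snoc_vec[OF x w, of 0] sigma_Mr(1)[OF x] by (simp del: motive_of_simps add: vecs_in_carrier)
    then show ?case
      using sigma_Mr(1)[OF x] by (simp del: motive_of_simps)
  qed
  moreover have "inj_on ?i (V 2)"
    by (rule inj_onI) (simp add: snoc_vec_inject)
  moreover have "(\<lambda>x\<in>carrier (Mw w). vec 1 (\<lambda>_. x $ 2)) \<in> ptm_hom \<iota> (Mw w) Nt"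
  proof (rule ptm_hom_restrict, goal_cases)
    case (1 x)
    then have "x $ 2 \<in> kbar_rats \<iota>"
      using vecs_in_nth[of x _ 3 2] by simp
    then show ?case
      by (auto intro: vecs_inI)
  next
    case (2 x y)
    then have "vec 1 (\<lambda>_. (x + y) $ 2) = vec 1 (\<lambda>_. x $ 2) + vec 1 (\<lambda>_. y $ 2)"
      by (intro eq_vecI) (auto simp: vecs_in_dim[of y _ 3])
    then show ?case
      using 2 by (simp add: V_add)
  next
    case (3 a x)
    then have "vec 1 (\<lambda>_. (a \<cdot>\<^sub>v x) $ 2) = a \<cdot>\<^sub>v vec 1 (\<lambda>_. x $ 2)"
      by (intro eq_vecI) (auto simp: vecs_in_dim[of x _ 3])
    then show ?case
      using 3 by (simp add: V_smult)
  next
    case (4 x)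
    then have "x \<in> V 3"
      by simp
    then obtain m c where x: "m \<in> V 2" "c \<in> kbar_rats \<iota>" "x = snoc_vec m c"
      by (rule snoc_vec_cases)
    have c: "vec 1 (\<lambda>_. c) \<in> V 1"
      using x by (auto intro: vecs_inI)
    have mem: "sigma Mr m + twist \<iota> c \<cdot>\<^sub>v w \<in> V 2"
      using x w sigma_Mr(1) by (intro V_add V_smult twist_mem_kbar_rats)
    have "vec 1 (\<lambda>_. sigma (Mw w) x $ 2) = map_vec (twist \<iota>) (vec 1 (\<lambda>_. c))"
      unfolding x(3) sigma_snoc_vec[OF x(1) w] snoc_vec_nth(3)[OF mem] by (intro eq_vecI) auto
    then show ?case
      using sigma_Mw_mem[OF \<open>x \<in> V 3\<close> w] x c by (simp del: motive_of_simps add: sigma_Nt carrier_Mw)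
  qed
  moreover have "?p ` V 3 = V 1"
  proof (intro equalityI subsetI)
    fix y assume "y \<in> ?p ` V 3"
    then obtain x where "x \<in> V 3" "y = vec 1 (\<lambda>_. x $ 2)"
      by auto
    then show "y \<in> V 1"
      using vecs_in_nth[of x _ 3 2] by (auto intro: vecs_inI)
  next
    fix y assume y: "y \<in> V 1"
    then have "y $ 0 \<in> kbar_rats \<iota>"
      by (rule vecs_in_nth) simp
    then have "snoc_vec (0\<^sub>v 2) (y $ 0) \<in> V 3"
      by (intro snoc_vec_mem V_zero)
    moreover have "y = vec 1 (\<lambda>_. snoc_vec (0\<^sub>v 2) (y $ 0) $ 2)"
      using y by (intro eq_vecI) (auto simp: snoc_vec_nth(3)[OF V_zero])
    ultimately show "y \<in> ?p ` V 3"
      by (intro image_eqI[of _ _ "snoc_vec (0\<^sub>v 2) (y $ 0)"]) (simp_all only: restrict_apply if_True)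
  qed
  moreover have "?i ` V 2 = {x \<in> V 3. ?p x = 0\<^sub>v 1}"
  proof (intro equalityI subsetI)
    fix x assume "x \<in> ?i ` V 2"
    then obtain m where m: "m \<in> V 2" "x = snoc_vec m 0"
      by auto
    then show "x \<in> {x \<in> V 3. ?p x = 0\<^sub>v 1}"
      using snoc_vec_mem[OF m(1) z] by (auto intro!: eq_vecI)
  next
    fix x assume "x \<in> {x \<in> V 3. ?p x = 0\<^sub>v 1}"
    then have x: "x \<in> V 3" "vec 1 (\<lambda>_. x $ 2) = 0\<^sub>v 1"
      by auto
    obtain m c where mc: "m \<in> V 2" "c \<in> kbar_rats \<iota>" "x = snoc_vec m c"
      by (rule snoc_vec_cases[OF x(1)])
    have "c = vec 1 (\<lambda>_. x $ 2) $ 0"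
      using mc by simp
    then have "c = 0"
      unfolding x(2) by simp
    then show "x \<in> ?i ` V 2"
      using mc by auto
  qed
  ultimately show ?thesis
    unfolding extensions_def row_extension_def using t by (simp add: Mr_simps(1) del: motive_of_simps(5))
qed

text \<open>The description of extensions of 1 by M through M / (\<sigma> - 1) M: a lift n of 1 is
  moved by \<sigma> by an element of M, and another choice of n changes it by an element of
  (\<sigma> - 1) M.\<close>

definition has_cocycle :: "('c fls, 'c fls vec) extension \<Rightarrow> 'c fls vec \<Rightarrow> bool" where
  "has_cocycle = (\<lambda>(X, i, p) w. \<exists>n\<in>carrier X. p n = vec 1 (\<lambda>_. 1) \<and> sigma X n = n \<oplus>\<^bsub>X\<^esub> i w)"

text \<open>Classes are indexed by a cocycle, which turns the operations of \<open>Ext1\<close> into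
  operations on the vector w.\<close>

definition extension_class :: "'c fls vec \<Rightarrow> ('c fls, 'c fls vec) extension set" where
  "extension_class w = {E \<in> extensions \<iota> Nt Mr. has_cocycle E w}"

lemma kbar_rats_ring_simps:
  "carrier (kbar_rats_ring \<iota>) = kbar_rats \<iota>" "add (kbar_rats_ring \<iota>) = (+)"
  "monoid.mult (kbar_rats_ring \<iota>) = (*)" "monoid.one (kbar_rats_ring \<iota>) = 1" "zero (kbar_rats_ring \<iota>) = 0"
  by (simp_all add: kbar_rats_ring_def)

end

locale motive_extension = drinfeld \<iota> \<kappa>
  for \<iota> :: "'f::{field,finite} fls \<Rightarrow> 'c::{field,complete_space}" and \<kappa> +
  fixes X :: "('c fls, 'c fls vec) sigma_module" and i p :: "'c fls vec \<Rightarrow> 'c fls vec"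
  assumes extension: "(X, i, p) \<in> extensions \<iota> Nt Mr"
begin

lemma pre_X: "pre_t_motive \<iota> X"
  using extension rat_motive_t_motive unfolding extensions_def rat_motive_def by blast

sublocale X: Module.module "kbar_rats_ring \<iota>" X
  using pre_X unfolding pre_t_motive_def by blast

lemmas X_smult_closed = X.smult_closed[unfolded kbar_rats_ring_simps]
lemmas X_l_distr = X.smult_l_distr[unfolded kbar_rats_ring_simps]
lemmas X_r_distr = X.smult_r_distr[unfolded kbar_rats_ring_simps]
lemmas X_smult_assoc = X.smult_assoc1[unfolded kbar_rats_ring_simps]
lemmas X_smult_zero = X.smult_l_null[unfolded kbar_rats_ring_simps]

lemma X_sigma:
  "x \<in> carrier X \<Longrightarrow> sigma X x \<in> carrier X"
  "x \<in> carrier X \<Longrightarrow> y \<in> carrier X \<Longrightarrow> sigma X (x \<oplus>\<^bsub>X\<^esub> y) = sigma X x \<oplus>\<^bsub>X\<^esub> sigma X y"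
  "a \<in> kbar_rats \<iota> \<Longrightarrow> x \<in> carrier X \<Longrightarrow> sigma X (a \<odot>\<^bsub>X\<^esub> x) = twist \<iota> a \<odot>\<^bsub>X\<^esub> sigma X x"
  using pre_X unfolding pre_t_motive_def by (auto dest: bij_betwE)

lemma i_hom: "i \<in> ptm_hom \<iota> Mr X" and p_hom: "p \<in> ptm_hom \<iota> X Nt"
  using extension unfolding extensions_def by auto

lemma i_mem: "m \<in> V 2 \<Longrightarrow> i m \<in> carrier X"
  and i_add: "m \<in> V 2 \<Longrightarrow> m' \<in> V 2 \<Longrightarrow> i (m + m') = i m \<oplus>\<^bsub>X\<^esub> i m'"
  and i_smult: "a \<in> kbar_rats \<iota> \<Longrightarrow> m \<in> V 2 \<Longrightarrow> i (a \<cdot>\<^sub>v m) = a \<odot>\<^bsub>X\<^esub> i m"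
  and i_sigma: "m \<in> V 2 \<Longrightarrow> i (sigma Mr m) = sigma X (i m)"
  using ptm_homD[OF i_hom] by simp_all

lemma p_mem: "x \<in> carrier X \<Longrightarrow> p x \<in> V 1"
  and p_add: "x \<in> carrier X \<Longrightarrow> y \<in> carrier X \<Longrightarrow> p (x \<oplus>\<^bsub>X\<^esub> y) = p x + p y"
  and p_smult: "a \<in> kbar_rats \<iota> \<Longrightarrow> x \<in> carrier X \<Longrightarrow> p (a \<odot>\<^bsub>X\<^esub> x) = a \<cdot>\<^sub>v p x"
  using ptm_homD[OF p_hom] by simp_all

lemma i_inj: "m \<in> V 2 \<Longrightarrow> m' \<in> V 2 \<Longrightarrow> i m = i m' \<Longrightarrow> m = m'"
  using extension unfolding extensions_def inj_on_def by auto

lemma i_image: "i ` V 2 = {x \<in> carrier X. p x = 0\<^sub>v 1}"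
  using extension unfolding extensions_def by auto

lemma p_i: "m \<in> V 2 \<Longrightarrow> p (i m) = 0\<^sub>v 1"
  using i_image by blast

lemma i_zero: "i (0\<^sub>v 2) = \<zero>\<^bsub>X\<^esub>"
proof -
  have "i (0 \<cdot>\<^sub>v 0\<^sub>v 2) = \<zero>\<^bsub>X\<^esub>"
    using i_smult[OF kbarr.zero_mem V_zero] X_smult_zero[OF i_mem[OF V_zero]] by simp
  moreover have "0 \<cdot>\<^sub>v 0\<^sub>v 2 = (0\<^sub>v 2 :: 'c fls vec)"
    by (intro eq_vecI) auto
  ultimately show ?thesis
    by simp
qed

text \<open>The map sends (m, c) to i m + c n. It respects \<sigma> by the cocycle equation, and it
  is bijective because n lifts 1 and i identifies M with the kernel of p.\<close>

lemma hom_from_row_extension: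
  assumes w: "w \<in> V 2" and n: "n \<in> carrier X" "p n = vec 1 (\<lambda>_. 1)" "sigma X n = n \<oplus>\<^bsub>X\<^esub> i w"
  shows "\<exists>g \<in> ptm_hom \<iota> (Mw w) X. (\<forall>m\<in>V 2. g (snoc_vec m 0) = i m) \<and>
    (\<forall>x\<in>V 3. p (g x) = vec 1 (\<lambda>_. x $ 2)) \<and> bij_betw g (V 3) (carrier X)"
proof -
  let ?f = "\<lambda>x. i (first_two x) \<oplus>\<^bsub>X\<^esub> x $ 2 \<odot>\<^bsub>X\<^esub> n"
  let ?g = "\<lambda>x\<in>carrier (Mw w). ?f x"
  have f: "?f (snoc_vec m c) = i m \<oplus>\<^bsub>X\<^esub> c \<odot>\<^bsub>X\<^esub> n" if "m \<in> V 2" for m c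
    using that by simp
  have mem: "i m \<oplus>\<^bsub>X\<^esub> c \<odot>\<^bsub>X\<^esub> n \<in> carrier X" if "m \<in> V 2" "c \<in> kbar_rats \<iota>" for m c
    using that n i_mem X_smult_closed by simp
  have pf: "p (i m \<oplus>\<^bsub>X\<^esub> c \<odot>\<^bsub>X\<^esub> n) = vec 1 (\<lambda>_. c)" if "m \<in> V 2" "c \<in> kbar_rats \<iota>" for m c
    using that n i_mem X_smult_closed
    by (simp add: p_add p_smult p_i) (intro eq_vecI; simp)
  have "?g \<in> ptm_hom \<iota> (Mw w) X"
  proof (rule ptm_hom_restrict, goal_cases)
    case (1 x)
    then have "x \<in> V 3"
      by simp
    then obtain m c where "m \<in> V 2" "c \<in> kbar_rats \<iota>" "x = snoc_vec m c"
      by (rule snoc_vec_cases)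
    then show ?case
      using mem f by simp
  next
    case (2 x y)
    then have xy: "x \<in> V 3" "y \<in> V 3"
      by simp_all
    obtain m c where x: "m \<in> V 2" "c \<in> kbar_rats \<iota>" "x = snoc_vec m c"
      by (rule snoc_vec_cases[OF xy(1)])
    obtain m' c' where y: "m' \<in> V 2" "c' \<in> kbar_rats \<iota>" "y = snoc_vec m' c'"
      by (rule snoc_vec_cases[OF xy(2)])
    have "?f (x + y) = i (m + m') \<oplus>\<^bsub>X\<^esub> (c + c') \<odot>\<^bsub>X\<^esub> n"
      unfolding x(3) y(3) snoc_vec_add[OF x(1) y(1)] by (rule f[OF V_add[OF x(1) y(1)]])
    also have "\<dots> = ?f x \<oplus>\<^bsub>X\<^esub> ?f y"
      unfolding x(3) y(3) f[OF x(1)] f[OF y(1)]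
      using x y n i_mem X_smult_closed by (simp add: i_add X_l_distr X.M.a_ac)
    finally show ?case
      using xy V_add by simp
  next
    case (3 a x)
    then have ax: "a \<in> kbar_rats \<iota>" "x \<in> V 3"
      by simp_all
    obtain m c where x: "m \<in> V 2" "c \<in> kbar_rats \<iota>" "x = snoc_vec m c"
      by (rule snoc_vec_cases[OF ax(2)])
    have "?f (a \<cdot>\<^sub>v x) = i (a \<cdot>\<^sub>v m) \<oplus>\<^bsub>X\<^esub> (a * c) \<odot>\<^bsub>X\<^esub> n"
      unfolding x(3) snoc_vec_smult by (rule f[OF V_smult[OF ax(1) x(1)]])
    also have "\<dots> = a \<odot>\<^bsub>X\<^esub> ?f x"
      unfolding x(3) f[OF x(1)]
      using ax(1) x n i_mem X_smult_closed by (simp add: i_smult X_r_distr X_smult_assoc)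
    finally show ?case
      using ax V_smult by simp
  next
    case (4 x)
    then have x3: "x \<in> V 3"
      by simp
    obtain m c where x: "m \<in> V 2" "c \<in> kbar_rats \<iota>" "x = snoc_vec m c"
      by (rule snoc_vec_cases[OF x3])
    have c: "twist \<iota> c \<in> kbar_rats \<iota>"
      using x(2) by (rule twist_mem_kbar_rats)
    have s: "sigma Mr m \<in> V 2"
      by (rule sigma_Mr(1)[OF x(1)])
    have "?f (sigma (Mw w) x) = i (sigma Mr m + twist \<iota> c \<cdot>\<^sub>v w) \<oplus>\<^bsub>X\<^esub> twist \<iota> c \<odot>\<^bsub>X\<^esub> n"
      unfolding x(3) sigma_snoc_vec[OF x(1) w] by (rule f[OF V_add[OF s V_smult[OF c w]]])
    also have "\<dots> = sigma X (?f x)"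
      unfolding x(3) f[OF x(1)]
      using x c s w n i_mem X_smult_closed X_sigma(1)
      by (simp add: i_add i_smult i_sigma X_sigma V_smult X_r_distr X.M.a_ac)
    finally show ?case
      using sigma_Mw_mem[OF x3 w] by (simp del: motive_of_simps(5))
  qed
  moreover have g: "?g (snoc_vec m c) = i m \<oplus>\<^bsub>X\<^esub> c \<odot>\<^bsub>X\<^esub> n" if "m \<in> V 2" "c \<in> kbar_rats \<iota>" for m c
    using that snoc_vec_mem by simp
  have "?g (snoc_vec m 0) = i m" if "m \<in> V 2" for m
    using that n g[OF that kbarr.zero_mem] i_mem by (simp add: X_smult_zero)
  moreover have pg: "p (?g x) = vec 1 (\<lambda>_. x $ 2)" if "x \<in> V 3" for x
    using that
  proof (rule snoc_vec_cases)
    fix m c assume x: "m \<in> V 2" "c \<in> kbar_rats \<iota>" "x = snoc_vec m c"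
    show ?thesis
      unfolding x(3) g[OF x(1,2)] pf[OF x(1,2)] snoc_vec_nth(3)[OF x(1)] ..
  qed
  moreover have "bij_betw ?g (V 3) (carrier X)"
    unfolding bij_betw_def
  proof (intro conjI inj_onI equalityI subsetI)
    fix x y assume xy: "x \<in> V 3" "y \<in> V 3" and eq: "?g x = ?g y"
    obtain m c where x: "m \<in> V 2" "c \<in> kbar_rats \<iota>" "x = snoc_vec m c"
      by (rule snoc_vec_cases[OF xy(1)])
    obtain m' c' where y: "m' \<in> V 2" "c' \<in> kbar_rats \<iota>" "y = snoc_vec m' c'"
      by (rule snoc_vec_cases[OF xy(2)])
    have "vec 1 (\<lambda>_. x $ 2) $ 0 = vec 1 (\<lambda>_. y $ 2) $ 0"
      unfolding pg[OF xy(1), symmetric] pg[OF xy(2), symmetric] eq ..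
    then have c: "c = c'"
      using x y by simp
    have "i m \<oplus>\<^bsub>X\<^esub> c \<odot>\<^bsub>X\<^esub> n = i m' \<oplus>\<^bsub>X\<^esub> c \<odot>\<^bsub>X\<^esub> n"
      using eq unfolding x(3) y(3) g[OF x(1,2)] g[OF y(1,2)] unfolding c .
    then have "i m = i m'"
      using x y n i_mem X_smult_closed X.M.add.right_cancel by simp
    then show "x = y"
      unfolding x(3) y(3) c using i_inj[OF x(1) y(1)] by simp
  next
    fix z assume "z \<in> ?g ` V 3"
    then obtain x where x: "x \<in> V 3" "z = ?g x"
      by blast
    obtain m c where "m \<in> V 2" "c \<in> kbar_rats \<iota>" "x = snoc_vec m c"
      by (rule snoc_vec_cases[OF x(1)])
    then show "z \<in> carrier X"
      unfolding x(2) using g mem by simp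
  next
    fix z assume z: "z \<in> carrier X"
    define c where "c = p z $ 0"
    have c: "c \<in> kbar_rats \<iota>"
      unfolding c_def by (rule vecs_in_nth[OF p_mem[OF z]]) simp
    have c': "- c \<in> kbar_rats \<iota>"
      using c by (rule kbarr.uminus_mem)
    \<comment> \<open>Subtracting the right multiple of n moves z into the kernel of p.\<close>
    let ?y = "z \<oplus>\<^bsub>X\<^esub> (- c) \<odot>\<^bsub>X\<^esub> n"
    have y: "?y \<in> carrier X"
      using z c' n X_smult_closed by simp
    have "p ?y = p z + (- c) \<cdot>\<^sub>v vec 1 (\<lambda>_. 1)"
      using z c' n X_smult_closed by (simp add: p_add p_smult)
    also have "\<dots> = 0\<^sub>v 1"
      using p_mem[OF z] by (intro eq_vecI) (auto simp: c_def)
    finally obtain m where m: "m \<in> V 2" "?y = i m"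
      using i_image y by blast
    have "(- c) \<odot>\<^bsub>X\<^esub> n \<oplus>\<^bsub>X\<^esub> c \<odot>\<^bsub>X\<^esub> n = \<zero>\<^bsub>X\<^esub>"
      using X_l_distr[OF c' c n(1)] X_smult_zero[OF n(1)] by simp
    then have "i m \<oplus>\<^bsub>X\<^esub> c \<odot>\<^bsub>X\<^esub> n = z"
      unfolding m(2)[symmetric] using z c c' n X_smult_closed by (simp add: X.M.a_assoc)
    then have "z = ?g (snoc_vec m c)"
      using g[OF m(1) c] by simp
    then show "z \<in> ?g ` V 3"
      using snoc_vec_mem[OF m(1) c] by (rule image_eqI)
  qed
  ultimately show ?thesis
    by (intro bexI[of _ ?g] conjI ballI)
qed

text \<open>A section is determined by the image of 1, which has to be a lift of 1 fixed by
  \<sigma>.\<close>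

lemma split_iff_has_cocycle_zero:
  "(\<exists>s \<in> ptm_hom \<iota> Nt X. \<forall>y\<in>carrier Nt. p (s y) = y) \<longleftrightarrow> has_cocycle (X, i, p) (0\<^sub>v 2)"
proof
  let ?u = "vec 1 (\<lambda>_. 1) :: 'c fls vec"
  have u: "?u \<in> V 1"
    by (rule vecs_inI) (simp_all add: kbarr.one_mem)
  assume "\<exists>s \<in> ptm_hom \<iota> Nt X. \<forall>y\<in>carrier Nt. p (s y) = y"
  then obtain s where s: "s \<in> ptm_hom \<iota> Nt X" "\<And>y. y \<in> V 1 \<Longrightarrow> p (s y) = y"
    by auto
  have "sigma Nt ?u = ?u"
    unfolding sigma_Nt[OF u] by (intro eq_vecI) auto
  then have "sigma X (s ?u) = s ?u"
    using ptm_homD(4)[OF s(1), of ?u] u by simp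
  moreover have "s ?u \<in> carrier X"
    using ptm_homD(1)[OF s(1), of ?u] u by simp
  ultimately show "has_cocycle (X, i, p) (0\<^sub>v 2)"
    unfolding has_cocycle_def using s(2)[OF u] by (auto simp: i_zero intro!: bexI[of _ "s ?u"])
next
  assume "has_cocycle (X, i, p) (0\<^sub>v 2)"
  then obtain n where n: "n \<in> carrier X" "p n = vec 1 (\<lambda>_. 1)" "sigma X n = n"
    unfolding has_cocycle_def by (auto simp: i_zero)
  have nth: "y $ 0 \<in> kbar_rats \<iota>" if "y \<in> V 1" for y
    using that by (rule vecs_in_nth) simp
  have "(\<lambda>y\<in>carrier Nt. y $ 0 \<odot>\<^bsub>X\<^esub> n) \<in> ptm_hom \<iota> Nt X"
  proof (rule ptm_hom_restrict, goal_cases)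
    case (1 y)
    then show ?case
      using n nth X_smult_closed by simp
  next
    case (2 x y)
    then have "x \<in> V 1" "y \<in> V 1"
      by simp_all
    then show ?case
      using n nth X_l_distr by (simp add: V_add)
  next
    case (3 a x)
    then have "x \<in> V 1" "a \<in> kbar_rats \<iota>"
      by simp_all
    then show ?case
      using n nth X_smult_assoc by (simp add: V_smult)
  next
    case (4 x)
    then have x: "x \<in> V 1"
      by simp
    then show ?case
      using n nth[OF x] V_twist[OF x] by (simp add: sigma_Nt X_sigma)
  qed
  moreover have "p (y $ 0 \<odot>\<^bsub>X\<^esub> n) = y" if "y \<in> V 1" for y
    unfolding p_smult[OF nth[OF that] n(1)] n(2) using that by (intro eq_vecI) auto
  ultimately show "\<exists>s \<in> ptm_hom \<iota> Nt X. \<forall>y\<in>carrier Nt. p (s y) = y"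
    by (intro bexI[of _ "\<lambda>y\<in>carrier Nt. y $ 0 \<odot>\<^bsub>X\<^esub> n"]) auto
qed

end

lemma ptm_hom_comp_restrict:
  assumes h: "h \<in> ptm_hom \<iota> B C"
    and f: "\<And>x. x \<in> carrier A \<Longrightarrow> f x \<in> carrier B"
    "\<And>x y. x \<in> carrier A \<Longrightarrow> y \<in> carrier A \<Longrightarrow> x \<oplus>\<^bsub>A\<^esub> y \<in> carrier A \<and> f (x \<oplus>\<^bsub>A\<^esub> y) = f x \<oplus>\<^bsub>B\<^esub> f y"
    "\<And>a x. a \<in> kbar_rats \<iota> \<Longrightarrow> x \<in> carrier A \<Longrightarrow> a \<odot>\<^bsub>A\<^esub> x \<in> carrier A \<and> f (a \<odot>\<^bsub>A\<^esub> x) = a \<odot>\<^bsub>B\<^esub> f x"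
    "\<And>x. x \<in> carrier A \<Longrightarrow> sigma A x \<in> carrier A \<and> f (sigma A x) = sigma B (f x)"
  shows "(\<lambda>x\<in>carrier A. h (f x)) \<in> ptm_hom \<iota> A C"
  by (rule ptm_hom_restrict) (use f ptm_homD[OF h] in simp_all)

lemma fibre_product_simps [simp]:
  "carrier (fibre_product X p Y r) = {(x, y) \<in> carrier X \<times> carrier Y. p x = r y}"
  "(x, y) \<oplus>\<^bsub>fibre_product X p Y r\<^esub> (x', y') = (x \<oplus>\<^bsub>X\<^esub> x', y \<oplus>\<^bsub>Y\<^esub> y')"
  "a \<odot>\<^bsub>fibre_product X p Y r\<^esub> (x, y) = (a \<odot>\<^bsub>X\<^esub> x, a \<odot>\<^bsub>Y\<^esub> y)"
  "sigma (fibre_product X p Y r) (x, y) = (sigma X x, sigma Y y)"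
  by (simp_all add: fibre_product_def)

text \<open>
  This avoids having to show that \<open>Ext1\<close> is an abelian group, on which the library lemmas about
  finite sums rely.
\<close>

lemma finsum_eqI:
  fixes M :: "('a, 'b) ring_scheme"
  assumes "finite I" and S0: "S {} = \<zero>\<^bsub>M\<^esub>"
    and step: "\<And>A x. A \<subseteq> I \<Longrightarrow> x \<in> I \<Longrightarrow> x \<notin> A \<Longrightarrow> f x \<oplus>\<^bsub>M\<^esub> S A = S (insert x A)"
    and closed: "\<And>A. A \<subseteq> I \<Longrightarrow> S A \<in> carrier M"
  shows "finsum M f I = S I"
proof -
  let ?D = "foldSetD (carrier M) (add M \<circ> f) \<zero>\<^bsub>M\<^esub>"
  have unique: "z = S A" if "(A, z) \<in> ?D" "A \<subseteq> I" for A z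
    using that
  proof (induction)
    case emptyI
    then show ?case
      using S0 by simp
  next
    case (insertI x A y)
    then have "y = S A"
      by blast
    then show ?case
      using insertI step[of A x] by simp
  qed
  have exist: "(A, S A) \<in> ?D" if "finite A" "A \<subseteq> I" for A
    using that
  proof (induction A rule: finite_induct)
    case empty
    show ?case
      using closed[of "{}"] S0 by (auto intro: foldSetD.emptyI)
  next
    case (insert x A)
    have eq: "(add M \<circ> f) x (S A) = S (insert x A)"
      using step[of A x] insert by simp
    have "(insert x A, (add M \<circ> f) x (S A)) \<in> ?D"
      using insert closed[of "insert x A"] eq by (intro foldSetD.insertI) (auto simp del: comp_apply)
    then show ?case
      unfolding eq .
  qed
  have "finsum M f I = foldD (carrier M) (add M \<circ> f) \<zero>\<^bsub>M\<^esub> I"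
    using assms(1) by (simp add: finsum_def finprod_def)
  also have "\<dots> = S I"
    unfolding foldD_def
  proof (rule the_equality)
    show "(I, S I) \<in> ?D"
      by (rule exist[OF assms(1) order_refl])
    show "z = S I" if "(I, z) \<in> ?D" for z
      by (rule unique[OF that order_refl])
  qed
  finally show ?thesis .
qed

lemma Ext1_simps:
  "carrier (Ext1 \<iota> N M) = extensions \<iota> N M // ext_equiv \<iota> N M"
  "\<zero>\<^bsub>Ext1 \<iota> N M\<^esub> = {(X, i, p) \<in> extensions \<iota> N M. \<exists>s \<in> ptm_hom \<iota> N X. \<forall>y\<in>carrier N. p (s y) = y}"
  "C \<oplus>\<^bsub>Ext1 \<iota> N M\<^esub> D = {E \<in> extensions \<iota> N M. \<exists>E1\<in>C. \<exists>E2\<in>D. is_baer_sum \<iota> M E1 E2 E}"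
  "f \<odot>\<^bsub>Ext1 \<iota> N M\<^esub> C = {E \<in> extensions \<iota> N M. \<exists>E0\<in>C. is_pushout \<iota> M f E0 E}"
  by (simp_all add: Ext1_def)

context drinfeld
begin

lemma motive_extensionI: "(X, i, p) \<in> extensions \<iota> Nt Mr \<Longrightarrow> motive_extension \<iota> \<kappa> X i p"
  by unfold_locales

text \<open>A map over the identity of the quotient carries lifts of 1 to lifts of 1. This serves
  equivalences and pushouts alike.\<close>

lemma has_cocycle_push:
  assumes E: "(X, i, p) \<in> extensions \<iota> Nt Mr"
    and g: "g \<in> ptm_hom \<iota> X X'" "\<And>x. x \<in> carrier X \<Longrightarrow> p' (g x) = p x"
    and w: "w \<in> V 2" "g (i w) = i' w'" and c: "has_cocycle (X, i, p) w"
  shows "has_cocycle (X', i', p') w'"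
proof -
  interpret motive_extension \<iota> \<kappa> X i p
    by (rule motive_extensionI[OF E])
  obtain n where n: "n \<in> carrier X" "p n = vec 1 (\<lambda>_. 1)" "sigma X n = n \<oplus>\<^bsub>X\<^esub> i w"
    using c unfolding has_cocycle_def by auto
  have "sigma X' (g n) = g n \<oplus>\<^bsub>X'\<^esub> i' w'"
    using ptm_homD(4)[OF g(1) n(1)] ptm_homD(2)[OF g(1) n(1) i_mem[OF w(1)]] n(3) w(2) by simp
  then show ?thesis
    unfolding has_cocycle_def using ptm_homD(1)[OF g(1) n(1)] g(2)[OF n(1)] n(2) by auto
qed

lemma has_cocycle_row_extension:
  assumes w: "w \<in> V 2"
  shows "has_cocycle (row_extension w) w"
proof -
  let ?n = "snoc_vec (0\<^sub>v 2) 1"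
  have n: "?n \<in> V 3"
    by (intro snoc_vec_mem V_zero kbarr.one_mem)
  have "sigma Mr (0\<^sub>v 2) = 0\<^sub>v 2"
    by (rule V2_eqI) (simp_all add: sigma_Mr V_zero)
  then have "sigma (Mw w) ?n = snoc_vec (0\<^sub>v 2 + 1 \<cdot>\<^sub>v w) 1"
    unfolding sigma_snoc_vec[OF V_zero w] by simp
  also have "1 \<cdot>\<^sub>v w = w"
    by (intro eq_vecI) auto
  also have "snoc_vec (0\<^sub>v 2 + w) 1 = ?n + snoc_vec w 0"
    unfolding snoc_vec_add[OF V_zero w] by simp
  finally have "sigma (Mw w) ?n = ?n \<oplus>\<^bsub>Mw w\<^esub> snoc_vec w 0"
    by simp
  then show ?thesis
    unfolding has_cocycle_def row_extension_def using n w
    by (auto intro!: bexI[of _ ?n] simp del: motive_of_simps(5) simp: snoc_vec_nth(3)[OF V_zero])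
qed

lemma ext_equiv_iff:
  "((X, i, p), (X', i', p')) \<in> ext_equiv \<iota> N M \<longleftrightarrow>
     (X, i, p) \<in> extensions \<iota> N M \<and> (X', i', p') \<in> extensions \<iota> N M \<and>
     (\<exists>g \<in> ptm_hom \<iota> X X'. bij_betw g (carrier X) (carrier X') \<and>
        (\<forall>x\<in>carrier M. g (i x) = i' x) \<and> (\<forall>x\<in>carrier X. p' (g x) = p x))"
  by (simp add: ext_equiv_def)

text \<open>Every extension with cocycle w is isomorphic to the standard one. Only t-motives count
  as extensions, so E has to be secured by constructing the t-motive with bottom row w.\<close>

lemma extension_class_eq:
  assumes w: "w \<in> V 2" and E: "row_extension w \<in> extensions \<iota> Nt Mr"
  shows "ext_equiv \<iota> Nt Mr `` {row_extension w} = extension_class w"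
proof (intro equalityI subsetI)
  fix Y assume "Y \<in> ext_equiv \<iota> Nt Mr `` {row_extension w}"
  moreover obtain X i p where Y: "Y = (X, i, p)"
    by (cases Y)
  ultimately have "(row_extension w, (X, i, p)) \<in> ext_equiv \<iota> Nt Mr"
    by simp
  then obtain g where g: "(X, i, p) \<in> extensions \<iota> Nt Mr" "g \<in> ptm_hom \<iota> (Mw w) X"
    "\<forall>x\<in>carrier Mr. g ((\<lambda>x\<in>V 2. snoc_vec x 0) x) = i x"
    "\<forall>x\<in>carrier (Mw w). p (g x) = (\<lambda>x\<in>V 3. vec 1 (\<lambda>_. x $ 2)) x"
    unfolding row_extension_def ext_equiv_iff by blast
  have "has_cocycle (X, i, p) w"
  proof (rule has_cocycle_push[where X = "Mw w" and i = "\<lambda>x\<in>V 2. snoc_vec x 0" and p = "\<lambda>x\<in>V 3. vec 1 (\<lambda>_. x $ 2)"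
        and w = w and g = g])
    show "g ((\<lambda>x\<in>V 2. snoc_vec x 0) w) = i w"
      using bspec[OF g(3), of w] w by (simp only: Mr_simps)
    show "p (g x) = (\<lambda>x\<in>V 3. vec 1 (\<lambda>_. x $ 2)) x" if "x \<in> carrier (Mw w)" for x
      by (rule bspec[OF g(4) that])
  qed (fact g w E[unfolded row_extension_def] has_cocycle_row_extension[OF w, unfolded row_extension_def])+
  then show "Y \<in> extension_class w"
    unfolding Y extension_class_def using g(1) by simp
next
  fix Y assume "Y \<in> extension_class w"
  moreover obtain X i p where Y: "Y = (X, i, p)"
    by (cases Y)
  ultimately have X: "(X, i, p) \<in> extensions \<iota> Nt Mr" "has_cocycle (X, i, p) w"
    by (simp_all add: extension_class_def)
  interpret motive_extension \<iota> \<kappa> X i p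
    by (rule motive_extensionI[OF X(1)])
  obtain n where n: "n \<in> carrier X" "p n = vec 1 (\<lambda>_. 1)" "sigma X n = n \<oplus>\<^bsub>X\<^esub> i w"
    using X(2) unfolding has_cocycle_def by auto
  obtain g where g: "g \<in> ptm_hom \<iota> (Mw w) X" "\<And>m. m \<in> V 2 \<Longrightarrow> g (snoc_vec m 0) = i m"
    "\<And>x. x \<in> V 3 \<Longrightarrow> p (g x) = vec 1 (\<lambda>_. x $ 2)" "bij_betw g (V 3) (carrier X)"
    using hom_from_row_extension[OF w n] by blast
  have "(row_extension w, (X, i, p)) \<in> ext_equiv \<iota> Nt Mr"
    unfolding row_extension_def ext_equiv_iff
    using E[unfolded row_extension_def] X(1) g by (auto intro!: bexI[of _ g] simp del: motive_of_simps(5))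
  then show "Y \<in> ext_equiv \<iota> Nt Mr `` {row_extension w}"
    unfolding Y by simp
qed

lemma extension_class_carrier:
  assumes "w \<in> V 2" "row_extension w \<in> extensions \<iota> Nt Mr"
  shows "extension_class w \<in> carrier (Ext1 \<iota> Nt Mr)"
  unfolding Ext1_simps extension_class_eq[OF assms, symmetric] using assms(2) by (rule quotientI)

lemma extension_class_zero: "\<zero>\<^bsub>Ext1 \<iota> Nt Mr\<^esub> = extension_class (0\<^sub>v 2)"
proof -
  have "(\<exists>s \<in> ptm_hom \<iota> Nt X. \<forall>y\<in>carrier Nt. p (s y) = y) \<longleftrightarrow> has_cocycle (X, i, p) (0\<^sub>v 2)"
    if "(X, i, p) \<in> extensions \<iota> Nt Mr" for X i p
    using motive_extension.split_iff_has_cocycle_zero[OF motive_extensionI[OF that]] .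
  then show ?thesis
    unfolding Ext1_simps extension_class_def by auto
qed

text \<open>One inclusion pushes a lift of 1 forward. For the other, if X has cocycle f w, then (m,
  c) goes to (f m, c), followed by the isomorphism onto X; this exhibits X as a pushout of
  \<open>row_extension w\<close>.\<close>

lemma extension_class_smult:
  assumes f: "f \<in> ptm_hom \<iota> Mr Mr" and w: "w \<in> V 2" and E: "row_extension w \<in> extensions \<iota> Nt Mr"
  shows "f \<odot>\<^bsub>Ext1 \<iota> Nt Mr\<^esub> extension_class w = extension_class (f w)"
proof (intro equalityI subsetI)
  fix Y assume "Y \<in> f \<odot>\<^bsub>Ext1 \<iota> Nt Mr\<^esub> extension_class w"
  then obtain Y0 where Y0: "Y \<in> extensions \<iota> Nt Mr" "Y0 \<in> extensions \<iota> Nt Mr" "has_cocycle Y0 w" "is_pushout \<iota> Mr f Y0 Y"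
    unfolding Ext1_simps extension_class_def by blast
  moreover obtain X i p X' i' p' where Y: "Y = (X', i', p')" "Y0 = (X, i, p)"
    by (cases Y, cases Y0)
  ultimately obtain g where g: "g \<in> ptm_hom \<iota> X X'" "\<And>x. x \<in> V 2 \<Longrightarrow> g (i x) = i' (f x)"
    "\<And>x. x \<in> carrier X \<Longrightarrow> p' (g x) = p x"
    by auto
  have "has_cocycle Y (f w)"
    unfolding Y
  proof (rule has_cocycle_push[where X = X and i = i and p = p and w = w and g = g])
    show "(X, i, p) \<in> extensions \<iota> Nt Mr" "has_cocycle (X, i, p) w"
      using Y0 unfolding Y by simp_all
  qed (fact g w g(2)[OF w])+
  then show "Y \<in> extension_class (f w)"
    unfolding extension_class_def using Y0(1) by simp
next
  fix Y assume "Y \<in> extension_class (f w)"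
  moreover obtain X i p where Y: "Y = (X, i, p)"
    by (cases Y)
  ultimately have X: "(X, i, p) \<in> extensions \<iota> Nt Mr" "has_cocycle (X, i, p) (f w)"
    by (simp_all add: extension_class_def)
  have fV: "f m \<in> V 2" if "m \<in> V 2" for m
    using ptm_homD(1)[OF f, of m] that by simp
  have fadd: "f (m + m') = f m + f m'" if "m \<in> V 2" "m' \<in> V 2" for m m'
    using ptm_homD(2)[OF f, of m m'] that by simp
  have fsmult: "f (a \<cdot>\<^sub>v m) = a \<cdot>\<^sub>v f m" if "a \<in> kbar_rats \<iota>" "m \<in> V 2" for a m
    using ptm_homD(3)[OF f, of m a] that by simp
  have fsig: "f (sigma Mr m) = sigma Mr (f m)" if "m \<in> V 2" for m
    using ptm_homD(4)[OF f, of m] that by simp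
  interpret motive_extension \<iota> \<kappa> X i p
    by (rule motive_extensionI[OF X(1)])
  obtain n where n: "n \<in> carrier X" "p n = vec 1 (\<lambda>_. 1)" "sigma X n = n \<oplus>\<^bsub>X\<^esub> i (f w)"
    using X(2) unfolding has_cocycle_def by auto
  obtain h where h: "h \<in> ptm_hom \<iota> (Mw (f w)) X" "\<And>m. m \<in> V 2 \<Longrightarrow> h (snoc_vec m 0) = i m"
    "\<And>x. x \<in> V 3 \<Longrightarrow> p (h x) = vec 1 (\<lambda>_. x $ 2)" "bij_betw h (V 3) (carrier X)"
    using hom_from_row_extension[OF fV[OF w] n] by blast
  let ?F = "\<lambda>x. snoc_vec (f (first_two x)) (x $ 2)"
  have F: "?F (snoc_vec m c) = snoc_vec (f m) c" if "m \<in> V 2" for m c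
    using that by simp
  let ?g = "\<lambda>x\<in>carrier (Mw w). h (?F x)"
  have g: "?g \<in> ptm_hom \<iota> (Mw w) X"
  proof (rule ptm_hom_comp_restrict[OF h(1)], goal_cases)
    case (1 x)
    then have "x \<in> V 3"
      by simp
    then obtain m c where "m \<in> V 2" "c \<in> kbar_rats \<iota>" "x = snoc_vec m c"
      by (rule snoc_vec_cases)
    then show ?case
      using fV snoc_vec_mem by simp
  next
    case (2 x y)
    then have xy: "x \<in> V 3" "y \<in> V 3"
      by simp_all
    obtain m c where x: "m \<in> V 2" "c \<in> kbar_rats \<iota>" "x = snoc_vec m c"
      by (rule snoc_vec_cases[OF xy(1)])
    obtain m' c' where y: "m' \<in> V 2" "c' \<in> kbar_rats \<iota>" "y = snoc_vec m' c'"
      by (rule snoc_vec_cases[OF xy(2)])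
    have "?F (x + y) = ?F x + ?F y"
      unfolding x(3) y(3) snoc_vec_add[OF x(1) y(1)] F[OF V_add[OF x(1) y(1)]] F[OF x(1)] F[OF y(1)]
        fadd[OF x(1) y(1)] snoc_vec_add[OF fV[OF x(1)] fV[OF y(1)]] ..
    then show ?case
      using V_add[OF xy] by simp
  next
    case (3 a x)
    then have ax: "a \<in> kbar_rats \<iota>" "x \<in> V 3"
      by simp_all
    obtain m c where x: "m \<in> V 2" "c \<in> kbar_rats \<iota>" "x = snoc_vec m c"
      by (rule snoc_vec_cases[OF ax(2)])
    have "?F (a \<cdot>\<^sub>v x) = a \<cdot>\<^sub>v ?F x"
      unfolding x(3) snoc_vec_smult F[OF V_smult[OF ax(1) x(1)]] F[OF x(1)] fsmult[OF ax(1) x(1)] ..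
    then show ?case
      using V_smult[OF ax] by simp
  next
    case (4 x)
    then have x3: "x \<in> V 3"
      by simp
    obtain m c where x: "m \<in> V 2" "c \<in> kbar_rats \<iota>" "x = snoc_vec m c"
      by (rule snoc_vec_cases[OF x3])
    have c: "twist \<iota> c \<in> kbar_rats \<iota>"
      using x(2) by (rule twist_mem_kbar_rats)
    have s: "sigma Mr m \<in> V 2"
      by (rule sigma_Mr(1)[OF x(1)])
    have cw: "twist \<iota> c \<cdot>\<^sub>v w \<in> V 2"
      by (rule V_smult[OF c w])
    have "?F (sigma (Mw w) x) = sigma (Mw (f w)) (?F x)"
      unfolding x(3) sigma_snoc_vec[OF x(1) w] F[OF V_add[OF s cw]] F[OF x(1)] fadd[OF s cw] fsig[OF x(1)]
        fsmult[OF c w] sigma_snoc_vec[OF fV[OF x(1)] fV[OF w]] ..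
    then show ?case
      using sigma_Mw_mem[OF x3 w] unfolding carrier_Mw by (rule conjI[rotated])
  qed
  have gi: "?g (snoc_vec m 0) = i (f m)" if "m \<in> V 2" for m
  proof -
    have "snoc_vec m 0 \<in> carrier (Mw w)"
      unfolding carrier_Mw by (rule snoc_vec_mem[OF that kbarr.zero_mem])
    then show ?thesis
      unfolding restrict_apply using F[OF that] h(2)[OF fV[OF that]] by (simp only: if_True)
  qed
  have gp: "p (?g x) = vec 1 (\<lambda>_. x $ 2)" if x: "x \<in> V 3" for x
    using x
  proof (rule snoc_vec_cases)
    fix m c assume mc: "m \<in> V 2" "c \<in> kbar_rats \<iota>" "x = snoc_vec m c"
    have "?g x = h (?F x)"
      using x unfolding carrier_Mw by (simp only: restrict_apply if_True)
    also have "\<dots> = h (snoc_vec (f m) c)"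
      unfolding mc(3) F[OF mc(1)] ..
    finally show ?thesis
      using h(3)[OF snoc_vec_mem[OF fV[OF mc(1)] mc(2)]] mc fV[OF mc(1)] by simp
  qed
  have "is_pushout \<iota> Mr f (row_extension w) (X, i, p)"
    unfolding row_extension_def is_pushout.simps
  proof (intro bexI[OF _ g] conjI ballI)
    fix x assume "x \<in> carrier Mr"
    then have "x \<in> V 2"
      by simp
    then show "?g ((\<lambda>x\<in>V 2. snoc_vec x 0) x) = i (f x)"
      using gi by (simp only: restrict_apply if_True)
  next
    fix x assume "x \<in> carrier (Mw w)"
    then have "x \<in> V 3"
      by simp
    then show "p (?g x) = (\<lambda>x\<in>V 3. vec 1 (\<lambda>_. x $ 2)) x"
      using gp by (simp only: restrict_apply if_True)
  qed
  then show "Y \<in> f \<odot>\<^bsub>Ext1 \<iota> Nt Mr\<^esub> extension_class w"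
    unfolding Ext1_simps extension_class_def Y using X(1) E has_cocycle_row_extension[OF w] by blast
qed

text \<open>A pair of lifts of 1 is a point of the fibre product, and the cocycles add up.
  Conversely, the map from ((m, c), (m', c)) to (m + m', c) presents any extension with cocycle v +
  w as a Baer sum of the standard ones.\<close>

lemma extension_class_add:
  assumes v: "v \<in> V 2" "row_extension v \<in> extensions \<iota> Nt Mr" and w: "w \<in> V 2" "row_extension w \<in> extensions \<iota> Nt Mr"
  shows "extension_class v \<oplus>\<^bsub>Ext1 \<iota> Nt Mr\<^esub> extension_class w = extension_class (v + w)"
proof (intro equalityI subsetI)
  fix Y assume "Y \<in> extension_class v \<oplus>\<^bsub>Ext1 \<iota> Nt Mr\<^esub> extension_class w"
  then obtain Y1 Y2 where YY: "Y \<in> extensions \<iota> Nt Mr" "Y1 \<in> extensions \<iota> Nt Mr" "has_cocycle Y1 v"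
    "Y2 \<in> extensions \<iota> Nt Mr" "has_cocycle Y2 w" "is_baer_sum \<iota> Mr Y1 Y2 Y"
    unfolding Ext1_simps extension_class_def by blast
  obtain X i p X1 i1 p1 X2 i2 p2 where Y: "Y = (X, i, p)" "Y1 = (X1, i1, p1)" "Y2 = (X2, i2, p2)"
    by (cases Y, cases Y1, cases Y2)
  let ?A = "fibre_product X1 p1 X2 p2"
  obtain g where g: "g \<in> ptm_hom \<iota> ?A X"
    "\<forall>x\<in>carrier Mr. \<forall>y\<in>carrier Mr. g (i1 x, i2 y) = i (x \<oplus>\<^bsub>Mr\<^esub> y)"
    "\<forall>(x, y)\<in>carrier ?A. p (g (x, y)) = p1 x"
    using YY(6) unfolding Y is_baer_sum.simps by blast
  interpret X1: motive_extension \<iota> \<kappa> X1 i1 p1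
    by (rule motive_extensionI[OF YY(2)[unfolded Y]])
  interpret X2: motive_extension \<iota> \<kappa> X2 i2 p2
    by (rule motive_extensionI[OF YY(4)[unfolded Y]])
  obtain n1 where n1: "n1 \<in> carrier X1" "p1 n1 = vec 1 (\<lambda>_. 1)" "sigma X1 n1 = n1 \<oplus>\<^bsub>X1\<^esub> i1 v"
    using YY(3) unfolding Y has_cocycle_def by auto
  obtain n2 where n2: "n2 \<in> carrier X2" "p2 n2 = vec 1 (\<lambda>_. 1)" "sigma X2 n2 = n2 \<oplus>\<^bsub>X2\<^esub> i2 w"
    using YY(5) unfolding Y has_cocycle_def by auto
  have n: "(n1, n2) \<in> carrier ?A"
    using n1 n2 by simp
  have i: "(i1 v, i2 w) \<in> carrier ?A"
    using X1.i_mem[OF v(1)] X2.i_mem[OF w(1)] X1.p_i[OF v(1)] X2.p_i[OF w(1)] by simp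
  have "sigma X (g (n1, n2)) = g (sigma ?A (n1, n2))"
    using ptm_homD(4)[OF g(1) n] ..
  also have "sigma ?A (n1, n2) = (n1, n2) \<oplus>\<^bsub>?A\<^esub> (i1 v, i2 w)"
    using n1 n2 by simp
  also have "g \<dots> = g (n1, n2) \<oplus>\<^bsub>X\<^esub> i (v + w)"
    using ptm_homD(2)[OF g(1) n i] g(2) v w by simp
  finally have "has_cocycle (X, i, p) (v + w)"
    unfolding has_cocycle_def using ptm_homD(1)[OF g(1) n] bspec[OF g(3) n] n1(2) by auto
  then show "Y \<in> extension_class (v + w)"
    unfolding extension_class_def using YY(1) Y by simp
next
  fix Y assume "Y \<in> extension_class (v + w)"
  moreover obtain X i p where Y: "Y = (X, i, p)"
    by (cases Y)
  ultimately have X: "(X, i, p) \<in> extensions \<iota> Nt Mr" "has_cocycle (X, i, p) (v + w)"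
    by (simp_all add: extension_class_def)
  interpret motive_extension \<iota> \<kappa> X i p
    by (rule motive_extensionI[OF X(1)])
  obtain n where n: "n \<in> carrier X" "p n = vec 1 (\<lambda>_. 1)" "sigma X n = n \<oplus>\<^bsub>X\<^esub> i (v + w)"
    using X(2) unfolding has_cocycle_def by auto
  have vw: "v + w \<in> V 2"
    by (rule V_add[OF v(1) w(1)])
  obtain h where h: "h \<in> ptm_hom \<iota> (Mw (v + w)) X" "\<And>m. m \<in> V 2 \<Longrightarrow> h (snoc_vec m 0) = i m"
    "\<And>x. x \<in> V 3 \<Longrightarrow> p (h x) = vec 1 (\<lambda>_. x $ 2)" "bij_betw h (V 3) (carrier X)"
    using hom_from_row_extension[OF vw n] by blast
  let ?p = "\<lambda>x\<in>V 3. vec 1 (\<lambda>_. x $ 2) :: 'c fls vec"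
  let ?A = "fibre_product (Mw v) ?p (Mw w) ?p"
  have A_mem: "(snoc_vec m c, snoc_vec m' c) \<in> carrier ?A" if "m \<in> V 2" "m' \<in> V 2" "c \<in> kbar_rats \<iota>" for m m' c
    using that snoc_vec_mem by simp
  have A_cases: "\<exists>m m' c. m \<in> V 2 \<and> m' \<in> V 2 \<and> c \<in> kbar_rats \<iota> \<and> z = (snoc_vec m c, snoc_vec m' c)"
    if "z \<in> carrier ?A" for z
  proof -
    obtain x y where z: "z = (x, y)"
      by (cases z)
    have xy: "x \<in> V 3" "y \<in> V 3" "?p x = ?p y"
      using that unfolding z by auto
    obtain m c where x: "m \<in> V 2" "c \<in> kbar_rats \<iota>" "x = snoc_vec m c"
      by (rule snoc_vec_cases[OF xy(1)])
    obtain m' c' where y: "m' \<in> V 2" "c' \<in> kbar_rats \<iota>" "y = snoc_vec m' c'"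
      by (rule snoc_vec_cases[OF xy(2)])
    have "?p x $ 0 = c" "?p y $ 0 = c'"
      using xy(1,2) x y by simp_all
    then have "c = c'"
      using xy(3) by simp
    then show ?thesis
      using x y z by blast
  qed
  let ?F = "\<lambda>(x, y). snoc_vec (first_two x + first_two y) (x $ 2)"
  have F: "?F (snoc_vec m c, snoc_vec m' c) = snoc_vec (m + m') c" if "m \<in> V 2" "m' \<in> V 2" for m m' c
    using that by simp
  let ?g = "\<lambda>z\<in>carrier ?A. h (?F z)"
  have g: "?g \<in> ptm_hom \<iota> ?A X"
  proof (rule ptm_hom_comp_restrict[OF h(1)], goal_cases)
    case (1 z)
    then obtain m m' c where z: "m \<in> V 2" "m' \<in> V 2" "c \<in> kbar_rats \<iota>" "z = (snoc_vec m c, snoc_vec m' c)"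
      using A_cases by blast
    show ?case
      unfolding z(4) F[OF z(1,2)] carrier_Mw by (rule snoc_vec_mem[OF V_add[OF z(1,2)] z(3)])
  next
    case (2 z z')
    obtain a b c where z: "a \<in> V 2" "b \<in> V 2" "c \<in> kbar_rats \<iota>" "z = (snoc_vec a c, snoc_vec b c)"
      using A_cases[OF 2(1)] by blast
    obtain a' b' c' where z': "a' \<in> V 2" "b' \<in> V 2" "c' \<in> kbar_rats \<iota>" "z' = (snoc_vec a' c', snoc_vec b' c')"
      using A_cases[OF 2(2)] by blast
    have eq: "z \<oplus>\<^bsub>?A\<^esub> z' = (snoc_vec (a + a') (c + c'), snoc_vec (b + b') (c + c'))"
      unfolding z(4) z'(4) by (simp add: snoc_vec_add z z')
    have mem: "a + a' \<in> V 2" "b + b' \<in> V 2" "c + c' \<in> kbar_rats \<iota>"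
      using z z' by (auto intro: V_add kbarr.add_mem)
    have carr: "a \<in> carrier_vec 2" "b \<in> carrier_vec 2" "a' \<in> carrier_vec 2" "b' \<in> carrier_vec 2"
      using z z' by (auto simp: vecs_in_carrier)
    have "a + a' + (b + b') = a + b + (a' + b')"
      using carr by (intro eq_vecI) auto
    then have add: "?F (z \<oplus>\<^bsub>?A\<^esub> z') = ?F z + ?F z'"
      unfolding eq F[OF mem(1,2)] unfolding z(4) z'(4) F[OF z(1,2)] F[OF z'(1,2)]
        snoc_vec_add[OF V_add[OF z(1,2)] V_add[OF z'(1,2)]] by simp
    have "z \<oplus>\<^bsub>?A\<^esub> z' \<in> carrier ?A"
      unfolding eq by (rule A_mem[OF mem])
    then show ?case
      using add by (simp only: motive_of_simps)
  next
    case (3 r z)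
    obtain a b c where z: "a \<in> V 2" "b \<in> V 2" "c \<in> kbar_rats \<iota>" "z = (snoc_vec a c, snoc_vec b c)"
      using A_cases[OF 3(2)] by blast
    have eq: "r \<odot>\<^bsub>?A\<^esub> z = (snoc_vec (r \<cdot>\<^sub>v a) (r * c), snoc_vec (r \<cdot>\<^sub>v b) (r * c))"
      unfolding z(4) by (simp add: snoc_vec_smult)
    have mem: "r \<cdot>\<^sub>v a \<in> V 2" "r \<cdot>\<^sub>v b \<in> V 2" "r * c \<in> kbar_rats \<iota>"
      using z 3(1) by (auto intro: V_smult kbarr.mult_mem)
    have "r \<cdot>\<^sub>v a + r \<cdot>\<^sub>v b = r \<cdot>\<^sub>v (a + b)"
      using z by (simp add: smult_add_distrib_vec[of a 2 b] vecs_in_carrier)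
    then have smult: "?F (r \<odot>\<^bsub>?A\<^esub> z) = r \<cdot>\<^sub>v ?F z"
      unfolding eq F[OF mem(1,2)] unfolding z(4) F[OF z(1,2)] snoc_vec_smult by simp
    have "r \<odot>\<^bsub>?A\<^esub> z \<in> carrier ?A"
      unfolding eq by (rule A_mem[OF mem])
    then show ?case
      using smult by (simp only: motive_of_simps)
  next
    case (4 z)
    obtain a b c where z: "a \<in> V 2" "b \<in> V 2" "c \<in> kbar_rats \<iota>" "z = (snoc_vec a c, snoc_vec b c)"
      using A_cases[OF 4] by blast
    let ?c = "twist \<iota> c"
    have c: "?c \<in> kbar_rats \<iota>"
      using z(3) by (rule twist_mem_kbar_rats)
    have s: "sigma Mr a \<in> V 2" "sigma Mr b \<in> V 2"
      using z sigma_Mr(1) by blast+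
    have eq: "sigma ?A z = (snoc_vec (sigma Mr a + ?c \<cdot>\<^sub>v v) ?c, snoc_vec (sigma Mr b + ?c \<cdot>\<^sub>v w) ?c)"
      unfolding z(4) fibre_product_simps sigma_snoc_vec[OF z(1) v(1)] sigma_snoc_vec[OF z(2) w(1)] ..
    have mem: "sigma Mr a + ?c \<cdot>\<^sub>v v \<in> V 2" "sigma Mr b + ?c \<cdot>\<^sub>v w \<in> V 2"
      using s v(1) w(1) c by (auto intro: V_add V_smult)
    have "sigma Mr (a + b) = sigma Mr a + sigma Mr b"
    proof (rule V2_eqI)
      show "sigma Mr (a + b) $ 0 = (sigma Mr a + sigma Mr b) $ 0"
        "sigma Mr (a + b) $ Suc 0 = (sigma Mr a + sigma Mr b) $ Suc 0"
        using z s V_add[OF z(1,2)] by (simp_all add: sigma_Mr tw.hom_add algebra_simps V2_iff)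
    qed (intro V_add s sigma_Mr(1) z)+
    moreover have "sigma Mr a + ?c \<cdot>\<^sub>v v + (sigma Mr b + ?c \<cdot>\<^sub>v w) = sigma Mr a + sigma Mr b + ?c \<cdot>\<^sub>v (v + w)"
      using s v(1) w(1) by (intro eq_vecI) (auto simp: algebra_simps V2_iff)
    ultimately have "?F (sigma ?A z) = sigma (Mw (v + w)) (?F z)"
      unfolding eq F[OF mem] unfolding z(4) F[OF z(1,2)] sigma_snoc_vec[OF V_add[OF z(1,2)] vw] by simp
    then show ?case
      unfolding eq using A_mem[OF mem c] by (rule conjI[rotated])
  qed
  have g_apply: "?g (snoc_vec m c, snoc_vec m' c) = h (snoc_vec (m + m') c)" if "m \<in> V 2" "m' \<in> V 2" "c \<in> kbar_rats \<iota>" for m m' c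
    using A_mem[OF that] F[OF that(1,2)] by (simp only: restrict_apply if_True)
  have "is_baer_sum \<iota> Mr (row_extension v) (row_extension w) (X, i, p)"
    unfolding row_extension_def is_baer_sum.simps
  proof (intro bexI[OF _ g] conjI ballI)
    fix x y assume "x \<in> carrier Mr" "y \<in> carrier Mr"
    then have xy: "x \<in> V 2" "y \<in> V 2"
      by simp_all
    show "?g ((\<lambda>x\<in>V 2. snoc_vec x 0) x, (\<lambda>x\<in>V 2. snoc_vec x 0) y) = i (x \<oplus>\<^bsub>Mr\<^esub> y)"
      using xy g_apply[OF xy kbarr.zero_mem] h(2)[OF V_add[OF xy]] by (simp only: restrict_apply if_True Mr_simps)
  next
    fix z assume "z \<in> carrier ?A"
    then obtain m m' c where z: "m \<in> V 2" "m' \<in> V 2" "c \<in> kbar_rats \<iota>" "z = (snoc_vec m c, snoc_vec m' c)"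
      using A_cases by blast
    have "p (?g z) = vec 1 (\<lambda>_. c)"
      unfolding z(4) g_apply[OF z(1-3)] h(3)[OF snoc_vec_mem[OF V_add[OF z(1,2)] z(3)]] snoc_vec_nth(3)[OF V_add[OF z(1,2)]] ..
    also have "\<dots> = ?p (snoc_vec m c)"
      using snoc_vec_mem[OF z(1,3)] z(1) by simp
    finally show "case z of (x, y) \<Rightarrow> p (?g (x, y)) = ?p x"
      unfolding z(4) by (simp only: prod.case)
  qed
  then show "Y \<in> extension_class v \<oplus>\<^bsub>Ext1 \<iota> Nt Mr\<^esub> extension_class w"
    unfolding Ext1_simps extension_class_def Y using X(1) v w has_cocycle_row_extension by blast
qed

section \<open>Endomorphisms and the combination of the classes\<close>

definition entries :: "'c fls vec \<Rightarrow> 'c fls \<times> 'c fls" where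
  "entries w = (w $ 0, w $ Suc 0)"

lemma sig_entries: "m \<in> V 2 \<Longrightarrow> sig (entries m) = entries (sigma Mr m)"
  by (simp add: sig_def entries_def sigma_Mr)

text \<open>As \<sigma> m_1 = m_2, this vector generates \<open>M_rho\<close> over
  kbar(t)[\<sigma>], and an endomorphism is determined by its image.\<close>

definition m1 :: "'c fls vec" where "m1 = unit_vec 2 0"

lemma m1: "m1 \<in> V 2" "m1 $ 0 = 1" "m1 $ Suc 0 = 0"
  by (simp_all add: V2_iff m1_def kbarr.mems)

lemma sigma_m1: "sigma Mr m1 $ 0 = 0" "sigma Mr m1 $ Suc 0 = 1"
  by (simp_all add: sigma_Mr m1)

lemma endomorphismD:
  assumes "f \<in> ptm_hom \<iota> Mr Mr" "m \<in> V 2"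
  shows "f m \<in> V 2" "m' \<in> V 2 \<Longrightarrow> f (m + m') = f m + f m'"
    "a \<in> kbar_rats \<iota> \<Longrightarrow> f (a \<cdot>\<^sub>v m) = a \<cdot>\<^sub>v f m" "f (sigma Mr m) = sigma Mr (f m)"
  using ptm_homD[OF assms(1), of m] assms(2) by simp_all

text \<open>Apply f to the relation \<sigma>^2 m_1 = T m_1 - K \<sigma> m_1.\<close>

lemma sig_eq_endomorphism:
  assumes f: "f \<in> ptm_hom \<iota> Mr Mr"
  shows "sig_eq (entries (f m1))"
proof -
  let ?e = "sigma Mr m1" and ?Y = "f m1"
  have e: "?e \<in> V 2" and Y: "?Y \<in> V 2"
    using sigma_Mr(1)[OF m1(1)] endomorphismD(1)[OF f m1(1)] by simp_all
  have sY: "sigma Mr ?Y \<in> V 2"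
    by (rule sigma_Mr(1)[OF Y])
  have T: "T \<in> kbar_rats \<iota>" and K: "- K \<in> kbar_rats \<iota>"
    using T_mem_kbar_rats K_mem_kbar_rats kbarr.uminus_mem by auto
  have mem: "T \<cdot>\<^sub>v m1 \<in> V 2" "(- K) \<cdot>\<^sub>v ?e \<in> V 2"
    by (rule V_smult[OF T m1(1)], rule V_smult[OF K e])
  have "sigma Mr ?e = T \<cdot>\<^sub>v m1 + (- K) \<cdot>\<^sub>v ?e"
  proof (rule V2_eqI[OF sigma_Mr(1)[OF e] V_add[OF mem]])
    have d: "dim_vec m1 = 2" "dim_vec ?e = 2"
      using m1(1) e by (simp_all add: V2_iff)
    show "sigma Mr ?e $ 0 = (T \<cdot>\<^sub>v m1 + (- K) \<cdot>\<^sub>v ?e) $ 0"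
      "sigma Mr ?e $ Suc 0 = (T \<cdot>\<^sub>v m1 + (- K) \<cdot>\<^sub>v ?e) $ Suc 0"
      using d by (simp_all add: sigma_Mr[OF e] sigma_m1 m1(2,3))
  qed
  then have "f (sigma Mr ?e) = f (T \<cdot>\<^sub>v m1 + (- K) \<cdot>\<^sub>v ?e)"
    by (rule arg_cong)
  then have "sigma Mr (sigma Mr ?Y) = T \<cdot>\<^sub>v ?Y + (- K) \<cdot>\<^sub>v sigma Mr ?Y"
    unfolding endomorphismD(4)[OF f e] endomorphismD(2)[OF f mem]
      endomorphismD(3)[OF f m1(1) T] endomorphismD(3)[OF f e K] endomorphismD(4)[OF f m1(1)] .
  then have "sig (sig (entries ?Y)) = entries (T \<cdot>\<^sub>v ?Y + (- K) \<cdot>\<^sub>v sigma Mr ?Y)"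
    unfolding sig_entries[OF Y] sig_entries[OF sY] by simp
  moreover have "dim_vec ?Y = 2" "dim_vec (sigma Mr ?Y) = 2"
    using Y sY by (simp_all add: V2_iff)
  ultimately show ?thesis
    unfolding sig_eq_def sig_entries[OF Y] sig_entries[OF sY] by (simp add: entries_def)
qed

lemma endomorphism_eq_zero:
  assumes f: "f \<in> ptm_hom \<iota> Mr Mr" and zero: "f m1 = 0\<^sub>v 2"
  shows "f = \<zero>\<^bsub>ptm_End \<iota> Mr\<^esub>"
proof -
  let ?e = "sigma Mr m1"
  have e: "?e \<in> V 2"
    by (rule sigma_Mr(1)[OF m1(1)])
  have "sigma Mr (0\<^sub>v 2) = 0\<^sub>v 2"
    by (rule V2_eqI) (simp_all add: sigma_Mr V_zero)
  then have fe: "f ?e = 0\<^sub>v 2"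
    using endomorphismD(4)[OF f m1(1)] zero by simp
  have "f x = 0\<^sub>v 2" if x: "x \<in> V 2" for x
  proof -
    have x01: "x $ 0 \<in> kbar_rats \<iota>" "x $ Suc 0 \<in> kbar_rats \<iota>"
      using x by (simp_all add: V2_iff)
    have mem: "x $ 0 \<cdot>\<^sub>v m1 \<in> V 2" "x $ Suc 0 \<cdot>\<^sub>v ?e \<in> V 2"
      by (rule V_smult[OF x01(1) m1(1)], rule V_smult[OF x01(2) e])
    have d: "dim_vec m1 = 2" "dim_vec ?e = 2"
      using m1(1) e by (simp_all add: V2_iff)
    have "x = x $ 0 \<cdot>\<^sub>v m1 + x $ Suc 0 \<cdot>\<^sub>v ?e"
      by (rule V2_eqI[OF x V_add[OF mem]]) (simp_all add: d sigma_m1 m1(2,3))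
    then have "f x = x $ 0 \<cdot>\<^sub>v f m1 + x $ Suc 0 \<cdot>\<^sub>v f ?e"
      using endomorphismD(2)[OF f mem] endomorphismD(3)[OF f m1(1) x01(1)] endomorphismD(3)[OF f e x01(2)]
      by simp
    then show ?thesis
      unfolding zero fe by (simp add: vec_eq_iff)
  qed
  \<comment> \<open>Morphisms are compared as functions, so the values outside the carrier matter
    too.\<close>
  moreover have "f x = undefined" if "x \<notin> V 2" for x
    using f that unfolding ptm_hom_def by auto
  ultimately show ?thesis
    unfolding ptm_End_def by (auto simp: fun_eq_iff restrict_def)
qed

text \<open>The invariant of partial sums: \<open>fq_denominators\<close> provides the
  trivialisation when the next row is added, and \<open>t_motive\<close> makes the standard
  extension an element of \<open>extensions\<close>.\<close>

definition admissible :: "'c fls vec \<Rightarrow> bool" where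
  "admissible w \<longleftrightarrow> w \<in> V 2 \<and> fq_denominators (entries w) \<and> t_motive \<iota> (Mw w)"

lemma admissible_row_extension: "admissible w \<Longrightarrow> row_extension w \<in> extensions \<iota> Nt Mr"
  unfolding admissible_def by (intro row_extension_mem) simp_all

lemma const_mem_rats: "a \<in> kbar \<iota> \<Longrightarrow> fls_const a \<in> kbar_rats \<iota>"
  using const_mem_kbar_polys kbar_polys_subset_rats by blast

lemma admissible_const:
  assumes a: "a \<in> kbar \<iota>"
  shows "admissible (fls_const a \<cdot>\<^sub>v m1)"
proof -
  have "entries (fls_const a \<cdot>\<^sub>v m1) = (fls_const a, 0)"
    using m1 by (simp add: entries_def V2_iff)
  then show ?thesis
    unfolding admissible_def using fq_denominators_const[OF a] t_motive_Phi_alpha[OF a] V_smult[OF const_mem_rats[OF a] m1(1)]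
    by (simp add: entries_def)
qed

lemma admissible_add:
  assumes a: "a \<in> kbar \<iota>" and w: "admissible w" and m: "m \<in> V 2" "sig_eq (entries m)"
  shows "admissible (fls_const a \<cdot>\<^sub>v m + w)"
proof -
  have w': "w \<in> V 2" "fq_denominators (entries w)" "t_motive \<iota> (motive_of \<iota> (Phi_v (entries w)))"
    using w by (simp_all add: admissible_def entries_def)
  have mk: "fst (entries m) \<in> kbar_rats \<iota>" "snd (entries m) \<in> kbar_rats \<iota>"
    using m(1) by (simp_all add: entries_def V2_iff)
  have eq: "entries (fls_const a \<cdot>\<^sub>v m + w) = (fst (entries w) + fls_const a * fst (entries m), snd (entries w) + fls_const a * snd (entries m))"
    using m(1) w'(1) by (simp add: entries_def V2_iff)
  have "fq_denominators (entries (fls_const a \<cdot>\<^sub>v m + w))"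
    unfolding eq using fq_denominators_add[OF w'(2) fq_denominators_of_sig_eq[OF mk m(2) a]] by simp
  moreover have "t_motive \<iota> (motive_of \<iota> (Phi_v (entries (fls_const a \<cdot>\<^sub>v m + w))))"
    unfolding eq by (rule t_motive_Phi_v_add[OF a w'(2,3) mk m(2)])
  moreover have "fls_const a \<cdot>\<^sub>v m + w \<in> V 2"
    by (intro V_add V_smult const_mem_rats a m w')
  ultimately show ?thesis
    unfolding admissible_def by (simp only: entries_def)
qed

lemma M_alpha_class_eq:
  assumes a: "a \<in> kbar \<iota>"
  shows "M_alpha_class \<iota> \<kappa> a = extension_class (fls_const a \<cdot>\<^sub>v m1)"
proof -
  have m: "fls_const a \<cdot>\<^sub>v m1 \<in> V 2"
    by (rule V_smult[OF const_mem_rats[OF a] m1(1)])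
  have c: "(fls_const a \<cdot>\<^sub>v m1) $ 0 = fls_const a" "(fls_const a \<cdot>\<^sub>v m1) $ Suc 0 = 0"
    using m1 by (simp_all add: V2_iff)
  have "0\<^sub>v 1 = vec 1 (\<lambda>_. 0 :: 'c fls)"
    by (intro eq_vecI) auto
  then have "M_alpha \<iota> \<kappa> a = row_extension (fls_const a \<cdot>\<^sub>v m1)"
    unfolding M_alpha_def row_extension_def Phi_alpha_eq c snoc_vec_def
    by (simp only: Mr_simps motive_of_simps(1) Phi_v_dims)
  then show ?thesis
    unfolding M_alpha_class_def using extension_class_eq[OF m admissible_row_extension[OF admissible_const[OF a]]] by simp
qed

text \<open>The sum in \<open>Ext1\<close> is followed through the subsets of I, each partial sum
  being the class of an admissible row. If the total class is zero, the standard extension with row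
  S I has a lift (m, 1) fixed by \<sigma>; then m = \<sigma> m + S I, and the entries of m are r1
  and r2.\<close>

proposition splitting_of_combination:
  assumes I: "finite I" and a: "\<And>i. i \<in> I \<Longrightarrow> \<alpha> i \<in> kbar \<iota>"
    and c: "\<And>i. i \<in> I \<Longrightarrow> c i \<in> ptm_hom \<iota> Mr Mr"
    and eq: "(\<Oplus>\<^bsub>Ext1 \<iota> Nt Mr\<^esub>i\<in>I. c i \<odot>\<^bsub>Ext1 \<iota> Nt Mr\<^esub> M_alpha_class \<iota> \<kappa> (\<alpha> i)) = \<zero>\<^bsub>Ext1 \<iota> Nt Mr\<^esub>"
  obtains r1 r2 where "r1 \<in> kbar_rats \<iota>" "r2 \<in> kbar_rats \<iota>"
    "r1 = T * twist \<iota> r2 + (\<Sum>i\<in>I. fls_const (\<alpha> i) * c i m1 $ 0)"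
    "r2 = twist \<iota> r1 - K * twist \<iota> r2 + (\<Sum>i\<in>I. fls_const (\<alpha> i) * c i m1 $ Suc 0)"
proof -
  have Y: "c i m1 \<in> V 2" "sig_eq (entries (c i m1))" if "i \<in> I" for i
    using endomorphismD(1)[OF c[OF that] m1(1)] sig_eq_endomorphism[OF c[OF that]] by simp_all
  define S where "S A = vec 2 (\<lambda>k. \<Sum>i\<in>A. fls_const (\<alpha> i) * c i m1 $ k)" for A
  have S_empty: "S {} = 0\<^sub>v 2"
    unfolding S_def by (intro eq_vecI) auto
  have S_insert: "S (insert x A) = fls_const (\<alpha> x) \<cdot>\<^sub>v c x m1 + S A" if "A \<subseteq> I" "x \<in> I" "x \<notin> A" for x A
  proof -
    have "finite A"
      using that(1) I by (rule finite_subset)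
    then show ?thesis
      unfolding S_def using that Y(1)[OF that(2)] by (intro eq_vecI) (auto simp: V2_iff)
  qed
  \<comment> \<open>The empty sum is admissible as the case a = 0 of
    \<open>admissible_const\<close>.\<close>
  have zero_eq: "fls_const 0 \<cdot>\<^sub>v m1 = 0\<^sub>v 2"
    using m1(1) by (intro eq_vecI) (auto simp: V2_iff)
  have adm0: "admissible (0\<^sub>v 2)"
    using admissible_const[OF kbar.zero_mem] unfolding zero_eq .
  have adm: "admissible (S A)" if "A \<subseteq> I" for A
  proof -
    have "finite A"
      using that I by (rule finite_subset)
    then show ?thesis
      using that
    proof (induction A rule: finite_induct)
      case empty
      show ?case
        unfolding S_empty by (rule adm0)
    next
      case (insert x A)
      then have "x \<in> I" "A \<subseteq> I"
        by auto
      then show ?case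
        unfolding S_insert[OF \<open>A \<subseteq> I\<close> \<open>x \<in> I\<close> insert(2)]
        using insert.IH by (intro admissible_add a Y)
    qed
  qed
  have adm1: "admissible (fls_const (\<alpha> i) \<cdot>\<^sub>v c i m1)" if "i \<in> I" for i
  proof -
    have "fls_const (\<alpha> i) \<cdot>\<^sub>v c i m1 + 0\<^sub>v 2 = fls_const (\<alpha> i) \<cdot>\<^sub>v c i m1"
      using Y(1)[OF that] by (intro right_zero_vec) (simp add: vecs_in_carrier)
    then show ?thesis
      using admissible_add[OF a[OF that] adm0 Y[OF that]] by simp
  qed
  have adm_V: "w \<in> V 2" if "admissible w" for w
    using that by (simp add: admissible_def)
  have summand: "c i \<odot>\<^bsub>Ext1 \<iota> Nt Mr\<^esub> M_alpha_class \<iota> \<kappa> (\<alpha> i) = extension_class (fls_const (\<alpha> i) \<cdot>\<^sub>v c i m1)" if i: "i \<in> I" for i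
  proof -
    have ac: "admissible (fls_const (\<alpha> i) \<cdot>\<^sub>v m1)"
      by (rule admissible_const[OF a[OF i]])
    show ?thesis
      unfolding M_alpha_class_eq[OF a[OF i]] extension_class_smult[OF c[OF i] adm_V[OF ac] admissible_row_extension[OF ac]]
        endomorphismD(3)[OF c[OF i] m1(1) const_mem_rats[OF a[OF i]]] ..
  qed
  have "(\<Oplus>\<^bsub>Ext1 \<iota> Nt Mr\<^esub>i\<in>I. c i \<odot>\<^bsub>Ext1 \<iota> Nt Mr\<^esub> M_alpha_class \<iota> \<kappa> (\<alpha> i)) = extension_class (S I)"
  proof (rule finsum_eqI[where S = "\<lambda>A. extension_class (S A)", OF I])
    show "extension_class (S {}) = \<zero>\<^bsub>Ext1 \<iota> Nt Mr\<^esub>"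
      unfolding S_empty extension_class_zero ..
  next
    fix A x assume A: "A \<subseteq> I" "x \<in> I" "x \<notin> A"
    show "c x \<odot>\<^bsub>Ext1 \<iota> Nt Mr\<^esub> M_alpha_class \<iota> \<kappa> (\<alpha> x) \<oplus>\<^bsub>Ext1 \<iota> Nt Mr\<^esub> extension_class (S A) = extension_class (S (insert x A))"
      unfolding summand[OF A(2)] S_insert[OF A]
      by (rule extension_class_add[OF adm_V[OF adm1[OF A(2)]] admissible_row_extension[OF adm1[OF A(2)]]
            adm_V[OF adm[OF A(1)]] admissible_row_extension[OF adm[OF A(1)]]])
  next
    fix A assume "A \<subseteq> I"
    then show "extension_class (S A) \<in> carrier (Ext1 \<iota> Nt Mr)"
      by (intro extension_class_carrier adm_V admissible_row_extension adm)
  qed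
  then have "extension_class (S I) = extension_class (0\<^sub>v 2)"
    using eq extension_class_zero by simp
  moreover have SV: "S I \<in> V 2" and E: "row_extension (S I) \<in> extensions \<iota> Nt Mr"
    by (rule adm_V[OF adm[OF order_refl]], rule admissible_row_extension[OF adm[OF order_refl]])
  then have "row_extension (S I) \<in> extension_class (S I)"
    unfolding extension_class_def using has_cocycle_row_extension[OF SV] by simp
  ultimately have "has_cocycle (row_extension (S I)) (0\<^sub>v 2)"
    unfolding extension_class_def by simp
  then obtain n where n: "n \<in> V 3" "vec 1 (\<lambda>_. n $ 2) = vec 1 (\<lambda>_. 1 :: 'c fls)"
    "sigma (Mw (S I)) n = n + snoc_vec (0\<^sub>v 2) 0"
    unfolding has_cocycle_def row_extension_def by (auto simp: V_zero simp del: motive_of_simps(5))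
  obtain m d where md: "m \<in> V 2" "d \<in> kbar_rats \<iota>" "n = snoc_vec m d"
    by (rule snoc_vec_cases[OF n(1)])
  have "n $ 2 = vec 1 (\<lambda>_. n $ 2) $ 0"
    by simp
  then have "n $ 2 = 1"
    unfolding n(2) by simp
  then have d: "d = 1"
    using md by simp
  have one: "1 \<cdot>\<^sub>v S I = S I"
    by (intro eq_vecI) auto
  have m0: "m + 0\<^sub>v 2 = m"
    using md(1) by (simp add: vecs_in_carrier)
  have sm: "sigma Mr m \<in> V 2"
    by (rule sigma_Mr(1)[OF md(1)])
  have "snoc_vec (sigma Mr m + S I) 1 = snoc_vec m 1"
    using n(3) unfolding md(3) d sigma_snoc_vec[OF md(1) SV] snoc_vec_add[OF md(1) V_zero] m0 by (simp add: one)
  then have "sigma Mr m + S I = m"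
    unfolding snoc_vec_inject[OF V_add[OF sm SV] md(1)] ..
  then have m: "m $ k = (sigma Mr m + S I) $ k" for k
    by simp
  have dim: "dim_vec (S I) = 2" "dim_vec (sigma Mr m) = 2"
    using sm by (simp_all add: S_def V2_iff)
  have "(sigma Mr m + S I) $ 0 = T * twist \<iota> (m $ Suc 0) + S I $ 0"
    "(sigma Mr m + S I) $ Suc 0 = twist \<iota> (m $ 0) - K * twist \<iota> (m $ Suc 0) + S I $ Suc 0"
    using dim by (simp_all add: sigma_Mr[OF md(1)])
  note r = trans[OF m this(1)] trans[OF m this(2)]
  show ?thesis
  proof (rule that)
    show "m $ 0 \<in> kbar_rats \<iota>" "m $ Suc 0 \<in> kbar_rats \<iota>"
      using md(1) by (simp_all add: V2_iff)
    have "S I $ 0 = (\<Sum>i\<in>I. fls_const (\<alpha> i) * c i m1 $ 0)"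
      "S I $ Suc 0 = (\<Sum>i\<in>I. fls_const (\<alpha> i) * c i m1 $ Suc 0)"
      by (simp_all add: S_def)
    then show "m $ 0 = T * twist \<iota> (m $ Suc 0) + (\<Sum>i\<in>I. fls_const (\<alpha> i) * c i m1 $ 0)"
      "m $ Suc 0 = twist \<iota> (m $ 0) - K * twist \<iota> (m $ Suc 0) + (\<Sum>i\<in>I. fls_const (\<alpha> i) * c i m1 $ Suc 0)"
      using r by argo+
  qed
qed

end

theorem theorem4p2:
  fixes \<iota> :: "'f::{field,finite} fls \<Rightarrow> 'c::{field,complete_space}"
    and \<kappa> \<omega>\<^sub>1 \<omega>\<^sub>2 :: 'c and u :: "nat \<Rightarrow> 'c" and n :: nat
  assumes "C_infinity \<iota>"
    and "\<kappa> \<in> kbar \<iota>"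
    and "has_CM \<iota> \<kappa>"
    and "separable_over (CM_field \<iota> \<kappa>) (k_field \<iota>)"
    and "period_lattice \<iota> \<kappa> = {a * \<omega>\<^sub>1 + b * \<omega>\<^sub>2 |a b. a \<in> A_ring \<iota> \<and> b \<in> A_ring \<iota>}"
    and "\<And>i. i \<in> {1..n} \<Longrightarrow> exp_rho \<iota> \<kappa> (u i) \<in> kbar \<iota>"
    and "\<And>c d. \<lbrakk>c \<in> CM_field \<iota> \<kappa>; d \<in> {1..n} \<rightarrow> CM_field \<iota> \<kappa>;
              c * \<omega>\<^sub>1 + (\<Sum>i=1..n. d i * u i) = 0\<rbrakk>
           \<Longrightarrow> c = 0 \<and> (\<forall>i\<in>{1..n}. d i = 0)"
  shows "lin_indep_family
           (ptm_End \<iota> (M_rho \<iota> \<kappa>))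
           (Ext1 \<iota> (trivial_motive \<iota>) (M_rho \<iota> \<kappa>))
           {1..n} (\<lambda>i. M_alpha_class \<iota> \<kappa> (exp_rho \<iota> \<kappa> (u i)))"
proof -
  interpret drinfeld \<iota> \<kappa>
    using assms(1,2) by (intro drinfeld.intro drinfeld_axioms.intro)
  let ?\<alpha> = "\<lambda>i. exp_rho \<iota> \<kappa> (u i)"
  have "M_alpha_class \<iota> \<kappa> (?\<alpha> i) \<in> carrier (Ext1 \<iota> Nt Mr)" if i: "i \<in> {1..n}" for i
  proof -
    have "admissible (fls_const (?\<alpha> i) \<cdot>\<^sub>v m1)"
      by (rule admissible_const[OF assms(6)[OF i]])
    then show ?thesis
      unfolding M_alpha_class_eq[OF assms(6)[OF i]]
      by (intro extension_class_carrier admissible_row_extension) (simp_all add: admissible_def)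
  qed
  moreover have "c i = \<zero>\<^bsub>ptm_End \<iota> Mr\<^esub>"
    if c: "c \<in> {1..n} \<rightarrow> carrier (ptm_End \<iota> Mr)"
      and eq: "(\<Oplus>\<^bsub>Ext1 \<iota> Nt Mr\<^esub>i\<in>{1..n}. c i \<odot>\<^bsub>Ext1 \<iota> Nt Mr\<^esub> M_alpha_class \<iota> \<kappa> (?\<alpha> i)) = \<zero>\<^bsub>Ext1 \<iota> Nt Mr\<^esub>"
      and i: "i \<in> {1..n}" for c i
  proof -
    have hom: "c j \<in> ptm_hom \<iota> Mr Mr" if "j \<in> {1..n}" for j
      using c that by (auto simp: ptm_End_def)
    obtain r1 r2 where r: "r1 \<in> kbar_rats \<iota>" "r2 \<in> kbar_rats \<iota>"
      "r1 = T * twist \<iota> r2 + (\<Sum>j\<in>{1..n}. fls_const (?\<alpha> j) * c j m1 $ 0)"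
      "r2 = twist \<iota> r1 - K * twist \<iota> r2 + (\<Sum>j\<in>{1..n}. fls_const (?\<alpha> j) * c j m1 $ Suc 0)"
      by (rule splitting_of_combination[OF _ assms(6) hom eq]) simp_all
    have y: "fst (entries (c j m1)) \<in> kbar_rats \<iota> \<and> snd (entries (c j m1)) \<in> kbar_rats \<iota> \<and> sig_eq (entries (c j m1))"
      if "j \<in> {1..n}" for j
      using endomorphismD(1)[OF hom[OF that] m1(1)] sig_eq_endomorphism[OF hom[OF that]]
      by (simp add: entries_def V2_iff)
    have "entries (c i m1) = (0, 0)"
      by (rule splitting_imp_zero[OF assms(3,5,7) y r(1,2) _ _ i]) (use r(3,4) in \<open>simp_all add: entries_def\<close>)
    then have "c i m1 = 0\<^sub>v 2"
      using endomorphismD(1)[OF hom[OF i] m1(1)] by (intro V2_eqI) (simp_all add: entries_def V_zero)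
    then show ?thesis
      by (rule endomorphism_eq_zero[OF hom[OF i]])
  qed
  ultimately show ?thesis
    unfolding lin_indep_family_def by blast
qed

end
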